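(* Let $L>0$ and let $\gamma(s)=(x(s),y(s))$, $s\in[0,L]$, be a smooth, simple, non-closed plane curve parametrized by arc length and symmetric with respect to the $y$-axis, i.e. $x(L-s)=-x(s)$ and $y(L-s)=y(s)$ for $s\in[0,L/2]$. Let $k(s)$ be its signed curvature. Let $\delta:[0,L]\to(0,\infty)$ be smooth and even with respect to $s=L/2$. Put $$D^F=\{(s,r)\in\mathbb{R}^2: 0<s<L,\ 0<r<\delta(s)\},\qquad D=\{(x(s)+ry'(s),\,y(s)-rx'(s)): (s,r)\in D^F\},$$ and assume that the map $(s,r)\mapsto (x(s)+ry'(s),\,y(s)-rx'(s))$ is one-to-one from $\overline{D^F}$ onto $\overline{D}$. Let $p=2$ and assume $1+rk(s)>0$ for all $(s,r)\in\overline{D^F}$. Then $$\mu_1(D)=\mu_1^{odd}(D)$$ if any of the following conditions is satisfied: (a) $k(s)\ge 0$ for all $s\in[0,L]$ and $$\mu_1(D)<\frac{1}{\max_{s\in[0,L]}\,(2\delta(s)+\delta(s)^2k(s))^2};$$ (b) $k(s)<0$ for all $s\in[0,L]$ and $$\mu_1(D)<\frac{1}{\max_{s\in[0,L]}\dfrac{4\delta(s)^2}{(1+\delta(s)k(s))^2}};$$ (c) $k(s)$ changes its sign in $[0,L]$ and $$\mu_1(D)<\frac{1}{\max\left\{\max_{s\in[0,L]}(2\delta(s)+\delta(s)^2k(s))^2,\ \max_{s\in[0,L]}\dfrac{4\delta(s)^2}{(1+\delta(s)k(s))^2}\right\}}.$$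
   Context: Signed curvature: $k(s)=x'(s)y''(s)-x''(s)y'(s)$, so that the Jacobian of the map $(s,r)\mapsto(x(s)+ry'(s),y(s)-rx'(s))$ has absolute value $|1+rk(s)|$. For $p>1$ the Neumann $p$-Laplace eigenvalue problem on $D$ is $-\mathrm{div}(|\nabla u|^{p-2}\nabla u)=\mu|u|^{p-2}u$ in $D$, $|\nabla u|^{p-2}\frac{\partial u}{\partial\mathbf{n}}=0$ on $\partial D$ (in the weak sense). For $p=2$ this is the Neumann Laplacian eigenvalue problem. Its first nonzero eigenvalue is $$\mu_1(D)=\min\left\{\frac{\int_D|\nabla v|^p\,dxdy}{\int_D|v|^p\,dxdy}: v\in W^{1,p}(D)\setminus\{0\},\ \int_D|v|^{p-2}v\,dxdy=0\right\}.$$ $\mu_1^{odd}(D)$ denotes the lowest nonzero eigenvalue of this problem having a corresponding eigenfunction that is odd with respect to the $y$-axis ($u(-x,y)=-u(x,y)$); equivalently, it is the minimum of $\int_D|\nabla v|^p\,dxdy\big/\int_D|v|^p\,dxdy$ over nonzero $v\in W^{1,p}(D)$ odd with respect to the $y$-axis. *)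

theory Defs
  imports "HOL-Analysis.Analysis"
begin

section \<open>The Sobolev space of once weakly differentiable functions\<close>

definition partial_deriv :: "'a::euclidean_space \<Rightarrow> ('a \<Rightarrow> real) \<Rightarrow> 'a \<Rightarrow> real" where
  "partial_deriv b \<phi> z = frechet_derivative \<phi> (at z) b"

text \<open>All iterated partial derivatives exist and are (totally) differentiable, hence continuous.\<close>

definition smooth :: "('a::euclidean_space \<Rightarrow> real) \<Rightarrow> bool" where
  "smooth \<phi> \<longleftrightarrow>
     (\<forall>bs. set bs \<subseteq> Basis \<longrightarrow> (\<forall>z. foldr partial_deriv bs \<phi> differentiable (at z)))"

definition test_function :: "'a::euclidean_space set \<Rightarrow> ('a \<Rightarrow> real) \<Rightarrow> bool" where
  "test_function D \<phi> \<longleftrightarrow>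
     smooth \<phi> \<and> compact (closure {z. \<phi> z \<noteq> 0}) \<and> closure {z. \<phi> z \<noteq> 0} \<subseteq> D"

definition in_Lp :: "real \<Rightarrow> 'a::euclidean_space set \<Rightarrow> ('a \<Rightarrow> 'b::euclidean_space) \<Rightarrow> bool" where
  "in_Lp p D f \<longleftrightarrow>
     f \<in> borel_measurable (lebesgue_on D) \<and>
     integrable (lebesgue_on D) (\<lambda>z. norm (f z) powr p)"

definition weak_gradient ::
  "'a::euclidean_space set \<Rightarrow> ('a \<Rightarrow> real) \<Rightarrow> ('a \<Rightarrow> 'a) \<Rightarrow> bool" where
  "weak_gradient D u g \<longleftrightarrow>
     (\<forall>\<phi>. test_function D \<phi> \<longrightarrow>
       (\<forall>b\<in>Basis. (LINT z|lebesgue_on D. u z * partial_deriv b \<phi> z)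
                 = - (LINT z|lebesgue_on D. (g z \<bullet> b) * \<phi> z)))"

text \<open>\<open>sobolev p D u g\<close>: for open \<open>D\<close>, the function \<open>u\<close> lies in W^{1,p}(D) and \<open>g\<close> is
  (a representative of) its weak gradient, which is unique almost everywhere.\<close>

definition sobolev ::
  "real \<Rightarrow> 'a::euclidean_space set \<Rightarrow> ('a \<Rightarrow> real) \<Rightarrow> ('a \<Rightarrow> 'a) \<Rightarrow> bool" where
  "sobolev p D u g \<longleftrightarrow> in_Lp p D u \<and> in_Lp p D g \<and> weak_gradient D u g"

definition nonzero_on :: "'a::euclidean_space set \<Rightarrow> ('a \<Rightarrow> real) \<Rightarrow> bool" where
  "nonzero_on D u \<longleftrightarrow> \<not> (AE z in lebesgue_on D. u z = 0)"

section \<open>The Neumann eigenvalue problem for the p-Laplacian\<close>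

text \<open>Weak form. Since \<open>0 powr a = 0\<close>, the factors with exponent \<open>p - 2\<close> make the products
  \<open>|u|\<^sup>p\<^sup>-\<^sup>2 u\<close> and \<open>|g|\<^sup>p\<^sup>-\<^sup>2 g\<close> vanish at zeros of \<open>u\<close> and \<open>g\<close>, as usual for every \<open>p > 1\<close>.\<close>

definition neumann_eigenfunction ::
  "real \<Rightarrow> 'a::euclidean_space set \<Rightarrow> real \<Rightarrow> ('a \<Rightarrow> real) \<Rightarrow> bool" where
  "neumann_eigenfunction p D \<mu> u \<longleftrightarrow>
     nonzero_on D u \<and>
     (\<exists>g. sobolev p D u g \<and>
       (\<forall>v h. sobolev p D v h \<longrightarrow>
          (LINT z|lebesgue_on D. norm (g z) powr (p - 2) * (g z \<bullet> h z))
          = \<mu> * (LINT z|lebesgue_on D. \<bar>u z\<bar> powr (p - 2) * u z * v z)))"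

definition rayleigh_quotients :: "real \<Rightarrow> 'a::euclidean_space set \<Rightarrow> real set" where
  "rayleigh_quotients p D =
     {(LINT z|lebesgue_on D. norm (h z) powr p) / (LINT z|lebesgue_on D. \<bar>v z\<bar> powr p) | v h.
        sobolev p D v h \<and> nonzero_on D v \<and>
        (LINT z|lebesgue_on D. \<bar>v z\<bar> powr (p - 2) * v z) = 0}"

text \<open>The minima below are literal; they are attained when W^{1,p}(D) embeds compactly
  into \<open>L\<^sup>p(D)\<close>.\<close>

definition mu1 :: "real \<Rightarrow> 'a::euclidean_space set \<Rightarrow> real" where
  "mu1 p D = (LEAST \<mu>. \<mu> \<in> rayleigh_quotients p D)"

definition odd_in_x_on :: "(real \<times> real) set \<Rightarrow> (real \<times> real \<Rightarrow> real) \<Rightarrow> bool" where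
  "odd_in_x_on D u \<longleftrightarrow> (AE z in lebesgue_on D. u (- fst z, snd z) = - u z)"

definition mu1_odd :: "real \<Rightarrow> (real \<times> real) set \<Rightarrow> real" where
  "mu1_odd p D =
     (LEAST \<mu>. \<mu> \<noteq> 0 \<and> (\<exists>u. neumann_eigenfunction p D \<mu> u \<and> odd_in_x_on D u))"

section \<open>Curved strips\<close>

text \<open>Derivatives on \<open>[0,L]\<close> are one-sided at the end points, so only the values on \<open>[0,L]\<close>
  matter.\<close>

definition deriv_Icc :: "real \<Rightarrow> (real \<Rightarrow> real) \<Rightarrow> real \<Rightarrow> real" where
  "deriv_Icc L f s = vector_derivative f (at s within {0..L})"

definition smooth_Icc :: "real \<Rightarrow> (real \<Rightarrow> real) \<Rightarrow> bool" where
  "smooth_Icc L f \<longleftrightarrow>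
     (\<forall>n. \<forall>s\<in>{0..L}. (deriv_Icc L ^^ n) f differentiable (at s within {0..L}))"

definition signed_curvature :: "real \<Rightarrow> (real \<Rightarrow> real) \<Rightarrow> (real \<Rightarrow> real) \<Rightarrow> real \<Rightarrow> real" where
  "signed_curvature L x y s =
     deriv_Icc L x s * deriv_Icc L (deriv_Icc L y) s
     - deriv_Icc L (deriv_Icc L x) s * deriv_Icc L y s"

definition strip_map ::
  "real \<Rightarrow> (real \<Rightarrow> real) \<Rightarrow> (real \<Rightarrow> real) \<Rightarrow> real \<times> real \<Rightarrow> real \<times> real" where
  "strip_map L x y = (\<lambda>(s, r). (x s + r * deriv_Icc L y s, y s - r * deriv_Icc L x s))"

definition flat_strip :: "real \<Rightarrow> (real \<Rightarrow> real) \<Rightarrow> (real \<times> real) set" where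
  "flat_strip L \<delta> = {(s, r). 0 < s \<and> s < L \<and> 0 < r \<and> r < \<delta> s}"

definition curved_strip ::
  "real \<Rightarrow> (real \<Rightarrow> real) \<Rightarrow> (real \<Rightarrow> real) \<Rightarrow> (real \<Rightarrow> real) \<Rightarrow> (real \<times> real) set" where
  "curved_strip L x y \<delta> = strip_map L x y ` flat_strip L \<delta>"

end

theory Submission
  imports Defs
begin

text \<open>Let \<open>u\<close> be a minimizer for \<open>\<mu>\<^sub>1\<close>; it exists by a Poincare inequality modulo finitely many mean
  values, so that Rellich's theorem is not needed. If the odd part of \<open>u\<close> is nonzero, it is an odd
  eigenfunction. Suppose then that \<open>u\<close> is even. On each fibre \<open>s = const\<close> a function that vanishes
  somewhere satisfies a one-dimensional Poincare inequality, with a constant that is smaller than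
  \<open>1/\<mu>\<^sub>1\<close> under the hypotheses. If no fibre were entirely positive, this would apply to the positive
  part of \<open>u\<close>, whose Rayleigh quotient is \<open>\<mu>\<^sub>1\<close>, and force it to vanish, against the mean value
  zero. Hence \<open>u\<close> is positive on some fibre, and likewise negative on another one. Cutting the
  positive or the negative part of \<open>u\<close> at a fibre of the opposite sign to the left of the axis
  leaves a function that vanishes near the axis and whose Rayleigh quotient is at most \<open>\<mu>\<^sub>1\<close>. Its odd
  extension has mean value zero, so it is a minimizer. Neither nodal domains nor unique
  continuation enter.

  In the coordinates \<open>(s, r / \<delta> s)\<close> weak differentiability becomes absolute continuity on almost
  all coordinate lines, which makes truncation, cutting and reflection elementary.\<close>

section \<open>Lebesgue measure on a set, square integrable functions\<close>

text \<open>Odd competitors form a smaller class, so what has to be produced is a minimizer that is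
  odd. For an even \<open>u\<close> both signs occur on fibres left of the axis, and their order
  decides: if no negative fibre there had positive ones to its left and no positive fibre had
  negative ones to its left, then one negative fibre would exclude all positive ones. So some fibre
  has fibres of the opposite sign to its left, and the cut is made at it. Since \<open>u\<close> is
  defined almost everywhere only, existence of a fibre means a non-null set of parameters, and the
  order argument is an exchange of almost-everywhere quantifiers by Fubini's theorem.

  Cutting strictly left of the axis makes the supports of the cut function and its reflection
  disjoint: the odd extension is their difference, and no traces have to be matched on the axis. The
  quotient stays at most \<open>\<mu>\<close> because the cut function is a test function in the
  equation for \<open>u\<close>.

  Curvature enters through the fibre inequality alone: it compares Jacobians at two points of a
  fibre, and for \<open>k \<ge> 0\<close> and \<open>k < 0\<close> the worst ratio times
  \<open>\<delta>\<^sup>2\<close> is dominated by the two expressions in the hypotheses.\<close>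

definition onm :: "'a::euclidean_space set \<Rightarrow> 'a measure" where
  "onm A = density lborel (indicator A)"

text \<open>Being a density on the whole space, the measure keeps the Borel sigma-algebra and the
  full space whatever \<open>A\<close> is. Measurability conditions therefore do not mention
  \<open>A\<close>, and restriction, product and image are computed with indicators.\<close>

lemma sets_onm [simp, measurable_cong]: "sets (onm A) = sets borel"
  by (simp add: onm_def)

lemma space_onm [simp]: "space (onm A) = UNIV"
  by (simp add: onm_def)

lemma AE_onm:
  assumes "A \<in> sets borel"
  shows "(AE x in onm A. P x) \<longleftrightarrow> (AE x in lborel. x \<in> A \<longrightarrow> P x)"
proof -
  have "(AE x in onm A. P x) \<longleftrightarrow> (AE x in lborel. (0::ennreal) < indicator A x \<longrightarrow> P x)"
    unfolding onm_def by (rule AE_density) (use assms in auto)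
  then show ?thesis by (simp add: indicator_def)
qed

lemma AE_onm_mem: "A \<in> sets borel \<Longrightarrow> AE x in onm A. x \<in> A"
  by (simp add: AE_onm)

lemma indicator_ennreal_eq: "(indicator A :: 'a \<Rightarrow> ennreal) = (\<lambda>x. ennreal (indicator A x))"
  by (auto simp: fun_eq_iff split: split_indicator)

lemma integral_onm:
  fixes f :: "'a::euclidean_space \<Rightarrow> real"
  assumes "A \<in> sets borel" "f \<in> borel_measurable borel"
  shows "(LINT x|onm A. f x) = (LINT x|lborel. indicator A x * f x)"
  unfolding onm_def indicator_ennreal_eq
  by (subst integral_density) (use assms in \<open>auto\<close>)

lemma integrable_onm:
  fixes f :: "'a::euclidean_space \<Rightarrow> real"
  assumes "A \<in> sets borel" "f \<in> borel_measurable borel"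
  shows "integrable (onm A) f \<longleftrightarrow> integrable lborel (\<lambda>x. indicator A x * f x)"
  unfolding onm_def indicator_ennreal_eq
  by (subst integrable_density) (use assms in \<open>auto\<close>)

lemma nn_integral_onm:
  assumes "A \<in> sets borel" "f \<in> borel_measurable borel"
  shows "(\<integral>\<^sup>+x. f x \<partial>onm A) = (\<integral>\<^sup>+x. indicator A x * f x \<partial>lborel)"
  unfolding onm_def
  by (subst nn_integral_density) (use assms in \<open>auto\<close>)

lemma emeasure_onm:
  assumes "A \<in> sets borel" "B \<in> sets borel"
  shows "emeasure (onm A) B = emeasure lborel (A \<inter> B)"
  unfolding onm_def using assms by (intro emeasure_restricted) auto

lemma onm_subset_integrable:
  fixes f :: "'a::euclidean_space \<Rightarrow> real"
  assumes "integrable (onm A) f" "B \<subseteq> A" "A \<in> sets borel" "B \<in> sets borel"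
  shows "integrable (onm B) f"
proof -
  have m: "f \<in> borel_measurable borel"
    using borel_measurable_integrable[OF assms(1)] by (simp cong: measurable_cong_sets)
  have "integrable lborel (\<lambda>x. indicator B x *\<^sub>R (indicator A x * f x))"
    by (rule integrable_mult_indicator) (use assms m integrable_onm[of A f] in auto)
  moreover have "(\<lambda>x. indicator B x *\<^sub>R (indicator A x * f x)) = (\<lambda>x. indicator B x * f x)"
    using assms(2) by (auto simp: fun_eq_iff split: split_indicator)
  ultimately show ?thesis using assms m by (simp add: integrable_onm)
qed

lemma finite_measure_onm:
  fixes A :: "'a::euclidean_space set"
  assumes "bounded A" "A \<in> sets borel"
  shows "finite_measure (onm A)"
proof (rule finite_measureI)
  have "emeasure lborel A < \<infinity>" using assms(1) by (rule emeasure_bounded_finite)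
  then show "emeasure (onm A) (space (onm A)) \<noteq> \<infinity>" using assms by (simp add: emeasure_onm)
qed

lemma onm_Times:
  fixes A :: "real set" and B :: "real set"
  assumes "bounded B" "A \<in> sets borel" "B \<in> sets borel"
  shows "onm A \<Otimes>\<^sub>M onm B = onm (A \<times> B)"
proof -
  interpret B: finite_measure "onm B" using assms by (intro finite_measure_onm)
  have "onm A \<Otimes>\<^sub>M onm B = density (lborel \<Otimes>\<^sub>M lborel) (\<lambda>(x,y). indicator A x * indicator B y)"
    unfolding onm_def
    by (rule pair_measure_density)
       (use assms B.sigma_finite_measure_axioms in \<open>auto simp: onm_def sigma_finite_lborel\<close>)
  also have "\<dots> = onm (A \<times> B)"
    unfolding onm_def lborel_prod by (rule arg_cong2[where f=density]) (auto simp: fun_eq_iff split: split_indicator)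
  finally show ?thesis .
qed

text \<open>The definitions are phrased with \<open>lebesgue_on\<close>, the proof works with
  \<open>onm\<close>; on Borel functions the completion does not change integrals.\<close>

lemma lebesgue_on_onm:
  fixes f :: "'a::euclidean_space \<Rightarrow> real"
  assumes "A \<in> sets borel" "f \<in> borel_measurable borel"
  shows "(LINT x|lebesgue_on A. f x) = (LINT x|onm A. f x)"
    and "integrable (lebesgue_on A) f \<longleftrightarrow> integrable (onm A) f"
proof -
  have *: "(\<lambda>x. indicator A x * f x) \<in> borel_measurable lborel" using assms by auto
  show "(LINT x|lebesgue_on A. f x) = (LINT x|onm A. f x)"
    using assms by (subst integral_restrict_space) (auto simp: integral_completion[OF *] integral_onm)
  show "integrable (lebesgue_on A) f \<longleftrightarrow> integrable (onm A) f"
    using assms by (subst integrable_restrict_space) (auto simp: integrable_completion[OF *] integrable_onm)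
qed

lemma AE_lebesgue_on_onm:
  fixes A :: "'a::euclidean_space set"
  assumes "A \<in> sets borel"
  shows "(AE x in lebesgue_on A. P x) \<longleftrightarrow> (AE x in onm A. P x)"
  using assms by (subst AE_restrict_space_iff) (auto simp: AE_completion_iff AE_onm)

section \<open>Square integrable functions: Cauchy-Schwarz inequality and completeness\<close>

definition L2fun :: "'a measure \<Rightarrow> ('a \<Rightarrow> real) \<Rightarrow> bool" where
  "L2fun M f \<longleftrightarrow> f \<in> borel_measurable M \<and> integrable M (\<lambda>x. (f x)\<^sup>2)"

lemma L2fun_meas: "L2fun M f \<Longrightarrow> f \<in> borel_measurable M"
  and L2fun_int: "L2fun M f \<Longrightarrow> integrable M (\<lambda>x. (f x)\<^sup>2)"
  by (auto simp: L2fun_def)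

lemma L2fun_prod:
  assumes "L2fun M f" "L2fun M g"
  shows "integrable M (\<lambda>x. f x * g x)"
proof (rule Bochner_Integration.integrable_bound)
  have [measurable]: "f \<in> borel_measurable M" "g \<in> borel_measurable M" using assms by (auto simp: L2fun_def)
  show "integrable M (\<lambda>x. (f x)\<^sup>2 + (g x)\<^sup>2)" using assms by (auto simp: L2fun_def)
  show "(\<lambda>x. f x * g x) \<in> borel_measurable M" by measurable
  have "\<bar>a * b\<bar> \<le> a\<^sup>2 + b\<^sup>2" for a b :: real
  proof -
    have "0 \<le> (\<bar>a\<bar> - \<bar>b\<bar>)\<^sup>2" by simp
    then have "2 * \<bar>a * b\<bar> \<le> a\<^sup>2 + b\<^sup>2" by (simp add: power2_diff abs_mult)
    then show ?thesis by (smt (verit) abs_ge_zero)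
  qed
  then show "AE x in M. norm (f x * g x) \<le> norm ((f x)\<^sup>2 + (g x)\<^sup>2)" by simp
qed

lemma L2fun_add: assumes "L2fun M f" "L2fun M g" shows "L2fun M (\<lambda>x. f x + g x)"
proof -
  have [measurable]: "f \<in> borel_measurable M" "g \<in> borel_measurable M" using assms by (auto simp: L2fun_def)
  have "integrable M (\<lambda>x. (f x)\<^sup>2 + (g x)\<^sup>2 + 2 * (f x * g x))"
    using assms L2fun_prod[OF assms] by (auto simp: L2fun_def)
  then show ?thesis by (simp add: L2fun_def power2_sum algebra_simps)
qed

lemma L2fun_cmult: assumes "L2fun M f" shows "L2fun M (\<lambda>x. c * f x)"
  using assms by (auto simp: L2fun_def power_mult_distrib)

lemma L2fun_diff: assumes "L2fun M f" "L2fun M g" shows "L2fun M (\<lambda>x. f x - g x)"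
  using L2fun_add[OF assms(1) L2fun_cmult[OF assms(2), of "-1"]] by simp

lemma (in finite_measure) L2fun_const: "L2fun M (\<lambda>x. c)"
  by (simp add: L2fun_def)

lemma (in finite_measure) L2fun_integrable: "L2fun M f \<Longrightarrow> integrable M f"
  using L2fun_prod[of M f "\<lambda>_. 1"] L2fun_const[of 1] by simp

lemma Cauchy_Schwarz_integral:
  assumes "L2fun M f" "L2fun M g"
  shows "(LINT x|M. f x * g x)\<^sup>2 \<le> (LINT x|M. (f x)\<^sup>2) * (LINT x|M. (g x)\<^sup>2)"
proof -
  let ?A = "LINT x|M. (f x)\<^sup>2" and ?B = "LINT x|M. (g x)\<^sup>2" and ?C = "LINT x|M. f x * g x"
  note i = L2fun_int[OF assms(1)] L2fun_int[OF assms(2)] L2fun_prod[OF assms]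
  have q: "0 \<le> ?A - 2 * t * ?C + t\<^sup>2 * ?B" for t
  proof -
    have "0 \<le> (LINT x|M. (f x - t * g x)\<^sup>2)" by simp
    also have "(\<lambda>x. (f x - t * g x)\<^sup>2) = (\<lambda>x. (f x)\<^sup>2 - 2 * t * (f x * g x) + t\<^sup>2 * (g x)\<^sup>2)"
      by (auto simp: power2_eq_square algebra_simps)
    also have "(LINT x|M. (f x)\<^sup>2 - 2 * t * (f x * g x) + t\<^sup>2 * (g x)\<^sup>2) = ?A - 2 * t * ?C + t\<^sup>2 * ?B"
      using i by simp
    finally show ?thesis .
  qed
  have B0: "?B \<ge> 0" and A0: "?A \<ge> 0" by auto
  show ?thesis
  proof (cases "?B = 0")
    case True
    have "?C = 0"
    proof (rule ccontr)
      assume "?C \<noteq> 0"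
      \<comment> \<open>With \<open>?B = 0\<close> the quadratic is affine in \<open>t\<close>; at
        this \<open>t\<close> its value is -1.\<close>
      then show False using q[of "(?A + 1) / (2 * ?C)"] True by (simp add: field_simps)
    qed
    then show ?thesis using True by simp
  next
    case False
    then have "?B > 0" using B0 by linarith
    \<comment> \<open>Here the minimizer of the quadratic is inserted.\<close>
    then show ?thesis using q[of "?C / ?B"] by (simp add: field_simps power2_eq_square)
  qed
qed

lemma (in finite_measure) Cauchy_Schwarz_abs:
  assumes "L2fun M f"
  shows "(LINT x|M. \<bar>f x\<bar>)\<^sup>2 \<le> measure M (space M) * (LINT x|M. (f x)\<^sup>2)"
proof -
  have "L2fun M (\<lambda>x. \<bar>f x\<bar>)" using assms by (auto simp: L2fun_def)
  from Cauchy_Schwarz_integral[OF this L2fun_const[of 1]] show ?thesis by (simp add: mult.commute)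
qed

text \<open>Riesz--Fischer: a subsequence with \<open>L\<^sup>2\<close> increments \<open>2\<^sup>-\<^sup>k\<close> converges almost everywhere, and
  Fatou's lemma identifies its limit as the \<open>L\<^sup>2\<close> limit of the whole sequence.\<close>

lemma (in finite_measure) L2fun_complete:
  fixes f :: "nat \<Rightarrow> 'a \<Rightarrow> real"
  assumes f: "\<And>n. L2fun M (f n)"
    and cau: "\<And>e. e > 0 \<Longrightarrow> \<exists>N. \<forall>m\<ge>N. \<forall>n\<ge>N. (LINT x|M. (f m x - f n x)\<^sup>2) < e"
  obtains h where "L2fun M h" "(\<lambda>n. LINT x|M. (f n x - h x)\<^sup>2) \<longlonglongrightarrow> 0"
proof -
  have [measurable]: "f n \<in> borel_measurable M" for n using f by (simp add: L2fun_def)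
  have "\<exists>N. \<forall>k. (\<forall>m\<ge>N k. \<forall>n\<ge>N k. (LINT x|M. (f m x - f n x)\<^sup>2) < (1/4)^k)"
    using cau[of "(1/4)^_"] by (intro choice allI) auto
  then obtain N where N: "\<And>k m n. m \<ge> N k \<Longrightarrow> n \<ge> N k \<Longrightarrow> (LINT x|M. (f m x - f n x)\<^sup>2) < (1/4)^k" by blast
  \<comment> \<open>The sum dominates \<open>N k\<close> and is monotone in \<open>k\<close>; the
    summand \<open>k\<close> sends the indices to infinity, which is needed when Fatou's lemma is
    applied along them.\<close>
  define r where "r k = (\<Sum>i\<le>k. N i) + k" for k
  have rN: "r k \<ge> N k" for k unfolding r_def by (rule trans_le_add1) (rule member_le_sum, auto)
  have rS: "r k \<le> r (Suc k)" for k by (simp add: r_def)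
  have rk: "r k \<ge> k" for k by (simp add: r_def)
  define d where "d k x = \<bar>f (r (Suc k)) x - f (r k) x\<bar>" for k x
  have [measurable]: "d k \<in> borel_measurable M" for k unfolding d_def by measurable
  define C where "C = sqrt (measure M (space M))"
  have di: "integrable M (d k)" for k
    unfolding d_def by (intro integrable_abs L2fun_integrable L2fun_diff f)
  have dI: "(LINT x|M. d k x) \<le> C * (1/2)^k" for k
  proof -
    have "(LINT x|M. d k x)\<^sup>2 \<le> measure M (space M) * (LINT x|M. (f (r (Suc k)) x - f (r k) x)\<^sup>2)"
      unfolding d_def by (rule Cauchy_Schwarz_abs) (intro L2fun_diff f)
    also have "\<dots> \<le> measure M (space M) * (1/4)^k"
      using N[where k=k and m="r (Suc k)" and n="r k"] rN[of k] rS[of k] by (intro mult_left_mono) auto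
    also have "\<dots> = (C * (1/2)^k)\<^sup>2"
      unfolding C_def power_mult_distrib power_mult[symmetric] by (simp add: power_mult mult.commute[of k 2] power2_eq_square)
    finally show ?thesis by (rule power2_le_imp_le) (simp add: C_def)
  qed
  have "(\<integral>\<^sup>+x. (\<Sum>k. ennreal (d k x)) \<partial>M) = (\<Sum>k. \<integral>\<^sup>+x. ennreal (d k x) \<partial>M)"
    by (rule nn_integral_suminf) measurable
  also have "\<dots> \<le> (\<Sum>k. ennreal (C * (1/2)^k))"
  proof (rule suminf_le)
    fix k
    have "(\<integral>\<^sup>+x. ennreal (d k x) \<partial>M) = ennreal (LINT x|M. d k x)"
      by (rule nn_integral_eq_integral[OF di]) (simp add: d_def)
    then show "(\<integral>\<^sup>+x. ennreal (d k x) \<partial>M) \<le> ennreal (C * (1/2)^k)"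
      using dI[of k] by (simp add: ennreal_leI)
  qed auto
  also have "\<dots> = ennreal (\<Sum>k. C * (1/2)^k)"
    by (rule suminf_ennreal2) (auto simp: C_def intro!: summable_mult summable_geometric)
  also have "\<dots> < \<infinity>" by simp
  finally have "AE x in M. (\<Sum>k. ennreal (d k x)) \<noteq> \<infinity>"
    by (intro nn_integral_noteq_infinite) auto
  then have "AE x in M. convergent (\<lambda>k. f (r k) x)"
  proof eventually_elim
    case (elim x)
    have "summable (\<lambda>k. d k x)"
      by (rule summable_suminf_not_top) (use elim in \<open>auto simp: d_def\<close>)
    then have "summable (\<lambda>k. f (r (Suc k)) x - f (r k) x)"
      unfolding d_def by (rule summable_rabs_cancel)
    then have "convergent (\<lambda>n. \<Sum>k<n. f (r (Suc k)) x - f (r k) x)" by (simp add: summable_iff_convergent)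
    then have "convergent (\<lambda>n. (\<Sum>k<n. f (r (Suc k)) x - f (r k) x) + f (r 0) x)"
      by (rule convergent_add[OF _ convergent_const])
    then show ?case by (simp add: sum_lessThan_telescope[of "\<lambda>k. f (r k) x"])
  qed
  then have lim: "AE x in M. (\<lambda>k. f (r k) x) \<longlonglongrightarrow> lim (\<lambda>k. f (r k) x)"
    by (simp add: convergent_LIMSEQ_iff)
  define h where "h x = lim (\<lambda>k. f (r k) x)" for x
  have [measurable]: "h \<in> borel_measurable M" unfolding h_def by measurable
  have fat: "(\<integral>\<^sup>+x. ennreal ((f n x - h x)\<^sup>2) \<partial>M) \<le> ennreal e"
    if e: "e > 0" and M: "\<And>m. m \<ge> M' \<Longrightarrow> (LINT x|M. (f n x - f m x)\<^sup>2) < e" for n e M'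
  proof -
    have "(\<integral>\<^sup>+x. ennreal ((f n x - h x)\<^sup>2) \<partial>M) = (\<integral>\<^sup>+x. liminf (\<lambda>k. ennreal ((f n x - f (r k) x)\<^sup>2)) \<partial>M)"
    proof (rule nn_integral_cong_AE, use lim in eventually_elim)
      case (elim x)
      have "(\<lambda>k. ennreal ((f n x - f (r k) x)\<^sup>2)) \<longlonglongrightarrow> ennreal ((f n x - h x)\<^sup>2)"
        using elim by (intro tendsto_intros) (auto simp: h_def)
      then show ?case by (simp add: lim_imp_Liminf[symmetric])
    qed
    also have "\<dots> \<le> liminf (\<lambda>k. \<integral>\<^sup>+x. ennreal ((f n x - f (r k) x)\<^sup>2) \<partial>M)"
      by (rule nn_integral_liminf) measurable
    also have "\<dots> \<le> ennreal e"
    proof (rule Liminf_le)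
      have "(\<integral>\<^sup>+x. ennreal ((f n x - f (r k) x)\<^sup>2) \<partial>M) \<le> ennreal e" if "k \<ge> M'" for k
        using M[of "r k"] rk[of k] that L2fun_int[OF L2fun_diff[OF f f], of n "r k"]
        by (subst nn_integral_eq_integral) (auto intro!: ennreal_leI)
      then show "\<forall>\<^sub>F k in sequentially. (\<integral>\<^sup>+x. ennreal ((f n x - f (r k) x)\<^sup>2) \<partial>M) \<le> ennreal e"
        by (auto simp: eventually_sequentially)
    qed simp
    finally show ?thesis .
  qed
  have L: "L2fun M (\<lambda>x. f n x - h x) \<and> (LINT x|M. (f n x - h x)\<^sup>2) \<le> e"
    if e: "e > 0" and M: "\<And>m. m \<ge> M' \<Longrightarrow> (LINT x|M. (f n x - f m x)\<^sup>2) < e" for n e M'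
  proof -
    have "integrable M (\<lambda>x. (f n x - h x)\<^sup>2)"
      using le_less_trans[OF fat[OF e M] ennreal_less_top] by (intro integrableI_bounded) (auto simp: less_top)
    then show ?thesis using fat[OF e M] e by (auto simp: L2fun_def nn_integral_eq_integral ennreal_le_iff)
  qed
  have lim0: "(\<lambda>n. LINT x|M. (f n x - h x)\<^sup>2) \<longlonglongrightarrow> 0"
  proof (rule LIMSEQ_I)
    fix e :: real assume e: "e > 0"
    obtain N' where N': "\<forall>m\<ge>N'. \<forall>n\<ge>N'. (LINT x|M. (f m x - f n x)\<^sup>2) < e/2" using cau[of "e/2"] e by auto
    have "norm ((LINT x|M. (f n x - h x)\<^sup>2) - 0) < e" if "n \<ge> N'" for n
      using L[of "e/2" N' n] N' that e by auto
    then show "\<exists>no. \<forall>n\<ge>no. norm ((LINT x|M. (f n x - h x)\<^sup>2) - 0) < e" by blast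
  qed
  have "L2fun M h"
  proof -
    obtain N' where N': "\<forall>m\<ge>N'. \<forall>n\<ge>N'. (LINT x|M. (f m x - f n x)\<^sup>2) < 1" using cau[of 1] by auto
    have "L2fun M (\<lambda>x. f N' x - h x)" using L[of 1 N' N'] N' by auto
    from L2fun_diff[OF f[of N'] this] show ?thesis by simp
  qed
  then show thesis using lim0 that by blast
qed

text \<open>Only indicators need an argument; sums and dominated limits follow by the triangle
  inequality. A Borel set of finite measure lies between a closed \<open>F\<close> and an open
  \<open>U\<close> with \<open>U - F\<close> of small measure, and a Urysohn function that is 1 on
  \<open>F\<close> and 0 off \<open>U\<close> differs from the indicator on \<open>U - F\<close>
  only.\<close>

lemma integrable_approx_continuous:
  fixes f :: "'a::euclidean_space \<Rightarrow> real"
  assumes "integrable lborel f"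
  shows "\<forall>e>0. \<exists>v. continuous_on UNIV v \<and> integrable lborel v \<and> (LINT x|lborel. \<bar>f x - v x\<bar>) < e"
  using assms
proof (induction rule: integrable_induct)
  case (base A c)
  show ?case
  proof (intro allI impI)
    fix e :: real assume e: "e > 0"
    \<comment> \<open>The final error is at most \<open>2 * e' * \<bar>c\<bar>\<close>; the
      \<open>+ 1\<close> covers \<open>c = 0\<close>.\<close>
    define e' where "e' = e / (2 * (\<bar>c\<bar> + 1))"
    have e': "e' > 0" using e by (simp add: e'_def)
    have A: "A \<in> sets lebesgue" using base by auto
    obtain U where U: "open U" "A \<subseteq> U" "U - A \<in> lmeasurable" "emeasure lebesgue (U - A) < ennreal e'"
      using sets_lebesgue_outer_open[OF A e'] by blast
    obtain F where F: "closed F" "F \<subseteq> A" "A - F \<in> lmeasurable" "emeasure lebesgue (A - F) < ennreal e'"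
      using sets_lebesgue_inner_closed[OF A e'] by blast
    have UB [measurable]: "U \<in> sets borel" "F \<in> sets borel" using U F by auto
    have [measurable]: "A \<in> sets borel" using base by auto
    obtain g :: "'a \<Rightarrow> real" where g: "continuous_on UNIV g" "\<And>x. g x \<in> closed_segment 0 1"
       "\<And>x. x \<in> - U \<Longrightarrow> g x = 0" "\<And>x. x \<in> F \<Longrightarrow> g x = 1"
      by (rule Urysohn_local[of UNIV "-U" F 0 1]) (use U F in auto)
    have [measurable]: "g \<in> borel_measurable borel" using g(1) by (rule borel_measurable_continuous_onI)
    have g01: "0 \<le> g x" "g x \<le> 1" for x using g(2)[of x] by (auto simp: closed_segment_eq_real_ivl split: if_splits)
    have m: "emeasure lborel (U - F) < ennreal (2 * e')"
    proof -
      have "U - F = (U - A) \<union> (A - F)" using U F by auto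
      then have "emeasure lborel (U - F) \<le> emeasure lborel (U - A) + emeasure lborel (A - F)"
        by (simp add: emeasure_subadditive)
      also have "\<dots> < ennreal e' + ennreal e'"
        using U(4) F(4) by (intro add_strict_mono) (auto)
      also have "\<dots> = ennreal (2 * e')" using e' by (simp flip: ennreal_plus)
      finally show ?thesis .
    qed
    have fin: "emeasure lborel (U - F) < \<infinity>" using m by (simp add: less_trans[OF _ ennreal_less_top])
    have mm: "measure lborel (U - F) < 2 * e'"
      using m e' fin by (simp add: emeasure_eq_ennreal_measure ennreal_less_iff less_top)
    have iUF: "integrable lborel (indicator (U - F) :: 'a \<Rightarrow> real)" using fin by auto
    have le: "\<bar>indicator A x - g x\<bar> \<le> indicator (U - F) x" for x
      using g01[of x] g(3,4)[of x] U(2) F(2) by (auto split: split_indicator)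
    have iA: "integrable lborel (indicator A :: 'a \<Rightarrow> real)" using base by auto
    have id: "integrable lborel (\<lambda>x. indicator A x - g x)"
      by (rule Bochner_Integration.integrable_bound[OF iUF]) (use le in auto)
    have ig: "integrable lborel g" using Bochner_Integration.integrable_diff[OF iA id] by simp
    have "(LINT x|lborel. \<bar>indicator A x *\<^sub>R c - g x * c\<bar>) = (LINT x|lborel. \<bar>indicator A x - g x\<bar> * \<bar>c\<bar>)"
      by (simp flip: abs_mult left_diff_distrib)
    also have "\<dots> = (LINT x|lborel. \<bar>indicator A x - g x\<bar>) * \<bar>c\<bar>" by simp
    also have "\<dots> \<le> (LINT x|lborel. indicator (U - F) x) * \<bar>c\<bar>"
      using le id iUF by (intro mult_right_mono integral_mono) auto
    also have "\<dots> \<le> 2 * e' * \<bar>c\<bar>" using mm by (intro mult_right_mono) auto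
    also have "\<dots> < e" using e by (simp add: e'_def field_simps)
    finally have "(LINT x|lborel. \<bar>indicator A x *\<^sub>R c - g x * c\<bar>) < e" .
    then show "\<exists>v. continuous_on UNIV v \<and> integrable lborel v \<and> (LINT x|lborel. \<bar>indicator A x *\<^sub>R c - v x\<bar>) < e"
      using g(1) ig by (intro exI[of _ "\<lambda>x. g x * c"]) (auto intro!: continuous_intros)
  qed
next
  case (add f g)
  show ?case
  proof (intro allI impI)
    fix e :: real assume e: "e > 0"
    obtain v where v: "continuous_on UNIV v" "integrable lborel v" "(LINT x|lborel. \<bar>f x - v x\<bar>) < e/2"
      using add(3) e by (meson half_gt_zero)
    obtain w where w: "continuous_on UNIV w" "integrable lborel w" "(LINT x|lborel. \<bar>g x - w x\<bar>) < e/2"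
      using add(4) e by (meson half_gt_zero)
    have "(LINT x|lborel. \<bar>f x + g x - (v x + w x)\<bar>) \<le> (LINT x|lborel. \<bar>f x - v x\<bar> + \<bar>g x - w x\<bar>)"
      using add v w by (intro integral_mono) auto
    also have "\<dots> < e" using add v w by simp
    finally show "\<exists>v. continuous_on UNIV v \<and> integrable lborel v \<and> (LINT x|lborel. \<bar>f x + g x - v x\<bar>) < e"
      using v w by (intro exI[of _ "\<lambda>x. v x + w x"]) (auto intro!: continuous_intros)
  qed
next
  case (lim f s)
  show ?case
  proof (intro allI impI)
    fix e :: real assume e: "e > 0"
    have [measurable]: "f \<in> borel_measurable borel" "\<And>i. s i \<in> borel_measurable borel"
      using lim(1,4) by (auto dest!: borel_measurable_integrable)
    have if': "integrable lborel f" using lim by simp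
    \<comment> \<open>The induction supplies approximations with
      \<open>\<bar>s i x\<bar> \<le> 2 * \<bar>f x\<bar>\<close>, which explains the dominating
      function \<open>3 * \<bar>f x\<bar>\<close>.\<close>
    have "(\<lambda>i. LINT x|lborel. \<bar>f x - s i x\<bar>) \<longlonglongrightarrow> (LINT x|(lborel::'a measure). (0::real))"
    proof (rule integral_dominated_convergence[where w="\<lambda>x. 3 * \<bar>f x\<bar>"])
      show "AE x in lborel. (\<lambda>i. \<bar>f x - s i x\<bar>) \<longlonglongrightarrow> 0"
      proof (rule AE_I2)
        fix x :: 'a
        have "(\<lambda>i. \<bar>f x - s i x\<bar>) \<longlonglongrightarrow> \<bar>f x - f x\<bar>" using lim by (intro tendsto_intros) auto
        then show "(\<lambda>i. \<bar>f x - s i x\<bar>) \<longlonglongrightarrow> 0" by simp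
      qed
      show "AE x in lborel. norm \<bar>f x - s i x\<bar> \<le> 3 * \<bar>f x\<bar>" for i
      proof (rule AE_I2)
        fix x :: 'a
        have "\<bar>s i x\<bar> \<le> 2 * \<bar>f x\<bar>" using lim(3)[of x i] by auto
        then show "norm \<bar>f x - s i x\<bar> \<le> 3 * \<bar>f x\<bar>" by auto
      qed
    qed (use if' in auto)
    then have "\<forall>\<^sub>F i in sequentially. (LINT x|lborel. \<bar>f x - s i x\<bar>) < e/2"
      using e by (intro order_tendstoD(2)) auto
    then obtain i where i: "(LINT x|lborel. \<bar>f x - s i x\<bar>) < e/2" by (auto simp: eventually_sequentially)
    obtain v where v: "continuous_on UNIV v" "integrable lborel v" "(LINT x|lborel. \<bar>s i x - v x\<bar>) < e/2"
      using lim e by (meson half_gt_zero)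
    have "(LINT x|lborel. \<bar>f x - v x\<bar>) \<le> (LINT x|lborel. \<bar>f x - s i x\<bar> + \<bar>s i x - v x\<bar>)"
      using lim v if' by (intro integral_mono) auto
    also have "\<dots> < e" using lim v if' i by simp
    finally show "\<exists>v. continuous_on UNIV v \<and> integrable lborel v \<and> (LINT x|lborel. \<bar>f x - v x\<bar>) < e"
      using v by blast
  qed
qed

section \<open>Absolutely continuous functions on an interval\<close>

text \<open>The integral is not oriented: the value is 0 for \<open>s \<le> a\<close>, and the
  function is a primitive to the right of \<open>a\<close> only. Absolute continuity enters the
  development solely through such indefinite integrals.\<close>

definition prim :: "real \<Rightarrow> (real \<Rightarrow> real) \<Rightarrow> real \<Rightarrow> real" where
  "prim a g s = (LINT \<sigma>|lborel. indicator {a<..<s} \<sigma> * g \<sigma>)"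

text \<open>Equality almost everywhere makes this a property of equivalence classes:
  \<open>f\<close> has an absolutely continuous representative, and \<open>g\<close> is its
  derivative. Values at single points, as in cutting, have to be taken from
  \<open>c + prim a g\<close> and not from \<open>f\<close>.\<close>

definition w11 :: "real \<Rightarrow> real \<Rightarrow> (real \<Rightarrow> real) \<Rightarrow> (real \<Rightarrow> real) \<Rightarrow> bool" where
  "w11 a b f g \<longleftrightarrow> integrable (onm {a<..<b}) g \<and> (\<exists>c. AE s in onm {a<..<b}. f s = c + prim a g s)"

lemma integrable_onm_borel: "integrable (onm A) g \<Longrightarrow> g \<in> borel_measurable borel"
  using borel_measurable_integrable[of "onm A" g] by (simp cong: measurable_cong_sets)

text \<open>Joint measurability in the end point and a parameter is what Fubini's theorem asks for
  when primitives along all lines of a family are considered together.\<close>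

lemma prim_measurable_param:
  assumes [measurable]: "case_prod G \<in> borel_measurable (borel \<Otimes>\<^sub>M borel)"
  shows "(\<lambda>(s,t). prim a (\<lambda>\<sigma>. G \<sigma> t) s) \<in> borel_measurable (borel \<Otimes>\<^sub>M borel)"
proof -
  have "(\<lambda>p. LINT \<sigma>|lborel. (if a < \<sigma> \<and> \<sigma> < fst p then G \<sigma> (snd p) else 0)) \<in> borel_measurable (borel \<Otimes>\<^sub>M borel)"
    by measurable
  also have "(\<lambda>p. LINT \<sigma>|lborel. (if a < \<sigma> \<and> \<sigma> < fst p then G \<sigma> (snd p) else 0)) = (\<lambda>(s,t). prim a (\<lambda>\<sigma>. G \<sigma> t) s)"
    by (auto simp: fun_eq_iff prim_def intro!: Bochner_Integration.integral_cong)
  finally show ?thesis .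
qed

lemma prim_measurable [measurable]:
  assumes [measurable]: "g \<in> borel_measurable borel"
  shows "prim a g \<in> borel_measurable borel"
proof -
  have "(\<lambda>(s,t::real). prim a g s) \<in> borel_measurable (borel \<Otimes>\<^sub>M borel)"
    by (rule prim_measurable_param[of "\<lambda>\<sigma> t. g \<sigma>"]) measurable
  then have "(\<lambda>s. (\<lambda>(s,t::real). prim a g s) (s, 0)) \<in> borel_measurable borel" by measurable
  then show ?thesis by simp
qed

lemma prim_eq_integral_onm:
  "g \<in> borel_measurable borel \<Longrightarrow> prim a g s = (LINT \<sigma>|onm {a<..<s}. g \<sigma>)"
  by (simp add: prim_def integral_onm)

lemma prim_base [simp]: "prim a g a = 0"
  by (simp add: prim_def)

lemma prim_cong_AE:
  assumes "AE s in onm {a<..<b}. g s = h s" "s \<le> b" "g \<in> borel_measurable borel" "h \<in> borel_measurable borel"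
  shows "prim a g s = prim a h s"
  unfolding prim_def
proof (rule integral_cong_AE)
  have "AE s in lborel. s \<in> {a<..<b} \<longrightarrow> g s = h s" using assms by (simp add: AE_onm)
  then show "AE \<sigma> in lborel. indicator {a<..<s} \<sigma> * g \<sigma> = indicator {a<..<s} \<sigma> * h \<sigma>"
    by eventually_elim (use assms(2) in \<open>auto split: split_indicator\<close>)
qed (use assms in auto)

lemma prim_diff:
  assumes g: "integrable (onm {a<..<b}) g" and s: "a \<le> s" "s \<le> s'" "s' \<le> b"
  shows "prim a g s' - prim a g s = (LINT \<sigma>|onm {s<..<s'}. g \<sigma>)"
proof -
  have [measurable]: "g \<in> borel_measurable borel" using g by (rule integrable_onm_borel)
  have i: "integrable lborel (\<lambda>x. indicator {a<..<s} x * g x)" "integrable lborel (\<lambda>x. indicator {a<..<s'} x * g x)"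
    using onm_subset_integrable[OF g, of "{a<..<s}"] onm_subset_integrable[OF g, of "{a<..<s'}"] s
      greaterThanLessThan_subseteq_greaterThanLessThan[of a s a b] greaterThanLessThan_subseteq_greaterThanLessThan[of a s' a b]
    by (simp_all add: integrable_onm)
  have "prim a g s' - prim a g s = (LINT x|lborel. indicator {a<..<s'} x * g x - indicator {a<..<s} x * g x)"
    using i by (simp add: prim_def)
  also have "\<dots> = (LINT x|lborel. indicator {s<..<s'} x * g x)"
  proof (rule integral_cong_AE)
    show "AE x in lborel. indicator {a<..<s'} x * g x - indicator {a<..<s} x * g x = indicator {s<..<s'} x * g x"
      using AE_lborel_singleton[of s] by eventually_elim (use s in \<open>auto split: split_indicator\<close>)
  qed auto
  finally show ?thesis by (simp add: integral_onm)
qed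

lemma prim_diff_abs:
  assumes g: "integrable (onm {a<..<b}) g" and s: "s \<in> {a..b}" "s' \<in> {a..b}"
  shows "\<bar>prim a g s' - prim a g s\<bar> \<le> (LINT \<sigma>|onm {a<..<b}. \<bar>g \<sigma>\<bar>)"
proof -
  have *: "\<bar>prim a g s' - prim a g s\<bar> \<le> (LINT \<sigma>|onm {a<..<b}. \<bar>g \<sigma>\<bar>)" if s: "a \<le> s" "s \<le> s'" "s' \<le> b" for s s'
  proof -
    have [measurable]: "g \<in> borel_measurable borel" using g by (rule integrable_onm_borel)
    have i: "integrable (onm {s<..<s'}) g" by (rule onm_subset_integrable[OF g]) (use s in auto)
    have "\<bar>prim a g s' - prim a g s\<bar> \<le> (LINT \<sigma>|onm {s<..<s'}. \<bar>g \<sigma>\<bar>)"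
      unfolding prim_diff[OF g s] by (rule integral_abs_bound)
    also have "\<dots> \<le> (LINT \<sigma>|onm {a<..<b}. \<bar>g \<sigma>\<bar>)"
      using i g s by (auto simp: integral_onm integrable_onm intro!: integral_mono split: split_indicator
          dest: integrable_abs simp: abs_mult)
    finally show ?thesis .
  qed
  show ?thesis using *[of s s'] *[of s' s] s by (cases "s \<le> s'") (auto simp: abs_minus_commute)
qed

lemma prim_HK:
  assumes g: "integrable (onm {a<..<b}) g" and s: "a \<le> s" "s \<le> b"
  shows "g integrable_on {a..s}" "prim a g s = integral {a..s} g"
proof -
  have m [measurable]: "g \<in> borel_measurable borel" using g by (rule integrable_onm_borel)
  have i: "integrable (onm {a<..<s}) g" by (rule onm_subset_integrable[OF g]) (use s in auto)
  have i': "integrable lborel (\<lambda>x. indicator {a..s} x *\<^sub>R g x)"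
  proof (rule integrable_cong_AE_imp[of lborel "\<lambda>x. indicator {a<..<s} x * g x"])
    show "AE x in lborel. indicator {a<..<s} x * g x = indicator {a..s} x *\<^sub>R g x"
      using AE_lborel_singleton[of a] AE_lborel_singleton[of s]
      by eventually_elim (auto split: split_indicator)
  qed (use i in \<open>auto simp: integrable_onm\<close>)
  then have *: "set_integrable lborel {a..s} g" by (simp add: set_integrable_def)
  show "g integrable_on {a..s}" using set_borel_integral_eq_integral(1)[OF *] .
  have "prim a g s = (LINT x:{a..s}|lborel. g x)"
    unfolding prim_def set_lebesgue_integral_def
  proof (rule integral_cong_AE)
    show "AE x in lborel. indicator {a<..<s} x * g x = indicator {a..s} x *\<^sub>R g x"
      using AE_lborel_singleton[of a] AE_lborel_singleton[of s]
      by eventually_elim (auto split: split_indicator)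
  qed auto
  then show "prim a g s = integral {a..s} g" using set_borel_integral_eq_integral(2)[OF *] by simp
qed

section \<open>The chain rule for primitives\<close>

lemma integrable_onm_bounded_mult:
  fixes g h :: "'a::euclidean_space \<Rightarrow> real"
  assumes g: "integrable (onm A) g" and h: "h \<in> borel_measurable borel" "\<And>x. \<bar>h x\<bar> \<le> M"
  shows "integrable (onm A) (\<lambda>x. h x * g x)"
proof (rule Bochner_Integration.integrable_bound)
  have [measurable]: "g \<in> borel_measurable borel" using g by (rule integrable_onm_borel)
  show "integrable (onm A) (\<lambda>x. M * \<bar>g x\<bar>)" using g by auto
  show "(\<lambda>x. h x * g x) \<in> borel_measurable (onm A)" using h(1) by measurable
  show "AE x in onm A. norm (h x * g x) \<le> norm (M * \<bar>g x\<bar>)"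
    using h(2) by (intro AE_I2) (auto simp: abs_mult intro!: mult_right_mono order_trans[OF h(2)])
qed

lemma integrable_onm_continuous:
  fixes g :: "real \<Rightarrow> real"
  assumes "continuous_on UNIV g"
  shows "integrable (onm {a<..<b}) g"
proof -
  have [measurable]: "g \<in> borel_measurable borel" using assms by (rule borel_measurable_continuous_onI)
  have "set_integrable lborel {a..b} g"
    by (rule borel_integrable_atLeastAtMost') (use assms continuous_on_subset in auto)
  then have "set_integrable lborel {a<..<b} g" by (rule set_integrable_subset) auto
  then show ?thesis by (simp add: integrable_onm set_integrable_def)
qed

text \<open>A primitive of a continuous function is differentiable everywhere, so the fundamental
  theorem of calculus applies. For integrable \<open>g\<close> the formula is obtained from this
  case by approximation.\<close>

lemma prim_chain_continuous:
  assumes g: "continuous_on UNIV g" and F: "\<And>x. (F has_real_derivative F' x) (at x)"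
    and F': "continuous_on UNIV F'" and s: "a \<le> s"
  shows "F (c + prim a g s) = F c + prim a (\<lambda>\<sigma>. F' (c + prim a g \<sigma>) * g \<sigma>) s"
proof -
  note i = integrable_onm_continuous[OF g]
  define f where "f \<sigma> = c + integral {a..\<sigma>} g" for \<sigma>
  have fp: "f \<sigma> = c + prim a g \<sigma>" if "a \<le> \<sigma>" for \<sigma>
    using prim_HK(2)[OF i[of a \<sigma>] that] by (simp add: f_def)
  have "(f has_real_derivative g \<sigma>) (at \<sigma> within {a..s})" if "\<sigma> \<in> {a..s}" for \<sigma>
    unfolding f_def using integral_has_real_derivative[of a s g \<sigma>] that continuous_on_subset[OF g, of "{a..s}"]
    by (auto intro!: derivative_eq_intros)
  then have d: "((\<lambda>\<sigma>. F (f \<sigma>)) has_real_derivative F' (f \<sigma>) * g \<sigma>) (at \<sigma> within {a..s})" if "\<sigma> \<in> {a..s}" for \<sigma>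
    by (rule DERIV_chain2[where f=F and g=f, OF F[of "f \<sigma>"]]) (use that in blast)
  have hi: "((\<lambda>\<sigma>. F' (f \<sigma>) * g \<sigma>) has_integral (F (f s) - F (f a))) {a..s}"
    by (rule fundamental_theorem_of_calculus[OF s]) (use d in \<open>auto simp: has_real_derivative_iff_has_vector_derivative\<close>)
  have cf: "continuous_on {a..s} f"
    unfolding f_def by (intro continuous_intros indefinite_integral_continuous_1 integrable_continuous_interval continuous_on_subset[OF g]) auto
  have ci: "continuous_on {a..s} (\<lambda>\<sigma>. F' (f \<sigma>) * g \<sigma>)"
    by (intro continuous_intros continuous_on_compose2[OF F' cf] continuous_on_subset[OF g]) auto
  have [measurable]: "g \<in> borel_measurable borel" "F' \<in> borel_measurable borel"
    using g F' by (auto intro: borel_measurable_continuous_onI)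
  let ?h = "\<lambda>\<sigma>. F' (c + prim a g \<sigma>) * g \<sigma>"
  have "set_integrable lborel {a..s} (\<lambda>\<sigma>. F' (f \<sigma>) * g \<sigma>)"
    by (rule borel_integrable_atLeastAtMost'[OF ci])
  then have si: "set_integrable lborel {a..s} ?h"
    by (rule iffD1[OF set_integrable_cong, rotated 3]) (use fp in auto)
  then have "set_integrable lborel {a<..<s} ?h" by (rule set_integrable_subset) auto
  then have ih: "integrable (onm {a<..<s}) ?h" by (simp add: integrable_onm set_integrable_def)
  have "prim a ?h s = integral {a..s} ?h" by (rule prim_HK(2)[OF ih s]) simp
  also have "\<dots> = integral {a..s} (\<lambda>\<sigma>. F' (f \<sigma>) * g \<sigma>)" by (rule integral_cong) (use fp in auto)
  also have "\<dots> = F (f s) - F (f a)" using hi by (rule integral_unique)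
  finally show ?thesis using fp[of s] fp[of a] s by simp
qed

text \<open>Continuous functions are dense in \<open>L^1\<close>, and \<open>L^1\<close> convergence
  of the integrands makes the primitives converge uniformly on the interval.\<close>

lemma prim_chain:
  assumes g: "integrable (onm {a<..<b}) g" and F: "\<And>x. (F has_real_derivative F' x) (at x)"
    and F': "continuous_on UNIV F'" "\<And>x. \<bar>F' x\<bar> \<le> M" and s: "s \<in> {a..b}"
  shows "F (c + prim a g s) = F c + prim a (\<lambda>\<sigma>. F' (c + prim a g \<sigma>) * g \<sigma>) s"
proof -
  have [measurable]: "g \<in> borel_measurable borel" using g by (rule integrable_onm_borel)
  have [measurable]: "F' \<in> borel_measurable borel" using F'(1) by (rule borel_measurable_continuous_onI)
  have gi: "integrable lborel (\<lambda>x. indicator {a<..<b} x * g x)" using g by (simp add: integrable_onm)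
  have "\<exists>v. continuous_on UNIV v \<and> integrable lborel v \<and> (LINT x|lborel. \<bar>indicator {a<..<b} x * g x - v x\<bar>) < inverse (real (Suc n))" for n
    using integrable_approx_continuous[OF gi] by simp
  then obtain v where v: "\<And>n. continuous_on UNIV (v n)" "\<And>n. integrable lborel (v n)"
     "\<And>n. (LINT x|lborel. \<bar>indicator {a<..<b} x * g x - v n x\<bar>) < inverse (real (Suc n))" by metis
  have [measurable]: "v n \<in> borel_measurable borel" for n using v(1) by (rule borel_measurable_continuous_onI)
  define e where "e n = (LINT x|lborel. \<bar>indicator {a<..<b} x * g x - v n x\<bar>)" for n
  have e0: "e \<longlonglongrightarrow> 0"
    by (rule tendsto_sandwich[OF _ _ tendsto_const LIMSEQ_inverse_real_of_nat])
       (use v(3) in \<open>auto simp: e_def less_imp_le simp del: of_nat_Suc\<close>)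
  have pd: "\<bar>prim a (v n) s - prim a g s\<bar> \<le> e n" if "s \<in> {a..b}" for s n
  proof -
    have i: "integrable lborel (\<lambda>x. indicator {a<..<s} x * g x)" "integrable lborel (\<lambda>x. indicator {a<..<s} x * v n x)"
      using onm_subset_integrable[OF g, of "{a<..<s}"] that integrable_onm_continuous[OF v(1)[of n], of a s]
        greaterThanLessThan_subseteq_greaterThanLessThan[of a s a b]
      by (simp_all add: integrable_onm)
    have "\<bar>prim a (v n) s - prim a g s\<bar> = \<bar>LINT x|lborel. indicator {a<..<s} x * v n x - indicator {a<..<s} x * g x\<bar>"
      unfolding prim_def using i by simp
    also have "\<dots> \<le> (LINT x|lborel. \<bar>indicator {a<..<s} x * v n x - indicator {a<..<s} x * g x\<bar>)" by (rule integral_abs_bound)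
    also have "\<dots> \<le> e n"
      unfolding e_def using i gi v(2)[of n] that by (intro integral_mono) (auto split: split_indicator)
    finally show ?thesis .
  qed
  have pl: "(\<lambda>n. prim a (v n) s) \<longlonglongrightarrow> prim a g s" if "s \<in> {a..b}" for s
  proof (rule Lim_null[THEN iffD2], rule Lim_null_comparison[OF _ e0])
    show "\<forall>\<^sub>F n in sequentially. norm (prim a (v n) s - prim a g s) \<le> e n" using pd[OF that] by simp
  qed
  have contF: "isCont F x" for x using F by (rule DERIV_isCont)
  have contF': "isCont F' x" for x using F'(1) by (simp add: continuous_on_eq_continuous_at)
  have L1: "(\<lambda>n. F (c + prim a (v n) s)) \<longlonglongrightarrow> F (c + prim a g s)"
    by (rule isCont_tendsto_compose[OF contF]) (intro tendsto_intros pl s)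
  \<comment> \<open>The integral is split: \<open>?A\<close> carries the difference of
    \<open>v n\<close> and \<open>g\<close> and is small since \<open>F'\<close> is bounded; in
    \<open>?B\<close> the factor \<open>g\<close> is fixed and only the argument of
    \<open>F'\<close> moves, so dominated convergence applies.\<close>
  let ?A = "\<lambda>n \<sigma>. indicator {a<..<s} \<sigma> * (F' (c + prim a (v n) \<sigma>) * (v n \<sigma> - indicator {a<..<b} \<sigma> * g \<sigma>))"
  let ?B = "\<lambda>n \<sigma>. indicator {a<..<s} \<sigma> * (F' (c + prim a (v n) \<sigma>) * g \<sigma>)"
  have M0: "M \<ge> 0" using F'(2)[of 0] by linarith
  have iA: "integrable lborel (?A n)" for n
  proof (rule Bochner_Integration.integrable_bound)
    show "integrable lborel (\<lambda>\<sigma>. M * (v n \<sigma> - indicator {a<..<b} \<sigma> * g \<sigma>))" using v(2)[of n] gi by simp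
    show "AE x in lborel. norm (?A n x) \<le> norm (M * (v n x - indicator {a<..<b} x * g x))"
      using F'(2) M0 by (intro AE_I2) (auto simp: abs_mult intro!: mult_right_mono split: split_indicator)
  qed measurable
  have bB: "norm (?B n x) \<le> M * \<bar>indicator {a<..<b} x * g x\<bar>" for n x
    using F'(2) M0 s by (auto simp: abs_mult intro!: mult_right_mono split: split_indicator)
  have iB: "integrable lborel (?B n)" for n
  proof (rule Bochner_Integration.integrable_bound)
    show "integrable lborel (\<lambda>\<sigma>. M * \<bar>indicator {a<..<b} \<sigma> * g \<sigma>\<bar>)" using gi by auto
    show "AE x in lborel. norm (?B n x) \<le> norm (M * \<bar>indicator {a<..<b} x * g x\<bar>)"
      using bB M0 by (intro AE_I2) (auto simp: abs_mult)
  qed measurable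
  have "prim a (\<lambda>\<sigma>. F' (c + prim a (v n) \<sigma>) * v n \<sigma>) s = (LINT \<sigma>|lborel. ?A n \<sigma>) + (LINT \<sigma>|lborel. ?B n \<sigma>)" for n
  proof -
    have "(LINT \<sigma>|lborel. ?A n \<sigma>) + (LINT \<sigma>|lborel. ?B n \<sigma>) = (LINT \<sigma>|lborel. ?A n \<sigma> + ?B n \<sigma>)"
      using iA iB by simp
    also have "\<dots> = prim a (\<lambda>\<sigma>. F' (c + prim a (v n) \<sigma>) * v n \<sigma>) s"
      unfolding prim_def using s by (intro Bochner_Integration.integral_cong) (auto split: split_indicator simp: algebra_simps)
    finally show ?thesis by simp
  qed
  moreover have "(\<lambda>n. LINT \<sigma>|lborel. ?A n \<sigma>) \<longlonglongrightarrow> 0"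
  proof (rule Lim_null_comparison)
    show "\<forall>\<^sub>F n in sequentially. norm (LINT \<sigma>|lborel. ?A n \<sigma>) \<le> M * e n"
    proof (rule always_eventually, rule allI)
      fix n
      have "norm (LINT \<sigma>|lborel. ?A n \<sigma>) \<le> (LINT \<sigma>|lborel. norm (?A n \<sigma>))" by (rule integral_norm_bound)
      also have "\<dots> \<le> (LINT \<sigma>|lborel. M * \<bar>indicator {a<..<b} \<sigma> * g \<sigma> - v n \<sigma>\<bar>)"
      proof (rule integral_mono)
        show "integrable lborel (\<lambda>\<sigma>. norm (?A n \<sigma>))" using iA by (rule integrable_norm)
        show "integrable lborel (\<lambda>\<sigma>. M * \<bar>indicator {a<..<b} \<sigma> * g \<sigma> - v n \<sigma>\<bar>)" using gi v(2)[of n] by simp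
        show "norm (?A n \<sigma>) \<le> M * \<bar>indicator {a<..<b} \<sigma> * g \<sigma> - v n \<sigma>\<bar>" for \<sigma>
          using F'(2) M0 by (auto simp: abs_mult abs_minus_commute intro!: mult_mono split: split_indicator)
      qed
      also have "\<dots> = M * e n" by (simp add: e_def)
      finally show "norm (LINT \<sigma>|lborel. ?A n \<sigma>) \<le> M * e n" .
    qed
    show "(\<lambda>n. M * e n) \<longlonglongrightarrow> 0" using tendsto_mult[OF tendsto_const e0, of M] by simp
  qed
  moreover have "(\<lambda>n. LINT \<sigma>|lborel. ?B n \<sigma>) \<longlonglongrightarrow> (LINT \<sigma>|lborel. indicator {a<..<s} \<sigma> * (F' (c + prim a g \<sigma>) * g \<sigma>))"
  proof (rule integral_dominated_convergence[where w="\<lambda>x. M * \<bar>indicator {a<..<b} x * g x\<bar>"])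
    show "integrable lborel (\<lambda>\<sigma>. M * \<bar>indicator {a<..<b} \<sigma> * g \<sigma>\<bar>)" using gi by auto
    show "AE x in lborel. norm (?B n x) \<le> M * \<bar>indicator {a<..<b} x * g x\<bar>" for n using bB by simp
    have "(\<lambda>n. ?B n x) \<longlonglongrightarrow> indicator {a<..<s} x * (F' (c + prim a g x) * g x)" for x
    proof (cases "x \<in> {a<..<s}")
      case True
      then show ?thesis using s
        by (intro tendsto_intros isCont_tendsto_compose[OF contF'] pl) auto
    qed simp
    then show "AE x in lborel. (\<lambda>n. ?B n x) \<longlonglongrightarrow> indicator {a<..<s} x * (F' (c + prim a g x) * g x)" by simp
  qed measurable
  ultimately have "(\<lambda>n. prim a (\<lambda>\<sigma>. F' (c + prim a (v n) \<sigma>) * v n \<sigma>) s) \<longlonglongrightarrow> 0 + prim a (\<lambda>\<sigma>. F' (c + prim a g \<sigma>) * g \<sigma>) s"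
    unfolding prim_def[of a "\<lambda>\<sigma>. F' (c + prim a g \<sigma>) * g \<sigma>"] by (simp only:) (rule tendsto_add)
  then have "(\<lambda>n. F c + prim a (\<lambda>\<sigma>. F' (c + prim a (v n) \<sigma>) * v n \<sigma>) s) \<longlonglongrightarrow> F c + (0 + prim a (\<lambda>\<sigma>. F' (c + prim a g \<sigma>) * g \<sigma>) s)"
    by (intro tendsto_intros)
  moreover have "F (c + prim a (v n) s) = F c + prim a (\<lambda>\<sigma>. F' (c + prim a (v n) \<sigma>) * v n \<sigma>) s" for n
    by (rule prim_chain_continuous[OF v(1) F F'(1)]) (use s in auto)
  ultimately show ?thesis using LIMSEQ_unique[OF L1] by simp
qed

text \<open>The absolute value is approximated by
  \<open>sqrt (x\<^sup>2 + \<epsilon>\<^sup>2)\<close>. The derivatives are bounded by 1 and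
  converge to \<open>sgn\<close> at every point, with the limit 0 at 0; this allows dominated
  convergence without any information on the zero set of the primitive.\<close>

lemma prim_abs:
  assumes g: "integrable (onm {a<..<b}) g" and s: "s \<in> {a..b}"
  shows "\<bar>c + prim a g s\<bar> = \<bar>c\<bar> + prim a (\<lambda>\<sigma>. sgn (c + prim a g \<sigma>) * g \<sigma>) s"
proof -
  have [measurable]: "g \<in> borel_measurable borel" using g by (rule integrable_onm_borel)
  have gi: "integrable lborel (\<lambda>x. indicator {a<..<b} x * g x)" using g by (simp add: integrable_onm)
  define \<epsilon> where "\<epsilon> n = inverse (real (Suc n))" for n
  have \<epsilon>: "\<epsilon> n > 0" for n by (simp add: \<epsilon>_def)
  have \<epsilon>0: "\<epsilon> \<longlonglongrightarrow> 0" unfolding \<epsilon>_def by (rule LIMSEQ_inverse_real_of_nat)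
  define F where "F n x = sqrt (x\<^sup>2 + (\<epsilon> n)\<^sup>2)" for n x
  define F' where "F' n x = x / F n x" for n x
  have pos: "x\<^sup>2 + (\<epsilon> n)\<^sup>2 > 0" for n x using \<epsilon>[of n] by (intro add_nonneg_pos) auto
  have Fp: "F n x > 0" for n x using pos by (simp add: F_def)
  have Fge: "\<bar>x\<bar> \<le> F n x" for n x unfolding F_def by (rule real_le_rsqrt) simp
  have cF: "continuous_on UNIV (F' n)" for n
    unfolding F'_def F_def using pos less_imp_neq[OF pos] by (intro continuous_intros) (auto simp: real_sqrt_eq_zero_cancel_iff)
  have [measurable]: "F' n \<in> borel_measurable borel" for n using cF by (rule borel_measurable_continuous_onI)
  have F'1: "\<bar>F' n x\<bar> \<le> 1" for n x using Fge[of x n] Fp[of n x] by (simp add: F'_def)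
  have dF: "(F n has_real_derivative F' n x) (at x)" for n x
  proof -
    have "((\<lambda>x. x\<^sup>2 + (\<epsilon> n)\<^sup>2) has_real_derivative 2 * x) (at x)"
      by (auto intro!: derivative_eq_intros)
    moreover have "(sqrt has_real_derivative inverse (sqrt (x\<^sup>2 + (\<epsilon> n)\<^sup>2)) / 2) (at (x\<^sup>2 + (\<epsilon> n)\<^sup>2))"
      by (rule DERIV_real_sqrt[OF pos])
    ultimately have "((\<lambda>x. sqrt (x\<^sup>2 + (\<epsilon> n)\<^sup>2)) has_real_derivative (inverse (sqrt (x\<^sup>2 + (\<epsilon> n)\<^sup>2)) / 2 * (2 * x))) (at x)"
      by (intro DERIV_chain2[where f=sqrt and g="\<lambda>x. x\<^sup>2 + (\<epsilon> n)\<^sup>2"])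
    moreover have "inverse w / 2 * (2 * x) = x / w" for w :: real by (simp add: field_simps)
    ultimately have "((\<lambda>x. sqrt (x\<^sup>2 + (\<epsilon> n)\<^sup>2)) has_real_derivative (x / sqrt (x\<^sup>2 + (\<epsilon> n)\<^sup>2))) (at x)"
      by (simp only:)
    then show ?thesis unfolding F_def[abs_def] F'_def .
  qed
  have Fl: "(\<lambda>n. F n x) \<longlonglongrightarrow> \<bar>x\<bar>" for x
  proof -
    have "(\<lambda>n. F n x) \<longlonglongrightarrow> sqrt (x\<^sup>2 + 0\<^sup>2)" unfolding F_def by (intro tendsto_intros \<epsilon>0)
    then show ?thesis by simp
  qed
  have F'l: "(\<lambda>n. F' n x) \<longlonglongrightarrow> sgn x" for x
  proof (cases "x = 0")
    case False
    have "(\<lambda>n. F' n x) \<longlonglongrightarrow> x / \<bar>x\<bar>" unfolding F'_def using False by (intro tendsto_intros Fl) auto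
    then show ?thesis by (simp add: sgn_real_def abs_if split: if_splits)
  qed (simp add: F'_def)
  let ?f = "\<lambda>\<sigma>. c + prim a g \<sigma>"
  have "(\<lambda>n. prim a (\<lambda>\<sigma>. F' n (?f \<sigma>) * g \<sigma>) s) \<longlonglongrightarrow> prim a (\<lambda>\<sigma>. sgn (?f \<sigma>) * g \<sigma>) s"
    unfolding prim_def[of a "\<lambda>\<sigma>. _ \<sigma> * g \<sigma>"]
  proof (rule integral_dominated_convergence[where w="\<lambda>x. \<bar>indicator {a<..<b} x * g x\<bar>"])
    show "integrable lborel (\<lambda>x. \<bar>indicator {a<..<b} x * g x\<bar>)" using gi by (rule integrable_abs)
    show "AE x in lborel. (\<lambda>n. indicator {a<..<s} x * (F' n (?f x) * g x)) \<longlonglongrightarrow> indicator {a<..<s} x * (sgn (?f x) * g x)"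
      by (intro AE_I2 tendsto_intros F'l)
    show "AE x in lborel. norm (indicator {a<..<s} x * (F' n (?f x) * g x)) \<le> \<bar>indicator {a<..<b} x * g x\<bar>" for n
      using F'1[of n] s by (intro AE_I2) (auto simp: abs_mult mult_left_le_one_le split: split_indicator)
  qed measurable
  then have "(\<lambda>n. F n c + prim a (\<lambda>\<sigma>. F' n (?f \<sigma>) * g \<sigma>) s) \<longlonglongrightarrow> \<bar>c\<bar> + prim a (\<lambda>\<sigma>. sgn (?f \<sigma>) * g \<sigma>) s"
    by (intro tendsto_add Fl)
  moreover have "F n (?f s) = F n c + prim a (\<lambda>\<sigma>. F' n (?f \<sigma>) * g \<sigma>) s" for n
    by (rule prim_chain[OF g dF cF F'1 s])
  ultimately show ?thesis using LIMSEQ_unique[OF Fl[of "?f s"]] by simp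
qed

section \<open>Operations on absolutely continuous functions: truncation, cutting, integration by
  parts, limits\<close>

lemma AE_ivl: "AE s in onm {a<..<b::real}. a < s \<and> s < b"
  by (subst AE_onm) auto

lemma w11_int: "w11 a b f g \<Longrightarrow> integrable (onm {a<..<b}) g"
  by (simp add: w11_def)

lemma w11_I: "integrable (onm {a<..<b}) g \<Longrightarrow> (AE s in onm {a<..<b}. f s = c + prim a g s) \<Longrightarrow> w11 a b f g"
  by (auto simp: w11_def)

lemma prim_shift:
  assumes g: "integrable (onm {a<..<b}) g" and s: "a \<le> s" "s \<le> s'" "s' \<le> b"
  shows "prim a g s' = prim a g s + prim s g s'"
  using prim_diff[OF assms] prim_eq_integral_onm[OF integrable_onm_borel[OF g], of s s'] by simp

lemma prim_lincomb:
  assumes "integrable (onm {a<..<b}) g" "integrable (onm {a<..<b}) h" "s \<le> b"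
  shows "prim a (\<lambda>\<sigma>. p * g \<sigma> + q * h \<sigma>) s = p * prim a g s + q * prim a h s"
proof -
  have m [measurable]: "g \<in> borel_measurable borel" "h \<in> borel_measurable borel"
    using assms by (auto intro: integrable_onm_borel)
  have "{a<..<s} \<subseteq> {a<..<b}" using assms(3) by auto
  then have "integrable (onm {a<..<s}) g" "integrable (onm {a<..<s}) h"
    using assms(1,2) by (auto intro: onm_subset_integrable)
  then show ?thesis by (simp add: prim_eq_integral_onm)
qed

lemma w11_subset:
  assumes w: "w11 a b f g" and s: "a \<le> a'" "a' \<le> b'" "b' \<le> b"
  shows "w11 a' b' f g"
proof -
  note g = w11_int[OF w]
  obtain c where c: "AE s in lborel. s \<in> {a<..<b} \<longrightarrow> f s = c + prim a g s"
    using w by (auto simp: w11_def AE_onm)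
  show ?thesis
  proof (rule w11_I[where c="c + prim a g a'"])
    show "integrable (onm {a'<..<b'}) g" by (rule onm_subset_integrable[OF g]) (use s in auto)
    have "AE x in lborel. x \<in> {a'<..<b'} \<longrightarrow> f x = c + prim a g a' + prim a' g x"
      using c
    proof eventually_elim
      case (elim x)
      show ?case
      proof
        assume "x \<in> {a'<..<b'}"
        then show "f x = c + prim a g a' + prim a' g x"
          using elim prim_shift[OF g s(1), of x] s by auto
      qed
    qed
    then show "AE x in onm {a'<..<b'}. f x = c + prim a g a' + prim a' g x" by (simp add: AE_onm)
  qed
qed

lemma w11_cong_AE:
  assumes w: "w11 a b f g" and f: "AE s in onm {a<..<b}. f' s = f s" and g: "AE s in onm {a<..<b}. g' s = g s"
    and m: "g' \<in> borel_measurable borel"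
  shows "w11 a b f' g'"
proof -
  obtain c where c: "AE s in onm {a<..<b}. f s = c + prim a g s" using w by (auto simp: w11_def)
  note i = w11_int[OF w]
  have p: "prim a g' s = prim a g s" if "s \<le> b" for s
    by (rule prim_cong_AE[OF g that m integrable_onm_borel[OF i]])
  show ?thesis
  proof (rule w11_I[where c=c])
    show "integrable (onm {a<..<b}) g'"
      by (rule integrable_cong_AE_imp[OF i]) (use g m in auto)
    show "AE s in onm {a<..<b}. f' s = c + prim a g' s"
      using c f AE_ivl[of a b] by eventually_elim (use p in auto)
  qed
qed

text \<open>Since \<open>max 0 x\<close> is the half sum of \<open>x\<close> and
  \<open>\<bar>x\<bar>\<close>, this is the derivative of the positive part that the chain rule for
  the absolute value delivers.\<close>

definition theta :: "real \<Rightarrow> real" where "theta x = (1 + sgn x) / 2"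

lemma theta_measurable [measurable]: "theta \<in> borel_measurable borel"
  unfolding theta_def[abs_def] by measurable

lemma theta_bounds: "0 \<le> theta x" "theta x \<le> 1" "(theta x)\<^sup>2 \<le> theta x" "\<bar>theta x\<bar> \<le> 1"
  and theta_pos: "x > 0 \<Longrightarrow> theta x = 1"
  by (auto simp: theta_def sgn_real_def power2_eq_square)

text \<open>The value \<open>theta 0 = 1/2\<close> is harmless: only \<open>theta\<^sup>2 \<le> theta\<close> is needed below, so one can do
  without the fact that a weak gradient vanishes almost everywhere on a level set.\<close>

lemma prim_pos:
  assumes g: "integrable (onm {a<..<b}) g" and s: "s \<in> {a..b}"
  shows "max 0 (c + prim a g s) = max 0 c + prim a (\<lambda>\<sigma>. theta (c + prim a g \<sigma>) * g \<sigma>) s"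
proof -
  have [measurable]: "g \<in> borel_measurable borel" using g by (rule integrable_onm_borel)
  have "integrable (onm {a<..<b}) (\<lambda>\<sigma>. sgn (c + prim a g \<sigma>) * g \<sigma>)"
    by (rule integrable_onm_bounded_mult[OF g, where M=1]) (auto simp: sgn_real_def)
  from prim_lincomb[OF g this, of s "1/2" "1/2"] s
  have "prim a (\<lambda>\<sigma>. theta (c + prim a g \<sigma>) * g \<sigma>) s = (prim a g s + prim a (\<lambda>\<sigma>. sgn (c + prim a g \<sigma>) * g \<sigma>) s) / 2"
    by (simp add: theta_def algebra_simps add_divide_distrib)
  then show ?thesis using prim_abs[OF g s, of c] by (auto simp: max_def abs_if field_simps split: if_splits)
qed

lemma prim_theta_AE:
  assumes g: "integrable (onm {a<..<b}) g" and [measurable]: "f \<in> borel_measurable borel"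
    and c: "AE s in onm {a<..<b}. f s = c + prim a g s" and s: "s \<le> b"
  shows "prim a (\<lambda>\<sigma>. theta (c + prim a g \<sigma>) * g \<sigma>) s = prim a (\<lambda>\<sigma>. theta (f \<sigma>) * g \<sigma>) s"
proof (rule prim_cong_AE)
  have [measurable]: "g \<in> borel_measurable borel" using g by (rule integrable_onm_borel)
  show "AE s in onm {a<..<b}. theta (c + prim a g s) * g s = theta (f s) * g s"
    using c by eventually_elim simp
  show "(\<lambda>\<sigma>. theta (c + prim a g \<sigma>) * g \<sigma>) \<in> borel_measurable borel"
       "(\<lambda>\<sigma>. theta (f \<sigma>) * g \<sigma>) \<in> borel_measurable borel" by measurable
qed (rule s)

lemma w11_pos:
  assumes w: "w11 a b f g" and f [measurable]: "f \<in> borel_measurable borel"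
  shows "w11 a b (\<lambda>s. max 0 (f s)) (\<lambda>s. theta (f s) * g s)"
proof -
  obtain c where c: "AE s in onm {a<..<b}. f s = c + prim a g s" using w by (auto simp: w11_def)
  note i = w11_int[OF w]
  show ?thesis
  proof (rule w11_I[where c="max 0 c"])
    show "integrable (onm {a<..<b}) (\<lambda>s. theta (f s) * g s)"
      by (rule integrable_onm_bounded_mult[OF i, where M=1]) (auto simp: theta_bounds)
    show "AE s in onm {a<..<b}. max 0 (f s) = max 0 c + prim a (\<lambda>s. theta (f s) * g s) s"
      using c AE_ivl[of a b]
      by eventually_elim (use prim_pos[OF i] prim_theta_AE[OF i f c] in auto)
  qed
qed

text \<open>The continuous representative is at most 0 at \<open>s2\<close>, so its positive part
  vanishes there and can be continued by zero without a jump. The sign condition is therefore put on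
  \<open>c + prim a g s2\<close>; the value of \<open>f\<close> at \<open>s2\<close> says nothing by
  itself.\<close>

lemma w11_cut_pos:
  assumes g: "integrable (onm {a<..<b}) g" and f [measurable]: "f \<in> borel_measurable borel"
    and c: "AE s in onm {a<..<b}. f s = c + prim a g s"
    and s2: "s2 \<in> {a..b}" "c + prim a g s2 \<le> 0"
  shows "w11 a b (\<lambda>s. if s < s2 then max 0 (f s) else 0) (\<lambda>s. if s < s2 then theta (f s) * g s else 0)"
proof -
  have [measurable]: "g \<in> borel_measurable borel" using g by (rule integrable_onm_borel)
  let ?h = "\<lambda>s. theta (f s) * g s" and ?k = "\<lambda>s. if s < s2 then theta (f s) * g s else 0"
  have ih: "integrable (onm {a<..<b}) ?h"
    by (rule integrable_onm_bounded_mult[OF g, where M=1]) (auto simp: theta_bounds)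
  have "integrable (onm {a<..<b}) (\<lambda>s. (if s < s2 then 1 else 0) * ?h s)"
    by (rule integrable_onm_bounded_mult[OF ih, where M=1]) auto
  then have ik: "integrable (onm {a<..<b}) ?k"
    by (rule back_subst[where P="integrable (onm {a<..<b})"]) (auto simp: fun_eq_iff)
  have p: "max 0 (c + prim a g s) = max 0 c + prim a ?h s" if "s \<in> {a..b}" for s
    using prim_pos[OF g that, of c] prim_theta_AE[OF g f c, of s] that by simp
  have k1: "prim a ?k s = prim a ?h s" if "s \<le> s2" for s
    unfolding prim_def using that by (intro Bochner_Integration.integral_cong) (auto split: split_indicator)
  have k2: "prim a ?k s = prim a ?h s2" if "s \<ge> s2" for s
    unfolding prim_def using that by (intro Bochner_Integration.integral_cong) (auto split: split_indicator)
  show ?thesis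
  proof (rule w11_I[where c="max 0 c"])
    show "integrable (onm {a<..<b}) ?k" by (rule ik)
    show "AE s in onm {a<..<b}. (if s < s2 then max 0 (f s) else 0) = max 0 c + prim a ?k s"
      using c AE_ivl[of a b]
    proof eventually_elim
      case (elim s)
      show ?case
      proof (cases "s < s2")
        case True
        then show ?thesis using elim p[of s] k1[of s] by simp
      next
        case False
        then show ?thesis using elim p[of s2] k2[of s] s2 by simp
      qed
    qed
  qed
qed

text \<open>If \<open>f\<close> is not positive almost everywhere, its continuous representative is
  at most 0 at some point \<open>s0\<close>. Integrating the derivative of the positive part from
  \<open>s0\<close> bounds the positive part everywhere. This is the one-dimensional core of the
  fibre inequality.\<close>

lemma w11_fibre:
  assumes w: "w11 a b f g" and f [measurable]: "f \<in> borel_measurable borel"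
    and n: "\<not> (AE s in onm {a<..<b}. f s > 0)"
  shows "AE s in onm {a<..<b}. max 0 (f s) \<le> (LINT \<sigma>|onm {a<..<b}. theta (f \<sigma>) * \<bar>g \<sigma>\<bar>)"
proof -
  obtain c where c: "AE s in onm {a<..<b}. f s = c + prim a g s" using w by (auto simp: w11_def)
  note g = w11_int[OF w]
  let ?h = "\<lambda>s. theta (f s) * g s"
  have ih: "integrable (onm {a<..<b}) ?h"
    by (rule integrable_onm_bounded_mult[OF g, where M=1]) (auto simp: theta_bounds)
  have p: "max 0 (c + prim a g s) = max 0 c + prim a ?h s" if "s \<in> {a..b}" for s
    using prim_pos[OF g that, of c] prim_theta_AE[OF g f c, of s] that by simp
  have "\<exists>s0\<in>{a<..<b}. c + prim a g s0 \<le> 0"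
  proof (rule ccontr)
    assume "\<not> ?thesis"
    then have *: "\<And>s. s \<in> {a<..<b} \<Longrightarrow> c + prim a g s > 0" by force
    have "AE s in onm {a<..<b}. f s > 0"
      using c AE_ivl[of a b] by eventually_elim (use * in auto)
    then show False using n by simp
  qed
  then obtain s0 where s0: "s0 \<in> {a<..<b}" "c + prim a g s0 \<le> 0" by blast
  show ?thesis using c AE_ivl[of a b]
  proof eventually_elim
    case (elim s)
    have "max 0 (f s) = prim a ?h s - prim a ?h s0" using p[of s] p[of s0] elim s0 by auto
    also have "\<dots> \<le> (LINT \<sigma>|onm {a<..<b}. \<bar>?h \<sigma>\<bar>)"
      using prim_diff_abs[OF ih, of s0 s] s0 elim by auto
    also have "(\<lambda>\<sigma>. \<bar>?h \<sigma>\<bar>) = (\<lambda>\<sigma>. theta (f \<sigma>) * \<bar>g \<sigma>\<bar>)" by (auto simp: abs_mult theta_bounds)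
    finally show ?case .
  qed
qed

lemma has_integral_imp_onm:
  fixes g :: "real \<Rightarrow> real"
  assumes "integrable (onm {a<..<b}) g" "(g has_integral I) {a..b}" "a \<le> b"
  shows "(LINT s|onm {a<..<b}. g s) = I"
  using prim_HK(2)[OF assms(1,3)] prim_eq_integral_onm[OF integrable_onm_borel[OF assms(1)]] assms
  by (simp add: integral_unique)

text \<open>After \<open>f\<close> is replaced by \<open>c + prim a g\<close>, the constant
  contributes nothing because \<open>\<Phi>\<close> vanishes at both ends, and the rest is Fubini's
  theorem on a triangle.\<close>

lemma w11_parts:
  assumes w: "w11 a b f g" and ab: "a < b"
    and \<Phi>c: "continuous_on {a..b} \<Phi>" and \<Phi>0: "\<Phi> a = 0" "\<Phi> b = 0"
    and d: "\<And>s. s \<in> {a<..<b} \<Longrightarrow> (\<Phi> has_real_derivative \<Phi>' s) (at s)"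
    and m [measurable]: "\<Phi> \<in> borel_measurable borel" "\<Phi>' \<in> borel_measurable borel" "f \<in> borel_measurable borel"
    and M: "\<And>s. \<bar>\<Phi>' s\<bar> \<le> M"
  shows "(LINT s|onm {a<..<b}. f s * \<Phi>' s) = - (LINT s|onm {a<..<b}. g s * \<Phi> s)"
proof -
  note g = w11_int[OF w]
  obtain c where c: "AE s in onm {a<..<b}. f s = c + prim a g s" using w by (auto simp: w11_def)
  have [measurable]: "g \<in> borel_measurable borel" using g by (rule integrable_onm_borel)
  interpret fin: finite_measure "onm {a<..<b}" by (rule finite_measure_onm) auto
  have M0: "M \<ge> 0" using M[of 0] by linarith
  have \<Phi>'i: "integrable (onm {u<..<b}) \<Phi>'" if "a \<le> u" for u
  proof -
    have "integrable (onm {a<..<b}) \<Phi>'"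
      by (rule fin.integrable_const_bound[where B=M]) (use M in auto)
    then show ?thesis by (rule onm_subset_integrable) (use that in auto)
  qed
  have I: "(LINT s|onm {u<..<b}. \<Phi>' s) = - \<Phi> u" if "a \<le> u" "u \<le> b" for u
  proof -
    have "(\<Phi>' has_integral (\<Phi> b - \<Phi> u)) {u..b}"
    proof (rule fundamental_theorem_of_calculus_interior)
      show "continuous_on {u..b} \<Phi>" by (rule continuous_on_subset[OF \<Phi>c]) (use that in auto)
      show "(\<Phi> has_vector_derivative \<Phi>' x) (at x)" if "x \<in> {u<..<b}" for x
        using d[of x] that \<open>a \<le> u\<close> by (auto simp: has_real_derivative_iff_has_vector_derivative)
    qed (use that in auto)
    from has_integral_imp_onm[OF \<Phi>'i[OF that(1)] this that(2)] show ?thesis using \<Phi>0 by simp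
  qed
  \<comment> \<open>The triangle is \<open>a < \<sigma> < s < b\<close>. Integration over
    \<open>\<sigma>\<close> first produces \<open>\<Phi>' s * prim a g s\<close>, integration over
    \<open>s\<close> first produces \<open>- (g \<sigma> * \<Phi> \<sigma>)\<close>.\<close>
  define K where "K s \<sigma> = (if a < \<sigma> \<and> \<sigma> < s \<and> s < b then \<Phi>' s * g \<sigma> else 0)" for s \<sigma>
  have Km [measurable]: "case_prod K \<in> borel_measurable (lborel \<Otimes>\<^sub>M lborel)" unfolding K_def by measurable
  have gi: "integrable lborel (\<lambda>\<sigma>. indicator {a<..<b} \<sigma> * g \<sigma>)" using g by (simp add: integrable_onm)
  have ii: "integrable lborel (indicator {a<..<b} :: real \<Rightarrow> real)"
    using ab by (intro integrable_real_indicator) auto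
  have Ki: "integrable (lborel \<Otimes>\<^sub>M lborel) (case_prod K)"
  proof (rule Bochner_Integration.integrable_bound[OF _ Km])
    show "integrable (lborel \<Otimes>\<^sub>M lborel) (\<lambda>(s,\<sigma>). (M * indicator {a<..<b} s) * \<bar>indicator {a<..<b} \<sigma> * g \<sigma>\<bar>)"
    proof (rule lborel_pair.Fubini_integrable)
      show "integrable lborel (\<lambda>s. LINT \<sigma>|lborel. norm (case (s,\<sigma>) of (s,\<sigma>) \<Rightarrow> (M * indicator {a<..<b} s) * \<bar>indicator {a<..<b} \<sigma> * g \<sigma>\<bar>))"
        using M0 ii by (simp add: abs_mult)
      show "AE s in lborel. integrable lborel (\<lambda>\<sigma>. case (s,\<sigma>) of (s,\<sigma>) \<Rightarrow> (M * indicator {a<..<b} s) * \<bar>indicator {a<..<b} \<sigma> * g \<sigma>\<bar>)"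
        using integrable_abs[OF gi] by (intro AE_I2) simp
    qed measurable
    show "AE p in lborel \<Otimes>\<^sub>M lborel. norm (case_prod K p) \<le> norm (case p of (s,\<sigma>) \<Rightarrow> (M * indicator {a<..<b} s) * \<bar>indicator {a<..<b} \<sigma> * g \<sigma>\<bar>)"
      using M M0 by (intro AE_I2) (auto simp: K_def abs_mult intro!: mult_right_mono split: split_indicator)
  qed
  have F: "(LINT \<sigma>|lborel. LINT s|lborel. K s \<sigma>) = (LINT s|lborel. LINT \<sigma>|lborel. K s \<sigma>)"
    by (rule lborel_pair.Fubini_integral[OF Ki])
  have "(LINT \<sigma>|lborel. K s \<sigma>) = indicator {a<..<b} s * (\<Phi>' s * prim a g s)" for s
  proof -
    have "(LINT \<sigma>|lborel. K s \<sigma>) = (LINT \<sigma>|lborel. (indicator {a<..<b} s * \<Phi>' s) * (indicator {a<..<s} \<sigma> * g \<sigma>))"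
      by (intro Bochner_Integration.integral_cong) (auto simp: K_def split: split_indicator)
    then show ?thesis by (simp add: prim_def)
  qed
  then have 1: "(LINT s|lborel. LINT \<sigma>|lborel. K s \<sigma>) = (LINT s|onm {a<..<b}. \<Phi>' s * prim a g s)"
    by (simp add: integral_onm)
  have "(LINT s|lborel. K s \<sigma>) = indicator {a<..<b} \<sigma> * (- (g \<sigma> * \<Phi> \<sigma>))" for \<sigma>
  proof -
    have "(LINT s|lborel. K s \<sigma>) = (LINT s|lborel. (indicator {a<..<b} \<sigma> * g \<sigma>) * (indicator {\<sigma><..<b} s * \<Phi>' s))"
      by (intro Bochner_Integration.integral_cong) (auto simp: K_def split: split_indicator)
    also have "\<dots> = indicator {a<..<b} \<sigma> * g \<sigma> * (LINT s|onm {\<sigma><..<b}. \<Phi>' s)" by (simp add: integral_onm)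
    finally show ?thesis using I[of \<sigma>] by (auto split: split_indicator)
  qed
  then have 2: "(LINT \<sigma>|lborel. LINT s|lborel. K s \<sigma>) = - (LINT \<sigma>|onm {a<..<b}. g \<sigma> * \<Phi> \<sigma>)"
    by (simp add: integral_onm)
  obtain B where B: "\<And>s. s \<in> {a..b} \<Longrightarrow> \<bar>prim a g s\<bar> \<le> B"
    using prim_diff_abs[OF g, of a] ab by fastforce
  have pi: "integrable (onm {a<..<b}) (\<lambda>s. \<Phi>' s * prim a g s)"
  proof (rule fin.integrable_const_bound[where B="M * B"])
    show "AE s in onm {a<..<b}. norm (\<Phi>' s * prim a g s) \<le> M * B"
      using AE_ivl[of a b] by eventually_elim (use M B M0 in \<open>auto simp: abs_mult intro!: mult_mono\<close>)
  qed measurable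
  have "(LINT s|onm {a<..<b}. f s * \<Phi>' s) = (LINT s|onm {a<..<b}. c * \<Phi>' s + \<Phi>' s * prim a g s)"
    by (rule integral_cong_AE) (use c in \<open>auto simp: algebra_simps elim!: eventually_mono\<close>)
  also have "\<dots> = c * (LINT s|onm {a<..<b}. \<Phi>' s) + (LINT s|onm {a<..<b}. \<Phi>' s * prim a g s)"
    using \<Phi>'i[of a] pi by simp
  also have "\<dots> = - (LINT s|onm {a<..<b}. g s * \<Phi> s)"
    using I[of a] \<Phi>0 ab 1 2 F by simp
  finally show ?thesis .
qed

text \<open>Subtracting the primitives leaves the constants \<open>c n\<close>, and these converge
  in \<open>L^1\<close> to \<open>f - prim a g\<close>. An \<open>L^1\<close> limit of constants on
  a bounded interval is constant.\<close>

lemma w11_closed: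
  assumes ab: "a < b" and w: "\<And>n. w11 a b (F n) (G n)" and F: "\<And>n. integrable (onm {a<..<b}) (F n)"
    and f: "integrable (onm {a<..<b}) f" and g: "integrable (onm {a<..<b}) g"
    and Ff: "(\<lambda>n. LINT s|onm {a<..<b}. \<bar>F n s - f s\<bar>) \<longlonglongrightarrow> 0"
    and Gg: "(\<lambda>n. LINT s|onm {a<..<b}. \<bar>G n s - g s\<bar>) \<longlonglongrightarrow> 0"
  shows "w11 a b f g"
proof -
  interpret fin: finite_measure "onm {a<..<b}" by (rule finite_measure_onm) auto
  have [measurable]: "f \<in> borel_measurable borel" "g \<in> borel_measurable borel" "F n \<in> borel_measurable borel" for n
    using f g F by (auto intro: integrable_onm_borel)
  obtain c where c: "\<And>n. AE s in onm {a<..<b}. F n s = c n + prim a (G n) s"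
    using w unfolding w11_def by metis
  have Gi: "integrable (onm {a<..<b}) (G n)" for n using w11_int[OF w] .
  have m: "measure (onm {a<..<b}) UNIV = b - a" using ab by (simp add: measure_def emeasure_onm)
  define h where "h s = f s - prim a g s" for s
  define e where "e n = (LINT s|onm {a<..<b}. \<bar>F n s - f s\<bar>) + (b - a) * (LINT s|onm {a<..<b}. \<bar>G n s - g s\<bar>)" for n
  have e0: "e \<longlonglongrightarrow> 0"
    unfolding e_def using tendsto_add[OF Ff tendsto_mult[OF tendsto_const Gg, of "b - a"]] by simp
  have pd: "\<bar>prim a (G n) s - prim a g s\<bar> \<le> (LINT s|onm {a<..<b}. \<bar>G n s - g s\<bar>)" if "s \<in> {a..b}" for n s
  proof -
    have "prim a (G n) s - prim a g s = prim a (\<lambda>\<sigma>. G n \<sigma> - g \<sigma>) s"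
      using prim_lincomb[OF Gi[of n] g, of s 1 "-1"] that by simp
    then show ?thesis using prim_diff_abs[of a b "\<lambda>\<sigma>. G n \<sigma> - g \<sigma>" a s] that Gi[of n] g ab by simp
  qed
  have pm: "integrable (onm {a<..<b}) (prim a g)"
  proof (rule fin.integrable_const_bound[where B="LINT s|onm {a<..<b}. \<bar>g s\<bar>"])
    show "AE s in onm {a<..<b}. norm (prim a g s) \<le> (LINT s|onm {a<..<b}. \<bar>g s\<bar>)"
      using AE_ivl[of a b]
      by eventually_elim (use prim_diff_abs[OF g, of a] ab in auto)
  qed measurable
  have hi: "integrable (onm {a<..<b}) h" unfolding h_def using f pm by simp
  have le: "(LINT s|onm {a<..<b}. \<bar>h s - c n\<bar>) \<le> e n" for n
  proof -
    have "(LINT s|onm {a<..<b}. \<bar>h s - c n\<bar>) \<le> (LINT s|onm {a<..<b}. \<bar>F n s - f s\<bar> + (LINT s|onm {a<..<b}. \<bar>G n s - g s\<bar>))"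
    proof (rule integral_mono_AE)
      show "AE s in onm {a<..<b}. \<bar>h s - c n\<bar> \<le> \<bar>F n s - f s\<bar> + (LINT s|onm {a<..<b}. \<bar>G n s - g s\<bar>)"
        using c[of n] AE_ivl[of a b]
      proof eventually_elim
        case (elim s)
        then show ?case using pd[of s n] by (auto simp: h_def)
      qed
    qed (use hi F f in auto)
    also have "\<dots> = e n" using F[of n] f by (simp add: e_def m)
    finally show ?thesis .
  qed
  \<comment> \<open>Convergence of the constants \<open>c n\<close> is not known in advance; the
    mean value of \<open>h\<close> is the only candidate for their limit.\<close>
  define C where "C = (LINT s|onm {a<..<b}. h s) / (b - a)"
  have cC: "\<bar>C - c n\<bar> * (b - a) \<le> e n" for n
  proof -
    have "(C - c n) * (b - a) = (LINT s|onm {a<..<b}. h s - c n)" using hi ab by (simp add: C_def m field_simps)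
    then have "\<bar>C - c n\<bar> * (b - a) = \<bar>LINT s|onm {a<..<b}. h s - c n\<bar>" using ab by (metis abs_mult abs_of_pos diff_gt_0_iff_gt)
    also have "\<dots> \<le> (LINT s|onm {a<..<b}. \<bar>h s - c n\<bar>)" by (rule integral_abs_bound)
    finally show ?thesis using le[of n] by simp
  qed
  have "(LINT s|onm {a<..<b}. \<bar>h s - C\<bar>) \<le> 2 * e n" for n
  proof -
    have "(LINT s|onm {a<..<b}. \<bar>h s - C\<bar>) \<le> (LINT s|onm {a<..<b}. \<bar>h s - c n\<bar> + \<bar>C - c n\<bar>)"
      using hi by (intro integral_mono) auto
    also have "\<dots> = (LINT s|onm {a<..<b}. \<bar>h s - c n\<bar>) + \<bar>C - c n\<bar> * (b - a)" using hi by (simp add: m)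
    finally show ?thesis using le[of n] cC[of n] by simp
  qed
  then have "(LINT s|onm {a<..<b}. \<bar>h s - C\<bar>) \<le> 2 * 0"
    by (intro LIMSEQ_le_const[OF tendsto_mult[OF tendsto_const e0, of 2]]) auto
  then have "(LINT s|onm {a<..<b}. \<bar>h s - C\<bar>) = 0" by (intro antisym) auto
  then have "AE s in onm {a<..<b}. \<bar>h s - C\<bar> = 0"
    using hi by (subst (asm) integral_nonneg_eq_0_iff_AE) auto
  then have "AE s in onm {a<..<b}. f s = C + prim a g s"
    by eventually_elim (auto simp: h_def)
  then show ?thesis using g by (rule w11_I[rotated])
qed

text \<open>On each inner interval the difference of \<open>f\<close> and the primitive from
  \<open>a\<close> is constant, and the constants agree because the intervals overlap. Countably
  many exceptional sets are then united.\<close>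

lemma w11_exhaust:
  assumes g: "integrable (onm {a<..<b}) g" and ab: "a < b"
    and w: "\<And>n. \<exists>a' b'. a \<le> a' \<and> a' \<le> a + e n \<and> b - e n \<le> b' \<and> b' \<le> b \<and> w11 a' b' f g"
    and e: "e \<longlonglongrightarrow> 0"
  shows "w11 a b f g"
proof -
  obtain \<alpha> \<beta> where w': "\<And>n. a \<le> \<alpha> n" "\<And>n. \<alpha> n \<le> a + e n" "\<And>n. b - e n \<le> \<beta> n" "\<And>n. \<beta> n \<le> b" "\<And>n. w11 (\<alpha> n) (\<beta> n) f g"
    using w by metis
  \<comment> \<open>From \<open>N\<close> on every inner interval contains the middle half of
    \<open>{a<..<b}\<close>, where the constants of any two of them can be compared.\<close>
  obtain N where N: "\<And>n. n \<ge> N \<Longrightarrow> e n < (b - a) / 4"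
    using order_tendstoD(2)[OF e, of "(b - a)/4"] ab by (auto simp: eventually_sequentially)
  have al: "\<alpha> n < (3*a + b)/4" "\<beta> n > (a + 3*b)/4" if "n \<ge> N" for n
    using w'(2,3)[of n] N[OF that] by (auto simp: field_simps)
  have "\<exists>c. AE s in onm {\<alpha> n<..<\<beta> n}. f s = c + prim a g s" if n: "n \<ge> N" for n
  proof -
    obtain c where "AE s in onm {\<alpha> n<..<\<beta> n}. f s = c + prim (\<alpha> n) g s" using w'(5)[of n] by (auto simp: w11_def)
    then have "AE s in onm {\<alpha> n<..<\<beta> n}. f s = (c - prim a g (\<alpha> n)) + prim a g s"
      using AE_ivl[of "\<alpha> n" "\<beta> n"]
    proof eventually_elim
      case (elim s)
      then show ?case using prim_shift[OF g w'(1)[of n], of s] w'(4)[of n] by simp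
    qed
    then show ?thesis by blast
  qed
  then obtain c where c: "\<And>n. n \<ge> N \<Longrightarrow> AE s in lborel. s \<in> {\<alpha> n<..<\<beta> n} \<longrightarrow> f s = c n + prim a g s"
    by (simp add: AE_onm) metis
  have cc: "c n = c N" if "n \<ge> N" for n
  proof (rule ccontr)
    assume ne: "c n \<noteq> c N"
    have "AE s in lborel. s \<notin> {(3*a + b)/4<..<(a + 3*b)/4}"
      using c[OF that] c[of N, OF order_refl]
    proof eventually_elim
      case (elim s)
      then show ?case using ne al[OF that] al[of N, OF order_refl] by (auto simp del: divide_less_eq less_divide_eq less_divide_eq_numeral1 divide_less_eq_numeral1)
    qed
    then have "{(3*a + b)/4<..<(a + 3*b)/4} \<in> null_sets lborel" by (intro AE_iff_null_sets[THEN iffD2]) auto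
    then show False using ab by (auto simp: null_sets_def)
  qed
  have "AE s in lborel. \<forall>n\<ge>N. s \<in> {\<alpha> n<..<\<beta> n} \<longrightarrow> f s = c N + prim a g s"
  proof (subst AE_all_countable, intro allI)
    fix n
    show "AE s in lborel. N \<le> n \<longrightarrow> s \<in> {\<alpha> n<..<\<beta> n} \<longrightarrow> f s = c N + prim a g s"
    proof (cases "N \<le> n")
      case True
      show ?thesis using c[OF True] by eventually_elim (simp add: cc[OF True])
    qed simp
  qed
  then have "AE s in lborel. s \<in> {a<..<b} \<longrightarrow> f s = c N + prim a g s"
  proof eventually_elim
    case (elim s)
    show ?case
    proof
      assume s: "s \<in> {a<..<b}"
      then have "\<forall>\<^sub>F n in sequentially. e n < min (s - a) (b - s)"
        using order_tendstoD(2)[OF e, of "min (s - a) (b - s)"] by auto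
      then obtain n where "n \<ge> N" "e n < min (s - a) (b - s)"
        by (metis eventually_sequentially nle_le)
      then show "f s = c N + prim a g s" using elim w'(2,3)[of n] by auto
    qed
  qed
  then show ?thesis by (intro w11_I[OF g, where c="c N"]) (simp add: AE_onm)
qed

section \<open>Mollification along curves\<close>

text \<open>These are the terms that arise on differentiating \<open>exp (- inverse x)\<close>,
  continued by zero: the derivative of \<open>eb k\<close> is a combination of
  \<open>eb (k + 2)\<close> and \<open>eb (k + 1)\<close>, so the family is closed under
  differentiation and all its members are smooth.\<close>

definition eb :: "nat \<Rightarrow> real \<Rightarrow> real" where
  "eb k x = (if x > 0 then exp (- inverse x) * inverse x ^ k else 0)"

lemma eb_nonneg: "0 \<le> eb k x"
  by (simp add: eb_def)

lemma eb_tendsto_0: "(eb k \<longlongrightarrow> 0) (at 0)"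
proof -
  have "((\<lambda>x::real. x ^ k / exp x) \<longlongrightarrow> 0) at_top" by (rule tendsto_power_div_exp_0)
  then have "((\<lambda>x::real. inverse x ^ k / exp (inverse x)) \<longlongrightarrow> 0) (at_right 0)"
    by (rule filterlim_compose[OF _ filterlim_inverse_at_top_right])
  then have "(eb k \<longlongrightarrow> 0) (at_right 0)"
  proof (rule Lim_transform_eventually)
    show "\<forall>\<^sub>F x in at_right 0. inverse x ^ k / exp (inverse x) = eb k x"
      by (auto simp: eb_def eventually_at_filter exp_minus divide_inverse)
  qed
  moreover have "(eb k \<longlongrightarrow> 0) (at_left 0)"
  proof (rule Lim_transform_eventually[OF tendsto_const])
    show "\<forall>\<^sub>F x in at_left 0. 0 = eb k x" by (auto simp: eb_def eventually_at_filter)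
  qed
  ultimately show ?thesis by (simp add: filterlim_at_split)
qed

lemma eb_deriv: "(eb k has_real_derivative (eb (k + 2) x - real k * eb (k + 1) x)) (at x)"
proof (cases "x = 0")
  case True
  have "((\<lambda>h. (eb k (0 + h) - eb k 0) / h) \<longlongrightarrow> 0) (at 0)"
  proof (rule Lim_transform_eventually[OF eb_tendsto_0[of "Suc k"]])
    show "\<forall>\<^sub>F h in at 0. eb (Suc k) h = (eb k (0 + h) - eb k 0) / h"
      by (auto simp: eb_def eventually_at_filter divide_inverse)
  qed
  then show ?thesis using True by (simp add: DERIV_def eb_def)
next
  case False
  show ?thesis
  proof (cases "x > 0")
    case True
    have "((\<lambda>x. exp (- inverse x) * inverse x ^ k) has_real_derivative
        (exp (- inverse x) * (inverse x ^ 2) * inverse x ^ k + exp (- inverse x) * (real k * inverse x ^ (k - 1) * (- (inverse x ^ 2))))) (at x)"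
      using True by (auto intro!: derivative_eq_intros simp: power2_eq_square)
    moreover have "exp (- inverse x) * (inverse x ^ 2) * inverse x ^ k + exp (- inverse x) * (real k * inverse x ^ (k - 1) * (- (inverse x ^ 2)))
        = eb (k + 2) x - real k * eb (k + 1) x"
      using True by (cases k) (simp_all add: eb_def power_add power2_eq_square)
    ultimately have "((\<lambda>x. exp (- inverse x) * inverse x ^ k) has_real_derivative (eb (k + 2) x - real k * eb (k + 1) x)) (at x)"
      by simp
    then show ?thesis
      by (rule has_field_derivative_transform_within_open[where S="{0<..}"]) (use True in \<open>auto simp: eb_def\<close>)
  next
    case neg: False
    have "((\<lambda>x. 0) has_real_derivative (eb (k + 2) x - real k * eb (k + 1) x)) (at x)"
      using neg by (simp add: eb_def)
    then show ?thesis
      by (rule has_field_derivative_transform_within_open[where S="{..<0}"]) (use neg False in \<open>auto simp: eb_def\<close>)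
  qed
qed

text \<open>An algebra of functions closed under partial derivatives. Membership gives smoothness in
  the sense of iterated partial derivatives by induction on their list, without computing any of
  them.\<close>

inductive_set bumps :: "('a::euclidean_space \<Rightarrow> real) set" where
  base: "(\<lambda>z. eb k (c + v \<bullet> z)) \<in> bumps"
| cmult: "f \<in> bumps \<Longrightarrow> (\<lambda>z. c * f z) \<in> bumps"
| add: "f \<in> bumps \<Longrightarrow> g \<in> bumps \<Longrightarrow> (\<lambda>z. f z + g z) \<in> bumps"
| mult: "f \<in> bumps \<Longrightarrow> g \<in> bumps \<Longrightarrow> (\<lambda>z. f z * g z) \<in> bumps"

lemma bumps_derivative:
  assumes "f \<in> bumps"
  shows "\<exists>D. (\<forall>z. (f has_derivative D z) (at z)) \<and> (\<forall>b. (\<lambda>z. D z b) \<in> bumps)"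
  using assms
proof induction
  case (base k c v)
  let ?D = "\<lambda>z b. (eb (k + 2) (c + v \<bullet> z) - real k * eb (k + 1) (c + v \<bullet> z)) * (v \<bullet> b)"
  have "((\<lambda>z. eb k (c + v \<bullet> z)) has_derivative ?D z) (at z)" for z
  proof -
    have 1: "(eb k has_derivative (\<lambda>t. (eb (k + 2) (c + v \<bullet> z) - real k * eb (k + 1) (c + v \<bullet> z)) * t)) (at (c + v \<bullet> z))"
      using eb_deriv[of k "c + v \<bullet> z"] by (simp add: has_field_derivative_def)
    have 2: "((\<lambda>z. c + v \<bullet> z) has_derivative (\<lambda>b. v \<bullet> b)) (at z)"
      by (auto intro!: derivative_eq_intros)
    show ?thesis using has_derivative_compose[OF 2 1] by simp
  qed
  moreover have "(\<lambda>z. ?D z b) \<in> bumps" for b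
  proof -
    have "(\<lambda>z. (v \<bullet> b) * (eb (k + 2) (c + v \<bullet> z) + (- real k) * eb (k + 1) (c + v \<bullet> z))) \<in> bumps"
      by (intro bumps.intros)
    then show ?thesis by (simp add: algebra_simps)
  qed
  ultimately show ?case by (intro exI[of _ ?D] conjI allI)
next
  case (cmult f c)
  then obtain D where D: "\<And>z. (f has_derivative D z) (at z)" "\<And>b. (\<lambda>z. D z b) \<in> bumps" by blast
  have "((\<lambda>z. c * f z) has_derivative (\<lambda>b. c * D z b)) (at z)" for z
    using D(1) by (rule has_derivative_mult_right)
  moreover have "(\<lambda>z. c * D z b) \<in> bumps" for b using D(2) by (rule bumps.cmult)
  ultimately show ?case by (intro exI[of _ "\<lambda>z b. c * D z b"]) auto
next
  case (add f g)
  then obtain D E where D: "\<And>z. (f has_derivative D z) (at z)" "\<And>b. (\<lambda>z. D z b) \<in> bumps"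
    and E: "\<And>z. (g has_derivative E z) (at z)" "\<And>b. (\<lambda>z. E z b) \<in> bumps" by blast
  have "((\<lambda>z. f z + g z) has_derivative (\<lambda>b. D z b + E z b)) (at z)" for z
    using D(1) E(1) by (rule has_derivative_add)
  moreover have "(\<lambda>z. D z b + E z b) \<in> bumps" for b using D(2) E(2) by (rule bumps.add)
  ultimately show ?case by (intro exI[of _ "\<lambda>z b. D z b + E z b"]) auto
next
  case (mult f g)
  then obtain D E where D: "\<And>z. (f has_derivative D z) (at z)" "\<And>b. (\<lambda>z. D z b) \<in> bumps"
    and E: "\<And>z. (g has_derivative E z) (at z)" "\<And>b. (\<lambda>z. E z b) \<in> bumps" by blast
  have "((\<lambda>z. f z * g z) has_derivative (\<lambda>b. f z * E z b + D z b * g z)) (at z)" for z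
    using D(1) E(1) by (rule has_derivative_mult)
  moreover have "(\<lambda>z. f z * E z b + D z b * g z) \<in> bumps" for b
    by (intro bumps.intros(3,4) D(2) E(2) mult.hyps)
  ultimately show ?case by (intro exI[of _ "\<lambda>z b. f z * E z b + D z b * g z"]) auto
qed

lemma partial_deriv_eq: "(f has_derivative D) (at z) \<Longrightarrow> partial_deriv b f z = D b"
  unfolding partial_deriv_def by (metis frechet_derivative_at)

lemma bumps_partial_deriv:
  assumes "f \<in> bumps"
  shows "partial_deriv b f \<in> bumps"
proof -
  obtain D where D: "\<And>z. (f has_derivative D z) (at z)" "\<And>b. (\<lambda>z. D z b) \<in> bumps"
    using bumps_derivative[OF assms] by blast
  have "partial_deriv b f = (\<lambda>z. D z b)" using partial_deriv_eq[OF D(1)] by (auto simp: fun_eq_iff)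
  then show ?thesis using D(2) by simp
qed

lemma bumps_continuous: "f \<in> bumps \<Longrightarrow> continuous_on UNIV f"
  using bumps_derivative[of f] by (metis has_derivative_continuous continuous_at_imp_continuous_on)

lemma bumps_smooth:
  assumes "f \<in> bumps"
  shows "smooth f"
proof -
  have "foldr partial_deriv bs f \<in> bumps" for bs
    by (induction bs) (use assms in \<open>auto intro: bumps_partial_deriv\<close>)
  then show ?thesis unfolding smooth_def using bumps_derivative by (metis differentiable_def)
qed

section \<open>Mollifiers in the plane\<close>

type_synonym plane = "real \<times> real"

text \<open>For \<open>r > 0\<close> this is positive exactly on the open square where both
  coordinates are less than \<open>1 / r\<close> in absolute value. Thus \<open>r\<close> is an
  inverse radius; the bound \<open>2 / r\<close> for the support below comes from estimating the
  norm by the sum of the coordinates.\<close>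

definition bmp :: "real \<Rightarrow> plane \<Rightarrow> real" where
  "bmp r h = (eb 0 (1 + r * fst h) * eb 0 (1 - r * fst h)) * (eb 0 (1 + r * snd h) * eb 0 (1 - r * snd h))"

definition kern :: "real \<Rightarrow> plane \<Rightarrow> real" where
  "kern r h = inverse (LINT h|lborel. bmp r h) * bmp r h"

lemma bmp_affine_bumps: "(\<lambda>w. bmp r (z - w)) \<in> bumps" "bmp r \<in> bumps"
proof -
  have "(\<lambda>w. (eb 0 ((1 + r * fst z) + (-r, 0) \<bullet> w) * eb 0 ((1 - r * fst z) + (r, 0) \<bullet> w)) * (eb 0 ((1 + r * snd z) + (0, -r) \<bullet> w) * eb 0 ((1 - r * snd z) + (0, r) \<bullet> w))) \<in> bumps"
    by (intro bumps.intros)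
  then show "(\<lambda>w. bmp r (z - w)) \<in> bumps" by (simp add: bmp_def[abs_def] inner_prod_def algebra_simps)
  have "(\<lambda>w. (eb 0 (1 + (r, 0) \<bullet> w) * eb 0 (1 + (-r, 0) \<bullet> w)) * (eb 0 (1 + (0, r) \<bullet> w) * eb 0 (1 + (0, -r) \<bullet> w))) \<in> bumps"
    by (intro bumps.intros)
  then show "bmp r \<in> bumps" by (simp add: bmp_def[abs_def] inner_prod_def algebra_simps)
qed

lemma kern_bumps: "(\<lambda>w. kern r (z - w)) \<in> bumps" "kern r \<in> bumps"
  unfolding kern_def[abs_def] by (intro bumps.cmult bmp_affine_bumps)+

lemma kern_continuous: "continuous_on UNIV (kern r)"
  by (rule bumps_continuous[OF kern_bumps(2)])

lemma kern_measurable [measurable]: "kern r \<in> borel_measurable borel"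
  by (rule borel_measurable_continuous_onI[OF kern_continuous])

lemma bmp_supp:
  assumes "bmp r h \<noteq> 0" "r > 0"
  shows "\<bar>fst h\<bar> < 1/r \<and> \<bar>snd h\<bar> < 1/r"
  using assms unfolding bmp_def eb_def by (auto simp: abs_if field_simps split: if_splits)

lemma kern_supp:
  assumes "kern r h \<noteq> 0" "r > 0"
  shows "norm h \<le> 2 / r"
proof -
  have "\<bar>fst h\<bar> < 1/r" "\<bar>snd h\<bar> < 1/r" using bmp_supp[of r h] assms by (auto simp: kern_def)
  moreover have "norm h \<le> \<bar>fst h\<bar> + \<bar>snd h\<bar>" using norm_Pair_le[of "fst h" "snd h"] by simp
  ultimately show ?thesis by (simp add: field_simps)
qed

lemma bumps_compact_bounded:
  assumes "f \<in> bumps" "\<And>h. norm h > R \<Longrightarrow> f h = 0"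
  shows "\<exists>M. \<forall>h. \<bar>f h\<bar> \<le> M" "integrable lborel f"
proof -
  have c: "continuous_on (cball 0 R) f" using bumps_continuous[OF assms(1)] by (rule continuous_on_subset) simp
  have "compact (f ` cball 0 R)" by (intro compact_continuous_image c compact_cball)
  then have "bounded (f ` cball 0 R)" by (rule compact_imp_bounded)
  then obtain M where "\<forall>y\<in>f ` cball 0 R. \<bar>y\<bar> \<le> M" by (auto simp: bounded_iff)
  then have "\<bar>f h\<bar> \<le> max M 0" for h using assms(2)[of h] by (cases "norm h \<le> R") force+
  then show "\<exists>M. \<forall>h. \<bar>f h\<bar> \<le> M" by blast
  have "integrable lborel (\<lambda>x. indicator (cball 0 R) x *\<^sub>R f x)"
    using borel_integrable_compact[OF compact_cball c] by (simp add: set_integrable_def)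
  moreover have "(\<lambda>x. indicator (cball 0 R) x *\<^sub>R f x) = f"
    using assms(2) by (auto simp: fun_eq_iff split: split_indicator)
  ultimately show "integrable lborel f" by simp
qed

lemma bmp_far: "r > 0 \<Longrightarrow> norm h > 2 / r \<Longrightarrow> bmp r h = 0"
proof (rule ccontr)
  assume a: "r > 0" "norm h > 2 / r" "bmp r h \<noteq> 0"
  then have "\<bar>fst h\<bar> < 1/r" "\<bar>snd h\<bar> < 1/r" using bmp_supp[of r h] by auto
  moreover have "norm h \<le> \<bar>fst h\<bar> + \<bar>snd h\<bar>" using norm_Pair_le[of "fst h" "snd h"] by simp
  ultimately show False using a(2) by (simp add: field_simps)
qed

lemma bmp_integral_pos:
  assumes r: "r > 0"
  shows "(LINT h|lborel. bmp r h) > 0"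
proof -
  have i: "integrable lborel (bmp r)"
    by (rule bumps_compact_bounded(2)[OF bmp_affine_bumps(2) bmp_far[OF r]])
  have c: "continuous_on UNIV (bmp r)" by (rule bumps_continuous[OF bmp_affine_bumps(2)])
  have nn: "0 \<le> bmp r h" for h by (simp add: bmp_def eb_nonneg)
  have "(LINT h|lborel. bmp r h) \<noteq> 0"
  proof
    assume "(LINT h|lborel. bmp r h) = 0"
    then have "AE h in lborel. bmp r h = 0" using i nn by (subst (asm) integral_nonneg_eq_0_iff_AE) auto
    then have ae: "AE h in lborel. h \<notin> {h. bmp r h \<noteq> 0}" by simp
    have o: "open {h. bmp r h \<noteq> 0}" by (rule open_Collect_neq) (use c in auto)
    then have "{h. bmp r h \<noteq> 0} \<in> null_sets lborel" using ae by (intro AE_iff_null_sets[THEN iffD2]) auto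
    then have "negligible {h. bmp r h \<noteq> 0}" using null_sets_completionI negligible_iff_null_sets by blast
    then have "{h. bmp r h \<noteq> 0} = {}" using o open_not_negligible by blast
    then have "bmp r 0 = 0" by blast
    then show False by (simp add: bmp_def eb_def)
  qed
  moreover have "(LINT h|lborel. bmp r h) \<ge> 0" using nn by simp
  ultimately show ?thesis by linarith
qed

lemma kern_nonneg: "0 \<le> kern r h"
  unfolding kern_def by (intro mult_nonneg_nonneg) (auto simp: bmp_def eb_nonneg)

lemma kern_integral:
  assumes r: "r > 0"
  shows "integrable lborel (kern r)" "(LINT h|lborel. kern r h) = 1" "\<exists>M. \<forall>h. \<bar>kern r h\<bar> \<le> M"
  using bmp_integral_pos[OF r] bumps_compact_bounded[OF kern_bumps(2), of "2/r" r] kern_supp[OF _ r]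
  by (auto simp: kern_def) (smt (verit) r bmp_far)+

lemma lborel_distr_reflect:
  fixes t :: "'a::euclidean_space"
  shows "distr lborel borel (\<lambda>x. t - x) = lborel"
proof -
  have "lborel = density (distr lborel borel (\<lambda>x. t + (-1) *\<^sub>R x)) (\<lambda>_. ennreal (\<bar>-1\<bar> ^ DIM('a)))"
    by (rule lborel_affine) simp
  then show ?thesis by (simp add: density_1)
qed

lemma lborel_distr_translate:
  fixes t :: "'a::euclidean_space"
  shows "distr lborel borel (\<lambda>x. x - t) = lborel"
proof -
  have "lborel = density (distr lborel borel (\<lambda>x. - t + 1 *\<^sub>R x)) (\<lambda>_. ennreal (\<bar>1\<bar> ^ DIM('a)))"
    by (rule lborel_affine) simp
  then show ?thesis by (simp add: density_1)
qed

lemma lborel_shift: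
  fixes f :: "'a::euclidean_space \<Rightarrow> real"
  assumes [measurable]: "f \<in> borel_measurable borel"
  shows "(LINT w|lborel. f (z - w)) = (LINT w|lborel. f w)" "(LINT w|lborel. f (w - z)) = (LINT w|lborel. f w)"
    "integrable lborel (\<lambda>w. f (z - w)) \<longleftrightarrow> integrable lborel f" "integrable lborel (\<lambda>w. f (w - z)) \<longleftrightarrow> integrable lborel f"
  using integral_distr[of "\<lambda>x. z - x" lborel borel f] integral_distr[of "\<lambda>x. x - z" lborel borel f]
    integrable_distr_eq[of "\<lambda>x. z - x" lborel borel f] integrable_distr_eq[of "\<lambda>x. x - z" lborel borel f]
  by (simp_all add: lborel_distr_reflect lborel_distr_translate)

definition mol :: "real \<Rightarrow> (plane \<Rightarrow> real) \<Rightarrow> plane \<Rightarrow> real" where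
  "mol r f z = (LINT w|lborel. f w * kern r (z - w))"

lemma mol_integrable:
  assumes r: "r > 0" and f: "integrable lborel f"
  shows "integrable lborel (\<lambda>w. f w * kern r (z - w))"
proof -
  obtain M where M: "\<And>h. \<bar>kern r h\<bar> \<le> M" using kern_integral(3)[OF r] by blast
 have M0: "M \<ge> 0" using M[of 0] by linarith
  show ?thesis
  proof (rule Bochner_Integration.integrable_bound)
    show "integrable lborel (\<lambda>w. M * f w)" using f by simp
    show "(\<lambda>w. f w * kern r (z - w)) \<in> borel_measurable lborel" using borel_measurable_integrable[OF f] by measurable
    show "AE w in lborel. norm (f w * kern r (z - w)) \<le> norm (M * f w)"
    proof (rule AE_I2)
      fix w :: plane
      have "\<bar>kern r (z - w)\<bar> * \<bar>f w\<bar> \<le> M * \<bar>f w\<bar>" by (rule mult_right_mono[OF M]) simp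
      then show "norm (f w * kern r (z - w)) \<le> norm (M * f w)" using M0 by (simp add: abs_mult mult.commute)
    qed
  qed
qed

text \<open>All translates of the kernel are nonnegative with integral 1, so after Fubini's theorem
  the kernel integrates out.\<close>

lemma mol_Young:
  assumes r: "r > 0" and f: "integrable lborel f"
  shows "integrable lborel (mol r f)" "(LINT z|lborel. \<bar>mol r f z\<bar>) \<le> (LINT z|lborel. \<bar>f z\<bar>)"
proof -
  have [measurable]: "f \<in> borel_measurable borel" using borel_measurable_integrable[OF f] by simp
  have sh: "(LINT z|lborel. kern r (z - w)) = 1" "integrable lborel (\<lambda>z. kern r (z - w))" for w
    using kern_integral[OF r] lborel_shift(2,4)[of "kern r" w] by auto
  have i: "integrable (lborel \<Otimes>\<^sub>M lborel) (\<lambda>(w,z). f w * kern r (z - w))"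
  proof (rule lborel_pair.Fubini_integrable)
    show "integrable lborel (\<lambda>w. LINT z|lborel. norm (case (w,z) of (w,z) \<Rightarrow> f w * kern r (z - w)))"
      using integrable_abs[OF f] sh by (simp add: abs_mult kern_nonneg)
    show "AE w in lborel. integrable lborel (\<lambda>z. case (w,z) of (w,z) \<Rightarrow> f w * kern r (z - w))"
      using sh by simp
  qed measurable
  have ia: "integrable (lborel \<Otimes>\<^sub>M lborel) (\<lambda>(w,z). \<bar>f w\<bar> * kern r (z - w))"
    using integrable_abs[OF i] by (simp add: abs_mult kern_nonneg case_prod_unfold)
  have "integrable lborel (\<lambda>z. LINT w|lborel. f w * kern r (z - w))"
    using lborel_pair.integrable_snd[OF i] by simp
  then show im: "integrable lborel (mol r f)" by (simp add: mol_def[abs_def])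
  have "(LINT z|lborel. \<bar>mol r f z\<bar>) \<le> (LINT z|lborel. LINT w|lborel. \<bar>f w\<bar> * kern r (z - w))"
  proof (rule integral_mono)
    show "integrable lborel (\<lambda>z. LINT w|lborel. \<bar>f w\<bar> * kern r (z - w))"
      using lborel_pair.integrable_snd[OF ia] by simp
    show "\<bar>mol r f z\<bar> \<le> (LINT w|lborel. \<bar>f w\<bar> * kern r (z - w))" for z
      using integral_abs_bound[of lborel "\<lambda>w. f w * kern r (z - w)"] by (simp add: mol_def abs_mult kern_nonneg)
  qed (use im in auto)
  also have "\<dots> = (LINT w|lborel. LINT z|lborel. \<bar>f w\<bar> * kern r (z - w))"
    using lborel_pair.Fubini_integral[OF ia] by simp
  also have "\<dots> = (LINT w|lborel. \<bar>f w\<bar>)" using sh by simp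
  finally show "(LINT z|lborel. \<bar>mol r f z\<bar>) \<le> (LINT z|lborel. \<bar>f z\<bar>)" .
qed

lemma mol_uniform:
  assumes v: "continuous_on UNIV v" "integrable lborel v" and B: "bounded B" and e: "e > 0"
  shows "\<exists>N. \<forall>n\<ge>N. \<forall>z\<in>B. \<bar>mol (real (Suc n)) v z - v z\<bar> \<le> e"
proof -
  obtain R where R: "\<And>z. z \<in> B \<Longrightarrow> norm z \<le> R" using B by (auto simp: bounded_iff)
  \<comment> \<open>The margin 2 accommodates the support of the kernel, whose radius
    \<open>2 / r\<close> is at most 2.\<close>
  have "uniformly_continuous_on (cball 0 (R + 2)) v"
    by (rule compact_uniformly_continuous) (use v continuous_on_subset in auto)
  then obtain d where d: "d > 0" "\<And>x y. x \<in> cball 0 (R+2) \<Longrightarrow> y \<in> cball 0 (R+2) \<Longrightarrow> dist y x < d \<Longrightarrow> dist (v y) (v x) < e"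
    unfolding uniformly_continuous_on_def using e by metis
  obtain N where N: "2 / d < real N" using reals_Archimedean2 by blast
  have [measurable]: "v \<in> borel_measurable borel" using v(1) by (rule borel_measurable_continuous_onI)
  show ?thesis
  proof (intro exI allI impI ballI)
    fix n z assume n: "n \<ge> N" and z: "z \<in> B"
    define r where "r = real (Suc n)"
    have r: "r > 0" "r \<ge> 1" "2 / r < d" "2 / r \<le> 2"
    proof -
      show r: "r > 0" "r \<ge> 1" by (auto simp: r_def)
      have "2 / d < r" using N n by (simp add: r_def)
      then show "2 / r < d" using d(1) r by (simp add: field_simps)
      show "2 / r \<le> 2" using r by (simp add: field_simps)
    qed
    have k: "(LINT w|lborel. kern r (z - w)) = 1" "integrable lborel (\<lambda>w. kern r (z - w))"
      using kern_integral[OF r(1)] lborel_shift(1,3)[of "kern r" z] by auto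
    have "mol r v z - v z = (LINT w|lborel. v w * kern r (z - w) - v z * kern r (z - w))"
      using mol_integrable[OF r(1) v(2), of z] k by (simp add: mol_def)
    also have "\<bar>\<dots>\<bar> \<le> (LINT w|lborel. e * kern r (z - w))"
    proof (rule order_trans[OF integral_abs_bound integral_mono])
      show "integrable lborel (\<lambda>w. \<bar>v w * kern r (z - w) - v z * kern r (z - w)\<bar>)"
        using mol_integrable[OF r(1) v(2), of z] k by auto
      show "integrable lborel (\<lambda>w. e * kern r (z - w))" using k by simp
      show "\<bar>v w * kern r (z - w) - v z * kern r (z - w)\<bar> \<le> e * kern r (z - w)" for w
      proof (cases "kern r (z - w) = 0")
        case False
        then have "norm (z - w) \<le> 2 / r" using kern_supp r by blast
        then have "dist w z < d" "norm w \<le> R + 2"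
          using r R[OF z] norm_triangle_ineq[of z "w - z"] by (auto simp: dist_norm norm_minus_commute)
        then have "dist (v w) (v z) < e" using d(2)[of z w] R[OF z] by auto
        then show ?thesis using kern_nonneg[of r "z - w"]
          by (auto simp: left_diff_distrib[symmetric] abs_mult dist_real_def intro!: mult_right_mono)
      qed simp
    qed
    also have "\<dots> = e" using k by simp
    finally show "\<bar>mol (real (Suc n)) v z - v z\<bar> \<le> e" by (simp add: r_def)
  qed
qed

text \<open>An \<open>L^1\<close>-close continuous \<open>v\<close> is inserted: mollification
  contracts \<open>f - v\<close>, it converges uniformly for \<open>v\<close> on the bounded set
  \<open>B\<close>, and \<open>f - v\<close> itself is small. Each of the three terms gets a third
  of \<open>e\<close>.\<close>

lemma mol_L1:
  assumes f: "integrable lborel f" and B: "bounded B" "B \<in> sets borel"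
  shows "(\<lambda>n. LINT z|onm B. \<bar>mol (real (Suc n)) f z - f z\<bar>) \<longlonglongrightarrow> 0"
proof (rule LIMSEQ_I)
  fix e :: real assume e: "e > 0"
  interpret fin: finite_measure "onm B" by (rule finite_measure_onm[OF B])
  obtain v where v: "continuous_on UNIV v" "integrable lborel v" "(LINT x|lborel. \<bar>f x - v x\<bar>) < e/3"
    using integrable_approx_continuous[OF f] e by (meson divide_pos_pos zero_less_numeral)
  define m where "m = measure (onm B) UNIV"
  have m0: "m \<ge> 0" by (simp add: m_def)
  obtain N where N: "\<And>n z. n \<ge> N \<Longrightarrow> z \<in> B \<Longrightarrow> \<bar>mol (real (Suc n)) v z - v z\<bar> \<le> e / (3 * (m + 1))"
    using mol_uniform[OF v(1,2) B(1), of "e / (3 * (m + 1))"] e m0 by auto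
  have [measurable]: "f \<in> borel_measurable borel" "v \<in> borel_measurable borel"
    using borel_measurable_integrable[OF f] borel_measurable_integrable[OF v(2)] by auto
  have onB: "integrable (onm B) h" if "integrable lborel h" for h :: "plane \<Rightarrow> real"
  proof -
    have "h \<in> borel_measurable borel" using borel_measurable_integrable[OF that] by simp
    then show ?thesis using integrable_mult_indicator[OF _ that, of B] B by (simp add: integrable_onm)
  qed
  have le: "(LINT z|onm B. \<bar>h z\<bar>) \<le> (LINT z|lborel. \<bar>h z\<bar>)" if "integrable lborel h" for h :: "plane \<Rightarrow> real"
  proof -
    have [measurable]: "h \<in> borel_measurable borel" using borel_measurable_integrable[OF that] by simp
    have "(LINT z|onm B. \<bar>h z\<bar>) = (LINT z|lborel. indicator B z * \<bar>h z\<bar>)" using B by (simp add: integral_onm)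
    also have "\<dots> \<le> (LINT z|lborel. \<bar>h z\<bar>)"
    proof (rule integral_mono)
      show "integrable lborel (\<lambda>z. indicator B z * \<bar>h z\<bar>)"
        using onB[OF integrable_abs[OF that]] B by (simp add: integrable_onm)
    qed (use that in \<open>auto split: split_indicator\<close>)
    finally show ?thesis .
  qed
  have "norm ((LINT z|onm B. \<bar>mol (real (Suc n)) f z - f z\<bar>) - 0) < e" if n: "n \<ge> N" for n
  proof -
    let ?r = "real (Suc n)"
    have r: "?r > 0" by simp
    have d: "integrable lborel (\<lambda>x. f x - v x)" using f v by simp
    note y = mol_Young[OF r d] and yf = mol_Young(1)[OF r f] and yv = mol_Young(1)[OF r v(2)]
    have lin: "mol ?r (\<lambda>x. f x - v x) z = mol ?r f z - mol ?r v z" for z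
      using mol_integrable[OF r f, of z] mol_integrable[OF r v(2), of z] by (simp add: mol_def left_diff_distrib)
    have "(LINT z|onm B. \<bar>mol ?r f z - f z\<bar>) \<le> (LINT z|onm B. \<bar>mol ?r (\<lambda>x. f x - v x) z\<bar> + e / (3 * (m + 1)) + \<bar>f z - v z\<bar>)"
    proof (rule integral_mono_AE)
      show "AE z in onm B. \<bar>mol ?r f z - f z\<bar> \<le> \<bar>mol ?r (\<lambda>x. f x - v x) z\<bar> + e / (3 * (m + 1)) + \<bar>f z - v z\<bar>"
        using AE_onm_mem[OF B(2)]
      proof eventually_elim
        case (elim z)
        then show ?case using N[OF n elim] unfolding lin by linarith
      qed
    qed (use onB[OF yf] onB[OF f] onB[OF y(1)] onB[OF d] in auto)
    also have "\<dots> = (LINT z|onm B. \<bar>mol ?r (\<lambda>x. f x - v x) z\<bar>) + e / (3 * (m + 1)) * m + (LINT z|onm B. \<bar>f z - v z\<bar>)"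
      using onB[OF y(1)] onB[OF d] by (simp add: m_def)
    also have "\<dots> < e"
    proof -
      have "(LINT z|onm B. \<bar>mol ?r (\<lambda>x. f x - v x) z\<bar>) < e/3" using le[OF y(1)] y(2) v(3) by linarith
      moreover have "(LINT z|onm B. \<bar>f z - v z\<bar>) < e/3" using le[OF d] v(3) by linarith
      moreover have "e / (3 * (m + 1)) * m \<le> e/3" using e m0 by (simp add: field_simps)
      ultimately show ?thesis by linarith
    qed
    finally show ?thesis by simp
  qed
  then show "\<exists>no. \<forall>n\<ge>no. norm ((LINT z|onm B. \<bar>mol (real (Suc n)) f z - f z\<bar>) - 0) < e" by blast
qed

lemma plane_components_measurable:
  fixes f :: "'a \<Rightarrow> plane"
  assumes "f \<in> borel_measurable M"
  shows "(\<lambda>x. fst (f x)) \<in> borel_measurable M" "(\<lambda>x. snd (f x)) \<in> borel_measurable M"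
  by (intro borel_measurable_continuous_on[OF _ assms] continuous_intros)+

text \<open>The reflected and translated kernel \<open>kern r (z0 - w)\<close> is a test function in
  \<open>w\<close>, because its support stays within distance \<open>2 / r\<close> of
  \<open>z0\<close> and hence in \<open>D\<close>. Differentiating in \<open>w\<close> instead of
  \<open>z0\<close> costs a sign, which cancels the sign in the weak formulation.\<close>

lemma mol_gradient:
  assumes r: "r > 0" and z0: "\<And>h. norm h \<le> 2 / r \<Longrightarrow> z0 + h \<in> D" and D: "D \<in> sets borel"
    and u: "u \<in> borel_measurable borel" and g: "g \<in> borel_measurable borel"
    and K: "(\<And>z. (kern r has_derivative KD z) (at z))" "(\<lambda>z. KD z b) \<in> bumps"
    and weak: "\<And>\<phi>. test_function D \<phi> \<Longrightarrow>
       (LINT z|onm D. u z * partial_deriv b \<phi> z) = - (LINT z|onm D. g z * \<phi> z)"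
  shows "(LINT w|lborel. (indicator D w * u w) * KD (z0 - w) b) = mol r (\<lambda>w. indicator D w * g w) z0"
proof -
  let ?\<phi> = "\<lambda>w. kern r (z0 - w)"
  have z0': "w \<in> D" if "norm (z0 - w) \<le> 2 / r" for w
    using z0[of "w - z0"] that by (simp add: norm_minus_commute)
  have nz: "norm (z0 - w) \<le> 2 / r" if "?\<phi> w \<noteq> 0" for w by (rule kern_supp[OF that r])
  have sub: "{w. ?\<phi> w \<noteq> 0} \<subseteq> cball z0 (2 / r)" unfolding cball_def dist_norm using nz by blast
  have cl: "closure {w. ?\<phi> w \<noteq> 0} \<subseteq> cball z0 (2 / r)"
    by (rule closure_minimal[OF sub]) simp
  have co: "compact (closure {w. ?\<phi> w \<noteq> 0})" using bounded_subset[OF bounded_cball sub] by (simp only: compact_closure)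
  have "closure {w. ?\<phi> w \<noteq> 0} \<subseteq> D" using cl z0' unfolding cball_def dist_norm by blast
  then have tf: "test_function D ?\<phi>"
    unfolding test_function_def using bumps_smooth[OF kern_bumps(1)] co by blast
  have pd: "partial_deriv b ?\<phi> w = - KD (z0 - w) b" for w
  proof -
    have "((\<lambda>w. z0 - w) has_derivative (\<lambda>h. - h)) (at w)" by (auto intro!: derivative_eq_intros)
    from has_derivative_compose[OF this K(1)]
    have "partial_deriv b ?\<phi> w = KD (z0 - w) (- b)" by (rule partial_deriv_eq)
    moreover have "linear (KD (z0 - w))" using K(1) has_derivative_linear by blast
    ultimately show ?thesis by (simp add: linear_neg)
  qed
  have [measurable]: "(\<lambda>z. KD z b) \<in> borel_measurable borel"
    by (rule borel_measurable_continuous_onI[OF bumps_continuous[OF K(2)]])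
  have [measurable]: "u \<in> borel_measurable borel" "g \<in> borel_measurable borel" "D \<in> sets borel" by fact+
  show ?thesis using weak[OF tf] by (simp add: pd integral_onm mol_def mult.assoc)
qed

text \<open>This is the chain rule for a mollified function in integrated form. The convolution is
  never differentiated: the kernel is differentiated along the curve, the result is integrated, and
  Fubini's theorem exchanges this with the integral against \<open>u\<close>.\<close>

lemma mol_curve:
  fixes u g1 g2 :: "plane \<Rightarrow> real" and \<gamma> \<gamma>' :: "real \<Rightarrow> plane"
  assumes r: "r > 0" and D: "D \<in> sets borel"
    and i: "integrable (onm D) u" "integrable (onm D) g1" "integrable (onm D) g2"
    and weak1: "\<And>\<phi>. test_function D \<phi> \<Longrightarrow> (LINT z|onm D. u z * partial_deriv (1,0) \<phi> z) = - (LINT z|onm D. g1 z * \<phi> z)"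
    and weak2: "\<And>\<phi>. test_function D \<phi> \<Longrightarrow> (LINT z|onm D. u z * partial_deriv (0,1) \<phi> z) = - (LINT z|onm D. g2 z * \<phi> z)"
    and \<gamma>: "continuous_on {a..b} \<gamma>" "\<And>s. s \<in> {a<..<b} \<Longrightarrow> (\<gamma> has_vector_derivative \<gamma>' s) (at s)"
    and \<gamma>m: "\<gamma> \<in> borel_measurable borel" "\<gamma>' \<in> borel_measurable borel" "\<And>s. norm (\<gamma>' s) \<le> C"
    and near: "\<And>s h. s \<in> {a..b} \<Longrightarrow> norm h \<le> 2 / r \<Longrightarrow> \<gamma> s + h \<in> D"
    and s: "s \<in> {a..b}"
  shows "mol r (\<lambda>w. indicator D w * u w) (\<gamma> s) = mol r (\<lambda>w. indicator D w * u w) (\<gamma> a) +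
    prim a (\<lambda>\<sigma>. mol r (\<lambda>w. indicator D w * g1 w) (\<gamma> \<sigma>) * fst (\<gamma>' \<sigma>) + mol r (\<lambda>w. indicator D w * g2 w) (\<gamma> \<sigma>) * snd (\<gamma>' \<sigma>)) s"
proof -
  obtain KD where K: "\<And>z. (kern r has_derivative KD z) (at z)" "\<And>b. (\<lambda>z. KD z b) \<in> bumps"
    using bumps_derivative[OF kern_bumps(2)] by blast
  have m [measurable]: "u \<in> borel_measurable borel" "g1 \<in> borel_measurable borel" "g2 \<in> borel_measurable borel"
    using i by (auto intro: integrable_onm_borel)
  have [measurable]: "\<gamma> \<in> borel_measurable borel" "\<gamma>' \<in> borel_measurable borel" "D \<in> sets borel" by fact+
  have C0: "C \<ge> 0" using \<gamma>m(3)[of 0] norm_ge_zero[of "\<gamma>' 0"] by linarith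
  define K1 where "K1 z = KD z (1,0)" for z
  define K2 where "K2 z = KD z (0,1)" for z
  have [measurable]: "K1 \<in> borel_measurable borel" "K2 \<in> borel_measurable borel"
    unfolding K1_def[abs_def] K2_def[abs_def] by (rule borel_measurable_continuous_onI[OF bumps_continuous[OF K(2)]])+
  have Kz: "KD z b = 0" if "norm z > 2 / r" for z b
  proof -
    have o: "open {z::plane. 2 / r < norm z}" by (intro open_Collect_less continuous_intros)
    have "((\<lambda>_. 0) has_derivative KD z) (at z)"
      by (rule has_derivative_transform_within_open[OF K(1) o]) (use that kern_supp[OF _ r] in force)+
    moreover have "((\<lambda>_. 0::real) has_derivative (\<lambda>_. 0)) (at z)" by simp
    ultimately have "KD z = (\<lambda>_. 0)" by (rule has_derivative_unique)
    then show ?thesis by simp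
  qed
  obtain M where M: "\<And>z. \<bar>K1 z\<bar> \<le> M" "\<And>z. \<bar>K2 z\<bar> \<le> M"
  proof -
    obtain M1 where "\<And>z. \<bar>K1 z\<bar> \<le> M1"
      using bumps_compact_bounded(1)[OF K(2)[of "(1,0)"], of "2/r"] Kz unfolding K1_def by blast
    moreover obtain M2 where "\<And>z. \<bar>K2 z\<bar> \<le> M2"
      using bumps_compact_bounded(1)[OF K(2)[of "(0,1)"], of "2/r"] Kz unfolding K2_def by blast
    ultimately show thesis by (intro that[of "max M1 M2"]) (auto simp: le_max_iff_disj)
  qed
  have M0: "M \<ge> 0" using M(1)[of 0] by linarith
  define c1 where "c1 \<sigma> = fst (\<gamma>' \<sigma>)" for \<sigma>
  define c2 where "c2 \<sigma> = snd (\<gamma>' \<sigma>)" for \<sigma>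
  have [measurable]: "c1 \<in> borel_measurable borel" "c2 \<in> borel_measurable borel"
    unfolding c1_def[abs_def] c2_def[abs_def] by (intro plane_components_measurable \<gamma>m)+
  \<comment> \<open>\<open>Q w \<sigma>\<close> is the derivative of
    \<open>kern r (\<gamma> \<sigma> - w)\<close> in \<open>\<sigma>\<close>. It is bounded
    uniformly in \<open>w\<close>, which together with an integrable \<open>U\<close> is what
    Fubini's theorem needs.\<close>
  define Q where "Q w \<sigma> = c1 \<sigma> * K1 (\<gamma> \<sigma> - w) + c2 \<sigma> * K2 (\<gamma> \<sigma> - w)" for w \<sigma>
  have Qm [measurable]: "(\<lambda>(w,\<sigma>). Q w \<sigma>) \<in> borel_measurable (borel \<Otimes>\<^sub>M borel)" unfolding Q_def by measurable
  have Qm' [measurable]: "Q w \<in> borel_measurable borel" for w unfolding Q_def by measurable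
  have QB: "\<bar>Q w \<sigma>\<bar> \<le> 2 * C * M" for w \<sigma>
  proof -
    have c: "\<bar>c1 \<sigma>\<bar> \<le> C" "\<bar>c2 \<sigma>\<bar> \<le> C"
      unfolding c1_def c2_def using \<gamma>m(3)[of \<sigma>] norm_fst_le[of "fst (\<gamma>' \<sigma>)" "snd (\<gamma>' \<sigma>)"] norm_snd_le[of "snd (\<gamma>' \<sigma>)" "fst (\<gamma>' \<sigma>)"] by auto
    have "\<bar>c1 \<sigma> * K1 (\<gamma> \<sigma> - w)\<bar> \<le> C * M" unfolding abs_mult by (intro mult_mono c M C0 abs_ge_zero)
    moreover have "\<bar>c2 \<sigma> * K2 (\<gamma> \<sigma> - w)\<bar> \<le> C * M" unfolding abs_mult by (intro mult_mono c M C0 abs_ge_zero)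
    ultimately show ?thesis unfolding Q_def by linarith
  qed
  interpret fin: finite_measure "onm {a<..<s}" by (rule finite_measure_onm) auto
  have Qi: "integrable (onm {a<..<s}) (Q w)" for w
    by (rule fin.integrable_const_bound[where B="2 * C * M"]) (use QB in auto)
  have ftc: "kern r (\<gamma> s - w) - kern r (\<gamma> a - w) = prim a (Q w) s" for w
  proof -
    have "(Q w has_integral (kern r (\<gamma> s - w) - kern r (\<gamma> a - w))) {a..s}"
    proof (rule fundamental_theorem_of_calculus_interior)
      show "a \<le> s" using s by simp
      show "continuous_on {a..s} (\<lambda>\<sigma>. kern r (\<gamma> \<sigma> - w))"
        by (intro continuous_on_compose2[OF kern_continuous] continuous_intros continuous_on_subset[OF \<gamma>(1)]) (use s in auto)
      fix \<sigma> assume "\<sigma> \<in> {a<..<s}"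
      then have "(\<gamma> has_vector_derivative \<gamma>' \<sigma>) (at \<sigma>)" using \<gamma>(2) s by auto
      then have "((\<lambda>\<sigma>. \<gamma> \<sigma> - w) has_derivative (\<lambda>t. t *\<^sub>R \<gamma>' \<sigma>)) (at \<sigma>)"
        by (auto simp: has_vector_derivative_def intro!: derivative_eq_intros)
      from has_derivative_compose[OF this K(1)]
      have d: "((\<lambda>\<sigma>. kern r (\<gamma> \<sigma> - w)) has_derivative (\<lambda>t. KD (\<gamma> \<sigma> - w) (t *\<^sub>R \<gamma>' \<sigma>))) (at \<sigma>)" .
      have lin: "linear (KD (\<gamma> \<sigma> - w))" using K(1) has_derivative_linear by blast
      have "\<gamma>' \<sigma> = fst (\<gamma>' \<sigma>) *\<^sub>R (1,0) + snd (\<gamma>' \<sigma>) *\<^sub>R (0,1)" by (simp add: prod_eq_iff)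
      then have "KD (\<gamma> \<sigma> - w) (\<gamma>' \<sigma>) = Q w \<sigma>"
        unfolding Q_def K1_def K2_def c1_def c2_def
        by (metis linear_add[OF lin] linear_scale[OF lin] real_scaleR_def)
      then show "((\<lambda>\<sigma>. kern r (\<gamma> \<sigma> - w)) has_vector_derivative Q w \<sigma>) (at \<sigma>)"
        using d by (simp add: has_vector_derivative_def linear_scale[OF lin])
    qed
    from has_integral_imp_onm[OF Qi this] s show ?thesis by (simp add: prim_eq_integral_onm)
  qed
  define U where "U w = indicator D w * u w" for w
  have Ui: "integrable lborel U" and [measurable]: "U \<in> borel_measurable borel"
    using i(1) D unfolding U_def[abs_def] by (auto simp: integrable_onm)
  have gi: "integrable lborel (\<lambda>w. indicator D w * g1 w)" "integrable lborel (\<lambda>w. indicator D w * g2 w)"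
    using i D by (auto simp: integrable_onm)
  define P where "P w \<sigma> = U w * (indicator {a<..<s} \<sigma> * Q w \<sigma>)" for w \<sigma>
  have Pm [measurable]: "case_prod P \<in> borel_measurable (lborel \<Otimes>\<^sub>M lborel)" unfolding P_def by measurable
  have Pi: "integrable (lborel \<Otimes>\<^sub>M lborel) (case_prod P)"
  proof (rule Bochner_Integration.integrable_bound[OF _ Pm])
    show "integrable (lborel \<Otimes>\<^sub>M lborel) (\<lambda>(w,\<sigma>). \<bar>U w\<bar> * (indicator {a<..<s} \<sigma> * (2 * C * M)))"
    proof (rule lborel_pair.Fubini_integrable)
      have ii: "integrable lborel (indicator {a<..<s} :: real \<Rightarrow> real)"
        using s by (intro integrable_real_indicator) auto
      show "integrable lborel (\<lambda>w. LINT \<sigma>|lborel. norm (case (w,\<sigma>) of (w,\<sigma>) \<Rightarrow> \<bar>U w\<bar> * (indicator {a<..<s} \<sigma> * (2 * C * M))))"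
        using Ui by (simp add: abs_mult)
      show "AE w in lborel. integrable lborel (\<lambda>\<sigma>. case (w,\<sigma>) of (w,\<sigma>) \<Rightarrow> \<bar>U w\<bar> * (indicator {a<..<s} \<sigma> * (2 * C * M)))"
        using ii by simp
    qed measurable
    show "AE p in lborel \<Otimes>\<^sub>M lborel. norm (case_prod P p) \<le> norm (case p of (w,\<sigma>) \<Rightarrow> \<bar>U w\<bar> * (indicator {a<..<s} \<sigma> * (2 * C * M)))"
      using QB C0 M0 by (intro AE_I2) (auto simp: P_def abs_mult intro!: mult_left_mono split: split_indicator)
  qed
  have Fub: "(LINT \<sigma>|lborel. LINT w|lborel. P w \<sigma>) = (LINT w|lborel. LINT \<sigma>|lborel. P w \<sigma>)"
    using lborel_pair.Fubini_integral[OF Pi] by simp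
  have "(LINT \<sigma>|lborel. P w \<sigma>) = U w * kern r (\<gamma> s - w) - U w * kern r (\<gamma> a - w)" for w
    unfolding P_def using ftc[of w, symmetric] by (simp add: prim_def right_diff_distrib)
  then have 1: "(LINT w|lborel. LINT \<sigma>|lborel. P w \<sigma>) = mol r U (\<gamma> s) - mol r U (\<gamma> a)"
    using mol_integrable[OF r Ui] by (simp add: mol_def)
  have KU: "integrable lborel (\<lambda>w. U w * K1 (z - w))" "integrable lborel (\<lambda>w. U w * K2 (z - w))" for z
  proof -
    have "integrable lborel (\<lambda>w. U w * k w)" if "k \<in> borel_measurable borel" "\<And>w. \<bar>k w\<bar> \<le> M" for k
    proof (rule Bochner_Integration.integrable_bound)
      show "integrable lborel (\<lambda>w. U w * M)" using Ui by simp
      show "AE w in lborel. norm (U w * k w) \<le> norm (U w * M)"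
        using that(2) M0 by (intro AE_I2) (simp add: abs_mult mult_left_mono)
    qed (use that in measurable)
    then show "integrable lborel (\<lambda>w. U w * K1 (z - w))" "integrable lborel (\<lambda>w. U w * K2 (z - w))"
      using M by auto
  qed
  have "(LINT w|lborel. P w \<sigma>) = indicator {a<..<s} \<sigma> * (mol r (\<lambda>w. indicator D w * g1 w) (\<gamma> \<sigma>) * fst (\<gamma>' \<sigma>) + mol r (\<lambda>w. indicator D w * g2 w) (\<gamma> \<sigma>) * snd (\<gamma>' \<sigma>))" for \<sigma>
  proof (cases "\<sigma> \<in> {a<..<s}")
    case True
    then have n: "\<gamma> \<sigma> + h \<in> D" if "norm h \<le> 2 / r" for h using near[of \<sigma> h] that s by auto
    have g1: "(LINT w|lborel. U w * K1 (\<gamma> \<sigma> - w)) = mol r (\<lambda>w. indicator D w * g1 w) (\<gamma> \<sigma>)"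
      unfolding U_def K1_def by (rule mol_gradient[OF r n D m(1,2) K weak1])
    have g2: "(LINT w|lborel. U w * K2 (\<gamma> \<sigma> - w)) = mol r (\<lambda>w. indicator D w * g2 w) (\<gamma> \<sigma>)"
      unfolding U_def K2_def by (rule mol_gradient[OF r n D m(1,3) K weak2])
    have "(LINT w|lborel. P w \<sigma>) = (LINT w|lborel. fst (\<gamma>' \<sigma>) * (U w * K1 (\<gamma> \<sigma> - w)) + snd (\<gamma>' \<sigma>) * (U w * K2 (\<gamma> \<sigma> - w)))"
      using True by (intro Bochner_Integration.integral_cong) (auto simp: P_def Q_def c1_def c2_def algebra_simps)
    also have "\<dots> = fst (\<gamma>' \<sigma>) * (LINT w|lborel. U w * K1 (\<gamma> \<sigma> - w)) + snd (\<gamma>' \<sigma>) * (LINT w|lborel. U w * K2 (\<gamma> \<sigma> - w))"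
      using KU by simp
    finally show ?thesis using True unfolding g1 g2 by (simp add: mult.commute)
  qed (simp add: P_def)
  then have "(LINT \<sigma>|lborel. LINT w|lborel. P w \<sigma>) = prim a (\<lambda>\<sigma>. mol r (\<lambda>w. indicator D w * g1 w) (\<gamma> \<sigma>) * fst (\<gamma>' \<sigma>) + mol r (\<lambda>w. indicator D w * g2 w) (\<gamma> \<sigma>) * snd (\<gamma>' \<sigma>)) s"
    by (simp add: prim_def)
  then show ?thesis using 1 Fub unfolding U_def[symmetric] by simp
qed

section \<open>Change of variables in the plane\<close>

text \<open>Determinants of derivatives are formed on Cartesian vectors, so the plane is identified
  with \<open>real^2\<close> for the change of variables and nowhere else.\<close>

definition tovec :: "plane \<Rightarrow> real^2" where "tovec p = vector [fst p, snd p]"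
definition ofvec :: "real^2 \<Rightarrow> plane" where "ofvec v = (v $ 1, v $ 2)"

lemma tovec_ofvec [simp]: "tovec (ofvec v) = v" "ofvec (tovec p) = p"
  by (auto simp: tovec_def ofvec_def vec_eq_iff forall_2)

lemma linear_tovec: "linear tovec" "linear ofvec"
  by (auto intro!: linearI simp: tovec_def ofvec_def vec_eq_iff forall_2)

lemma tovec_measurable [measurable]: "tovec \<in> borel_measurable borel" "ofvec \<in> borel_measurable borel"
  using linear_tovec by (auto intro!: borel_measurable_continuous_onI linear_continuous_on simp: linear_conv_bounded_linear)

lemma distr_tovec: "distr lborel borel tovec = (lborel :: (real^2) measure)"
proof (rule sym, rule lborel_eqI)
  fix l u :: "real^2" assume lu: "\<And>b. b \<in> Basis \<Longrightarrow> l \<bullet> b \<le> u \<bullet> b"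
  have B: "(Basis :: (real^2) set) = {axis 1 1, axis 2 1}"
    by (auto simp: Basis_vec_def UNIV_2)
  have ne: "axis 1 (1::real) \<noteq> (axis 2 1 :: real^2)" by (simp add: axis_eq_axis)
  have le: "l $ 1 \<le> u $ 1" "l $ 2 \<le> u $ 2"
    using lu[of "axis 1 1"] lu[of "axis 2 1"] by (auto simp: B inner_axis)
  have "tovec -` box l u = box (l $ 1) (u $ 1) \<times> box (l $ 2) (u $ 2)"
    by (auto simp: tovec_def mem_box_cart forall_2 box_real)
  then have "emeasure (distr lborel borel tovec) (box l u) = emeasure (lborel \<Otimes>\<^sub>M lborel) (box (l $ 1) (u $ 1) \<times> box (l $ 2) (u $ 2))"
    by (simp add: emeasure_distr lborel_prod)
  also have "\<dots> = ennreal (u $ 1 - l $ 1) * ennreal (u $ 2 - l $ 2)"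
    using le by (subst lborel.emeasure_pair_measure_Times) auto
  also have "\<dots> = (\<Prod>b\<in>Basis. (u - l) \<bullet> b)"
    using ne le by (simp add: B inner_axis ennreal_mult)
  finally show "emeasure (distr lborel borel tovec) (box l u) = (\<Prod>b\<in>Basis. (u - l) \<bullet> b)" .
qed simp

text \<open>\<open>P1 z\<close> and \<open>P2 z\<close> are the columns of the Jacobi matrix of
  \<open>\<Psi>\<close>; the formula for the measure of a differentiable image is transported
  through the identification with \<open>real^2\<close>.\<close>

lemma plane_cov_sets:
  fixes \<Psi> P1 P2 :: "plane \<Rightarrow> plane"
  assumes E: "E \<in> sets borel" and inj: "inj_on \<Psi> E" and im: "\<Psi> ` E \<in> sets borel" "bounded (\<Psi> ` E)"
    and d: "\<And>z. z \<in> E \<Longrightarrow> (\<Psi> has_derivative (\<lambda>h. fst h *\<^sub>R P1 z + snd h *\<^sub>R P2 z)) (at z)"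
    and J: "\<And>z. z \<in> E \<Longrightarrow> J z = \<bar>fst (P1 z) * snd (P2 z) - snd (P1 z) * fst (P2 z)\<bar>"
    and Jm [measurable]: "J \<in> borel_measurable borel"
  shows "emeasure lborel (\<Psi> ` E) = (\<integral>\<^sup>+z. ennreal (J z) * indicator E z \<partial>lborel)"
proof -
  have [measurable]: "E \<in> sets borel" by fact
  define S where "S = tovec ` E"
  define f where "f = tovec \<circ> \<Psi> \<circ> ofvec"
  define f' where "f' v h = tovec (fst (ofvec h) *\<^sub>R P1 (ofvec v) + snd (ofvec h) *\<^sub>R P2 (ofvec v))" for v h
  have S: "S = ofvec -` E" unfolding S_def by (auto simp: image_iff) (metis tovec_ofvec(1))
  have Sb: "S \<in> sets borel" unfolding S using measurable_sets[OF tovec_measurable(2) E] by simp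
  have fS: "f ` S = tovec ` (\<Psi> ` E)" by (auto simp: f_def S_def image_iff)
  have fS': "tovec ` (\<Psi> ` E) = ofvec -` (\<Psi> ` E)" by (auto simp: image_iff) (metis tovec_ofvec(1))
  have fSb: "f ` S \<in> sets borel" unfolding fS fS' using measurable_sets[OF tovec_measurable(2) im(1)] by simp
  have bl: "bounded_linear tovec" "bounded_linear ofvec" using linear_tovec by (auto simp: linear_conv_bounded_linear)
  have bfS: "bounded (f ` S)" unfolding fS by (rule bounded_linear_image[OF im(2) bl(1)])
  then have lm: "f ` S \<in> lmeasurable" using fSb by (intro bounded_set_imp_lmeasurable) auto
  have df: "(f has_derivative f' v) (at v within S)" if "v \<in> S" for v
  proof -
    have "ofvec v \<in> E" using that S by auto
    then have "((\<lambda>v. \<Psi> (ofvec v)) has_derivative (\<lambda>h. fst (ofvec h) *\<^sub>R P1 (ofvec v) + snd (ofvec h) *\<^sub>R P2 (ofvec v))) (at v)"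
      by (intro has_derivative_compose[OF bounded_linear_imp_has_derivative[OF bl(2)]] d)
    from has_derivative_compose[OF this bounded_linear_imp_has_derivative[OF bl(1)]]
    show ?thesis unfolding f_def f'_def comp_def by (rule has_derivative_at_withinI)
  qed
  have injf: "inj_on f S"
  proof (rule inj_onI)
    fix v w assume vw: "v \<in> S" "w \<in> S" "f v = f w"
    then have "\<Psi> (ofvec v) = \<Psi> (ofvec w)" unfolding f_def comp_def by (metis tovec_ofvec(2))
    then show "v = w" using inj vw S by (metis inj_onD tovec_ofvec(1) vimageE)
  qed
  have det: "\<bar>det (matrix (f' v))\<bar> = J (ofvec v)" if "v \<in> S" for v
    using that S by (simp add: J det_2 matrix_def f'_def tovec_def ofvec_def axis_def algebra_simps)
  have "((\<lambda>x. \<bar>det (matrix (f' x))\<bar>) has_integral measure lebesgue (f ` S)) S"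
    using has_measure_differentiable_image[OF _ df injf, of "measure lebesgue (f ` S)"] Sb lm by auto
  then have "(\<integral>\<^sup>+x. ennreal \<bar>det (matrix (f' x))\<bar> * indicator S x \<partial>lborel) = ennreal (measure lebesgue (f ` S))"
    by (rule nn_integral_has_integral_lebesgue'[rotated]) auto
  also have "ennreal (measure lebesgue (f ` S)) = emeasure lborel (f ` S)"
    using fSb emeasure_bounded_finite[OF bfS] by (simp add: emeasure_eq_ennreal_measure less_top[symmetric])
  also have "\<dots> = emeasure (distr lborel borel tovec) (f ` S)" by (simp add: distr_tovec)
  also have "\<dots> = emeasure lborel (\<Psi> ` E)"
  proof -
    have "tovec -` (f ` S) = \<Psi> ` E" unfolding fS by (auto simp: image_iff) (metis tovec_ofvec(2))+
    then show ?thesis using fSb by (simp add: emeasure_distr)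
  qed
  also have "(\<integral>\<^sup>+x. ennreal \<bar>det (matrix (f' x))\<bar> * indicator S x \<partial>lborel) = (\<integral>\<^sup>+x. ennreal (J (ofvec x)) * indicator S x \<partial>lborel)"
    by (intro nn_integral_cong) (auto simp: det split: split_indicator)
  also have "\<dots> = (\<integral>\<^sup>+x. ennreal (J (ofvec x)) * indicator S x \<partial>distr lborel borel tovec)" by (simp add: distr_tovec)
  also have "\<dots> = (\<integral>\<^sup>+z. ennreal (J z) * indicator E z \<partial>lborel)"
    using Sb by (subst nn_integral_distr) (auto intro!: nn_integral_cong simp: S split: split_indicator)
  finally show ?thesis by simp
qed

text \<open>Both measures are compared on a Borel set through the image of its preimage in
  \<open>Q\<close>. Invariance of domain makes the image of \<open>Q\<close> open, and hence the
  images that occur are Borel.\<close>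

lemma plane_cov:
  fixes \<Psi> P1 P2 :: "plane \<Rightarrow> plane"
  assumes Q: "open Q" and inj: "inj_on \<Psi> Q" and im: "bounded (\<Psi> ` Q)"
    and d: "\<And>z. z \<in> Q \<Longrightarrow> (\<Psi> has_derivative (\<lambda>h. fst h *\<^sub>R P1 z + snd h *\<^sub>R P2 z)) (at z)"
    and J: "\<And>z. z \<in> Q \<Longrightarrow> J z = \<bar>fst (P1 z) * snd (P2 z) - snd (P1 z) * fst (P2 z)\<bar>"
    and Jm [measurable]: "J \<in> borel_measurable borel" and \<Psi>m [measurable]: "\<Psi> \<in> borel_measurable borel"
  shows "open (\<Psi> ` Q)" "distr (density (onm Q) (\<lambda>z. ennreal (J z))) borel \<Psi> = onm (\<Psi> ` Q)"
proof -
  have c: "continuous_on Q \<Psi>"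
    using d by (meson continuous_at_imp_continuous_on has_derivative_continuous)
  show o: "open (\<Psi> ` Q)" by (rule invariance_of_domain[OF c Q inj])
  have Qb [measurable]: "Q \<in> sets borel" using Q by simp
  show "distr (density (onm Q) (\<lambda>z. ennreal (J z))) borel \<Psi> = onm (\<Psi> ` Q)"
  proof (rule measure_eqI)
    fix A assume "A \<in> sets (distr (density (onm Q) (\<lambda>z. ennreal (J z))) borel \<Psi>)"
    then have A [measurable]: "A \<in> sets borel" by simp
    define E where "E = Q \<inter> \<Psi> -` A"
    have E: "E \<in> sets borel" unfolding E_def using measurable_sets[OF \<Psi>m A] by auto
    have im': "\<Psi> ` E = \<Psi> ` Q \<inter> A" unfolding E_def by auto
    have pre: "\<Psi> -` A \<in> sets borel" using measurable_sets[OF \<Psi>m A] by simp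
    have "emeasure (distr (density (onm Q) (\<lambda>z. ennreal (J z))) borel \<Psi>) A = emeasure (density (onm Q) (\<lambda>z. ennreal (J z))) (\<Psi> -` A)"
      by (subst emeasure_distr) (auto cong: measurable_cong_sets)
    also have "\<dots> = (\<integral>\<^sup>+z. ennreal (J z) * indicator (\<Psi> -` A) z \<partial>onm Q)"
      using pre by (subst emeasure_density) (auto cong: measurable_cong_sets)
    also have "\<dots> = (\<integral>\<^sup>+z. ennreal (J z) * indicator E z \<partial>lborel)"
      using pre by (subst nn_integral_onm) (auto intro!: nn_integral_cong simp: E_def split: split_indicator)
    also have "\<dots> = emeasure lborel (\<Psi> ` E)"
    proof (rule plane_cov_sets[symmetric, OF E _ _ _ d J Jm])
      show "inj_on \<Psi> E" using inj unfolding E_def by (rule inj_on_subset) auto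
      show "\<Psi> ` E \<in> sets borel" unfolding im' using o by auto
      show "bounded (\<Psi> ` E)" unfolding im' using im by (rule bounded_subset) auto
    qed (auto simp: E_def)
    also have "\<dots> = emeasure (onm (\<Psi> ` Q)) A"
      unfolding im' using o by (simp add: emeasure_onm)
    finally show "emeasure (distr (density (onm Q) (\<lambda>z. ennreal (J z))) borel \<Psi>) A = emeasure (onm (\<Psi> ` Q)) A" .
  qed simp
qed

section \<open>Weak gradients in a chart\<close>

text \<open>\<open>P1\<close> and \<open>P2\<close> are the partial derivatives of the coordinate
  map. The bounds on \<open>J\<close> from both sides make integrals over the image and over the
  rectangle comparable, the bounds on \<open>P1\<close> and \<open>P2\<close> control gradients that
  are pulled back.\<close>

locale chart =
  fixes A B :: real and \<Psi> P1 P2 :: "plane \<Rightarrow> plane" and J :: "plane \<Rightarrow> real" and C c C' :: real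
  assumes AB: "0 < A" "0 < B" and c_pos: "c > 0"
    and \<Psi>m [measurable]: "\<Psi> \<in> borel_measurable borel" and P1m [measurable]: "P1 \<in> borel_measurable borel"
    and P2m [measurable]: "P2 \<in> borel_measurable borel" and Jm [measurable]: "J \<in> borel_measurable borel"
    and inj: "inj_on \<Psi> ({0<..<A} \<times> {0<..<B})"
    and deriv: "\<And>z. z \<in> {0<..<A} \<times> {0<..<B} \<Longrightarrow> (\<Psi> has_derivative (\<lambda>h. fst h *\<^sub>R P1 z + snd h *\<^sub>R P2 z)) (at z)"
    and J_det: "\<And>z. z \<in> {0<..<A} \<times> {0<..<B} \<Longrightarrow> J z = \<bar>fst (P1 z) * snd (P2 z) - snd (P1 z) * fst (P2 z)\<bar>"
    and P_bound: "\<And>z. norm (P1 z) \<le> C" "\<And>z. norm (P2 z) \<le> C"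
    and J_low: "\<And>z. z \<in> {0<..<A} \<times> {0<..<B} \<Longrightarrow> c \<le> J z"
    and J_up: "\<And>z. z \<in> {0<..<A} \<times> {0<..<B} \<Longrightarrow> J z \<le> C'"
    and bdd: "bounded (\<Psi> ` ({0<..<A} \<times> {0<..<B}))"
begin

definition Q :: "plane set" where "Q = {0<..<A} \<times> {0<..<B}"
definition D :: "plane set" where "D = \<Psi> ` Q"

lemma Q_open: "open Q" unfolding Q_def by (intro open_Times) auto
lemma Q_sets [measurable]: "Q \<in> sets borel" using Q_open by simp
lemma Q_bounded: "bounded Q" unfolding Q_def by (intro bounded_Times) auto

lemma D_open: "open D" and distr_\<Psi>: "distr (density (onm Q) (\<lambda>z. ennreal (J z))) borel \<Psi> = onm D"
proof -
  note * = plane_cov[OF Q_open, of \<Psi> P1 P2 J, folded D_def]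
  have "inj_on \<Psi> Q" "bounded D" using inj bdd by (auto simp: Q_def D_def)
  note * = *[OF this deriv[folded Q_def] J_det[folded Q_def] Jm \<Psi>m]
  show "open D" "distr (density (onm Q) (\<lambda>z. ennreal (J z))) borel \<Psi> = onm D" by (rule *; assumption)+
qed

lemma D_sets [measurable]: "D \<in> sets borel" using D_open by simp
lemma D_bounded: "bounded D" using bdd by (simp add: D_def Q_def)

lemma onm_Q: "onm {0<..<A} \<Otimes>\<^sub>M onm {0<..<B} = onm Q"
  unfolding Q_def by (rule onm_Times) auto

sublocale fQ: finite_measure "onm Q" by (rule finite_measure_onm[OF Q_bounded Q_sets])
sublocale fD: finite_measure "onm D" by (rule finite_measure_onm[OF D_bounded D_sets])
sublocale fA: finite_measure "onm {0<..<A}" by (rule finite_measure_onm) auto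
sublocale fB: finite_measure "onm {0<..<B}" by (rule finite_measure_onm) auto
sublocale pQ: pair_sigma_finite "onm {0<..<A}" "onm {0<..<B}" ..

lemma J_nonneg_AE: "AE z in onm Q. 0 \<le> J z"
  using AE_onm_mem[OF Q_sets] by eventually_elim (use J_low c_pos in \<open>fastforce simp: Q_def\<close>)

lemma integral_D:
  assumes [measurable]: "f \<in> borel_measurable borel"
  shows "(LINT z|onm D. f z) = (LINT z|onm Q. J z * f (\<Psi> z))"
    and "integrable (onm D) f \<longleftrightarrow> integrable (onm Q) (\<lambda>z. J z * f (\<Psi> z))"
proof -
  have "(LINT z|onm D. f z) = (LINT z|density (onm Q) (\<lambda>z. ennreal (J z)). f (\<Psi> z))"
    unfolding distr_\<Psi>[symmetric] by (rule integral_distr) auto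
  also have "\<dots> = (LINT z|onm Q. J z *\<^sub>R f (\<Psi> z))"
    by (rule integral_density) (use J_nonneg_AE in auto)
  finally show "(LINT z|onm D. f z) = (LINT z|onm Q. J z * f (\<Psi> z))" by simp
  have "integrable (onm D) f \<longleftrightarrow> integrable (density (onm Q) (\<lambda>z. ennreal (J z))) (\<lambda>z. f (\<Psi> z))"
    unfolding distr_\<Psi>[symmetric] by (rule integrable_distr_eq) auto
  also have "\<dots> \<longleftrightarrow> integrable (onm Q) (\<lambda>z. J z *\<^sub>R f (\<Psi> z))"
    by (rule integrable_density) (use J_nonneg_AE in auto)
  finally show "integrable (onm D) f \<longleftrightarrow> integrable (onm Q) (\<lambda>z. J z * f (\<Psi> z))" by simp
qed

lemma AE_D:
  assumes "{z. P z} \<in> sets borel"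
  shows "(AE z in onm D. P z) \<longleftrightarrow> (AE z in onm Q. P (\<Psi> z))"
proof -
  have "(AE z in onm D. P z) \<longleftrightarrow> (AE z in density (onm Q) (\<lambda>z. ennreal (J z)). P (\<Psi> z))"
    unfolding distr_\<Psi>[symmetric] by (rule AE_distr_iff) (use assms in auto)
  also have "\<dots> \<longleftrightarrow> (AE z in onm Q. 0 < ennreal (J z) \<longrightarrow> P (\<Psi> z))" by (rule AE_density) auto
  also have "\<dots> \<longleftrightarrow> (AE z in onm Q. P (\<Psi> z))"
  proof
    assume "AE z in onm Q. 0 < ennreal (J z) \<longrightarrow> P (\<Psi> z)"
    then show "AE z in onm Q. P (\<Psi> z)"
      using AE_onm_mem[OF Q_sets]
    proof eventually_elim
      case (elim z)
      then show ?case using J_low[folded Q_def, of z] c_pos by simp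
    qed
  next
    assume "AE z in onm Q. P (\<Psi> z)"
    then show "AE z in onm Q. 0 < ennreal (J z) \<longrightarrow> P (\<Psi> z)" by eventually_elim simp
  qed
  finally show ?thesis .
qed

lemma integrable_chart:
  assumes f: "integrable (onm D) f"
  shows "integrable (onm Q) (\<lambda>z. f (\<Psi> z))" "(LINT z|onm Q. \<bar>f (\<Psi> z)\<bar>) \<le> (LINT z|onm D. \<bar>f z\<bar>) / c"
proof -
  have [measurable]: "f \<in> borel_measurable borel" using f by (rule integrable_onm_borel)
  have i: "integrable (onm Q) (\<lambda>z. J z * f (\<Psi> z))" using f integral_D(2)[of f] by simp
  have le: "AE z in onm Q. c * \<bar>f (\<Psi> z)\<bar> \<le> J z * \<bar>f (\<Psi> z)\<bar>"
    using AE_onm_mem[OF Q_sets] by eventually_elim (use J_low in \<open>auto simp: Q_def intro!: mult_right_mono\<close>)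
  show i2: "integrable (onm Q) (\<lambda>z. f (\<Psi> z))"
  proof (rule Bochner_Integration.integrable_bound)
    show "integrable (onm Q) (\<lambda>z. (J z * f (\<Psi> z)) / c)" using i by simp
    show "AE z in onm Q. norm (f (\<Psi> z)) \<le> norm ((J z * f (\<Psi> z)) / c)"
      using le J_nonneg_AE by eventually_elim (use c_pos in \<open>auto simp: abs_mult field_simps\<close>)
  qed measurable
  have "c * (LINT z|onm Q. \<bar>f (\<Psi> z)\<bar>) = (LINT z|onm Q. c * \<bar>f (\<Psi> z)\<bar>)" by simp
  also have "\<dots> \<le> (LINT z|onm Q. J z * \<bar>f (\<Psi> z)\<bar>)"
  proof (rule integral_mono_AE)
    show "integrable (onm Q) (\<lambda>z. J z * \<bar>f (\<Psi> z)\<bar>)" using integral_D(2)[of "\<lambda>z. \<bar>f z\<bar>"] f by simp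
  qed (use i2 le in auto)
  also have "\<dots> = (LINT z|onm D. \<bar>f z\<bar>)" using integral_D(1)[of "\<lambda>z. \<bar>f z\<bar>"] by simp
  finally show "(LINT z|onm Q. \<bar>f (\<Psi> z)\<bar>) \<le> (LINT z|onm D. \<bar>f z\<bar>) / c" using c_pos by (simp add: field_simps)
qed

lemma L2fun_chart:
  assumes f: "L2fun (onm D) f"
  shows "L2fun (onm Q) (\<lambda>z. f (\<Psi> z))" "(LINT z|onm Q. (f (\<Psi> z))\<^sup>2) \<le> (LINT z|onm D. (f z)\<^sup>2) / c"
proof -
  have [measurable]: "f \<in> borel_measurable borel" using L2fun_meas[OF f] by (simp cong: measurable_cong_sets)
  show "L2fun (onm Q) (\<lambda>z. f (\<Psi> z))" unfolding L2fun_def using integrable_chart(1)[OF L2fun_int[OF f]] by simp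
  show "(LINT z|onm Q. (f (\<Psi> z))\<^sup>2) \<le> (LINT z|onm D. (f z)\<^sup>2) / c"
    using integrable_chart(2)[OF L2fun_int[OF f]] by simp
qed

text \<open>A compact piece of a coordinate line has positive distance from the complement of
  \<open>D\<close>; along it a sufficiently fine mollification sees values in \<open>D\<close>
  only.\<close>

lemma curve_near_D:
  assumes t: "t \<in> {0<..<B}" and a: "0 < a"
  shows "\<exists>N. \<forall>n\<ge>N. \<forall>s\<in>{a..A-a}. \<forall>h. norm h \<le> 2 / real (Suc n) \<longrightarrow> \<Psi> (s,t) + h \<in> D"
proof -
  have sub: "{a..A-a} \<times> {t} \<subseteq> Q" using t a by (auto simp: Q_def)
  have c: "continuous_on Q \<Psi>"
    unfolding Q_def using deriv by (meson continuous_at_imp_continuous_on has_derivative_continuous)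
  have "compact (\<Psi> ` ({a..A-a} \<times> {t}))"
    by (intro compact_continuous_image continuous_on_subset[OF c sub] compact_Times) auto
  moreover have "\<Psi> ` ({a..A-a} \<times> {t}) \<subseteq> D" unfolding D_def using sub by blast
  ultimately obtain e where e: "e > 0" "(\<Union>x\<in>\<Psi> ` ({a..A-a} \<times> {t}). ball x e) \<subseteq> D"
    using compact_subset_open_imp_ball_epsilon_subset[OF _ D_open] by metis
  obtain N where N: "2 / e < real N" using reals_Archimedean2 by blast
  show ?thesis
  proof (intro exI allI impI ballI)
    fix n s and h :: plane assume n: "n \<ge> N" and s: "s \<in> {a..A-a}" and h: "norm h \<le> 2 / real (Suc n)"
    have "2 / e < real (Suc n)" using N n by simp
    then have "2 / real (Suc n) < e" using e(1) by (simp add: field_simps)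
    then have "\<Psi> (s,t) + h \<in> ball (\<Psi> (s,t)) e" using h by (simp add: dist_norm)
    then show "\<Psi> (s,t) + h \<in> D" using e(2) s by blast
  qed
qed

text \<open>The component of the gradient \<open>(g1, g2)\<close> along the tangent vector
  \<open>P\<close>. For \<open>P1\<close> and \<open>P2\<close> the chain rule makes it the
  derivative of the pulled-back function along the coordinate lines.\<close>

definition pull :: "(plane \<Rightarrow> plane) \<Rightarrow> (plane \<Rightarrow> real) \<Rightarrow> (plane \<Rightarrow> real) \<Rightarrow> plane \<Rightarrow> real" where
  "pull P g1 g2 z = g1 (\<Psi> z) * fst (P z) + g2 (\<Psi> z) * snd (P z)"

lemma pull_measurable [measurable]:
  assumes [measurable]: "P \<in> borel_measurable borel" "g1 \<in> borel_measurable borel" "g2 \<in> borel_measurable borel"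
  shows "pull P g1 g2 \<in> borel_measurable borel"
proof -
  have [measurable]: "(\<lambda>z. fst (P z)) \<in> borel_measurable borel" "(\<lambda>z. snd (P z)) \<in> borel_measurable borel"
    by (intro plane_components_measurable assms)+
  show ?thesis unfolding pull_def[abs_def] by measurable
qed

lemma pull_bound:
  assumes "norm (P z) \<le> K"
  shows "\<bar>pull P g1 g2 z\<bar> \<le> K * (\<bar>g1 (\<Psi> z)\<bar> + \<bar>g2 (\<Psi> z)\<bar>)"
proof -
  have "\<bar>fst (P z)\<bar> \<le> K" "\<bar>snd (P z)\<bar> \<le> K"
    using assms norm_fst_le[of "fst (P z)" "snd (P z)"] norm_snd_le[of "snd (P z)" "fst (P z)"] by auto
  then have "\<bar>g1 (\<Psi> z) * fst (P z)\<bar> \<le> \<bar>g1 (\<Psi> z)\<bar> * K" "\<bar>g2 (\<Psi> z) * snd (P z)\<bar> \<le> \<bar>g2 (\<Psi> z)\<bar> * K"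
    by (auto simp: abs_mult intro!: mult_left_mono)
  then show ?thesis unfolding pull_def by (simp add: algebra_simps)
qed

lemma pull_integrable:
  assumes g: "integrable (onm D) g1" "integrable (onm D) g2" and P: "P \<in> borel_measurable borel" "\<And>z. norm (P z) \<le> K"
  shows "integrable (onm Q) (pull P g1 g2)"
    "(LINT z|onm Q. \<bar>pull P g1 g2 z\<bar>) \<le> K * ((LINT z|onm D. \<bar>g1 z\<bar>) + (LINT z|onm D. \<bar>g2 z\<bar>)) / c"
proof -
  have m: "g1 \<in> borel_measurable borel" "g2 \<in> borel_measurable borel" using g by (auto intro: integrable_onm_borel)
  note i = integrable_chart[OF g(1)] integrable_chart[OF g(2)]
  have K0: "K \<ge> 0" using P(2)[of undefined] norm_ge_zero[of "P undefined"] by linarith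
  show *: "integrable (onm Q) (pull P g1 g2)"
  proof (rule Bochner_Integration.integrable_bound)
    show "integrable (onm Q) (\<lambda>z. K * (\<bar>g1 (\<Psi> z)\<bar> + \<bar>g2 (\<Psi> z)\<bar>))" using i by auto
    show "AE z in onm Q. norm (pull P g1 g2 z) \<le> norm (K * (\<bar>g1 (\<Psi> z)\<bar> + \<bar>g2 (\<Psi> z)\<bar>))"
      using pull_bound[of P, OF P(2)] K0 by (intro AE_I2) (metis abs_of_nonneg abs_ge_zero add_nonneg_nonneg mult_nonneg_nonneg real_norm_def)
  qed (use P m in \<open>simp cong: measurable_cong_sets\<close>)
  have "(LINT z|onm Q. \<bar>pull P g1 g2 z\<bar>) \<le> (LINT z|onm Q. K * (\<bar>g1 (\<Psi> z)\<bar> + \<bar>g2 (\<Psi> z)\<bar>))"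
    by (rule integral_mono) (use * i pull_bound[of P, OF P(2)] in auto)
  also have "\<dots> = K * ((LINT z|onm Q. \<bar>g1 (\<Psi> z)\<bar>) + (LINT z|onm Q. \<bar>g2 (\<Psi> z)\<bar>))" using i by simp
  also have "\<dots> \<le> K * ((LINT z|onm D. \<bar>g1 z\<bar>) / c + (LINT z|onm D. \<bar>g2 z\<bar>) / c)"
    using i K0 by (intro mult_left_mono add_mono) auto
  finally show "(LINT z|onm Q. \<bar>pull P g1 g2 z\<bar>) \<le> K * ((LINT z|onm D. \<bar>g1 z\<bar>) + (LINT z|onm D. \<bar>g2 z\<bar>)) / c"
    by (simp only: add_divide_distrib[symmetric] times_divide_eq_right)
qed

text \<open>Mollified functions satisfy the integrated chain rule on every coordinate line, and this
  passes to the limit on almost every line. Near the ends of a line the mollifier would reach beyond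
  \<open>D\<close>, so the argument runs on inner intervals, which then exhaust
  \<open>{0<..<A}\<close>.\<close>

theorem weak_imp_acs:
  assumes i: "integrable (onm D) u" "integrable (onm D) g1" "integrable (onm D) g2"
    and weak1: "\<And>\<phi>. test_function D \<phi> \<Longrightarrow> (LINT z|onm D. u z * partial_deriv (1,0) \<phi> z) = - (LINT z|onm D. g1 z * \<phi> z)"
    and weak2: "\<And>\<phi>. test_function D \<phi> \<Longrightarrow> (LINT z|onm D. u z * partial_deriv (0,1) \<phi> z) = - (LINT z|onm D. g2 z * \<phi> z)"
  shows "AE t in onm {0<..<B}. w11 0 A (\<lambda>s. u (\<Psi> (s,t))) (\<lambda>s. pull P1 g1 g2 (s,t))"
proof -
  have m [measurable]: "u \<in> borel_measurable borel" "g1 \<in> borel_measurable borel" "g2 \<in> borel_measurable borel"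
    using i by (auto intro: integrable_onm_borel)
  \<comment> \<open>Extension by zero makes the convolution defined on the whole plane; in
    \<open>D\<close> it changes nothing.\<close>
  define ex where "ex f w = indicator D w * f w" for f :: "plane \<Rightarrow> real" and w
  define M where "M f n = mol (real (Suc n)) (ex f)" for f n
  have Mi: "integrable (onm D) (M f n)" "(\<lambda>n. LINT z|onm D. \<bar>M f n z - f z\<bar>) \<longlonglongrightarrow> 0" if "integrable (onm D) f" for f n
  proof -
    have fm [measurable]: "f \<in> borel_measurable borel" using that by (rule integrable_onm_borel)
    have l: "integrable lborel (ex f)" using that by (simp add: ex_def[abs_def] integrable_onm)
    have l2: "integrable lborel (M f n)" for n unfolding M_def by (rule mol_Young(1)[OF _ l]) simp
    then have [measurable]: "M f n \<in> borel_measurable borel" for n using borel_measurable_integrable[OF l2] by simp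
    show "integrable (onm D) (M f n)"
      using integrable_mult_indicator[OF _ l2, of D n] D_sets by (simp add: integrable_onm)
    have "(LINT z|onm D. \<bar>M f n z - ex f z\<bar>) = (LINT z|onm D. \<bar>M f n z - f z\<bar>)" for n
      by (simp add: integral_onm ex_def[abs_def]) (intro Bochner_Integration.integral_cong, auto split: split_indicator)
    then show "(\<lambda>n. LINT z|onm D. \<bar>M f n z - f z\<bar>) \<longlonglongrightarrow> 0"
      using mol_L1[OF l D_bounded D_sets] by (simp add: M_def)
  qed
  have Mm [measurable]: "M u n \<in> borel_measurable borel" "M g1 n \<in> borel_measurable borel" "M g2 n \<in> borel_measurable borel" for n
    using Mi(1)[OF i(1)] Mi(1)[OF i(2)] Mi(1)[OF i(3)] by (auto intro: integrable_onm_borel)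
  define F where "F n z = \<bar>M u n (\<Psi> z) - u (\<Psi> z)\<bar> + \<bar>pull P1 (M g1 n) (M g2 n) z - pull P1 g1 g2 z\<bar>" for n z
  have pd: "pull P1 (M g1 n) (M g2 n) z - pull P1 g1 g2 z = pull P1 (\<lambda>z. M g1 n z - g1 z) (\<lambda>z. M g2 n z - g2 z) z" for n z
    by (simp add: pull_def algebra_simps)
  have [measurable]: "F n \<in> borel_measurable borel" for n unfolding F_def[abs_def] by measurable
  have di: "integrable (onm D) (\<lambda>z. M f n z - f z)" if "integrable (onm D) f" for f n using Mi(1)[OF that] that by simp
  have Fi1: "integrable (onm Q) (\<lambda>z. \<bar>M u n (\<Psi> z) - u (\<Psi> z)\<bar>)" for n
    using integrable_chart(1)[OF di[OF i(1)]] by simp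
  have Fi2: "integrable (onm Q) (\<lambda>z. \<bar>pull P1 (M g1 n) (M g2 n) z - pull P1 g1 g2 z\<bar>)" for n
    unfolding pd by (intro integrable_abs pull_integrable(1)[OF di di P1m P_bound(1)] i)
  have Fi: "integrable (onm Q) (F n)" for n unfolding F_def[abs_def] using Fi1 Fi2 by simp
  have Fl: "(\<lambda>n. LINT z|onm Q. F n z) \<longlonglongrightarrow> 0"
  proof (rule Lim_null_comparison)
    let ?e = "\<lambda>f n. LINT z|onm D. \<bar>M f n z - f z\<bar>"
    show "\<forall>\<^sub>F n in sequentially. norm (LINT z|onm Q. F n z) \<le> ?e u n / c + C * (?e g1 n + ?e g2 n) / c"
    proof (rule always_eventually, rule allI)
      fix n
      have "(LINT z|onm Q. F n z) = (LINT z|onm Q. \<bar>M u n (\<Psi> z) - u (\<Psi> z)\<bar>) + (LINT z|onm Q. \<bar>pull P1 (M g1 n) (M g2 n) z - pull P1 g1 g2 z\<bar>)"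
        unfolding F_def using Fi1 Fi2 by simp
      also have "\<dots> \<le> ?e u n / c + C * (?e g1 n + ?e g2 n) / c"
        unfolding pd by (intro add_mono integrable_chart(2)[OF di[OF i(1)]] pull_integrable(2)[OF di di P1m P_bound(1)] i)
      finally show "norm (LINT z|onm Q. F n z) \<le> ?e u n / c + C * (?e g1 n + ?e g2 n) / c"
        by (simp add: F_def)
    qed
    have "(\<lambda>n. ?e u n / c + C * (?e g1 n + ?e g2 n) / c) \<longlonglongrightarrow> 0 / c + C * (0 + 0) / c"
      by (intro tendsto_intros Mi(2) i) (use c_pos in auto)
    then show "(\<lambda>n. ?e u n / c + C * (?e g1 n + ?e g2 n) / c) \<longlonglongrightarrow> 0" by simp
  qed
  define H where "H n t = (LINT s|onm {0<..<A}. F n (s,t))" for n t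
  have Fp: "integrable (onm {0<..<A} \<Otimes>\<^sub>M onm {0<..<B}) (\<lambda>(s,t). F n (s,t))" for n
    unfolding onm_Q using Fi by simp
  have Hi: "integrable (onm {0<..<B}) (H n)" for n
    unfolding H_def[abs_def] using pQ.integrable_snd[OF Fp] by simp
  have "(LINT t|onm {0<..<B}. norm (H n t)) = (LINT z|onm Q. F n z)" for n
  proof -
    have "(LINT t|onm {0<..<B}. norm (H n t)) = (LINT t|onm {0<..<B}. H n t)"
      by (intro Bochner_Integration.integral_cong refl) (simp add: H_def F_def)
    also have "\<dots> = (LINT z|(onm {0<..<A} \<Otimes>\<^sub>M onm {0<..<B}). F n z)"
      unfolding H_def[abs_def] using pQ.integral_snd[OF Fp] by simp
    finally show ?thesis by (simp add: onm_Q)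
  qed
  \<comment> \<open>Convergence in \<open>L^1\<close> over the rectangle gives, by Fubini's theorem
    and along a subsequence, convergence in \<open>L^1\<close> on almost every line.\<close>
  then obtain r :: "nat \<Rightarrow> nat" where r: "strict_mono r" "AE t in onm {0<..<B}. (\<lambda>n. H (r n) t) \<longlonglongrightarrow> 0"
    using tendsto_L1_AE_subseq[of "onm {0<..<B}" H, OF Hi] Fl by auto
  have AEi: "AE t in onm {0<..<B}. \<forall>n. integrable (onm {0<..<A}) (\<lambda>s. F n (s,t))"
  proof (subst AE_all_countable, intro allI)
    show "AE t in onm {0<..<B}. integrable (onm {0<..<A}) (\<lambda>s. F n (s,t))" for n
      using pQ.AE_integrable_snd[OF Fp] by simp
  qed
  have AEu: "AE t in onm {0<..<B}. integrable (onm {0<..<A}) (\<lambda>s. u (\<Psi> (s,t)))"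
    using pQ.AE_integrable_snd[of "\<lambda>s t. u (\<Psi> (s,t))"] integrable_chart(1)[OF i(1)] by (simp add: onm_Q split_def)
  have AEg: "AE t in onm {0<..<B}. integrable (onm {0<..<A}) (\<lambda>s. pull P1 g1 g2 (s,t))"
    using pQ.AE_integrable_snd[of "\<lambda>s t. pull P1 g1 g2 (s,t)"] pull_integrable(1)[OF i(2,3) P1m P_bound(1)] by (simp add: onm_Q split_def)
  show ?thesis using r(2) AEi AEu AEg AE_ivl[of 0 B]
  proof eventually_elim
    case (elim t)
    let ?u = "\<lambda>s. u (\<Psi> (s,t))" and ?g = "\<lambda>s. pull P1 g1 g2 (s,t)"
    let ?U = "\<lambda>n s. M u n (\<Psi> (s,t))" and ?G = "\<lambda>n s. pull P1 (M g1 n) (M g2 n) (s,t)"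
    have um [measurable]: "?u \<in> borel_measurable borel" "?g \<in> borel_measurable borel"
      "?U n \<in> borel_measurable borel" "?G n \<in> borel_measurable borel" for n by measurable
    have dU: "integrable (onm {0<..<A}) (\<lambda>s. \<bar>?U n s - ?u s\<bar>)" and dG: "integrable (onm {0<..<A}) (\<lambda>s. \<bar>?G n s - ?g s\<bar>)" for n
      by (rule Bochner_Integration.integrable_bound[of _ "\<lambda>s. F n (s,t)"]; use elim in \<open>auto simp: F_def\<close>)+
    have Ui: "integrable (onm {0<..<A}) (?U n)" and Gi: "integrable (onm {0<..<A}) (?G n)" for n
    proof -
      have "integrable (onm {0<..<A}) (\<lambda>s. ?U n s - ?u s)" "integrable (onm {0<..<A}) (\<lambda>s. ?G n s - ?g s)"
        using dU dG by (subst integrable_norm_iff[symmetric]; simp)+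
      then show "integrable (onm {0<..<A}) (?U n)" "integrable (onm {0<..<A}) (?G n)"
        using Bochner_Integration.integrable_add[of _ "\<lambda>s. ?U n s - ?u s" ?u] Bochner_Integration.integrable_add[of _ "\<lambda>s. ?G n s - ?g s" ?g] elim by auto
    qed
    have key: "w11 a (A - a) ?u ?g" if a: "0 < a" "a < A / 2" for a
    proof -
      have sub: "{a<..<A-a} \<subseteq> {0<..<A}" using a by auto
      note on = onm_subset_integrable[OF _ sub, simplified]
      have "t \<in> {0<..<B}" using elim by simp
      from curve_near_D[OF this a(1)]
      obtain N where N: "\<And>n s h. n \<ge> N \<Longrightarrow> s \<in> {a..A-a} \<Longrightarrow> norm h \<le> 2 / real (Suc n) \<Longrightarrow> \<Psi> (s,t) + h \<in> D"
        by blast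
      have w: "w11 a (A - a) (?U n) (?G n)" if n: "n \<ge> N" for n
      proof (rule w11_I[where c="?U n a"])
        show "integrable (onm {a<..<A-a}) (?G n)" by (rule on[OF Gi])
        have eq: "?U n s = ?U n a + prim a (?G n) s" if "s \<in> {a..A-a}" for s
          unfolding M_def ex_def[abs_def] pull_def
        proof (rule mol_curve[where \<gamma>="\<lambda>s. \<Psi> (s,t)" and \<gamma>'="\<lambda>s. P1 (s,t)" and C=C and b="A-a", OF _ D_sets i weak1 weak2])
          have inQ: "(\<sigma>,t) \<in> {0<..<A} \<times> {0<..<B}" if "\<sigma> \<in> {a..A-a}" for \<sigma> using that a elim by auto
          have dv: "((\<lambda>s. \<Psi> (s,t)) has_vector_derivative P1 (\<sigma>,t)) (at \<sigma>)" if "\<sigma> \<in> {a..A-a}" for \<sigma>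
          proof -
            have "((\<lambda>s. (s,t)) has_derivative (\<lambda>h. (h,0))) (at \<sigma>)" by (auto intro!: derivative_eq_intros)
            from has_derivative_compose[OF this deriv[OF inQ[OF that]]]
            show ?thesis by (simp add: has_vector_derivative_def)
          qed
          show "continuous_on {a..A-a} (\<lambda>s. \<Psi> (s,t))"
            using dv by (meson continuous_at_imp_continuous_on has_vector_derivative_continuous)
          show "((\<lambda>s. \<Psi> (s,t)) has_vector_derivative P1 (\<sigma>,t)) (at \<sigma>)" if "\<sigma> \<in> {a<..<A-a}" for \<sigma>
            using dv[of \<sigma>] that by auto
          show "(\<lambda>s. \<Psi> (s,t)) \<in> borel_measurable borel" "(\<lambda>s. P1 (s,t)) \<in> borel_measurable borel" by measurable
          show "norm (P1 (\<sigma>,t)) \<le> C" for \<sigma> by (rule P_bound)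
          show "\<Psi> (\<sigma>,t) + h \<in> D" if "\<sigma> \<in> {a..A-a}" "norm h \<le> 2 / real (Suc n)" for \<sigma> h by (rule N[OF n that])
        qed (use that in auto)
        show "AE s in onm {a<..<A-a}. ?U n s = ?U n a + prim a (?G n) s"
          using AE_ivl[of a "A-a"] by eventually_elim (rule eq, auto)
      qed
      have rN: "r (n + N) \<ge> N" for n using seq_suble[OF r(1), of "n + N"] by linarith
      have Hl: "(\<lambda>n. H (r (n + N)) t) \<longlonglongrightarrow> 0" using LIMSEQ_ignore_initial_segment[OF elim(1)] .
      have conv: "(\<lambda>n. LINT s|onm {a<..<A-a}. \<bar>X (r (n + N)) s - x s\<bar>) \<longlonglongrightarrow> 0"
        if X: "\<And>n. integrable (onm {0<..<A}) (\<lambda>s. \<bar>X n s - x s\<bar>)" "\<And>n s. \<bar>X n s - x s\<bar> \<le> F n (s,t)" for X :: "nat \<Rightarrow> real \<Rightarrow> real" and x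
      proof (rule Lim_null_comparison[OF _ Hl], rule always_eventually, rule allI)
        fix n
        let ?k = "r (n + N)"
        have xm [measurable]: "(\<lambda>s. \<bar>X ?k s - x s\<bar>) \<in> borel_measurable borel" using X(1) by (rule integrable_onm_borel)
        have "(LINT s|onm {a<..<A-a}. \<bar>X ?k s - x s\<bar>) \<le> (LINT s|onm {0<..<A}. \<bar>X ?k s - x s\<bar>)"
          using on[OF X(1)[of ?k]] X(1)[of ?k] sub
          by (simp add: integral_onm) (intro integral_mono, auto simp: integrable_onm split: split_indicator)
        also have "\<dots> \<le> H ?k t" unfolding H_def by (rule integral_mono) (use X elim in auto)
        finally show "norm (LINT s|onm {a<..<A-a}. \<bar>X ?k s - x s\<bar>) \<le> H ?k t" by simp
      qed
      show ?thesis
      proof (rule w11_closed[OF _ w[OF rN]])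
        show "(\<lambda>n. LINT s|onm {a<..<A-a}. \<bar>?U (r (n + N)) s - ?u s\<bar>) \<longlonglongrightarrow> 0"
          by (rule conv[OF dU]) (simp add: F_def)
        show "(\<lambda>n. LINT s|onm {a<..<A-a}. \<bar>?G (r (n + N)) s - ?g s\<bar>) \<longlonglongrightarrow> 0"
          by (rule conv[OF dG]) (simp add: F_def)
      qed (use a elim on[OF Ui] on in auto)
    qed
    show ?case
    proof (rule w11_exhaust[where e="\<lambda>n. A / 3 * inverse (real (Suc n))"])
      show "(\<lambda>n. A / 3 * inverse (real (Suc n))) \<longlonglongrightarrow> 0"
        using tendsto_mult[OF tendsto_const LIMSEQ_inverse_real_of_nat, of "A/3"] by simp
      fix n
      \<comment> \<open>The factor 1/3 keeps the margin below \<open>A / 2\<close>, as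
        \<open>key\<close> requires.\<close>
      let ?a = "A / 3 * inverse (real (Suc n))"
      have "inverse (real (Suc n)) \<le> 1" by (simp add: field_simps)
      then have "?a \<le> A / 3 * 1" using AB by (intro mult_left_mono) auto
      then have "w11 ?a (A - ?a) ?u ?g" using AB by (intro key) auto
      then show "\<exists>a' b'. 0 \<le> a' \<and> a' \<le> 0 + ?a \<and> A - ?a \<le> b' \<and> b' \<le> A \<and> w11 a' b' ?u ?g"
        using AB by (intro exI[of _ ?a] exI[of _ "A - ?a"]) auto
    qed (use elim AB in auto)
  qed
qed

end

section \<open>Coordinate lines of the second family, and iterated integrals\<close>

lemma flip_measurable [measurable]: "(\<lambda>z::plane. (snd z, fst z)) \<in> borel_measurable borel"
  by (intro borel_measurable_continuous_onI continuous_intros)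

context chart
begin

text \<open>Exchanging the coordinates only reverses the sign of the determinant, which the absolute
  value in \<open>J\<close> does not see. The statement for the second family of lines is thus an
  instance of the first.\<close>

lemma flipped_chart:
  "chart B A (\<lambda>z. \<Psi> (snd z, fst z)) (\<lambda>z. P2 (snd z, fst z)) (\<lambda>z. P1 (snd z, fst z)) (\<lambda>z. J (snd z, fst z)) C c C'"
proof
  have im: "(\<lambda>z. \<Psi> (snd z, fst z)) ` ({0<..<B} \<times> {0<..<A}) = \<Psi> ` ({0<..<A} \<times> {0<..<B})"
    by (force simp: image_iff)
  show "bounded ((\<lambda>z. \<Psi> (snd z, fst z)) ` ({0<..<B} \<times> {0<..<A}))" unfolding im by (rule bdd)
  show "inj_on (\<lambda>z. \<Psi> (snd z, fst z)) ({0<..<B} \<times> {0<..<A})"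
  proof (rule inj_onI)
    fix x y assume "x \<in> {0<..<B} \<times> {0<..<A}" "y \<in> {0<..<B} \<times> {0<..<A}" "\<Psi> (snd x, fst x) = \<Psi> (snd y, fst y)"
    then have "(snd x, fst x) = (snd y, fst y)"
      by (intro inj_onD[OF inj, of "(snd x, fst x)" "(snd y, fst y)"]) (simp_all add: mem_Times_iff)
    then show "x = y" by (simp add: prod_eq_iff)
  qed
  fix z :: plane assume z: "z \<in> {0<..<B} \<times> {0<..<A}"
  then have z': "(snd z, fst z) \<in> {0<..<A} \<times> {0<..<B}" by auto
  have "((\<lambda>z. (snd z, fst z)) has_derivative (\<lambda>h. (snd h, fst h))) (at z)"
    by (intro derivative_intros)
  from has_derivative_compose[OF this deriv[OF z']]
  show "((\<lambda>z. \<Psi> (snd z, fst z)) has_derivative (\<lambda>h. fst h *\<^sub>R P2 (snd z, fst z) + snd h *\<^sub>R P1 (snd z, fst z))) (at z)"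
    by (simp add: add.commute)
  show "J (snd z, fst z) = \<bar>fst (P2 (snd z, fst z)) * snd (P1 (snd z, fst z)) - snd (P2 (snd z, fst z)) * fst (P1 (snd z, fst z))\<bar>"
    unfolding J_det[OF z'] by (simp add: abs_minus_commute mult.commute)
  show "c \<le> J (snd z, fst z)" "J (snd z, fst z) \<le> C'" using J_low[OF z'] J_up[OF z'] by auto
qed (use AB c_pos P_bound in \<open>auto intro: measurable_compose[OF flip_measurable]\<close>)

theorem weak_imp_act:
  assumes i: "integrable (onm D) u" "integrable (onm D) g1" "integrable (onm D) g2"
    and weak1: "\<And>\<phi>. test_function D \<phi> \<Longrightarrow> (LINT z|onm D. u z * partial_deriv (1,0) \<phi> z) = - (LINT z|onm D. g1 z * \<phi> z)"
    and weak2: "\<And>\<phi>. test_function D \<phi> \<Longrightarrow> (LINT z|onm D. u z * partial_deriv (0,1) \<phi> z) = - (LINT z|onm D. g2 z * \<phi> z)"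
  shows "AE s in onm {0<..<A}. w11 0 B (\<lambda>t. u (\<Psi> (s,t))) (\<lambda>t. pull P2 g1 g2 (s,t))"
proof -
  interpret sw: chart B A "\<lambda>z. \<Psi> (snd z, fst z)" "\<lambda>z. P2 (snd z, fst z)" "\<lambda>z. P1 (snd z, fst z)" "\<lambda>z. J (snd z, fst z)" C c C'
    by (rule flipped_chart)
  have D: "sw.D = D" unfolding sw.D_def D_def sw.Q_def Q_def by (force simp: image_iff)
  show ?thesis
    using sw.weak_imp_acs[unfolded D, OF i weak1 weak2] by (simp add: sw.pull_def pull_def)
qed

lemma integral_Q_iterated:
  fixes f :: "plane \<Rightarrow> real"
  assumes f: "integrable (onm Q) f"
  shows "(LINT z|onm Q. f z) = (LINT t|onm {0<..<B}. LINT s|onm {0<..<A}. f (s,t))"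
    and "(LINT z|onm Q. f z) = (LINT s|onm {0<..<A}. LINT t|onm {0<..<B}. f (s,t))"
    and "integrable (onm {0<..<B}) (\<lambda>t. LINT s|onm {0<..<A}. f (s,t))"
    and "integrable (onm {0<..<A}) (\<lambda>s. LINT t|onm {0<..<B}. f (s,t))"
    and "AE t in onm {0<..<B}. integrable (onm {0<..<A}) (\<lambda>s. f (s,t))"
    and "AE s in onm {0<..<A}. integrable (onm {0<..<B}) (\<lambda>t. f (s,t))"
proof -
  have p: "integrable (onm {0<..<A} \<Otimes>\<^sub>M onm {0<..<B}) (\<lambda>(s,t). f (s,t))" using f by (simp add: onm_Q)
  show "(LINT z|onm Q. f z) = (LINT t|onm {0<..<B}. LINT s|onm {0<..<A}. f (s,t))"
    using pQ.integral_snd[OF p] by (simp add: onm_Q)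
  show "(LINT z|onm Q. f z) = (LINT s|onm {0<..<A}. LINT t|onm {0<..<B}. f (s,t))"
    using pQ.integral_fst'[of f] f by (simp add: onm_Q)
  show "integrable (onm {0<..<B}) (\<lambda>t. LINT s|onm {0<..<A}. f (s,t))"
    using pQ.integrable_snd[OF p] by simp
  show "integrable (onm {0<..<A}) (\<lambda>s. LINT t|onm {0<..<B}. f (s,t))"
    using pQ.integrable_fst'[of f] f by (simp add: onm_Q)
  show "AE t in onm {0<..<B}. integrable (onm {0<..<A}) (\<lambda>s. f (s,t))"
    using pQ.AE_integrable_snd[OF p] by simp
  show "AE s in onm {0<..<A}. integrable (onm {0<..<B}) (\<lambda>t. f (s,t))"
    using pQ.AE_integrable_fst'[of f] f by (simp add: onm_Q)
qed

end

section \<open>From absolute continuity on coordinate lines back to weak gradients\<close>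

lemma test_function_zero: "test_function D \<phi> \<Longrightarrow> z \<notin> D \<Longrightarrow> \<phi> z = 0"
  unfolding test_function_def using closure_subset[of "{z. \<phi> z \<noteq> 0}"] by blast

text \<open>What is used of a test function: it is continuously differentiable, and one constant
  bounds it together with its partial derivatives.\<close>

lemma test_function_C1:
  fixes \<phi> :: "plane \<Rightarrow> real"
  assumes "test_function D \<phi>"
  obtains M where "continuous_on UNIV \<phi>" "continuous_on UNIV (partial_deriv (1,0) \<phi>)" "continuous_on UNIV (partial_deriv (0,1) \<phi>)"
    "\<And>z. (\<phi> has_derivative (\<lambda>h. fst h * partial_deriv (1,0) \<phi> z + snd h * partial_deriv (0,1) \<phi> z)) (at z)"
    "\<And>z. \<bar>\<phi> z\<bar> \<le> M" "\<And>z. \<bar>partial_deriv (1,0) \<phi> z\<bar> \<le> M" "\<And>z. \<bar>partial_deriv (0,1) \<phi> z\<bar> \<le> M"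
proof -
  have sm: "smooth \<phi>" and K: "compact (closure {z. \<phi> z \<noteq> 0})" using assms by (auto simp: test_function_def)
  let ?K = "closure {z. \<phi> z \<noteq> 0}"
  have B: "(1,0) \<in> (Basis :: plane set)" "(0,1) \<in> (Basis :: plane set)" by (auto simp: Basis_prod_def)
  have d0: "\<phi> differentiable (at z)" for z using sm unfolding smooth_def by (metis empty_subsetI foldr.simps(1) id_apply list.set(1))
  have d1: "partial_deriv b \<phi> differentiable (at z)" if "b \<in> Basis" for b z
  proof -
    have "foldr partial_deriv [b] \<phi> differentiable (at z)" using sm that unfolding smooth_def by (metis empty_subsetI insert_subset list.simps(15) list.set(1))
    then show ?thesis by simp
  qed
  have c: "continuous_on UNIV f" if "\<And>z. f differentiable (at z)" for f :: "plane \<Rightarrow> real"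
    using that by (simp add: continuous_on_eq_continuous_at differentiable_imp_continuous_within)
  have hd: "(\<phi> has_derivative frechet_derivative \<phi> (at z)) (at z)" for z
    using d0 by (simp add: frechet_derivative_works)
  have deq: "frechet_derivative \<phi> (at z) = (\<lambda>h. fst h * partial_deriv (1,0) \<phi> z + snd h * partial_deriv (0,1) \<phi> z)" for z
  proof
    fix h :: plane
    have lin: "linear (frechet_derivative \<phi> (at z))" using hd has_derivative_linear by blast
    have "h = fst h *\<^sub>R (1,0) + snd h *\<^sub>R (0,1)" by (simp add: prod_eq_iff)
    then have "frechet_derivative \<phi> (at z) h = frechet_derivative \<phi> (at z) (fst h *\<^sub>R (1,0) + snd h *\<^sub>R (0,1))" by simp
    also have "\<dots> = fst h * partial_deriv (1,0) \<phi> z + snd h * partial_deriv (0,1) \<phi> z"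
      by (simp only: linear_add[OF lin] linear_scale[OF lin] partial_deriv_def real_scaleR_def)
    finally show "frechet_derivative \<phi> (at z) h = fst h * partial_deriv (1,0) \<phi> z + snd h * partial_deriv (0,1) \<phi> z" .
  qed
  have bnd: "\<exists>M. \<forall>z. \<bar>f z\<bar> \<le> M" if f: "continuous_on UNIV f" "\<And>z. z \<notin> ?K \<Longrightarrow> f z = 0" for f :: "plane \<Rightarrow> real"
  proof -
    have "compact (f ` ?K)" by (intro compact_continuous_image K continuous_on_subset[OF f(1)]) auto
    then have "bounded (f ` ?K)" by (rule compact_imp_bounded)
    then obtain M where "\<forall>y\<in>f ` ?K. \<bar>y\<bar> \<le> M" by (auto simp: bounded_iff)
    then have "\<bar>f z\<bar> \<le> max M 0" for z using f(2)[of z] by (cases "z \<in> ?K") (auto simp: le_max_iff_disj)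
    then show ?thesis by blast
  qed
  have pd0: "partial_deriv b \<phi> z = 0" if "z \<notin> ?K" for b z
  proof -
    have "((\<lambda>_. 0) has_derivative frechet_derivative \<phi> (at z)) (at z)"
    proof (rule has_derivative_transform_within_open[OF hd])
      show "open (- ?K)" by (rule open_Compl) simp
      show "\<phi> x = 0" if "x \<in> - ?K" for x using that closure_subset[of "{z. \<phi> z \<noteq> 0}"] by blast
    qed (use that in auto)
    moreover have "((\<lambda>_. 0::real) has_derivative (\<lambda>_. 0)) (at z)" by simp
    ultimately have "frechet_derivative \<phi> (at z) = (\<lambda>_. 0)" by (rule has_derivative_unique)
    then show ?thesis by (simp add: partial_deriv_def)
  qed
  have p0: "\<phi> z = 0" if "z \<notin> ?K" for z using that closure_subset[of "{z. \<phi> z \<noteq> 0}"] by blast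
  obtain M0 M1 M2 where M: "\<And>z. \<bar>\<phi> z\<bar> \<le> M0" "\<And>z. \<bar>partial_deriv (1,0) \<phi> z\<bar> \<le> M1" "\<And>z. \<bar>partial_deriv (0,1) \<phi> z\<bar> \<le> M2"
    using bnd[OF c[OF d0] p0] bnd[OF c[OF d1[OF B(1)]] pd0] bnd[OF c[OF d1[OF B(2)]] pd0] by metis
  show thesis
  proof (rule that[of "max M0 (max M1 M2)"])
    show "(\<phi> has_derivative (\<lambda>h. fst h * partial_deriv (1,0) \<phi> z + snd h * partial_deriv (0,1) \<phi> z)) (at z)" for z
      using hd unfolding deq .
    show "\<bar>\<phi> z\<bar> \<le> max M0 (max M1 M2)" "\<bar>partial_deriv (1,0) \<phi> z\<bar> \<le> max M0 (max M1 M2)" "\<bar>partial_deriv (0,1) \<phi> z\<bar> \<le> max M0 (max M1 M2)" for z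
      using M[of z] by auto
  qed (use c d0 d1 B in auto)
qed

text \<open>Three things are added for integration by parts in the chart. The mixed derivative
  \<open>P12\<close> is the same in both orders. The boundary of the rectangle is mapped outside
  \<open>D\<close>, so a test function composed with \<open>\<Psi>\<close> vanishes there. The
  determinant has a constant sign \<open>sg\<close>.\<close>

locale strip_chart = chart +
  fixes P12 :: "plane \<Rightarrow> plane" and sg :: real
  assumes cont: "continuous_on ({0..A} \<times> {0..B}) \<Psi>" "continuous_on ({0..A} \<times> {0..B}) P1" "continuous_on ({0..A} \<times> {0..B}) P2"
    and boundary: "\<And>z. z \<in> {0..A} \<times> {0..B} \<Longrightarrow> z \<notin> {0<..<A} \<times> {0<..<B} \<Longrightarrow> \<Psi> z \<notin> \<Psi> ` ({0<..<A} \<times> {0<..<B})"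
    and P12m [measurable]: "P12 \<in> borel_measurable borel" and P12_bound: "\<And>z. norm (P12 z) \<le> C"
    and d2: "\<And>s t. s \<in> {0<..<A} \<Longrightarrow> t \<in> {0<..<B} \<Longrightarrow> ((\<lambda>s. P2 (s,t)) has_vector_derivative P12 (s,t)) (at s)"
    and d1: "\<And>s t. s \<in> {0<..<A} \<Longrightarrow> t \<in> {0<..<B} \<Longrightarrow> ((\<lambda>t. P1 (s,t)) has_vector_derivative P12 (s,t)) (at t)"
    and sg: "sg * sg = 1"
    and det_sg: "\<And>z. z \<in> {0<..<A} \<times> {0<..<B} \<Longrightarrow> fst (P1 z) * snd (P2 z) - snd (P1 z) * fst (P2 z) = sg * J z"
begin

text \<open>Integration by parts along both families of coordinate lines; the terms with the mixed
  derivative \<open>P12\<close> cancel (Piola identity).\<close>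

lemma parts_identity:
  fixes e :: plane
  assumes e: "norm e \<le> 1" and um [measurable]: "u \<in> borel_measurable borel"
    and i: "integrable (onm D) u" "integrable (onm D) g1" "integrable (onm D) g2"
    and acs: "AE t in onm {0<..<B}. w11 0 A (\<lambda>s. u (\<Psi> (s,t))) (\<lambda>s. pull P1 g1 g2 (s,t))"
    and act: "AE s in onm {0<..<A}. w11 0 B (\<lambda>t. u (\<Psi> (s,t))) (\<lambda>t. pull P2 g1 g2 (s,t))"
    and tf: "test_function D \<phi>"
  defines "\<phi>x \<equiv> partial_deriv (1,0) \<phi>" and "\<phi>y \<equiv> partial_deriv (0,1) \<phi>"
  shows "(LINT z|onm Q. u (\<Psi> z) * (pull P1 \<phi>x \<phi>y z * (e \<bullet> P2 z) - pull P2 \<phi>x \<phi>y z * (e \<bullet> P1 z)))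
    = - (LINT z|onm Q. \<phi> (\<Psi> z) * (pull P1 g1 g2 z * (e \<bullet> P2 z) - pull P2 g1 g2 z * (e \<bullet> P1 z)))"
proof -
  obtain M where \<phi>: "continuous_on UNIV \<phi>" "continuous_on UNIV \<phi>x" "continuous_on UNIV \<phi>y"
    "\<And>z. (\<phi> has_derivative (\<lambda>h. fst h * \<phi>x z + snd h * \<phi>y z)) (at z)"
    "\<And>z. \<bar>\<phi> z\<bar> \<le> M" "\<And>z. \<bar>\<phi>x z\<bar> \<le> M" "\<And>z. \<bar>\<phi>y z\<bar> \<le> M"
    unfolding \<phi>x_def \<phi>y_def using test_function_C1[OF tf] by metis
  have m [measurable]: "g1 \<in> borel_measurable borel" "g2 \<in> borel_measurable borel"
    "\<phi> \<in> borel_measurable borel" "\<phi>x \<in> borel_measurable borel" "\<phi>y \<in> borel_measurable borel"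
    using i \<phi> by (auto intro: integrable_onm_borel borel_measurable_continuous_onI)
  define q1 where "q1 z = e \<bullet> P1 z" for z
  define q2 where "q2 z = e \<bullet> P2 z" for z
  define q12 where "q12 z = e \<bullet> P12 z" for z
  have [measurable]: "q1 \<in> borel_measurable borel" "q2 \<in> borel_measurable borel" "q12 \<in> borel_measurable borel"
    unfolding q1_def[abs_def] q2_def[abs_def] q12_def[abs_def] by measurable
  have C0: "C \<ge> 0" using P_bound(1)[of undefined] norm_ge_zero[of "P1 undefined"] by linarith
  have M0: "M \<ge> 0" using \<phi>(5)[of undefined] by linarith
  have ip: "\<bar>e \<bullet> v\<bar> \<le> C" if "norm v \<le> C" for v :: plane
  proof -
    have "\<bar>e \<bullet> v\<bar> \<le> norm e * norm v" by (rule Cauchy_Schwarz_ineq2)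
    also have "\<dots> \<le> 1 * C" using e that by (intro mult_mono) auto
    finally show ?thesis by simp
  qed
  have qb: "\<bar>q1 z\<bar> \<le> C" "\<bar>q2 z\<bar> \<le> C" "\<bar>q12 z\<bar> \<le> C" for z
    unfolding q1_def q2_def q12_def by (intro ip P_bound P12_bound)+
  have pb: "\<bar>pull P \<phi>x \<phi>y z\<bar> \<le> 2 * C * M" if "norm (P z) \<le> C" for P z
  proof -
    have "\<bar>pull P \<phi>x \<phi>y z\<bar> \<le> C * (\<bar>\<phi>x (\<Psi> z)\<bar> + \<bar>\<phi>y (\<Psi> z)\<bar>)" by (rule pull_bound[of P, OF that])
    also have "\<dots> \<le> C * (M + M)" by (intro mult_left_mono add_mono \<phi> C0)
    finally show ?thesis by simp
  qed
  \<comment> \<open>\<open>Y1\<close> is the derivative of \<open>X1\<close> in \<open>s\<close> and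
    \<open>Y2\<close> that of \<open>X2\<close> in \<open>t\<close>; they share the term with
    \<open>q12\<close>. Both \<open>X1\<close> and \<open>X2\<close> contain the factor
    \<open>\<phi>\<close> and hence vanish at the ends of the lines.\<close>
  define X1 where "X1 z = \<phi> (\<Psi> z) * q2 z" for z
  define X2 where "X2 z = \<phi> (\<Psi> z) * q1 z" for z
  define Y1 where "Y1 z = pull P1 \<phi>x \<phi>y z * q2 z + \<phi> (\<Psi> z) * q12 z" for z
  define Y2 where "Y2 z = pull P2 \<phi>x \<phi>y z * q1 z + \<phi> (\<Psi> z) * q12 z" for z
  have [measurable]: "X1 \<in> borel_measurable borel" "X2 \<in> borel_measurable borel" "Y1 \<in> borel_measurable borel" "Y2 \<in> borel_measurable borel"
    unfolding X1_def[abs_def] X2_def[abs_def] Y1_def[abs_def] Y2_def[abs_def] by measurable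
  have Xb: "\<bar>X1 z\<bar> \<le> M * C" "\<bar>X2 z\<bar> \<le> M * C" for z
    unfolding X1_def X2_def abs_mult by (intro mult_mono \<phi> qb M0 abs_ge_zero)+
  have Yb: "\<bar>Y1 z\<bar> \<le> 2 * C * M * C + M * C" "\<bar>Y2 z\<bar> \<le> 2 * C * M * C + M * C" for z
    unfolding Y1_def Y2_def using C0 M0
    by (intro order_trans[OF abs_triangle_ineq] add_mono; unfold abs_mult; intro mult_mono pb \<phi> qb P_bound abs_ge_zero; simp)+
  have ui: "integrable (onm Q) (\<lambda>z. u (\<Psi> z))" by (rule integrable_chart(1)[OF i(1)])
  have gi: "integrable (onm Q) (pull P1 g1 g2)" "integrable (onm Q) (pull P2 g1 g2)"
    by (rule pull_integrable(1)[OF i(2,3) P1m P_bound(1)], rule pull_integrable(1)[OF i(2,3) P2m P_bound(2)])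
  have iY: "integrable (onm Q) (\<lambda>z. u (\<Psi> z) * Y1 z)" "integrable (onm Q) (\<lambda>z. u (\<Psi> z) * Y2 z)"
    using integrable_onm_bounded_mult[OF ui _ Yb(1)] integrable_onm_bounded_mult[OF ui _ Yb(2)] by (auto simp: mult.commute)
  have iX: "integrable (onm Q) (\<lambda>z. pull P1 g1 g2 z * X1 z)" "integrable (onm Q) (\<lambda>z. pull P2 g1 g2 z * X2 z)"
    using integrable_onm_bounded_mult[OF gi(1) _ Xb(1)] integrable_onm_bounded_mult[OF gi(2) _ Xb(2)] by (auto simp: mult.commute)
  have \<phi>0: "\<phi> (\<Psi> z) = 0" if "z \<in> {0..A} \<times> {0..B}" "z \<notin> {0<..<A} \<times> {0<..<B}" for z
    using boundary[OF that] test_function_zero[OF tf] unfolding D_def Q_def by blast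
  have cq: "continuous_on ({0..A} \<times> {0..B}) X1" "continuous_on ({0..A} \<times> {0..B}) X2"
    unfolding X1_def[abs_def] X2_def[abs_def] q1_def q2_def
    by (intro continuous_intros continuous_on_compose2[OF \<phi>(1)] cont; simp)+
  have dphi: "((\<lambda>\<tau>. \<phi> (\<Psi> (f \<tau>))) has_real_derivative pull P \<phi>x \<phi>y (f \<tau>)) (at \<tau>)"
    if "((\<lambda>\<tau>. \<Psi> (f \<tau>)) has_vector_derivative P (f \<tau>)) (at \<tau>)" for f :: "real \<Rightarrow> plane" and P \<tau>
    unfolding has_field_derivative_def
    by (rule has_derivative_eq_rhs[OF has_derivative_compose[OF that[unfolded has_vector_derivative_def] \<phi>(4)]])
       (auto simp: fun_eq_iff pull_def algebra_simps)
  have dq: "((\<lambda>\<tau>. e \<bullet> g \<tau>) has_real_derivative e \<bullet> g') (at \<tau>)" if "(g has_vector_derivative g') (at \<tau>)" for g g' \<tau>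
    using that unfolding has_vector_derivative_def has_field_derivative_def
    by (auto intro!: derivative_eq_intros simp: mult_commute_abs)
  have d\<Psi>: "((\<lambda>s. \<Psi> (s,t)) has_vector_derivative P1 (s,t)) (at s)" "((\<lambda>t. \<Psi> (s,t)) has_vector_derivative P2 (s,t)) (at t)"
    if "s \<in> {0<..<A}" "t \<in> {0<..<B}" for s t
  proof -
    have inQ: "(s,t) \<in> {0<..<A} \<times> {0<..<B}" using that by auto
    have "((\<lambda>s. (s,t)) has_derivative (\<lambda>h. (h,0))) (at s)" "((\<lambda>t. (s,t)) has_derivative (\<lambda>h. (0,h))) (at t)"
      by (auto intro!: derivative_eq_intros)
    from has_derivative_compose[OF this(1) deriv[OF inQ]] has_derivative_compose[OF this(2) deriv[OF inQ]]
    show "((\<lambda>s. \<Psi> (s,t)) has_vector_derivative P1 (s,t)) (at s)" "((\<lambda>t. \<Psi> (s,t)) has_vector_derivative P2 (s,t)) (at t)"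
      by (simp_all add: has_vector_derivative_def)
  qed
  have I1: "(LINT z|onm Q. u (\<Psi> z) * Y1 z) = - (LINT z|onm Q. pull P1 g1 g2 z * X1 z)"
  proof -
    have "(LINT z|onm Q. u (\<Psi> z) * Y1 z) = (LINT t|onm {0<..<B}. LINT s|onm {0<..<A}. u (\<Psi> (s,t)) * Y1 (s,t))"
      by (rule integral_Q_iterated(1)[OF iY(1)])
    also have "\<dots> = (LINT t|onm {0<..<B}. - (LINT s|onm {0<..<A}. pull P1 g1 g2 (s,t) * X1 (s,t)))"
    proof (rule integral_cong_AE)
      show "AE t in onm {0<..<B}. (LINT s|onm {0<..<A}. u (\<Psi> (s,t)) * Y1 (s,t)) = - (LINT s|onm {0<..<A}. pull P1 g1 g2 (s,t) * X1 (s,t))"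
        using acs AE_ivl[of 0 B]
      proof eventually_elim
        case (elim t)
        show ?case
        proof (rule w11_parts[OF elim(1)])
          show "continuous_on {0..A} (\<lambda>s. X1 (s,t))"
            by (rule continuous_on_compose2[OF cq(1)]) (use elim in \<open>auto intro!: continuous_intros\<close>)
          show "X1 (0,t) = 0" "X1 (A,t) = 0" using \<phi>0[of "(0,t)"] \<phi>0[of "(A,t)"] elim AB by (auto simp: X1_def)
          show "((\<lambda>s. X1 (s,t)) has_real_derivative Y1 (s,t)) (at s)" if "s \<in> {0<..<A}" for s
          proof -
            have t: "t \<in> {0<..<B}" using elim by auto
            show ?thesis unfolding X1_def Y1_def q2_def q12_def
              by (rule DERIV_cong[OF DERIV_mult'[OF dphi[where f="\<lambda>s. (s,t)" and P=P1 and \<tau>=s, OF d\<Psi>(1)[OF that t]] dq[OF d2[OF that t]]]]) simp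
          qed
          show "\<bar>Y1 (s,t)\<bar> \<le> 2 * C * M * C + M * C" for s by (rule Yb)
          show "0 < A" by (rule AB)
          show "(\<lambda>s. X1 (s,t)) \<in> borel_measurable borel" "(\<lambda>s. Y1 (s,t)) \<in> borel_measurable borel" "(\<lambda>s. u (\<Psi> (s,t))) \<in> borel_measurable borel"
            by measurable
        qed
      qed
    qed (use integral_Q_iterated(3)[OF iY(1)] integral_Q_iterated(3)[OF iX(1)] in \<open>auto dest!: borel_measurable_integrable\<close>)
    also have "\<dots> = - (LINT z|onm Q. pull P1 g1 g2 z * X1 z)" using integral_Q_iterated(1)[OF iX(1)] by simp
    finally show ?thesis .
  qed
  have I2: "(LINT z|onm Q. u (\<Psi> z) * Y2 z) = - (LINT z|onm Q. pull P2 g1 g2 z * X2 z)"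
  proof -
    have "(LINT z|onm Q. u (\<Psi> z) * Y2 z) = (LINT s|onm {0<..<A}. LINT t|onm {0<..<B}. u (\<Psi> (s,t)) * Y2 (s,t))"
      by (rule integral_Q_iterated(2)[OF iY(2)])
    also have "\<dots> = (LINT s|onm {0<..<A}. - (LINT t|onm {0<..<B}. pull P2 g1 g2 (s,t) * X2 (s,t)))"
    proof (rule integral_cong_AE)
      show "AE s in onm {0<..<A}. (LINT t|onm {0<..<B}. u (\<Psi> (s,t)) * Y2 (s,t)) = - (LINT t|onm {0<..<B}. pull P2 g1 g2 (s,t) * X2 (s,t))"
        using act AE_ivl[of 0 A]
      proof eventually_elim
        case (elim s)
        show ?case
        proof (rule w11_parts[OF elim(1)])
          show "continuous_on {0..B} (\<lambda>t. X2 (s,t))"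
            by (rule continuous_on_compose2[OF cq(2)]) (use elim in \<open>auto intro!: continuous_intros\<close>)
          show "X2 (s,0) = 0" "X2 (s,B) = 0" using \<phi>0[of "(s,0)"] \<phi>0[of "(s,B)"] elim AB by (auto simp: X2_def)
          show "((\<lambda>t. X2 (s,t)) has_real_derivative Y2 (s,t)) (at t)" if "t \<in> {0<..<B}" for t
          proof -
            have s: "s \<in> {0<..<A}" using elim by auto
            show ?thesis unfolding X2_def Y2_def q1_def q12_def
              by (rule DERIV_cong[OF DERIV_mult'[OF dphi[where f="\<lambda>t. (s,t)" and P=P2 and \<tau>=t, OF d\<Psi>(2)[OF s that]] dq[OF d1[OF s that]]]]) simp
          qed
          show "\<bar>Y2 (s,t)\<bar> \<le> 2 * C * M * C + M * C" for t by (rule Yb)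
          show "0 < B" by (rule AB)
          show "(\<lambda>t. X2 (s,t)) \<in> borel_measurable borel" "(\<lambda>t. Y2 (s,t)) \<in> borel_measurable borel" "(\<lambda>t. u (\<Psi> (s,t))) \<in> borel_measurable borel"
            by measurable
        qed
      qed
    qed (use integral_Q_iterated(4)[OF iY(2)] integral_Q_iterated(4)[OF iX(2)] in \<open>auto dest!: borel_measurable_integrable\<close>)
    also have "\<dots> = - (LINT z|onm Q. pull P2 g1 g2 z * X2 z)" using integral_Q_iterated(2)[OF iX(2)] by simp
    finally show ?thesis .
  qed
  have "(LINT z|onm Q. u (\<Psi> z) * (pull P1 \<phi>x \<phi>y z * q2 z - pull P2 \<phi>x \<phi>y z * q1 z)) = (LINT z|onm Q. u (\<Psi> z) * Y1 z - u (\<Psi> z) * Y2 z)"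
    by (intro Bochner_Integration.integral_cong) (auto simp: Y1_def Y2_def algebra_simps)
  also have "\<dots> = - (LINT z|onm Q. pull P1 g1 g2 z * X1 z - pull P2 g1 g2 z * X2 z)"
    using I1 I2 iY iX by simp
  also have "(LINT z|onm Q. pull P1 g1 g2 z * X1 z - pull P2 g1 g2 z * X2 z) = (LINT z|onm Q. \<phi> (\<Psi> z) * (pull P1 g1 g2 z * q2 z - pull P2 g1 g2 z * q1 z))"
    by (intro Bochner_Integration.integral_cong) (auto simp: X1_def X2_def algebra_simps)
  finally show ?thesis unfolding q1_def q2_def .
qed

text \<open>Cramer's rule: in \<open>parts_identity\<close> the choice \<open>e = (0,1)\<close>
  turns the combination of pulled-back derivatives into the determinant times the first Cartesian
  component, and \<open>e = (1,0)\<close> into minus the determinant times the second. As the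
  determinant is \<open>sg * J\<close>, the sign cancels and the density of the change of variables
  remains.\<close>

theorem ac_imp_weak:
  assumes um [measurable]: "u \<in> borel_measurable borel"
    and i: "integrable (onm D) u" "integrable (onm D) g1" "integrable (onm D) g2"
    and acs: "AE t in onm {0<..<B}. w11 0 A (\<lambda>s. u (\<Psi> (s,t))) (\<lambda>s. pull P1 g1 g2 (s,t))"
    and act: "AE s in onm {0<..<A}. w11 0 B (\<lambda>t. u (\<Psi> (s,t))) (\<lambda>t. pull P2 g1 g2 (s,t))"
    and tf: "test_function D \<phi>"
  shows "(LINT z|onm D. u z * partial_deriv (1,0) \<phi> z) = - (LINT z|onm D. g1 z * \<phi> z)"
    and "(LINT z|onm D. u z * partial_deriv (0,1) \<phi> z) = - (LINT z|onm D. g2 z * \<phi> z)"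
proof -
  let ?x = "partial_deriv (1,0) \<phi>" and ?y = "partial_deriv (0,1) \<phi>"
  have m [measurable]: "g1 \<in> borel_measurable borel" "g2 \<in> borel_measurable borel"
    using i by (auto intro: integrable_onm_borel)
  have [measurable]: "\<phi> \<in> borel_measurable borel" "?x \<in> borel_measurable borel" "?y \<in> borel_measurable borel"
    using test_function_C1[OF tf] borel_measurable_continuous_onI by metis+
  have comb: "pull P1 a b z * ((0,1) \<bullet> P2 z) - pull P2 a b z * ((0,1) \<bullet> P1 z) = sg * (J z * a (\<Psi> z))"
    "pull P1 a b z * ((1,0) \<bullet> P2 z) - pull P2 a b z * ((1,0) \<bullet> P1 z) = - (sg * (J z * b (\<Psi> z)))" if "z \<in> Q" for a b z
  proof -
    have j: "sg * J z = fst (P1 z) * snd (P2 z) - snd (P1 z) * fst (P2 z)" using det_sg[of z] that by (simp add: Q_def)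
    show "pull P1 a b z * ((0,1) \<bullet> P2 z) - pull P2 a b z * ((0,1) \<bullet> P1 z) = sg * (J z * a (\<Psi> z))"
      unfolding mult.assoc[symmetric] j by (simp add: pull_def inner_prod_def algebra_simps)
    show "pull P1 a b z * ((1,0) \<bullet> P2 z) - pull P2 a b z * ((1,0) \<bullet> P1 z) = - (sg * (J z * b (\<Psi> z)))"
      unfolding mult.assoc[symmetric] j by (simp add: pull_def inner_prod_def algebra_simps)
  qed
  have sgc: "a = - b" if "sg * a = - (sg * b)" for a b
  proof -
    have "sg * a = sg * (- b)" using that by simp
    moreover have "sg \<noteq> 0" using sg by auto
    ultimately show ?thesis by (metis mult_left_cancel)
  qed
  have e: "norm ((1,0)::plane) \<le> 1" "norm ((0,1)::plane) \<le> 1" by (auto simp: norm_prod_def)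
  have cQ: "(LINT z|onm Q. f z) = (LINT z|onm Q. h z)"
    if "\<And>z. z \<in> Q \<Longrightarrow> f z = h z" "f \<in> borel_measurable borel" "h \<in> borel_measurable borel" for f h :: "plane \<Rightarrow> real"
    by (rule integral_cong_AE) (use that AE_onm_mem[OF Q_sets] in \<open>auto elim!: eventually_mono cong: measurable_cong_sets\<close>)
  have "sg * (LINT z|onm Q. J z * (u (\<Psi> z) * ?x (\<Psi> z))) = (LINT z|onm Q. u (\<Psi> z) * (pull P1 ?x ?y z * ((0,1) \<bullet> P2 z) - pull P2 ?x ?y z * ((0,1) \<bullet> P1 z)))"
    by (subst integral_mult_right_zero[symmetric], rule cQ) (auto simp: comb)
  also have "\<dots> = - (LINT z|onm Q. \<phi> (\<Psi> z) * (pull P1 g1 g2 z * ((0,1) \<bullet> P2 z) - pull P2 g1 g2 z * ((0,1) \<bullet> P1 z)))"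
    by (rule parts_identity[OF e(2) um i acs act tf])
  also have "\<dots> = - (sg * (LINT z|onm Q. J z * (g1 (\<Psi> z) * \<phi> (\<Psi> z))))"
    by (subst integral_mult_right_zero[symmetric], rule arg_cong[where f=uminus], rule cQ) (auto simp: comb)
  finally have "(LINT z|onm Q. J z * (u (\<Psi> z) * ?x (\<Psi> z))) = - (LINT z|onm Q. J z * (g1 (\<Psi> z) * \<phi> (\<Psi> z)))"
    by (rule sgc)
  then show "(LINT z|onm D. u z * ?x z) = - (LINT z|onm D. g1 z * \<phi> z)"
    using integral_D(1)[of "\<lambda>z. u z * ?x z"] integral_D(1)[of "\<lambda>z. g1 z * \<phi> z"] by simp
  have "sg * (LINT z|onm Q. J z * (u (\<Psi> z) * ?y (\<Psi> z))) = - (LINT z|onm Q. u (\<Psi> z) * (pull P1 ?x ?y z * ((1,0) \<bullet> P2 z) - pull P2 ?x ?y z * ((1,0) \<bullet> P1 z)))"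
    by (subst integral_mult_right_zero[symmetric], subst integral_minus[symmetric], rule cQ) (auto simp: comb)
  also have "\<dots> = (LINT z|onm Q. \<phi> (\<Psi> z) * (pull P1 g1 g2 z * ((1,0) \<bullet> P2 z) - pull P2 g1 g2 z * ((1,0) \<bullet> P1 z)))"
    unfolding parts_identity[OF e(1) um i acs act tf] by simp
  also have "\<dots> = - (sg * (LINT z|onm Q. J z * (g2 (\<Psi> z) * \<phi> (\<Psi> z))))"
    by (subst integral_mult_right_zero[symmetric], subst integral_minus[symmetric], rule cQ) (auto simp: comb)
  finally have "(LINT z|onm Q. J z * (u (\<Psi> z) * ?y (\<Psi> z))) = - (LINT z|onm Q. J z * (g2 (\<Psi> z) * \<phi> (\<Psi> z)))"
    by (rule sgc)
  then show "(LINT z|onm D. u z * ?y z) = - (LINT z|onm D. g2 z * \<phi> z)"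
    using integral_D(1)[of "\<lambda>z. u z * ?y z"] integral_D(1)[of "\<lambda>z. g2 z * \<phi> z"] by simp
qed

end

section \<open>Poincare inequality modulo finitely many mean values\<close>

lemma measure_ivl: "a \<le> b \<Longrightarrow> measure (onm {a<..<b::real}) UNIV = b - a"
  by (simp add: measure_def emeasure_onm)

lemma (in finite_measure) L2fun_bounded:
  "f \<in> borel_measurable M \<Longrightarrow> (\<And>x. \<bar>f x\<bar> \<le> K) \<Longrightarrow> L2fun M f"
proof -
  assume m: "f \<in> borel_measurable M" and b: "\<And>x. \<bar>f x\<bar> \<le> K"
  have "(f x)\<^sup>2 \<le> K\<^sup>2" for x
    using order_trans[OF b abs_ge_self, of x] by (simp only: abs_le_square_iff)
  then have "integrable M (\<lambda>x. (f x)\<^sup>2)" using m by (intro integrable_const_bound[where B="K\<^sup>2"]) auto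
  then show ?thesis using m by (simp add: L2fun_def)
qed

lemma mean_square_aux:
  fixes X M k :: real
  assumes "k > 0"
  shows "X - 2 * (M / k) * M + k * (M / k)\<^sup>2 = X - M\<^sup>2 / k"
proof -
  have "k * (M / k)\<^sup>2 = M\<^sup>2 / k" using assms by (simp add: power2_eq_square)
  moreover have "2 * (M / k) * M = 2 * (M\<^sup>2 / k)" by (simp add: power2_eq_square)
  ultimately show ?thesis by linarith
qed

lemma L2fun_cong_AE:
  assumes "L2fun M f" "AE x in M. g x = f x" "g \<in> borel_measurable M"
  shows "L2fun M g"
  unfolding L2fun_def
proof
  show "integrable M (\<lambda>x. (g x)\<^sup>2)"
    by (rule integrable_cong_AE_imp[OF L2fun_int[OF assms(1)]]) (use assms in auto)
qed (rule assms)

text \<open>The oscillation of \<open>f\<close> is at most the integral of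
  \<open>\<bar>g\<bar>\<close>, and Cauchy-Schwarz turns its square into the integral of
  \<open>g\<^sup>2\<close> with one factor \<open>b - a\<close>; integration yields the other. The
  last claim is the same estimate after the variance has been expanded.\<close>

lemma poincare_interval:
  assumes w: "w11 a b f g" and ab: "a < b" and fm: "f \<in> borel_measurable borel"
    and g: "L2fun (onm {a<..<b}) g"
  defines "m \<equiv> (LINT s|onm {a<..<b}. f s) / (b - a)"
  shows "L2fun (onm {a<..<b}) f"
    "(LINT s|onm {a<..<b}. (f s - m)\<^sup>2) \<le> (b - a)\<^sup>2 * (LINT s|onm {a<..<b}. (g s)\<^sup>2)"
    "(LINT s|onm {a<..<b}. (f s)\<^sup>2) \<le> (LINT s|onm {a<..<b}. f s)\<^sup>2 / (b - a) + (b - a)\<^sup>2 * (LINT s|onm {a<..<b}. (g s)\<^sup>2)"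
proof -
  interpret fin: finite_measure "onm {a<..<b}" by (rule finite_measure_onm) auto
  note gi = w11_int[OF w]
  have [measurable]: "g \<in> borel_measurable borel" "f \<in> borel_measurable borel" using gi fm by (auto intro: integrable_onm_borel)
  obtain c where c: "AE s in onm {a<..<b}. f s = c + prim a g s" using w by (auto simp: w11_def)
  define X where "X = (LINT s|onm {a<..<b}. \<bar>g s\<bar>)"
  have X2: "X\<^sup>2 \<le> (b - a) * (LINT s|onm {a<..<b}. (g s)\<^sup>2)"
    using fin.Cauchy_Schwarz_abs[OF g] ab by (simp add: X_def measure_ivl)
  have "X \<ge> 0" by (simp add: X_def)
  \<comment> \<open>Truncation at \<open>c - X\<close> and \<open>c + X\<close> changes
    \<open>f\<close> on a null set only; boundedness of the truncation gives square integrability of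
    \<open>f\<close>.\<close>
  then have L: "L2fun (onm {a<..<b}) (\<lambda>s. max (c - X) (min (c + X) (f s)))"
    by (intro fin.L2fun_bounded[where K="\<bar>c\<bar> + X"]) (auto simp: max_def min_def)
  have fb: "AE s in onm {a<..<b}. f s = max (c - X) (min (c + X) (f s))"
    using c AE_ivl[of a b]
  proof eventually_elim
    case (elim s)
    have "\<bar>prim a g s - prim a g a\<bar> \<le> X" unfolding X_def using prim_diff_abs[OF gi, of a s] elim by auto
    then show ?case using elim by auto
  qed
  show Lf: "L2fun (onm {a<..<b}) f" by (rule L2fun_cong_AE[OF L fb]) simp
  have fi: "integrable (onm {a<..<b}) f" by (rule fin.L2fun_integrable[OF Lf])
  have "AE s in onm {a<..<b}. (f s - m)\<^sup>2 \<le> X\<^sup>2"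
    using c AE_ivl[of a b]
  proof eventually_elim
    case (elim s)
    have mm: "m * (b - a) = (LINT s|onm {a<..<b}. f s)" using ab by (simp add: m_def)
    have "(LINT s'|onm {a<..<b}. f s - f s') = (b - a) * f s - (LINT s|onm {a<..<b}. f s)"
      using fi ab by (simp add: measure_ivl)
    then have "(f s - m) * (b - a) = (LINT s'|onm {a<..<b}. f s - f s')"
      unfolding mm[symmetric] by (simp add: left_diff_distrib right_diff_distrib mult.commute)
    also have "\<bar>\<dots>\<bar> \<le> (LINT s'|onm {a<..<b}. X)"
    proof (rule order_trans[OF integral_abs_bound integral_mono_AE])
      show "AE s' in onm {a<..<b}. \<bar>f s - f s'\<bar> \<le> X"
        using c AE_ivl[of a b]
      proof eventually_elim
        case (elim s')
        then show ?case using prim_diff_abs[OF gi, of s' s] \<open>f s = c + prim a g s\<close> \<open>a < s \<and> s < b\<close> unfolding X_def by auto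
      qed
    qed (use fi in auto)
    also have "\<dots> = X * (b - a)" using ab by (simp add: measure_ivl)
    finally have "\<bar>f s - m\<bar> \<le> X" using ab by (simp add: abs_mult)
    then show ?case using abs_le_square_iff[of "f s - m" X] by (auto simp: X_def)
  qed
  then have "(LINT s|onm {a<..<b}. (f s - m)\<^sup>2) \<le> (LINT s|onm {a<..<b}. X\<^sup>2)"
    using L2fun_int[OF L2fun_diff[OF Lf fin.L2fun_const]] by (intro integral_mono_AE) auto
  also have "\<dots> = (b - a) * X\<^sup>2" using ab by (simp add: measure_ivl)
  also have "\<dots> \<le> (b - a) * ((b - a) * (LINT s|onm {a<..<b}. (g s)\<^sup>2))" using ab X2 by (intro mult_left_mono) auto
  finally show 1: "(LINT s|onm {a<..<b}. (f s - m)\<^sup>2) \<le> (b - a)\<^sup>2 * (LINT s|onm {a<..<b}. (g s)\<^sup>2)"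
    by (simp add: power2_eq_square mult.assoc)
  have "(LINT s|onm {a<..<b}. (f s - m)\<^sup>2) = (LINT s|onm {a<..<b}. (f s)\<^sup>2 - 2 * m * f s + m\<^sup>2)"
    by (simp add: power2_diff algebra_simps)
  also have "\<dots> = (LINT s|onm {a<..<b}. (f s)\<^sup>2) - 2 * m * (LINT s|onm {a<..<b}. f s) + (b - a) * m\<^sup>2"
    using L2fun_int[OF Lf] fi ab by (simp add: measure_ivl)
  also have "\<dots> = (LINT s|onm {a<..<b}. (f s)\<^sup>2) - (LINT s|onm {a<..<b}. f s)\<^sup>2 / (b - a)"
    unfolding m_def by (rule mean_square_aux) (use ab in simp)
  finally show "(LINT s|onm {a<..<b}. (f s)\<^sup>2) \<le> (LINT s|onm {a<..<b}. f s)\<^sup>2 / (b - a) + (b - a)\<^sup>2 * (LINT s|onm {a<..<b}. (g s)\<^sup>2)"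
    using 1 by linarith
qed

section \<open>Poincare inequalities on rectangles and their subdivision\<close>

definition rect :: "real \<Rightarrow> real \<Rightarrow> real \<Rightarrow> real \<Rightarrow> plane set" where
  "rect a b c d = {a<..<b} \<times> {c<..<d}"

lemma rect_props [measurable]: "rect a b c d \<in> sets borel" and rect_bounded: "bounded (rect a b c d)"
  and onm_rect: "onm {a<..<b} \<Otimes>\<^sub>M onm {c<..<d} = onm (rect a b c d)"
proof -
  have "open (rect a b c d)" unfolding rect_def by (intro open_Times) auto
  then show "rect a b c d \<in> sets borel" by simp
  show "bounded (rect a b c d)" unfolding rect_def by (intro bounded_Times) auto
  show "onm {a<..<b} \<Otimes>\<^sub>M onm {c<..<d} = onm (rect a b c d)" unfolding rect_def by (rule onm_Times) auto
qed

definition ac_rect :: "real \<Rightarrow> real \<Rightarrow> real \<Rightarrow> real \<Rightarrow> (plane \<Rightarrow> real) \<Rightarrow> (plane \<Rightarrow> real) \<Rightarrow> (plane \<Rightarrow> real) \<Rightarrow> bool" where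
  "ac_rect a b c d U G1 G2 \<longleftrightarrow>
     L2fun (onm (rect a b c d)) U \<and> L2fun (onm (rect a b c d)) G1 \<and> L2fun (onm (rect a b c d)) G2 \<and>
     (AE t in onm {c<..<d}. w11 a b (\<lambda>s. U (s,t)) (\<lambda>s. G1 (s,t))) \<and>
     (AE s in onm {a<..<b}. w11 c d (\<lambda>t. U (s,t)) (\<lambda>t. G2 (s,t)))"

lemma L2fun_onm_borel: "L2fun (onm A) f \<Longrightarrow> f \<in> borel_measurable borel"
  using L2fun_meas[of "onm A" f] by (simp cong: measurable_cong_sets)

text \<open>The inequality in \<open>s\<close> bounds \<open>U\<close> by its integrals
  \<open>A t\<close> along the lines. The variation of \<open>A\<close> in \<open>t\<close> is not
  estimated by a derivative of \<open>A\<close>, which would require differentiation under the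
  integral, but by \<open>W\<close>, the deviation of \<open>U\<close> from its means
  \<open>n\<close> in the other direction.\<close>

lemma poincare_rect:
  assumes ac: "ac_rect a b c d U G1 G2" and ab: "a < b" and cd: "c < d"
  shows "(LINT z|onm (rect a b c d). (U z)\<^sup>2) \<le> (LINT z|onm (rect a b c d). U z)\<^sup>2 / ((b - a) * (d - c))
    + (b - a)\<^sup>2 * (LINT z|onm (rect a b c d). (G1 z)\<^sup>2) + (d - c)\<^sup>2 * (LINT z|onm (rect a b c d). (G2 z)\<^sup>2)"
proof -
  let ?S = "onm {a<..<b}" and ?T = "onm {c<..<d}" and ?R = "onm (rect a b c d)"
  let ?l = "b - a" and ?k = "d - c"
  interpret S: finite_measure ?S by (rule finite_measure_onm) auto
  interpret T: finite_measure ?T by (rule finite_measure_onm) auto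
  interpret R: finite_measure ?R by (rule finite_measure_onm[OF rect_bounded]) measurable
  interpret P: pair_sigma_finite ?S ?T ..
  have L: "L2fun ?R U" "L2fun ?R G1" "L2fun ?R G2" using ac by (auto simp: ac_rect_def)
  have [measurable]: "U \<in> borel_measurable borel" "G1 \<in> borel_measurable borel" "G2 \<in> borel_measurable borel"
    using L by (auto intro: L2fun_onm_borel)
  have snd: "(LINT z|?R. f z) = (LINT t|?T. LINT s|?S. f (s,t))" "integrable ?T (\<lambda>t. LINT s|?S. f (s,t))" "AE t in ?T. integrable ?S (\<lambda>s. f (s,t))"
    and fst: "(LINT z|?R. f z) = (LINT s|?S. LINT t|?T. f (s,t))" "integrable ?S (\<lambda>s. LINT t|?T. f (s,t))" "AE s in ?S. integrable ?T (\<lambda>t. f (s,t))"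
    if "integrable ?R f" for f :: "plane \<Rightarrow> real"
  proof -
    have p: "integrable (?S \<Otimes>\<^sub>M ?T) (\<lambda>(s,t). f (s,t))" using that by (simp add: onm_rect)
    show "(LINT z|?R. f z) = (LINT t|?T. LINT s|?S. f (s,t))" "integrable ?T (\<lambda>t. LINT s|?S. f (s,t))" "AE t in ?T. integrable ?S (\<lambda>s. f (s,t))"
      using P.integral_snd[OF p] P.integrable_snd[OF p] P.AE_integrable_snd[OF p] by (auto simp: onm_rect)
    show "(LINT z|?R. f z) = (LINT s|?S. LINT t|?T. f (s,t))" "integrable ?S (\<lambda>s. LINT t|?T. f (s,t))" "AE s in ?S. integrable ?T (\<lambda>t. f (s,t))"
      using P.integral_fst'[of f] P.integrable_fst'[of f] P.AE_integrable_fst'[of f] that by (auto simp: onm_rect)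
  qed
  note U2 = L2fun_int[OF L(1)] and G12 = L2fun_int[OF L(2)] and G22 = L2fun_int[OF L(3)] and Ui = R.L2fun_integrable[OF L(1)]
  have acs: "AE t in ?T. w11 a b (\<lambda>s. U (s,t)) (\<lambda>s. G1 (s,t))" and act: "AE s in ?S. w11 c d (\<lambda>t. U (s,t)) (\<lambda>t. G2 (s,t))"
    using ac by (auto simp: ac_rect_def)
  define A where "A t = (LINT s|?S. U (s,t))" for t
  define n where "n s = (LINT t|?T. U (s,t)) / ?k" for s
  have [measurable]: "A \<in> borel_measurable borel" "n \<in> borel_measurable borel"
    using borel_measurable_integrable[OF snd(2)[OF Ui]] borel_measurable_integrable[OF fst(2)[OF Ui]]
    unfolding A_def[abs_def] n_def[abs_def] by (auto cong: measurable_cong_sets)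
  have AL: "L2fun ?T A"
    unfolding L2fun_def
  proof
    show "integrable ?T (\<lambda>t. (A t)\<^sup>2)"
    proof (rule Bochner_Integration.integrable_bound)
      show "integrable ?T (\<lambda>t. ?l * (LINT s|?S. (U (s,t))\<^sup>2))" using snd(2)[OF U2] by simp
      show "AE t in ?T. norm ((A t)\<^sup>2) \<le> norm (?l * (LINT s|?S. (U (s,t))\<^sup>2))"
        using snd(3)[OF U2]
      proof eventually_elim
        case (elim t)
        have "(A t)\<^sup>2 \<le> (LINT s|?S. \<bar>U (s,t)\<bar>)\<^sup>2"
          unfolding A_def by (rule abs_le_square_iff[THEN iffD1]) (use integral_abs_bound[of ?S "\<lambda>s. U (s,t)"] in auto)
        also have "\<dots> \<le> ?l * (LINT s|?S. (U (s,t))\<^sup>2)"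
          using S.Cauchy_Schwarz_abs[of "\<lambda>s. U (s,t)"] elim ab by (simp add: L2fun_def measure_ivl)
        finally show ?case by simp
      qed
    qed measurable
  qed measurable
  have nL: "L2fun ?S n"
    unfolding L2fun_def
  proof
    show "integrable ?S (\<lambda>s. (n s)\<^sup>2)"
    proof (rule Bochner_Integration.integrable_bound)
      show "integrable ?S (\<lambda>s. (LINT t|?T. (U (s,t))\<^sup>2) / ?k)" using fst(2)[OF U2] by simp
      show "AE s in ?S. norm ((n s)\<^sup>2) \<le> norm ((LINT t|?T. (U (s,t))\<^sup>2) / ?k)"
        using fst(3)[OF U2]
      proof eventually_elim
        case (elim s)
        have "(?k * n s)\<^sup>2 \<le> (LINT t|?T. \<bar>U (s,t)\<bar>)\<^sup>2"
          unfolding n_def using cd by (intro abs_le_square_iff[THEN iffD1]) (use integral_abs_bound[of ?T "\<lambda>t. U (s,t)"] in auto)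
        also have "\<dots> \<le> ?k * (LINT t|?T. (U (s,t))\<^sup>2)"
          using T.Cauchy_Schwarz_abs[of "\<lambda>t. U (s,t)"] elim cd by (simp add: L2fun_def measure_ivl)
        finally have "?k * (?k * (n s)\<^sup>2) \<le> ?k * (LINT t|?T. (U (s,t))\<^sup>2)" by (simp add: power2_eq_square algebra_simps)
        then have "?k * (n s)\<^sup>2 \<le> (LINT t|?T. (U (s,t))\<^sup>2)" using cd by (simp only: mult_le_cancel_left_pos diff_gt_0_iff_gt)
        then show ?case using cd by (simp add: field_simps)
      qed
    qed measurable
  qed measurable
  define W where "W z = U z - n (fst z)" for z
  have nR: "L2fun ?R (\<lambda>z. n (fst z))"
  proof -
    have fm: "(\<lambda>z::plane. fst z) \<in> borel_measurable borel" by (rule plane_components_measurable) simp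
    have "integrable (?S \<Otimes>\<^sub>M ?T) (\<lambda>(s,t). (n s)\<^sup>2)"
      using L2fun_int[OF nL] by (intro P.Fubini_integrable) auto
    then show ?thesis using measurable_compose[OF fm, of n] by (simp add: L2fun_def onm_rect split_def cong: measurable_cong_sets)
  qed
  have WL: "L2fun ?R W" unfolding W_def[abs_def] by (rule L2fun_diff[OF L(1) nR])
  note W2 = L2fun_int[OF WL]
  have s1: "(LINT z|?R. (U z)\<^sup>2) \<le> (LINT t|?T. (A t)\<^sup>2) / ?l + ?l\<^sup>2 * (LINT z|?R. (G1 z)\<^sup>2)"
  proof -
    have "(LINT z|?R. (U z)\<^sup>2) \<le> (LINT t|?T. (A t)\<^sup>2 / ?l + ?l\<^sup>2 * (LINT s|?S. (G1 (s,t))\<^sup>2))"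
      unfolding snd(1)[OF U2]
    proof (rule integral_mono_AE)
      show "AE t in ?T. (LINT s|?S. (U (s,t))\<^sup>2) \<le> (A t)\<^sup>2 / ?l + ?l\<^sup>2 * (LINT s|?S. (G1 (s,t))\<^sup>2)"
        using acs snd(3)[OF G12]
      proof eventually_elim
        case (elim t)
        then show ?case unfolding A_def using poincare_interval(3)[OF elim(1) ab] by (simp add: L2fun_def)
      qed
    qed (use snd(2)[OF U2] snd(2)[OF G12] L2fun_int[OF AL] in auto)
    also have "\<dots> = (LINT t|?T. (A t)\<^sup>2) / ?l + ?l\<^sup>2 * (LINT z|?R. (G1 z)\<^sup>2)"
      using snd(1,2)[OF G12] L2fun_int[OF AL] by simp
    finally show ?thesis .
  qed
  have s2: "(LINT z|?R. (W z)\<^sup>2) \<le> ?k\<^sup>2 * (LINT z|?R. (G2 z)\<^sup>2)"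
  proof -
    have "(LINT z|?R. (W z)\<^sup>2) \<le> (LINT s|?S. ?k\<^sup>2 * (LINT t|?T. (G2 (s,t))\<^sup>2))"
      unfolding fst(1)[OF W2]
    proof (rule integral_mono_AE)
      show "AE s in ?S. (LINT t|?T. (W (s,t))\<^sup>2) \<le> ?k\<^sup>2 * (LINT t|?T. (G2 (s,t))\<^sup>2)"
        using act fst(3)[OF G22]
      proof eventually_elim
        case (elim s)
        then show ?case unfolding W_def n_def using poincare_interval(2)[OF elim(1) cd] by (simp add: L2fun_def)
      qed
    qed (use fst(2)[OF W2] fst(2)[OF G22] in auto)
    also have "\<dots> = ?k\<^sup>2 * (LINT z|?R. (G2 z)\<^sup>2)" using fst(1)[OF G22] by simp
    finally show ?thesis .
  qed
  define M where "M = (LINT z|?R. U z)"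
  have AM: "(LINT t|?T. A t) = M" unfolding M_def A_def using snd(1)[OF Ui] by simp
  have nM: "(LINT s|?S. n s) = M / ?k" unfolding M_def n_def using fst(1)[OF Ui] by simp
  have "(LINT t|?T. (A t - M / ?k)\<^sup>2) \<le> (LINT t|?T. ?l * (LINT s|?S. (W (s,t))\<^sup>2))"
  proof (rule integral_mono_AE)
    show "AE t in ?T. (A t - M / ?k)\<^sup>2 \<le> ?l * (LINT s|?S. (W (s,t))\<^sup>2)"
      using snd(3)[OF Ui] snd(3)[OF W2]
    proof eventually_elim
      case (elim t)
      \<comment> \<open>The integral of \<open>n\<close> over \<open>?S\<close> is
        \<open>M / ?k\<close>, so subtracting \<open>n\<close> from \<open>U\<close> subtracts
        exactly the mean value of \<open>A\<close>.\<close>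
      have "A t - M / ?k = (LINT s|?S. W (s,t))"
        unfolding A_def nM[symmetric] W_def using elim S.L2fun_integrable[OF nL] by simp
      then have "(A t - M / ?k)\<^sup>2 \<le> (LINT s|?S. \<bar>W (s,t)\<bar>)\<^sup>2"
        by (intro abs_le_square_iff[THEN iffD1]) (use integral_abs_bound[of ?S "\<lambda>s. W (s,t)"] in auto)
      also have "\<dots> \<le> ?l * (LINT s|?S. (W (s,t))\<^sup>2)"
        using S.Cauchy_Schwarz_abs[of "\<lambda>s. W (s,t)"] elim ab L2fun_onm_borel[OF WL] by (simp add: L2fun_def measure_ivl)
      finally show ?case .
    qed
  qed (use snd(2)[OF W2] L2fun_int[OF L2fun_diff[OF AL T.L2fun_const]] in auto)
  also have "\<dots> = ?l * (LINT z|?R. (W z)\<^sup>2)" using snd(1)[OF W2] by simp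
  also have "\<dots> \<le> ?l * (?k\<^sup>2 * (LINT z|?R. (G2 z)\<^sup>2))" using s2 ab by (intro mult_left_mono) auto
  finally have s3: "(LINT t|?T. (A t - M / ?k)\<^sup>2) \<le> ?l * (?k\<^sup>2 * (LINT z|?R. (G2 z)\<^sup>2))" .
  have "(LINT t|?T. (A t - M / ?k)\<^sup>2) = (LINT t|?T. (A t)\<^sup>2 - 2 * (M / ?k) * A t + (M / ?k)\<^sup>2)"
    by (simp add: power2_diff algebra_simps)
  also have "\<dots> = (LINT t|?T. (A t)\<^sup>2) - 2 * (M / ?k) * M + ?k * (M / ?k)\<^sup>2"
    using L2fun_int[OF AL] T.L2fun_integrable[OF AL] cd by (simp add: measure_ivl AM)
  also have "\<dots> = (LINT t|?T. (A t)\<^sup>2) - M\<^sup>2 / ?k" by (rule mean_square_aux) (use cd in simp)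
  finally have "(LINT t|?T. (A t)\<^sup>2) \<le> M\<^sup>2 / ?k + ?l * (?k\<^sup>2 * (LINT z|?R. (G2 z)\<^sup>2))" using s3 by linarith
  then have "(LINT t|?T. (A t)\<^sup>2) / ?l \<le> (M\<^sup>2 / ?k + ?l * (?k\<^sup>2 * (LINT z|?R. (G2 z)\<^sup>2))) / ?l"
    using ab by (intro divide_right_mono) auto
  also have "\<dots> = M\<^sup>2 / (?l * ?k) + ?k\<^sup>2 * (LINT z|?R. (G2 z)\<^sup>2)" using ab cd by (simp add: add_divide_distrib mult.commute)
  finally show ?thesis using s1 unfolding M_def by linarith
qed

lemma onm_subset_L2: "L2fun (onm A) f \<Longrightarrow> B \<subseteq> A \<Longrightarrow> A \<in> sets borel \<Longrightarrow> B \<in> sets borel \<Longrightarrow> L2fun (onm B) f"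
proof -
  assume f: "L2fun (onm A) f" and s: "B \<subseteq> A" "A \<in> sets borel" "B \<in> sets borel"
  have [measurable]: "f \<in> borel_measurable borel" using f by (rule L2fun_onm_borel)
  have "f \<in> borel_measurable (onm B)" by measurable
  then show ?thesis unfolding L2fun_def using onm_subset_integrable[OF L2fun_int[OF f] s] by blast
qed

lemma AE_onm_subset:
  fixes A B :: "'a::euclidean_space set"
  assumes "AE x in onm A. P x" "B \<subseteq> A" "A \<in> sets borel" "B \<in> sets borel"
  shows "AE x in onm B. P x"
proof -
  have "AE x in lborel. x \<in> A \<longrightarrow> P x" using assms by (simp add: AE_onm)
  then have "AE x in lborel. x \<in> B \<longrightarrow> P x" by eventually_elim (use assms in auto)
  then show ?thesis using assms by (simp add: AE_onm)
qed

lemma ac_rect_subset: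
  assumes ac: "ac_rect a b c d U G1 G2" and s: "a \<le> a'" "a' \<le> b'" "b' \<le> b" "c \<le> c'" "c' \<le> d'" "d' \<le> d"
  shows "ac_rect a' b' c' d' U G1 G2"
proof -
  have R: "rect a' b' c' d' \<subseteq> rect a b c d" using s by (auto simp: rect_def)
  have S: "{a'<..<b'} \<subseteq> {a<..<b}" and T: "{c'<..<d'} \<subseteq> {c<..<d}" using s by auto
  have ac1: "AE t in onm {c<..<d}. w11 a b (\<lambda>s. U (s,t)) (\<lambda>s. G1 (s,t))"
    and ac2: "AE s in onm {a<..<b}. w11 c d (\<lambda>t. U (s,t)) (\<lambda>t. G2 (s,t))"
    and L: "L2fun (onm (rect a b c d)) U" "L2fun (onm (rect a b c d)) G1" "L2fun (onm (rect a b c d)) G2"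
    using ac by (simp_all add: ac_rect_def)
  have "AE t in onm {c'<..<d'}. w11 a b (\<lambda>s. U (s,t)) (\<lambda>s. G1 (s,t))"
    by (rule AE_onm_subset[OF ac1 T]) auto
  then have "AE t in onm {c'<..<d'}. w11 a' b' (\<lambda>s. U (s,t)) (\<lambda>s. G1 (s,t))"
    by eventually_elim (rule w11_subset[OF _ s(1-3)])
  moreover have "AE s in onm {a'<..<b'}. w11 c d (\<lambda>t. U (s,t)) (\<lambda>t. G2 (s,t))"
    by (rule AE_onm_subset[OF ac2 S]) auto
  then have "AE s in onm {a'<..<b'}. w11 c' d' (\<lambda>t. U (s,t)) (\<lambda>t. G2 (s,t))"
    by eventually_elim (rule w11_subset[OF _ s(4-6)])
  ultimately show ?thesis
    unfolding ac_rect_def using onm_subset_L2[OF _ R rect_props rect_props] L by simp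
qed

text \<open>The quantitative substitute for a compact embedding: up to an arbitrarily small multiple
  of the energy, the \<open>L^2\<close> norm is controlled by finitely many linear functionals, the
  integrals over the sets in the family.\<close>

definition finite_rank_poincare :: "real \<Rightarrow> real \<Rightarrow> real \<Rightarrow> real \<Rightarrow> real \<Rightarrow> bool" where
  "finite_rank_poincare a b c d \<epsilon> \<longleftrightarrow> (\<exists>\<F> K. finite \<F> \<and> 0 \<le> K \<and> (\<forall>R\<in>\<F>. R \<in> sets borel \<and> R \<subseteq> rect a b c d) \<and>
     (\<forall>U G1 G2. ac_rect a b c d U G1 G2 \<longrightarrow>
       (LINT z|onm (rect a b c d). (U z)\<^sup>2) \<le> K * (\<Sum>R\<in>\<F>. (LINT z|onm R. U z)\<^sup>2)
         + \<epsilon> * (LINT z|onm (rect a b c d). (G1 z)\<^sup>2 + (G2 z)\<^sup>2)))"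

lemma finite_rank_poincare_union:
  assumes 1: "finite_rank_poincare a1 b1 c1 d1 \<epsilon>" and 2: "finite_rank_poincare a2 b2 c2 d2 \<epsilon>"
    and sub: "\<And>U G1 G2. ac_rect a b c d U G1 G2 \<Longrightarrow> ac_rect a1 b1 c1 d1 U G1 G2 \<and> ac_rect a2 b2 c2 d2 U G1 G2"
    and add: "\<And>f :: plane \<Rightarrow> real. integrable (onm (rect a b c d)) f \<Longrightarrow>
      (LINT z|onm (rect a b c d). f z) = (LINT z|onm (rect a1 b1 c1 d1). f z) + (LINT z|onm (rect a2 b2 c2 d2). f z)"
    and R: "rect a1 b1 c1 d1 \<subseteq> rect a b c d" "rect a2 b2 c2 d2 \<subseteq> rect a b c d"
  shows "finite_rank_poincare a b c d \<epsilon>"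
proof -
  obtain F1 K1 where F1: "finite F1" "0 \<le> K1" "\<forall>R\<in>F1. R \<in> sets borel \<and> R \<subseteq> rect a1 b1 c1 d1"
    "\<And>U G1 G2. ac_rect a1 b1 c1 d1 U G1 G2 \<Longrightarrow>
       (LINT z|onm (rect a1 b1 c1 d1). (U z)\<^sup>2) \<le> K1 * (\<Sum>R\<in>F1. (LINT z|onm R. U z)\<^sup>2)
         + \<epsilon> * (LINT z|onm (rect a1 b1 c1 d1). (G1 z)\<^sup>2 + (G2 z)\<^sup>2)" using 1 unfolding finite_rank_poincare_def by blast
  obtain F2 K2 where F2: "finite F2" "0 \<le> K2" "\<forall>R\<in>F2. R \<in> sets borel \<and> R \<subseteq> rect a2 b2 c2 d2"
    "\<And>U G1 G2. ac_rect a2 b2 c2 d2 U G1 G2 \<Longrightarrow>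
       (LINT z|onm (rect a2 b2 c2 d2). (U z)\<^sup>2) \<le> K2 * (\<Sum>R\<in>F2. (LINT z|onm R. U z)\<^sup>2)
         + \<epsilon> * (LINT z|onm (rect a2 b2 c2 d2). (G1 z)\<^sup>2 + (G2 z)\<^sup>2)" using 2 unfolding finite_rank_poincare_def by blast
  have "(LINT z|onm (rect a b c d). (U z)\<^sup>2) \<le> (K1 + K2) * (\<Sum>R\<in>F1 \<union> F2. (LINT z|onm R. U z)\<^sup>2)
         + \<epsilon> * (LINT z|onm (rect a b c d). (G1 z)\<^sup>2 + (G2 z)\<^sup>2)" if ac: "ac_rect a b c d U G1 G2" for U G1 G2
  proof -
    have i: "integrable (onm (rect a b c d)) (\<lambda>z. (U z)\<^sup>2)" "integrable (onm (rect a b c d)) (\<lambda>z. (G1 z)\<^sup>2 + (G2 z)\<^sup>2)"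
      using ac by (auto simp: ac_rect_def L2fun_def)
    have "K1 * (\<Sum>R\<in>F1. (LINT z|onm R. U z)\<^sup>2) \<le> K1 * (\<Sum>R\<in>F1 \<union> F2. (LINT z|onm R. U z)\<^sup>2)"
      using F1 F2 by (intro mult_left_mono sum_mono2) auto
    moreover have "K2 * (\<Sum>R\<in>F2. (LINT z|onm R. U z)\<^sup>2) \<le> K2 * (\<Sum>R\<in>F1 \<union> F2. (LINT z|onm R. U z)\<^sup>2)"
      using F1 F2 by (intro mult_left_mono sum_mono2) auto
    ultimately show ?thesis
      using F1(4)[OF conjunct1[OF sub[OF ac]]] F2(4)[OF conjunct2[OF sub[OF ac]]] unfolding add[OF i(1)] add[OF i(2)]
      by (simp add: distrib_left distrib_right)
  qed
  moreover have "finite (F1 \<union> F2)" "0 \<le> K1 + K2" "\<forall>R\<in>F1 \<union> F2. R \<in> sets borel \<and> R \<subseteq> rect a b c d"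
    using F1(1,2,3) F2(1,2,3) R by (simp, simp, blast)
  ultimately show ?thesis unfolding finite_rank_poincare_def by blast
qed

lemma AE_plane_line:
  "AE z in lborel. fst z \<noteq> (s::real) \<and> snd z \<noteq> (t::real)"
proof -
  have e: "emeasure lborel ({s} \<times> (UNIV::real set)) = 0" "emeasure lborel ((UNIV::real set) \<times> {t}) = 0"
    unfolding lborel_prod[symmetric] by (subst lborel.emeasure_pair_measure_Times; simp)+
  have "{s} \<times> (UNIV::real set) \<in> null_sets lborel" "(UNIV::real set) \<times> {t} \<in> null_sets lborel"
    using e by (auto simp: null_sets_def intro!: borel_closed closed_Times)
  from AE_not_in[OF this(1)] AE_not_in[OF this(2)] show ?thesis by eventually_elim auto
qed

lemma onm_union_integral:
  fixes f :: "'a::euclidean_space \<Rightarrow> real"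
  assumes f: "integrable (onm R) f" and m: "R \<in> sets borel" "R1 \<in> sets borel" "R2 \<in> sets borel"
    and R: "R1 \<subseteq> R" "R2 \<subseteq> R" "R1 \<inter> R2 = {}" and ae: "AE z in lborel. z \<in> R \<longrightarrow> z \<in> R1 \<or> z \<in> R2"
  shows "(LINT z|onm R. f z) = (LINT z|onm R1. f z) + (LINT z|onm R2. f z)"
proof -
  have [measurable]: "f \<in> borel_measurable borel" using f by (rule integrable_onm_borel)
  have i: "integrable lborel (\<lambda>z. indicator R1 z * f z)" "integrable lborel (\<lambda>z. indicator R2 z * f z)"
    using onm_subset_integrable[OF f R(1)] onm_subset_integrable[OF f R(2)] m by (auto simp: integrable_onm)
  have "(LINT z|onm R. f z) = (LINT z|lborel. indicator R1 z * f z + indicator R2 z * f z)"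
    unfolding integral_onm[OF m(1) \<open>f \<in> borel_measurable borel\<close>]
  proof (rule integral_cong_AE)
    show "AE z in lborel. indicator R z * f z = indicator R1 z * f z + indicator R2 z * f z"
      using ae by eventually_elim (use R in \<open>auto split: split_indicator\<close>)
  qed (use m in auto)
  then show ?thesis using i m by (simp add: integral_onm)
qed

text \<open>Halving both sides divides the factor of the energy by 4, and the four quarters share
  the energy of the whole. For \<open>n = 0\<close> the Poincare inequality is used with the
  rectangle itself as the only member of the family.\<close>

lemma finite_rank_poincare_halving:
  assumes "a < b" "c < d"
  shows "finite_rank_poincare a b c d (((b - a)\<^sup>2 + (d - c)\<^sup>2) / 4 ^ n)"
  using assms
proof (induction n arbitrary: a b c d)
  case 0
  have "(LINT z|onm (rect a b c d). (U z)\<^sup>2) \<le> inverse ((b - a) * (d - c)) * (\<Sum>R\<in>{rect a b c d}. (LINT z|onm R. U z)\<^sup>2)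
         + ((b - a)\<^sup>2 + (d - c)\<^sup>2) / 4 ^ 0 * (LINT z|onm (rect a b c d). (G1 z)\<^sup>2 + (G2 z)\<^sup>2)" if ac: "ac_rect a b c d U G1 G2" for U G1 G2
  proof -
    have i: "integrable (onm (rect a b c d)) (\<lambda>z. (G1 z)\<^sup>2)" "integrable (onm (rect a b c d)) (\<lambda>z. (G2 z)\<^sup>2)"
      using ac by (auto simp: ac_rect_def L2fun_def)
    have se: "(LINT z|onm (rect a b c d). (G1 z)\<^sup>2 + (G2 z)\<^sup>2) = (LINT z|onm (rect a b c d). (G1 z)\<^sup>2) + (LINT z|onm (rect a b c d). (G2 z)\<^sup>2)"
      using i by simp
    have nn: "0 \<le> (b - a)\<^sup>2 * (LINT z|onm (rect a b c d). (G2 z)\<^sup>2)" "0 \<le> (d - c)\<^sup>2 * (LINT z|onm (rect a b c d). (G1 z)\<^sup>2)" by auto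
    have "(LINT z|onm (rect a b c d). (U z)\<^sup>2) \<le> (LINT z|onm (rect a b c d). U z)\<^sup>2 / ((b - a) * (d - c))
      + ((b - a)\<^sup>2 + (d - c)\<^sup>2) * ((LINT z|onm (rect a b c d). (G1 z)\<^sup>2) + (LINT z|onm (rect a b c d). (G2 z)\<^sup>2))"
      using poincare_rect[OF ac 0] nn unfolding distrib_left distrib_right by linarith
    then show ?thesis unfolding se by (simp add: divide_inverse mult.commute)
  qed
  then show ?case unfolding finite_rank_poincare_def using 0
    by (intro exI[of _ "{rect a b c d}"] exI[of _ "inverse ((b - a) * (d - c))"]) auto
next
  case (Suc n)
  define e where "e = ((b - a)\<^sup>2 + (d - c)\<^sup>2) / 4 ^ Suc n"
  let ?p = "(a + b) / 2" and ?q = "(c + d) / 2"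
  have p: "a < ?p" "?p < b" and q: "c < ?q" "?q < d" using Suc.prems by auto
  have quarter: "finite_rank_poincare a' b' c' d' e" if "b' - a' = (b - a) / 2" "d' - c' = (d - c) / 2" for a' b' c' d'
  proof -
    have "a' < b'" using that(1) Suc.prems(1) half_gt_zero[of "b - a"] by linarith
    moreover have "c' < d'" using that(2) Suc.prems(2) half_gt_zero[of "d - c"] by linarith
    moreover have "(((b - a) / 2)\<^sup>2 + ((d - c) / 2)\<^sup>2) / 4 ^ n = e"
      by (simp add: e_def power_divide add_divide_distrib)
    ultimately show ?thesis using Suc.IH[of a' b' c' d'] by (simp only: that)
  qed
  have split_t: "finite_rank_poincare a' b' c d e" if "finite_rank_poincare a' b' c ?q e" "finite_rank_poincare a' b' ?q d e" "a' < b'" for a' b'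
  proof (rule finite_rank_poincare_union[OF that(1,2)])
    show "ac_rect a' b' c ?q U G1 G2 \<and> ac_rect a' b' ?q d U G1 G2" if "ac_rect a' b' c d U G1 G2" for U G1 G2
      using ac_rect_subset[OF that] q \<open>a' < b'\<close> by auto
    show "(LINT z|onm (rect a' b' c d). f z) = (LINT z|onm (rect a' b' c ?q). f z) + (LINT z|onm (rect a' b' ?q d). f z)"
      if "integrable (onm (rect a' b' c d)) f" for f :: "plane \<Rightarrow> real"
    proof (rule onm_union_integral[OF that])
      show "AE z in lborel. z \<in> rect a' b' c d \<longrightarrow> z \<in> rect a' b' c ?q \<or> z \<in> rect a' b' ?q d"
        using AE_plane_line[of 0 ?q] by eventually_elim (auto simp: rect_def)
    qed (use q in \<open>auto simp: rect_def[abs_def] intro: rect_props[unfolded rect_def]\<close>)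
  qed (use q in \<open>auto simp: rect_def\<close>)
  have "finite_rank_poincare a b c d e"
  proof (rule finite_rank_poincare_union[of a ?p c d _ ?p b c d])
    show "finite_rank_poincare a ?p c d e" by (rule split_t[OF quarter quarter p(1)]) (auto simp: field_simps)
    show "finite_rank_poincare ?p b c d e" by (rule split_t[OF quarter quarter p(2)]) (auto simp: field_simps)
    show "ac_rect a ?p c d U G1 G2 \<and> ac_rect ?p b c d U G1 G2" if "ac_rect a b c d U G1 G2" for U G1 G2
      using ac_rect_subset[OF that] p Suc.prems by auto
    show "(LINT z|onm (rect a b c d). f z) = (LINT z|onm (rect a ?p c d). f z) + (LINT z|onm (rect ?p b c d). f z)"
      if "integrable (onm (rect a b c d)) f" for f :: "plane \<Rightarrow> real"
    proof (rule onm_union_integral[OF that])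
      show "AE z in lborel. z \<in> rect a b c d \<longrightarrow> z \<in> rect a ?p c d \<or> z \<in> rect ?p b c d"
        using AE_plane_line[of ?p 0] by eventually_elim (auto simp: rect_def)
    qed (use p in \<open>auto simp: rect_def[abs_def] intro: rect_props[unfolded rect_def]\<close>)
  qed (use p in \<open>auto simp: rect_def\<close>)
  then show ?case unfolding e_def .
qed

lemma finite_rank_poincare_eps:
  assumes "a < b" "c < d" "\<epsilon> > 0"
  shows "finite_rank_poincare a b c d \<epsilon>"
proof -
  let ?X = "(b - a)\<^sup>2 + (d - c)\<^sup>2"
  have "(\<lambda>n. ?X * (1/4) ^ n) \<longlonglongrightarrow> ?X * 0" by (intro tendsto_intros LIMSEQ_power_zero) auto
  then have "\<forall>\<^sub>F n in sequentially. ?X * (1/4) ^ n < \<epsilon>" using assms by (intro order_tendstoD(2)) auto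
  then obtain n where n: "?X / 4 ^ n \<le> \<epsilon>" by (auto simp: eventually_sequentially power_divide) (metis less_imp_le order_refl)
  obtain F K where F: "finite F" "0 \<le> K" "\<forall>R\<in>F. R \<in> sets borel \<and> R \<subseteq> rect a b c d"
    "\<And>U G1 G2. ac_rect a b c d U G1 G2 \<Longrightarrow>
       (LINT z|onm (rect a b c d). (U z)\<^sup>2) \<le> K * (\<Sum>R\<in>F. (LINT z|onm R. U z)\<^sup>2)
         + ?X / 4 ^ n * (LINT z|onm (rect a b c d). (G1 z)\<^sup>2 + (G2 z)\<^sup>2)"
    using finite_rank_poincare_halving[OF assms(1,2), of n] unfolding finite_rank_poincare_def by blast
  have "(LINT z|onm (rect a b c d). (U z)\<^sup>2) \<le> K * (\<Sum>R\<in>F. (LINT z|onm R. U z)\<^sup>2)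
         + \<epsilon> * (LINT z|onm (rect a b c d). (G1 z)\<^sup>2 + (G2 z)\<^sup>2)" if "ac_rect a b c d U G1 G2" for U G1 G2
  proof -
    have "0 \<le> (LINT z|onm (rect a b c d). (G1 z)\<^sup>2 + (G2 z)\<^sup>2)" by (rule integral_nonneg_AE) simp
    from mult_right_mono[OF n this] F(4)[OF that] show ?thesis by linarith
  qed
  then show ?thesis unfolding finite_rank_poincare_def using F by blast
qed

section \<open>Existence of minimizers of the Rayleigh quotient\<close>

lemma L2fun_bounded_mult:
  assumes f: "L2fun M f" and h: "h \<in> borel_measurable M" "\<And>x. \<bar>h x\<bar> \<le> K"
  shows "L2fun M (\<lambda>x. h x * f x)"
proof -
  have [measurable]: "f \<in> borel_measurable M" "h \<in> borel_measurable M" using f h by (auto simp: L2fun_def)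
  have "integrable M (\<lambda>x. (h x * f x)\<^sup>2)"
  proof (rule Bochner_Integration.integrable_bound)
    show "integrable M (\<lambda>x. K\<^sup>2 * (f x)\<^sup>2)" using L2fun_int[OF f] by simp
    have "(h x)\<^sup>2 \<le> K\<^sup>2" for x using order_trans[OF h(2) abs_ge_self, of x] by (simp only: abs_le_square_iff)
    then show "AE x in M. norm ((h x * f x)\<^sup>2) \<le> norm (K\<^sup>2 * (f x)\<^sup>2)"
      by (intro AE_I2) (simp add: power_mult_distrib mult_right_mono)
  qed measurable
  then show ?thesis by (simp add: L2fun_def)
qed

lemma L2_lim_inner:
  assumes f: "\<And>n. L2fun M (F n)" "L2fun M f" "(\<lambda>n. LINT x|M. (F n x - f x)\<^sup>2) \<longlonglongrightarrow> 0" and h: "L2fun M h"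
  shows "(\<lambda>n. LINT x|M. F n x * h x) \<longlonglongrightarrow> (LINT x|M. f x * h x)"
proof -
  have "(\<lambda>n. ((LINT x|M. F n x * h x) - (LINT x|M. f x * h x))\<^sup>2) \<longlonglongrightarrow> 0"
  proof (rule Lim_null_comparison)
    show "\<forall>\<^sub>F n in sequentially. norm (((LINT x|M. F n x * h x) - (LINT x|M. f x * h x))\<^sup>2) \<le> (LINT x|M. (F n x - f x)\<^sup>2) * (LINT x|M. (h x)\<^sup>2)"
    proof (rule always_eventually, rule allI)
      fix n
      have "(LINT x|M. F n x * h x) - (LINT x|M. f x * h x) = (LINT x|M. (F n x - f x) * h x)"
        using L2fun_prod[OF f(1)[of n] h] L2fun_prod[OF f(2) h] by (simp add: left_diff_distrib)
      then show "norm (((LINT x|M. F n x * h x) - (LINT x|M. f x * h x))\<^sup>2) \<le> (LINT x|M. (F n x - f x)\<^sup>2) * (LINT x|M. (h x)\<^sup>2)"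
        using Cauchy_Schwarz_integral[OF L2fun_diff[OF f(1)[of n] f(2)] h] by simp
    qed
    show "(\<lambda>n. (LINT x|M. (F n x - f x)\<^sup>2) * (LINT x|M. (h x)\<^sup>2)) \<longlonglongrightarrow> 0"
      using tendsto_mult[OF f(3) tendsto_const] by simp
  qed
  then have "(\<lambda>n. sqrt (((LINT x|M. F n x * h x) - (LINT x|M. f x * h x))\<^sup>2)) \<longlonglongrightarrow> sqrt 0" by (rule tendsto_real_sqrt)
  then have "(\<lambda>n. (LINT x|M. F n x * h x) - (LINT x|M. f x * h x)) \<longlonglongrightarrow> 0" by (simp add: tendsto_rabs_zero_iff)
  then show ?thesis by (rule Lim_null[THEN iffD2])
qed

lemma L2_lim_norm:
  assumes f: "\<And>n. L2fun M (F n)" "L2fun M f" "(\<lambda>n. LINT x|M. (F n x - f x)\<^sup>2) \<longlonglongrightarrow> 0"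
  shows "(\<lambda>n. LINT x|M. (F n x)\<^sup>2) \<longlonglongrightarrow> (LINT x|M. (f x)\<^sup>2)"
proof -
  have "(LINT x|M. (F n x)\<^sup>2) = (LINT x|M. (F n x - f x)\<^sup>2) + 2 * (LINT x|M. F n x * f x) - (LINT x|M. f x * f x)" for n
  proof -
    have "(LINT x|M. (F n x - f x)\<^sup>2) = (LINT x|M. (F n x)\<^sup>2 - 2 * (F n x * f x) + f x * f x)"
      by (simp add: power2_eq_square algebra_simps)
    also have "\<dots> = (LINT x|M. (F n x)\<^sup>2) - 2 * (LINT x|M. F n x * f x) + (LINT x|M. f x * f x)"
      using L2fun_int[OF f(1)[of n]] L2fun_prod[OF f(1)[of n] f(2)] L2fun_prod[OF f(2) f(2)] by simp
    finally show ?thesis by simp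
  qed
  moreover have "(\<lambda>n. (LINT x|M. (F n x - f x)\<^sup>2) + 2 * (LINT x|M. F n x * f x) - (LINT x|M. f x * f x))
     \<longlonglongrightarrow> 0 + 2 * (LINT x|M. f x * f x) - (LINT x|M. f x * f x)"
    by (intro tendsto_intros f(3) L2_lim_inner f(1,2))
  ultimately show ?thesis by (simp add: power2_eq_square)
qed

lemma finite_family_subsequence:
  fixes x :: "'i \<Rightarrow> nat \<Rightarrow> real"
  assumes "finite I" "\<And>i. i \<in> I \<Longrightarrow> bounded (range (x i))"
  shows "\<exists>r. strict_mono r \<and> (\<forall>i\<in>I. convergent (\<lambda>n. x i (r n)))"
  using assms
proof (induction I)
  case empty
  show ?case by (intro exI[of _ id]) (auto simp: strict_mono_def)
next
  case (insert j I)
  then obtain r where r: "strict_mono r" "\<forall>i\<in>I. convergent (\<lambda>n. x i (r n))" by auto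
  have "bounded (range (\<lambda>n. x j (r n)))"
    using insert.prems[of j] by (rule bounded_subset) auto
  then obtain l q where q: "strict_mono q" "((\<lambda>n. x j (r n)) \<circ> q) \<longlonglongrightarrow> l"
    using bounded_imp_convergent_subsequence by metis
  have "convergent (\<lambda>n. x i (r (q n)))" if "i \<in> I" for i
    using r(2) that convergent_subseq_convergent[OF _ q(1), of "\<lambda>n. x i (r n)"] by (auto simp: comp_def)
  moreover have "convergent (\<lambda>n. x j (r (q n)))" using q(2) by (auto simp: convergent_def comp_def)
  ultimately show ?case using strict_mono_o[OF r(1) q(1)]
    by (intro exI[of _ "r \<circ> q"]) (auto simp: comp_def)
qed

lemma quadratic_form_vertex:
  fixes p q :: real
  assumes "\<And>e. 0 \<le> 2 * e * p + e\<^sup>2 * q"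
  shows "p = 0"
proof (rule ccontr)
  assume p: "p \<noteq> 0"
  \<comment> \<open>\<open>Q\<close> is positive and at least \<open>q\<close> whatever the sign of
    \<open>q\<close>; then \<open>e = - p / Q\<close> makes the expression at most
    \<open>- p\<^sup>2 / Q\<close>.\<close>
  define Q where "Q = \<bar>q\<bar> + 1"
  have Q: "Q > 0" "q \<le> Q" by (auto simp: Q_def)
  have "0 \<le> 2 * (- p / Q) * p + (- p / Q)\<^sup>2 * q" by (rule assms)
  also have "\<dots> \<le> 2 * (- p / Q) * p + (- p / Q)\<^sup>2 * Q" using Q by (intro add_left_mono mult_left_mono) auto
  also have "\<dots> = - (p\<^sup>2 / Q)" using Q by (simp add: power2_eq_square)
  also have "\<dots> < 0" using p Q by simp
  finally show False by simp
qed

section \<open>Sobolev functions on the strip\<close>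

context strip_chart
begin

lemma rect_Q: "rect 0 A 0 B = Q"
  by (simp add: rect_def Q_def)

text \<open>The space \<open>W^{1,2}\<close> with Borel representatives and a gradient given by
  components; the passage from and to \<open>sobolev\<close> is made only after the analysis is
  complete.\<close>

definition sob :: "(plane \<Rightarrow> real) \<Rightarrow> (plane \<Rightarrow> real) \<Rightarrow> (plane \<Rightarrow> real) \<Rightarrow> bool" where
  "sob u g1 g2 \<longleftrightarrow> L2fun (onm D) u \<and> L2fun (onm D) g1 \<and> L2fun (onm D) g2 \<and>
     (\<forall>\<phi>. test_function D \<phi> \<longrightarrow> (LINT z|onm D. u z * partial_deriv (1,0) \<phi> z) = - (LINT z|onm D. g1 z * \<phi> z)
        \<and> (LINT z|onm D. u z * partial_deriv (0,1) \<phi> z) = - (LINT z|onm D. g2 z * \<phi> z))"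

definition energy :: "(plane \<Rightarrow> real) \<Rightarrow> (plane \<Rightarrow> real) \<Rightarrow> real" where
  "energy g1 g2 = (LINT z|onm D. (g1 z)\<^sup>2 + (g2 z)\<^sup>2)"

lemma sob_L2: "sob u g1 g2 \<Longrightarrow> L2fun (onm D) u" "sob u g1 g2 \<Longrightarrow> L2fun (onm D) g1" "sob u g1 g2 \<Longrightarrow> L2fun (onm D) g2"
  by (auto simp: sob_def)

lemma sob_weak:
  assumes "sob u g1 g2" "test_function D \<phi>"
  shows "(LINT z|onm D. u z * partial_deriv (1,0) \<phi> z) = - (LINT z|onm D. g1 z * \<phi> z)"
    "(LINT z|onm D. u z * partial_deriv (0,1) \<phi> z) = - (LINT z|onm D. g2 z * \<phi> z)"
  using assms unfolding sob_def by blast+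

text \<open>The factor 2 comes from squaring a sum of two components, the division by
  \<open>c\<close> from passing to \<open>D\<close> with a Jacobian at least
  \<open>c\<close>.\<close>

lemma pull_L2:
  assumes g: "L2fun (onm D) g1" "L2fun (onm D) g2" and P: "P \<in> borel_measurable borel" "\<And>z. norm (P z) \<le> C"
  shows "L2fun (onm Q) (pull P g1 g2)" "(LINT z|onm Q. (pull P g1 g2 z)\<^sup>2) \<le> 2 * C\<^sup>2 / c * energy g1 g2"
proof -
  have b: "\<bar>fst (P z)\<bar> \<le> C" "\<bar>snd (P z)\<bar> \<le> C" for z
    using P(2)[of z] norm_fst_le[of "fst (P z)" "snd (P z)"] norm_snd_le[of "snd (P z)" "fst (P z)"] by auto
  have m: "(\<lambda>z. fst (P z)) \<in> borel_measurable borel" "(\<lambda>z. snd (P z)) \<in> borel_measurable borel"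
    by (intro plane_components_measurable P)+
  have "L2fun (onm Q) (\<lambda>z. fst (P z) * g1 (\<Psi> z))"
    by (rule L2fun_bounded_mult[OF L2fun_chart(1)[OF g(1)] _ b(1)]) (use m in measurable)
  moreover have "L2fun (onm Q) (\<lambda>z. snd (P z) * g2 (\<Psi> z))"
    by (rule L2fun_bounded_mult[OF L2fun_chart(1)[OF g(2)] _ b(2)]) (use m in measurable)
  ultimately have "L2fun (onm Q) (\<lambda>z. fst (P z) * g1 (\<Psi> z) + snd (P z) * g2 (\<Psi> z))"
    by (rule L2fun_add)
  then show L: "L2fun (onm Q) (pull P g1 g2)" by (simp add: pull_def[abs_def] mult.commute)
  have gi: "integrable (onm D) (\<lambda>z. (g1 z)\<^sup>2 + (g2 z)\<^sup>2)" using g by (auto simp: L2fun_def)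
  have le: "(pull P g1 g2 z)\<^sup>2 \<le> 2 * C\<^sup>2 * \<bar>(g1 (\<Psi> z))\<^sup>2 + (g2 (\<Psi> z))\<^sup>2\<bar>" for z
  proof -
    have "\<bar>pull P g1 g2 z\<bar> \<le> \<bar>C * (\<bar>g1 (\<Psi> z)\<bar> + \<bar>g2 (\<Psi> z)\<bar>)\<bar>"
      using pull_bound[of P, OF P(2)] by (rule order_trans) simp
    then have "(pull P g1 g2 z)\<^sup>2 \<le> (C * (\<bar>g1 (\<Psi> z)\<bar> + \<bar>g2 (\<Psi> z)\<bar>))\<^sup>2" by (simp only: abs_le_square_iff)
    also have "\<dots> = C\<^sup>2 * (\<bar>g1 (\<Psi> z)\<bar> + \<bar>g2 (\<Psi> z)\<bar>)\<^sup>2" by (rule power_mult_distrib)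
    also have "\<dots> \<le> C\<^sup>2 * (2 * ((g1 (\<Psi> z))\<^sup>2 + (g2 (\<Psi> z))\<^sup>2))"
    proof (rule mult_left_mono)
      have "0 \<le> (\<bar>g1 (\<Psi> z)\<bar> - \<bar>g2 (\<Psi> z)\<bar>)\<^sup>2" by simp
      then show "(\<bar>g1 (\<Psi> z)\<bar> + \<bar>g2 (\<Psi> z)\<bar>)\<^sup>2 \<le> 2 * ((g1 (\<Psi> z))\<^sup>2 + (g2 (\<Psi> z))\<^sup>2)"
        unfolding power2_sum power2_diff by simp
    qed simp
    finally show ?thesis by (simp add: algebra_simps)
  qed
  have "(LINT z|onm Q. (pull P g1 g2 z)\<^sup>2) \<le> (LINT z|onm Q. 2 * C\<^sup>2 * \<bar>(g1 (\<Psi> z))\<^sup>2 + (g2 (\<Psi> z))\<^sup>2\<bar>)"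
    by (rule integral_mono) (use L2fun_int[OF L] integrable_chart(1)[OF gi] le in auto)
  also have "\<dots> = 2 * C\<^sup>2 * (LINT z|onm Q. \<bar>(g1 (\<Psi> z))\<^sup>2 + (g2 (\<Psi> z))\<^sup>2\<bar>)" by simp
  also have "\<dots> \<le> 2 * C\<^sup>2 * ((LINT z|onm D. \<bar>(g1 z)\<^sup>2 + (g2 z)\<^sup>2\<bar>) / c)"
    by (rule mult_left_mono[OF integrable_chart(2)[OF gi]]) simp
  finally show "(LINT z|onm Q. (pull P g1 g2 z)\<^sup>2) \<le> 2 * C\<^sup>2 / c * energy g1 g2" by (simp add: energy_def)
qed

lemma sob_integrable: "sob u g1 g2 \<Longrightarrow> integrable (onm D) u" "sob u g1 g2 \<Longrightarrow> integrable (onm D) g1" "sob u g1 g2 \<Longrightarrow> integrable (onm D) g2"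
  using sob_L2 fD.L2fun_integrable by blast+

lemma sob_ac:
  assumes s: "sob u g1 g2"
  shows "ac_rect 0 A 0 B (\<lambda>z. u (\<Psi> z)) (pull P1 g1 g2) (pull P2 g1 g2)"
  unfolding ac_rect_def rect_Q
  using L2fun_chart(1)[OF sob_L2(1)[OF s]] pull_L2(1)[OF sob_L2(2,3)[OF s] P1m P_bound(1)]
    pull_L2(1)[OF sob_L2(2,3)[OF s] P2m P_bound(2)]
    weak_imp_acs[OF sob_integrable[OF s] sob_weak[OF s]] weak_imp_act[OF sob_integrable[OF s] sob_weak[OF s]]
  by simp

lemma sob_from_ac:
  assumes L: "L2fun (onm D) u" "L2fun (onm D) g1" "L2fun (onm D) g2"
    and acs: "AE t in onm {0<..<B}. w11 0 A (\<lambda>s. u (\<Psi> (s,t))) (\<lambda>s. pull P1 g1 g2 (s,t))"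
    and act: "AE s in onm {0<..<A}. w11 0 B (\<lambda>t. u (\<Psi> (s,t))) (\<lambda>t. pull P2 g1 g2 (s,t))"
  shows "sob u g1 g2"
  unfolding sob_def using L ac_imp_weak[OF L2fun_onm_borel[OF L(1)] L[THEN fD.L2fun_integrable] acs act] by blast

lemma sob_lincomb:
  assumes s: "sob u g1 g2" "sob v h1 h2"
  shows "sob (\<lambda>z. p * u z + q * v z) (\<lambda>z. p * g1 z + q * h1 z) (\<lambda>z. p * g2 z + q * h2 z)"
  unfolding sob_def
proof (intro conjI allI impI)
  show "L2fun (onm D) (\<lambda>z. p * u z + q * v z)" "L2fun (onm D) (\<lambda>z. p * g1 z + q * h1 z)" "L2fun (onm D) (\<lambda>z. p * g2 z + q * h2 z)"
    by (intro L2fun_add L2fun_cmult; use s in \<open>simp add: sob_def\<close>)+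
  fix \<phi> assume tf: "test_function D \<phi>"
  obtain M where \<phi>: "continuous_on UNIV \<phi>" "continuous_on UNIV (partial_deriv (1,0) \<phi>)" "continuous_on UNIV (partial_deriv (0,1) \<phi>)"
    "\<And>z. \<bar>\<phi> z\<bar> \<le> M" "\<And>z. \<bar>partial_deriv (1,0) \<phi> z\<bar> \<le> M" "\<And>z. \<bar>partial_deriv (0,1) \<phi> z\<bar> \<le> M"
    using test_function_C1[OF tf] by metis
  have L: "L2fun (onm D) \<phi>" "L2fun (onm D) (partial_deriv (1,0) \<phi>)" "L2fun (onm D) (partial_deriv (0,1) \<phi>)"
    using \<phi> by (auto intro!: fD.L2fun_bounded[where K=M] borel_measurable_continuous_onI simp: measurable_cong_sets[OF sets_onm refl])
  have lin: "(LINT z|onm D. (p * f z + q * g z) * h z) = p * (LINT z|onm D. f z * h z) + q * (LINT z|onm D. g z * h z)"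
    if "L2fun (onm D) f" "L2fun (onm D) g" "L2fun (onm D) h" for f g h
    using L2fun_prod[OF that(1,3)] L2fun_prod[OF that(2,3)] by (simp add: distrib_right mult.assoc)
  show "(LINT z|onm D. (p * u z + q * v z) * partial_deriv (1,0) \<phi> z) = - (LINT z|onm D. (p * g1 z + q * h1 z) * \<phi> z)"
       "(LINT z|onm D. (p * u z + q * v z) * partial_deriv (0,1) \<phi> z) = - (LINT z|onm D. (p * g2 z + q * h2 z) * \<phi> z)"
    using sob_weak[OF s(1) tf] sob_weak[OF s(2) tf] sob_L2[OF s(1)] sob_L2[OF s(2)] L by (simp_all add: lin)
qed

lemma sob_const: "sob (\<lambda>z. k) (\<lambda>z. 0) (\<lambda>z. 0)"
proof (rule sob_from_ac)
  have "w11 a b (\<lambda>_. k) (\<lambda>_. 0)" for a b by (rule w11_I[where c=k]) (auto simp: prim_def)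
  then show "AE t in onm {0<..<B}. w11 0 A (\<lambda>s. k) (\<lambda>s. pull P1 (\<lambda>z. 0) (\<lambda>z. 0) (s,t))"
    "AE s in onm {0<..<A}. w11 0 B (\<lambda>t. k) (\<lambda>t. pull P2 (\<lambda>z. 0) (\<lambda>z. 0) (s,t))"
    by (simp_all add: pull_def)
qed (rule fD.L2fun_const)+

text \<open>The weak formulation consists of inner products with fixed bounded functions, so it is
  stable under \<open>L^2\<close> convergence of the functions and their gradients.\<close>

lemma sob_limit:
  assumes s: "\<And>n. sob (U n) (G1 n) (G2 n)" and L: "L2fun (onm D) u" "L2fun (onm D) g1" "L2fun (onm D) g2"
    and c: "(\<lambda>n. LINT z|onm D. (U n z - u z)\<^sup>2) \<longlonglongrightarrow> 0" "(\<lambda>n. LINT z|onm D. (G1 n z - g1 z)\<^sup>2) \<longlonglongrightarrow> 0" "(\<lambda>n. LINT z|onm D. (G2 n z - g2 z)\<^sup>2) \<longlonglongrightarrow> 0"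
  shows "sob u g1 g2"
  unfolding sob_def
proof (intro conjI allI impI L)
  fix \<phi> assume tf: "test_function D \<phi>"
  obtain M where \<phi>: "continuous_on UNIV \<phi>" "continuous_on UNIV (partial_deriv (1,0) \<phi>)" "continuous_on UNIV (partial_deriv (0,1) \<phi>)"
    "\<And>z. \<bar>\<phi> z\<bar> \<le> M" "\<And>z. \<bar>partial_deriv (1,0) \<phi> z\<bar> \<le> M" "\<And>z. \<bar>partial_deriv (0,1) \<phi> z\<bar> \<le> M"
    using test_function_C1[OF tf] by metis
  have L\<phi>: "L2fun (onm D) \<phi>" "L2fun (onm D) (partial_deriv (1,0) \<phi>)" "L2fun (onm D) (partial_deriv (0,1) \<phi>)"
    using \<phi> by (auto intro!: fD.L2fun_bounded[where K=M] borel_measurable_continuous_onI simp: measurable_cong_sets[OF sets_onm refl])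
  note lu = L2_lim_inner[OF sob_L2(1)[OF s] L(1) c(1)]
  note l1 = L2_lim_inner[OF sob_L2(2)[OF s] L(2) c(2)]
  note l2 = L2_lim_inner[OF sob_L2(3)[OF s] L(3) c(3)]
  have "(\<lambda>n. LINT z|onm D. U n z * partial_deriv (1,0) \<phi> z) \<longlonglongrightarrow> - (LINT z|onm D. g1 z * \<phi> z)"
    unfolding sob_weak(1)[OF s tf] by (intro tendsto_minus l1 L\<phi>)
  from LIMSEQ_unique[OF lu[OF L\<phi>(2)] this]
  show "(LINT z|onm D. u z * partial_deriv (1,0) \<phi> z) = - (LINT z|onm D. g1 z * \<phi> z)" .
  have "(\<lambda>n. LINT z|onm D. U n z * partial_deriv (0,1) \<phi> z) \<longlonglongrightarrow> - (LINT z|onm D. g2 z * \<phi> z)"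
    unfolding sob_weak(2)[OF s tf] by (intro tendsto_minus l2 L\<phi>)
  from LIMSEQ_unique[OF lu[OF L\<phi>(3)] this]
  show "(LINT z|onm D. u z * partial_deriv (0,1) \<phi> z) = - (LINT z|onm D. g2 z * \<phi> z)" .
qed

lemma integral_D_le:
  assumes "L2fun (onm D) u"
  shows "(LINT z|onm D. (u z)\<^sup>2) \<le> C' * (LINT z|onm Q. (u (\<Psi> z))\<^sup>2)"
proof -
  have [measurable]: "u \<in> borel_measurable borel" using assms by (rule L2fun_onm_borel)
  have i: "integrable (onm Q) (\<lambda>z. J z * (u (\<Psi> z))\<^sup>2)"
    using integral_D(2)[of "\<lambda>z. (u z)\<^sup>2"] L2fun_int[OF assms] by simp
  have "(LINT z|onm D. (u z)\<^sup>2) = (LINT z|onm Q. J z * (u (\<Psi> z))\<^sup>2)" by (rule integral_D(1)) simp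
  also have "\<dots> \<le> (LINT z|onm Q. C' * (u (\<Psi> z))\<^sup>2)"
  proof (rule integral_mono_AE[OF i])
    show "AE z in onm Q. J z * (u (\<Psi> z))\<^sup>2 \<le> C' * (u (\<Psi> z))\<^sup>2"
      using AE_onm_mem[OF Q_sets] by eventually_elim (use J_up in \<open>auto simp: Q_def intro!: mult_right_mono\<close>)
  qed (use L2fun_int[OF L2fun_chart(1)[OF assms]] in simp)
  finally show ?thesis by simp
qed

lemma C'_pos: "C' > 0"
proof -
  have "(A/2, B/2) \<in> {0<..<A} \<times> {0<..<B}" using AB by auto
  then show ?thesis using J_low[of "(A/2,B/2)"] J_up[of "(A/2,B/2)"] c_pos by linarith
qed

lemma finite_rank_D:
  assumes \<theta>: "\<theta> > 0"
  shows "\<exists>\<F> K. finite \<F> \<and> 0 \<le> K \<and> (\<forall>R\<in>\<F>. R \<in> sets borel \<and> R \<subseteq> Q) \<and>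
     (\<forall>u g1 g2. sob u g1 g2 \<longrightarrow> (LINT z|onm D. (u z)\<^sup>2) \<le> K * (\<Sum>R\<in>\<F>. (LINT z|onm R. u (\<Psi> z))\<^sup>2) + \<theta> * energy g1 g2)"
proof -
  \<comment> \<open>\<open>C'\<close> is the cost of returning from the rectangle to
    \<open>D\<close>, and \<open>4 * C\<^sup>2 / c\<close> that of the two pulled-back derivatives.
    The \<open>+ 1\<close> keeps the divisor positive.\<close>
  define \<epsilon> where "\<epsilon> = \<theta> / (C' * (4 * C\<^sup>2 / c + 1))"
  have pp: "4 * C\<^sup>2 / c + 1 > 0" using c_pos by (intro add_nonneg_pos) auto
  have \<epsilon>: "\<epsilon> > 0" unfolding \<epsilon>_def using \<theta> C'_pos pp by (intro divide_pos_pos mult_pos_pos)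
  have \<epsilon>2: "C' * \<epsilon> * (4 * C\<^sup>2 / c) \<le> \<theta>"
  proof -
    have "C' * \<epsilon> * (4 * C\<^sup>2 / c) \<le> C' * \<epsilon> * (4 * C\<^sup>2 / c + 1)" using C'_pos \<epsilon> by (intro mult_left_mono) auto
    also have "\<dots> = \<theta>" unfolding \<epsilon>_def using C'_pos pp by simp
    finally show ?thesis .
  qed
  obtain F K where F: "finite F" "0 \<le> K" "\<forall>R\<in>F. R \<in> sets borel \<and> R \<subseteq> Q"
    "\<And>U G1 G2. ac_rect 0 A 0 B U G1 G2 \<Longrightarrow>
       (LINT z|onm Q. (U z)\<^sup>2) \<le> K * (\<Sum>R\<in>F. (LINT z|onm R. U z)\<^sup>2) + \<epsilon> * (LINT z|onm Q. (G1 z)\<^sup>2 + (G2 z)\<^sup>2)"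
    using finite_rank_poincare_eps[OF AB \<epsilon>] unfolding finite_rank_poincare_def rect_Q by blast
  have "(LINT z|onm D. (u z)\<^sup>2) \<le> (C' * K) * (\<Sum>R\<in>F. (LINT z|onm R. u (\<Psi> z))\<^sup>2) + \<theta> * energy g1 g2" if s: "sob u g1 g2" for u g1 g2
  proof -
    note L = sob_L2[OF s]
    note p1 = pull_L2[OF L(2,3) P1m P_bound(1)] and p2 = pull_L2[OF L(2,3) P2m P_bound(2)]
    have "(LINT z|onm Q. (pull P1 g1 g2 z)\<^sup>2 + (pull P2 g1 g2 z)\<^sup>2) \<le> 4 * C\<^sup>2 / c * energy g1 g2"
      using p1 p2 by (simp add: L2fun_def)
    then have "\<epsilon> * (LINT z|onm Q. (pull P1 g1 g2 z)\<^sup>2 + (pull P2 g1 g2 z)\<^sup>2) \<le> \<epsilon> * (4 * C\<^sup>2 / c * energy g1 g2)"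
      using \<epsilon> by (intro mult_left_mono) auto
    then have "(LINT z|onm Q. (u (\<Psi> z))\<^sup>2) \<le> K * (\<Sum>R\<in>F. (LINT z|onm R. u (\<Psi> z))\<^sup>2) + \<epsilon> * (4 * C\<^sup>2 / c * energy g1 g2)"
      using F(4)[OF sob_ac[OF s]] by linarith
    then have "C' * (LINT z|onm Q. (u (\<Psi> z))\<^sup>2) \<le> C' * (K * (\<Sum>R\<in>F. (LINT z|onm R. u (\<Psi> z))\<^sup>2) + \<epsilon> * (4 * C\<^sup>2 / c * energy g1 g2))"
      using C'_pos by (intro mult_left_mono) auto
    also have "\<dots> = (C' * K) * (\<Sum>R\<in>F. (LINT z|onm R. u (\<Psi> z))\<^sup>2) + C' * \<epsilon> * (4 * C\<^sup>2 / c) * energy g1 g2"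
      by (simp only: distrib_left mult.assoc)
    also have "\<dots> \<le> (C' * K) * (\<Sum>R\<in>F. (LINT z|onm R. u (\<Psi> z))\<^sup>2) + \<theta> * energy g1 g2"
      using \<epsilon>2 by (intro add_left_mono mult_right_mono) (auto simp: energy_def intro!: integral_nonneg_AE)
    finally show ?thesis using integral_D_le[OF L(1)] by linarith
  qed
  then show ?thesis using F(1-3) C'_pos by (intro exI[of _ F] exI[of _ "C' * K"]) auto
qed

lemma energy_nonneg: "0 \<le> energy g1 g2"
  unfolding energy_def by (rule integral_nonneg_AE) simp

lemma energy_split: "sob u g1 g2 \<Longrightarrow> energy g1 g2 = (LINT z|onm D. (g1 z)\<^sup>2) + (LINT z|onm D. (g2 z)\<^sup>2)"
  unfolding energy_def by (simp add: sob_def L2fun_def)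

text \<open>For a minimizing sequence the parallelogram identity bounds the energy of differences by
  their \<open>L\<^sup>2\<close> norm, so the Poincare inequality modulo finitely many functionals, with a single
  fixed small parameter, already gives a Cauchy subsequence.\<close>

theorem minimizer_exists:
  assumes ne: "\<exists>u g1 g2. sob u g1 g2 \<and> (LINT z|onm D. u z) = 0 \<and> (LINT z|onm D. (u z)\<^sup>2) = 1"
  obtains u g1 g2 where "sob u g1 g2" "(LINT z|onm D. u z) = 0" "(LINT z|onm D. (u z)\<^sup>2) = 1"
    "\<And>v h1 h2. sob v h1 h2 \<Longrightarrow> (LINT z|onm D. v z) = 0 \<Longrightarrow> energy g1 g2 * (LINT z|onm D. (v z)\<^sup>2) \<le> energy h1 h2"
proof -
  define V where "V = {energy g1 g2 |u g1 g2. sob u g1 g2 \<and> (LINT z|onm D. u z) = 0 \<and> (LINT z|onm D. (u z)\<^sup>2) = 1}"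
  define \<mu> where "\<mu> = Inf V"
  have Vne: "V \<noteq> {}" using ne by (auto simp: V_def)
  have Vbd: "bdd_below V" by (rule bdd_belowI[of _ 0]) (auto simp: V_def energy_nonneg)
  have \<mu>0: "\<mu> \<ge> 0" unfolding \<mu>_def by (rule cInf_greatest[OF Vne]) (auto simp: V_def energy_nonneg)
  have low: "\<mu> * (LINT z|onm D. (v z)\<^sup>2) \<le> energy h1 h2" if v: "sob v h1 h2" "(LINT z|onm D. v z) = 0" for v h1 h2
  proof (cases "(LINT z|onm D. (v z)\<^sup>2) = 0")
    case False
    define b where "b = (LINT z|onm D. (v z)\<^sup>2)"
    have b: "b > 0" unfolding b_def using False by (simp add: less_le)
    define k where "k = inverse (sqrt b)"
    have k: "k\<^sup>2 * b = 1" "k\<^sup>2 = inverse b" using b by (auto simp: k_def power_inverse)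
    have s: "sob (\<lambda>z. k * v z) (\<lambda>z. k * h1 z) (\<lambda>z. k * h2 z)" using sob_lincomb[OF v(1) v(1), of k 0] by simp
    have ee: "energy (\<lambda>z. k * h1 z) (\<lambda>z. k * h2 z) = k\<^sup>2 * energy h1 h2"
      unfolding energy_def by (simp add: power_mult_distrib flip: distrib_left)
    have "(LINT z|onm D. (k * v z)\<^sup>2) = 1" using k(1) by (simp add: b_def power_mult_distrib)
    moreover have "(LINT z|onm D. k * v z) = 0" using v(2) by simp
    ultimately have "energy (\<lambda>z. k * h1 z) (\<lambda>z. k * h2 z) \<in> V" unfolding V_def using s by blast
    then have "k\<^sup>2 * energy h1 h2 \<in> V" by (simp only: ee)
    then have "\<mu> \<le> k\<^sup>2 * energy h1 h2" unfolding \<mu>_def by (rule cInf_lower[OF _ Vbd])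
    then have "\<mu> * b \<le> energy h1 h2" unfolding k(2) using b by (simp add: field_simps)
    then show ?thesis unfolding b_def .
  qed (simp add: energy_nonneg)
  have "\<exists>u g1 g2. sob u g1 g2 \<and> (LINT z|onm D. u z) = 0 \<and> (LINT z|onm D. (u z)\<^sup>2) = 1 \<and> energy g1 g2 < \<mu> + inverse (real (Suc n))" for n
  proof -
    have "\<mu> < \<mu> + inverse (real (Suc n))" by simp
    then obtain y where "y \<in> V" "y < \<mu> + inverse (real (Suc n))" unfolding \<mu>_def using cInf_lessD[OF Vne] by blast
    then show ?thesis by (auto simp: V_def)
  qed
  then obtain U G1 G2 where S: "\<And>n. sob (U n) (G1 n) (G2 n)" "\<And>n. (LINT z|onm D. U n z) = 0"
    "\<And>n. (LINT z|onm D. (U n z)\<^sup>2) = 1" "\<And>n. energy (G1 n) (G2 n) < \<mu> + inverse (real (Suc n))"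
    by metis
  \<comment> \<open>Chosen so that \<open>\<mu> * \<theta> \<le> 1 / 2\<close>: this will allow half
    of the energy of a difference to be absorbed.\<close>
  define \<theta> where "\<theta> = 1 / (2 * (\<mu> + 1))"
  have \<theta>: "\<theta> > 0" "\<theta> \<le> 1" "\<mu> * \<theta> \<le> 1 / 2" using \<mu>0 by (auto simp: \<theta>_def field_simps)
  obtain F K where F: "finite F" "0 \<le> K" "\<forall>R\<in>F. R \<in> sets borel \<and> R \<subseteq> Q"
    "\<And>u g1 g2. sob u g1 g2 \<Longrightarrow> (LINT z|onm D. (u z)\<^sup>2) \<le> K * (\<Sum>R\<in>F. (LINT z|onm R. u (\<Psi> z))\<^sup>2) + \<theta> * energy g1 g2"
    using finite_rank_D[OF \<theta>(1)] by blast
  define x where "x R n = (LINT z|onm R. U n (\<Psi> z))" for R n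
  have UQ: "integrable (onm R) (\<lambda>z. U n (\<Psi> z))" if "R \<in> F" for R n
    by (rule onm_subset_integrable[OF integrable_chart(1)[OF sob_integrable(1)[OF S(1)]] _ Q_sets]) (use F(3) that in auto)
  have xb: "bounded (range (x R))" if R: "R \<in> F" for R
  proof -
    have "\<bar>x R n\<bar> \<le> (measure (onm D) UNIV + 1) / c" for n
    proof -
      have RQ: "R \<in> sets borel" "R \<subseteq> Q" using F(3) R by auto
      note i = integrable_chart[OF sob_integrable(1)[OF S(1)[of n]]]
      have [measurable]: "(\<lambda>z. U n (\<Psi> z)) \<in> borel_measurable borel" using i(1) by (rule integrable_onm_borel)
      have "\<bar>x R n\<bar> \<le> (LINT z|onm R. \<bar>U n (\<Psi> z)\<bar>)" unfolding x_def by (rule integral_abs_bound)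
      also have "\<dots> \<le> (LINT z|onm Q. \<bar>U n (\<Psi> z)\<bar>)"
        using integrable_abs[OF UQ[OF R, of n]] integrable_abs[OF i(1)] RQ
        by (auto simp: integral_onm integrable_onm intro!: integral_mono split: split_indicator)
      also have "\<dots> \<le> (LINT z|onm D. \<bar>U n z\<bar>) / c" by (rule i(2))
      also have "\<dots> \<le> (measure (onm D) UNIV + 1) / c"
      proof (rule divide_right_mono)
        have L: "L2fun (onm D) (\<lambda>z. \<bar>U n z\<bar>)" using sob_L2(1)[OF S(1)[of n]] by (auto simp: L2fun_def)
        have "(LINT z|onm D. \<bar>U n z\<bar>) \<le> (LINT z|onm D. 1 + (U n z)\<^sup>2)"
        proof (rule integral_mono)
          show "\<bar>U n z\<bar> \<le> 1 + (U n z)\<^sup>2" for z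
          proof (cases "\<bar>U n z\<bar> \<le> 1")
            case False
            then have "\<bar>U n z\<bar> * 1 \<le> \<bar>U n z\<bar> * \<bar>U n z\<bar>" by (intro mult_left_mono) auto
            then show ?thesis by (simp add: power2_eq_square)
          qed (simp add: add_increasing2)
        qed (use fD.L2fun_integrable[OF L] L2fun_int[OF sob_L2(1)[OF S(1)[of n]]] in auto)
        also have "\<dots> = measure (onm D) UNIV + 1" using L2fun_int[OF sob_L2(1)[OF S(1)[of n]]] S(3) by simp
        finally show "(LINT z|onm D. \<bar>U n z\<bar>) \<le> measure (onm D) UNIV + 1" .
      qed (use c_pos in simp)
      finally show ?thesis .
    qed
    then show ?thesis by (auto simp: bounded_iff)
  qed
  obtain r where r: "strict_mono r" "\<forall>R\<in>F. convergent (\<lambda>n. x R (r n))"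
    using finite_family_subsequence[OF F(1), of x] xb by blast
  then obtain l where l: "\<And>R. R \<in> F \<Longrightarrow> (\<lambda>n. x R (r n)) \<longlonglongrightarrow> l R" unfolding convergent_def by metis
  define T where "T n = (\<Sum>R\<in>F. 2 * (x R (r n) - l R)\<^sup>2)" for n
  have T0: "T \<longlonglongrightarrow> 0"
  proof -
    have "T \<longlonglongrightarrow> (\<Sum>R\<in>F. 2 * (l R - l R)\<^sup>2)" unfolding T_def by (intro tendsto_intros l)
    then show ?thesis by simp
  qed
  define e where "e n = energy (G1 (r n)) (G2 (r n)) - \<mu>" for n
  have e: "0 \<le> e n" "e n \<le> inverse (real (Suc n))" for n
  proof -
    show "0 \<le> e n" using low[OF S(1) S(2), of "r n"] S(3)[of "r n"] by (simp add: e_def)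
    have "inverse (real (Suc (r n))) \<le> inverse (real (Suc n))" using seq_suble[OF r(1), of n] by (simp add: field_simps)
    then show "e n \<le> inverse (real (Suc n))" using S(4)[of "r n"] unfolding e_def by linarith
  qed
  have e0: "e \<longlonglongrightarrow> 0"
    by (rule tendsto_sandwich[OF _ _ tendsto_const LIMSEQ_inverse_real_of_nat]) (use e in auto)
  \<comment> \<open>The common bound for the squared norm and the energy of differences: the terms
    with \<open>T n\<close> come from the functionals, whose values converge along the subsequence,
    and \<open>e n\<close> is the excess of energy over the infimum.\<close>
  define X where "X n = K * T n + 4 * e n + 2 * \<mu> * (K * T n)" for n
  have X0: "X \<longlonglongrightarrow> 0"
  proof -
    have "X \<longlonglongrightarrow> K * 0 + 4 * 0 + 2 * \<mu> * (K * 0)" unfolding X_def by (intro tendsto_intros T0 e0)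
    then show ?thesis by simp
  qed
  have diff: "(LINT z|onm D. (U (r n) z - U (r m) z)\<^sup>2) \<le> X n + X m"
    "energy (\<lambda>z. G1 (r n) z - G1 (r m) z) (\<lambda>z. G2 (r n) z - G2 (r m) z) \<le> X n + X m" for n m
  proof -
    define b where "b = (LINT z|onm D. (U (r n) z - U (r m) z)\<^sup>2)"
    define E where "E = energy (\<lambda>z. G1 (r n) z - G1 (r m) z) (\<lambda>z. G2 (r n) z - G2 (r m) z)"
    have sd: "sob (\<lambda>z. U (r n) z - U (r m) z) (\<lambda>z. G1 (r n) z - G1 (r m) z) (\<lambda>z. G2 (r n) z - G2 (r m) z)"
      using sob_lincomb[OF S(1)[of "r n"] S(1)[of "r m"], of 1 "-1"] by simp
    have ss: "sob (\<lambda>z. U (r n) z + U (r m) z) (\<lambda>z. G1 (r n) z + G1 (r m) z) (\<lambda>z. G2 (r n) z + G2 (r m) z)"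
      using sob_lincomb[OF S(1)[of "r n"] S(1)[of "r m"], of 1 1] by simp
    have par: "(LINT z|onm D. (f z - g z)\<^sup>2) = 2 * (LINT z|onm D. (f z)\<^sup>2) + 2 * (LINT z|onm D. (g z)\<^sup>2) - (LINT z|onm D. (f z + g z)\<^sup>2)"
      if "L2fun (onm D) f" "L2fun (onm D) g" for f g
    proof -
      have "(\<lambda>z. (f z - g z)\<^sup>2) = (\<lambda>z. 2 * (f z)\<^sup>2 + 2 * (g z)\<^sup>2 - (f z + g z)\<^sup>2)"
        by (auto simp: power2_sum power2_diff)
      then show ?thesis using L2fun_int[OF that(1)] L2fun_int[OF that(2)] L2fun_int[OF L2fun_add[OF that]] by simp
    qed
    have b4: "b = 4 - (LINT z|onm D. (U (r n) z + U (r m) z)\<^sup>2)"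
      unfolding b_def using par[OF sob_L2(1)[OF S(1)] sob_L2(1)[OF S(1)], of "r n" "r m"] S(3) by simp
    have "E = 2 * energy (G1 (r n)) (G2 (r n)) + 2 * energy (G1 (r m)) (G2 (r m)) - energy (\<lambda>z. G1 (r n) z + G1 (r m) z) (\<lambda>z. G2 (r n) z + G2 (r m) z)"
      unfolding E_def energy_split[OF sd] energy_split[OF ss] energy_split[OF S(1)]
      using par[OF sob_L2(2)[OF S(1)] sob_L2(2)[OF S(1)], of "r n" "r m"] par[OF sob_L2(3)[OF S(1)] sob_L2(3)[OF S(1)], of "r n" "r m"] by simp
    \<comment> \<open>The sum of two members of the sequence has mean value zero again, and by the
      parallelogram identity its squared norm is \<open>4 - b\<close>, so the infimum bounds its
      energy from below.\<close>
    moreover have "\<mu> * (4 - b) \<le> energy (\<lambda>z. G1 (r n) z + G1 (r m) z) (\<lambda>z. G2 (r n) z + G2 (r m) z)"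
    proof -
      have "(LINT z|onm D. U (r n) z + U (r m) z) = 0" using sob_integrable(1)[OF S(1)] S(2) by simp
      from low[OF ss this] show ?thesis unfolding b4 by simp
    qed
    ultimately have E1: "E \<le> 2 * e n + 2 * e m + \<mu> * b" by (simp add: e_def algebra_simps)
    have SS: "(\<Sum>R\<in>F. (LINT z|onm R. U (r n) (\<Psi> z) - U (r m) (\<Psi> z))\<^sup>2) \<le> T n + T m"
      unfolding T_def sum.distrib[symmetric]
    proof (rule sum_mono)
      fix R assume R: "R \<in> F"
      have eq: "(LINT z|onm R. U (r n) (\<Psi> z) - U (r m) (\<Psi> z)) = (x R (r n) - l R) - (x R (r m) - l R)"
        using UQ[OF R] by (simp add: x_def)
      have sq: "(p - q)\<^sup>2 \<le> 2 * p\<^sup>2 + 2 * q\<^sup>2" for p q :: real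
        using zero_le_power2[of "p + q"] by (simp add: power2_sum power2_diff)
      show "(LINT z|onm R. U (r n) (\<Psi> z) - U (r m) (\<Psi> z))\<^sup>2 \<le> 2 * (x R (r n) - l R)\<^sup>2 + 2 * (x R (r m) - l R)\<^sup>2"
        unfolding eq by (rule sq)
    qed
    have "b \<le> K * (T n + T m) + \<theta> * E"
      using F(4)[OF sd] mult_left_mono[OF SS F(2)] unfolding b_def E_def by linarith
    then have b1: "\<mu> * b \<le> \<mu> * (K * (T n + T m)) + (\<mu> * \<theta>) * E" and b2: "b \<le> K * (T n + T m) + E"
    proof -
      assume *: "b \<le> K * (T n + T m) + \<theta> * E"
      have E0: "E \<ge> 0" unfolding E_def by (rule energy_nonneg)
      show "\<mu> * b \<le> \<mu> * (K * (T n + T m)) + (\<mu> * \<theta>) * E" using mult_left_mono[OF * \<mu>0] by (simp add: algebra_simps)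
      show "b \<le> K * (T n + T m) + E" using * mult_right_mono[OF \<theta>(2) E0] by simp
    qed
    have E0: "E \<ge> 0" unfolding E_def by (rule energy_nonneg)
    \<comment> \<open>Since \<open>\<mu> * \<theta> \<le> 1 / 2\<close>, the bound \<open>E1\<close>
      contains at most half of \<open>E\<close> on the right, which moves to the left.\<close>
    have E2: "E \<le> 4 * e n + 4 * e m + 2 * (\<mu> * (K * (T n + T m)))"
      using E1 b1 mult_right_mono[OF \<theta>(3) E0] by linarith
    have XX: "X n + X m = K * (T n + T m) + (4 * e n + 4 * e m + 2 * (\<mu> * (K * (T n + T m))))"
      by (simp add: X_def algebra_simps)
    have "0 \<le> K * (T n + T m)" using F(2) by (intro mult_nonneg_nonneg add_nonneg_nonneg) (auto simp: T_def intro!: sum_nonneg)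
    then show "(LINT z|onm D. (U (r n) z - U (r m) z)\<^sup>2) \<le> X n + X m"
      "energy (\<lambda>z. G1 (r n) z - G1 (r m) z) (\<lambda>z. G2 (r n) z - G2 (r m) z) \<le> X n + X m"
      using b2 E2 unfolding XX b_def[symmetric] E_def[symmetric] by linarith+
  qed
  have cau: "\<exists>N. \<forall>m\<ge>N. \<forall>n\<ge>N. (LINT z|onm D. (f (r m) z - f (r n) z)\<^sup>2) < \<delta>"
    if "\<delta> > 0" "\<And>n m. (LINT z|onm D. (f (r n) z - f (r m) z)\<^sup>2) \<le> X n + X m" for \<delta> and f :: "nat \<Rightarrow> plane \<Rightarrow> real"
  proof -
    have "\<forall>\<^sub>F n in sequentially. X n < \<delta>/2" using X0 that(1) by (intro order_tendstoD(2)) auto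
    then obtain N where N: "\<And>n. n \<ge> N \<Longrightarrow> X n < \<delta>/2" by (auto simp: eventually_sequentially)
    show ?thesis
    proof (intro exI allI impI)
      fix m n assume "m \<ge> N" "n \<ge> N"
      then show "(LINT z|onm D. (f (r m) z - f (r n) z)\<^sup>2) < \<delta>" using that(2)[of m n] N[of m] N[of n] by linarith
    qed
  qed
  have Gd: "(LINT z|onm D. (G1 (r n) z - G1 (r m) z)\<^sup>2) \<le> X n + X m" "(LINT z|onm D. (G2 (r n) z - G2 (r m) z)\<^sup>2) \<le> X n + X m" for n m
  proof -
    have sd: "sob (\<lambda>z. U (r n) z - U (r m) z) (\<lambda>z. G1 (r n) z - G1 (r m) z) (\<lambda>z. G2 (r n) z - G2 (r m) z)"
      using sob_lincomb[OF S(1)[of "r n"] S(1)[of "r m"], of 1 "-1"] by simp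
    have "0 \<le> (LINT z|onm D. (G1 (r n) z - G1 (r m) z)\<^sup>2)" "0 \<le> (LINT z|onm D. (G2 (r n) z - G2 (r m) z)\<^sup>2)" by auto
    then show "(LINT z|onm D. (G1 (r n) z - G1 (r m) z)\<^sup>2) \<le> X n + X m" "(LINT z|onm D. (G2 (r n) z - G2 (r m) z)\<^sup>2) \<le> X n + X m"
      using diff(2)[of n m] unfolding energy_split[OF sd] by linarith+
  qed
  obtain u where u: "L2fun (onm D) u" "(\<lambda>n. LINT z|onm D. (U (r n) z - u z)\<^sup>2) \<longlonglongrightarrow> 0"
    using fD.L2fun_complete[of "\<lambda>n. U (r n)", OF sob_L2(1)[OF S(1)] cau[of _ U, OF _ diff(1)]] by blast
  obtain g1 where g1: "L2fun (onm D) g1" "(\<lambda>n. LINT z|onm D. (G1 (r n) z - g1 z)\<^sup>2) \<longlonglongrightarrow> 0"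
    using fD.L2fun_complete[of "\<lambda>n. G1 (r n)", OF sob_L2(2)[OF S(1)] cau[of _ G1, OF _ Gd(1)]] by blast
  obtain g2 where g2: "L2fun (onm D) g2" "(\<lambda>n. LINT z|onm D. (G2 (r n) z - g2 z)\<^sup>2) \<longlonglongrightarrow> 0"
    using fD.L2fun_complete[of "\<lambda>n. G2 (r n)", OF sob_L2(3)[OF S(1)] cau[of _ G2, OF _ Gd(2)]] by blast
  have s: "sob u g1 g2" by (rule sob_limit[OF S(1) u(1) g1(1) g2(1) u(2) g1(2) g2(2)])
  have m0: "(LINT z|onm D. u z) = 0"
    using LIMSEQ_unique[OF L2_lim_inner[OF sob_L2(1)[OF S(1)] u fD.L2fun_const[of 1]], of 0] S(2) by simp
  have n1: "(LINT z|onm D. (u z)\<^sup>2) = 1"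
    using LIMSEQ_unique[OF L2_lim_norm[OF sob_L2(1)[OF S(1)] u], of 1] S(3) by simp
  have "(\<lambda>n. energy (G1 (r n)) (G2 (r n))) \<longlonglongrightarrow> energy g1 g2"
    unfolding energy_split[OF s] energy_split[OF S(1)]
    by (intro tendsto_add L2_lim_norm[OF sob_L2(2)[OF S(1)] g1] L2_lim_norm[OF sob_L2(3)[OF S(1)] g2])
  moreover have "(\<lambda>n. e n + \<mu>) \<longlonglongrightarrow> 0 + \<mu>" by (intro tendsto_intros e0)
  then have "(\<lambda>n. energy (G1 (r n)) (G2 (r n))) \<longlonglongrightarrow> \<mu>" by (simp add: e_def)
  ultimately have "energy g1 g2 = \<mu>" by (rule LIMSEQ_unique)
  then show thesis using that[OF s m0 n1] low by simp
qed

text \<open>In directions of mean value zero, minimality says that a quadratic polynomial without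
  constant term is nonnegative, so its linear coefficient vanishes. Subtracting the mean from a
  general \<open>v\<close> changes neither side: constants have gradient zero, and \<open>u\<close>
  has mean value zero.\<close>

lemma euler_lagrange:
  assumes s: "sob u g1 g2" and m: "(LINT z|onm D. u z) = 0" and en: "energy g1 g2 = \<mu> * (LINT z|onm D. (u z)\<^sup>2)"
    and low: "\<And>v h1 h2. sob v h1 h2 \<Longrightarrow> (LINT z|onm D. v z) = 0 \<Longrightarrow> \<mu> * (LINT z|onm D. (v z)\<^sup>2) \<le> energy h1 h2"
    and v: "sob v h1 h2"
  shows "(LINT z|onm D. g1 z * h1 z + g2 z * h2 z) = \<mu> * (LINT z|onm D. u z * v z)"
proof -
  have *: "(LINT z|onm D. g1 z * h1 z + g2 z * h2 z) = \<mu> * (LINT z|onm D. u z * v z)"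
    if v: "sob v h1 h2" and v0: "(LINT z|onm D. v z) = 0" for v h1 h2
  proof -
    define p where "p = (LINT z|onm D. g1 z * h1 z + g2 z * h2 z) - \<mu> * (LINT z|onm D. u z * v z)"
    define q where "q = energy h1 h2 - \<mu> * (LINT z|onm D. (v z)\<^sup>2)"
    note Lu = sob_L2[OF s] and Lv = sob_L2[OF v]
    have "0 \<le> 2 * e * p + e\<^sup>2 * q" for e
    proof -
      have se: "sob (\<lambda>z. u z + e * v z) (\<lambda>z. g1 z + e * h1 z) (\<lambda>z. g2 z + e * h2 z)"
        using sob_lincomb[OF s v, of 1 e] by simp
      have sq: "(LINT z|onm D. (f z + e * g z)\<^sup>2) = (LINT z|onm D. (f z)\<^sup>2) + 2 * e * (LINT z|onm D. f z * g z) + e\<^sup>2 * (LINT z|onm D. (g z)\<^sup>2)"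
        if "L2fun (onm D) f" "L2fun (onm D) g" for f g
      proof -
        have "(\<lambda>z. (f z + e * g z)\<^sup>2) = (\<lambda>z. (f z)\<^sup>2 + 2 * e * (f z * g z) + e\<^sup>2 * (g z)\<^sup>2)"
          by (auto simp: power2_eq_square algebra_simps)
        then show ?thesis using L2fun_int[OF that(1)] L2fun_int[OF that(2)] L2fun_prod[OF that] by simp
      qed
      have "(LINT z|onm D. u z + e * v z) = 0" using sob_integrable(1)[OF s] sob_integrable(1)[OF v] m v0 by simp
      from low[OF se this] show ?thesis
        using en L2fun_prod[OF Lu(2) Lv(2)] L2fun_prod[OF Lu(3) Lv(3)]
        unfolding energy_split[OF se] energy_split[OF s] energy_split[OF v] sq[OF Lu(1) Lv(1)] sq[OF Lu(2) Lv(2)] sq[OF Lu(3) Lv(3)] p_def q_def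
        by (simp add: algebra_simps)
    qed
    then have "p = 0" by (rule quadratic_form_vertex)
    then show ?thesis by (simp add: p_def)
  qed
  define M where "M = measure (onm D) UNIV"
  define k where "k = (LINT z|onm D. v z) / M"
  \<comment> \<open>For \<open>M = 0\<close> the equation holds as well: \<open>k\<close> is 0 by
    the convention for division, and the integral over a null set vanishes.\<close>
  have "M * k = (LINT z|onm D. v z)"
  proof (cases "M = 0")
    case True
    then have "emeasure (onm D) UNIV = 0" using fD.emeasure_eq_measure[of UNIV] by (simp add: M_def)
    then have "AE z in onm D. False" by (intro AE_I[where N=UNIV]) auto
    then have "(LINT z|onm D. v z) = 0" by (intro integral_eq_zero_AE) auto
    then show ?thesis using True by simp
  qed (simp add: k_def)
  then have "(LINT z|onm D. v z - k) = 0" using sob_integrable(1)[OF v] by (simp add: M_def)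
  moreover have "sob (\<lambda>z. v z - k) h1 h2" using sob_lincomb[OF v sob_const, of 1 "-1" k] by simp
  ultimately have "(LINT z|onm D. g1 z * h1 z + g2 z * h2 z) = \<mu> * (LINT z|onm D. u z * (v z - k))" by (intro *) auto
  also have "(LINT z|onm D. u z * (v z - k)) = (LINT z|onm D. u z * v z - k * u z)" by (simp add: algebra_simps)
  also have "\<dots> = (LINT z|onm D. u z * v z)"
    using m L2fun_prod[OF sob_L2(1)[OF s] sob_L2(1)[OF v]] sob_integrable(1)[OF s] by simp
  finally show ?thesis .
qed

end

section \<open>Symmetric strips and nodal sets\<close>

definition sig :: "plane \<Rightarrow> plane" where "sig z = (- fst z, snd z)"

lemma sig_sig [simp]: "sig (sig z) = z" by (simp add: sig_def)

lemma sig_derivative: "(sig has_derivative sig) (at z)"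
  unfolding sig_def[abs_def] by (intro derivative_intros)

lemma sig_continuous: "continuous_on S sig"
  unfolding sig_def[abs_def] by (intro continuous_intros)

lemma sig_measurable [measurable]: "sig \<in> borel_measurable borel"
  by (rule borel_measurable_continuous_onI[OF sig_continuous])

lemma sig_Basis: "b \<in> Basis \<Longrightarrow> \<exists>k. sig b = k *\<^sub>R b"
  by (auto simp: Basis_prod_def sig_def intro: exI[of _ "-1"] exI[of _ 1])

text \<open>Each derivative along the first axis contributes a sign. Differentiability is
  insensitive to a constant factor, so the existence of some factor is all that is recorded.\<close>

lemma foldr_partial_deriv_sig:
  assumes "smooth \<phi>" "set bs \<subseteq> Basis"
  shows "\<exists>k. foldr partial_deriv bs (\<lambda>z. \<phi> (sig z)) = (\<lambda>z. k * foldr partial_deriv bs \<phi> (sig z))"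
  using assms(2)
proof (induction bs)
  case Nil
  show ?case by (intro exI[of _ 1]) simp
next
  case (Cons b bs)
  then obtain k where k: "foldr partial_deriv bs (\<lambda>z. \<phi> (sig z)) = (\<lambda>z. k * foldr partial_deriv bs \<phi> (sig z))" by auto
  have "b \<in> Basis" and bs: "set bs \<subseteq> Basis" using Cons.prems by simp_all
  then obtain l where l: "sig b = l *\<^sub>R b" using sig_Basis by blast
  let ?f = "foldr partial_deriv bs \<phi>"
  have d: "(?f has_derivative frechet_derivative ?f (at z)) (at z)" for z
  proof -
    have "?f differentiable (at z)" using assms(1) bs unfolding smooth_def by blast
    then show ?thesis by (rule frechet_derivative_works[THEN iffD1])
  qed
  have "partial_deriv b (\<lambda>z. k * ?f (sig z)) z = (k * l) * partial_deriv b ?f (sig z)" for z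
  proof -
    have "((\<lambda>z. k * ?f (sig z)) has_derivative (\<lambda>h. k * frechet_derivative ?f (at (sig z)) (sig h))) (at z)"
      by (intro has_derivative_mult_right has_derivative_compose[OF sig_derivative d])
    then have "partial_deriv b (\<lambda>z. k * ?f (sig z)) z = k * frechet_derivative ?f (at (sig z)) (sig b)" by (rule partial_deriv_eq)
    moreover have "linear (frechet_derivative ?f (at (sig z)))" using d has_derivative_linear by blast
    ultimately show ?thesis by (simp add: l linear_scale partial_deriv_def)
  qed
  then show ?case by (intro exI[of _ "k * l"]) (simp add: k fun_eq_iff)
qed

lemma smooth_sig:
  fixes \<phi> :: "plane \<Rightarrow> real"
  assumes "smooth \<phi>"
  shows "smooth (\<lambda>z. \<phi> (sig z))"
  unfolding smooth_def
proof (intro allI impI)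
  fix bs :: "plane list" and z assume bs: "set bs \<subseteq> Basis"
  obtain k where k: "foldr partial_deriv bs (\<lambda>z. \<phi> (sig z)) = (\<lambda>z. k * foldr partial_deriv bs \<phi> (sig z))"
    using foldr_partial_deriv_sig[OF assms bs] by blast
  have "foldr partial_deriv bs \<phi> differentiable (at (sig z))" using assms bs unfolding smooth_def by blast
  then obtain F where "(foldr partial_deriv bs \<phi> has_derivative F) (at (sig z))" unfolding differentiable_def by blast
  from has_derivative_mult_right[OF has_derivative_compose[OF sig_derivative this]]
  show "foldr partial_deriv bs (\<lambda>z. \<phi> (sig z)) differentiable (at z)" unfolding k differentiable_def by blast
qed

lemma partial_deriv_sig:
  assumes "test_function S \<phi>"
  shows "partial_deriv (1,0) (\<lambda>z. \<phi> (sig z)) z = - partial_deriv (1,0) \<phi> (sig z)"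
    "partial_deriv (0,1) (\<lambda>z. \<phi> (sig z)) z = partial_deriv (0,1) \<phi> (sig z)"
proof -
  obtain M :: real where "\<And>z. (\<phi> has_derivative (\<lambda>h. fst h * partial_deriv (1,0) \<phi> z + snd h * partial_deriv (0,1) \<phi> z)) (at z)"
    using test_function_C1[OF assms] by metis
  from partial_deriv_eq[OF has_derivative_compose[OF sig_derivative this]]
  show "partial_deriv (1,0) (\<lambda>z. \<phi> (sig z)) z = - partial_deriv (1,0) \<phi> (sig z)"
    "partial_deriv (0,1) (\<lambda>z. \<phi> (sig z)) z = partial_deriv (0,1) \<phi> (sig z)" by (auto simp: sig_def)
qed

lemma test_function_sig:
  assumes \<phi>: "test_function S \<phi>" and S: "sig ` S \<subseteq> S"
  shows "test_function S (\<lambda>z. \<phi> (sig z))"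
proof -
  let ?K = "closure {z. \<phi> z \<noteq> 0}"
  have K: "compact ?K" "?K \<subseteq> S" "smooth \<phi>" using \<phi> by (auto simp: test_function_def)
  have c: "compact (sig ` ?K)" by (rule compact_continuous_image[OF sig_continuous K(1)])
  have sub0: "{z. \<phi> (sig z) \<noteq> 0} \<subseteq> sig ` ?K"
  proof
    fix z assume "z \<in> {z. \<phi> (sig z) \<noteq> 0}"
    then have "sig z \<in> {z. \<phi> z \<noteq> 0}" by simp
    then have "sig z \<in> ?K" by (rule subsetD[OF closure_subset])
    then show "z \<in> sig ` ?K" by (metis image_eqI sig_sig)
  qed
  have sub: "closure {z. \<phi> (sig z) \<noteq> 0} \<subseteq> sig ` ?K" by (rule closure_minimal[OF sub0 compact_imp_closed[OF c]])
  have "compact (closure {z. \<phi> (sig z) \<noteq> 0})"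
    by (rule compact_closure[THEN iffD2]) (rule bounded_subset[OF compact_imp_bounded[OF c] sub0])
  then show ?thesis unfolding test_function_def using smooth_sig[OF K(3)] sub K(2) S by blast
qed

text \<open>\<open>fibre_const\<close> is the pointwise condition under which a one-dimensional
  inequality on a fibre holds with constant \<open>\<kappa>\<close> after weighting by the Jacobian:
  \<open>B\<close> is the length of the parameter interval, \<open>P2\<close> the tangent of the
  fibre, and the Jacobians belong to two arbitrary points of the same fibre.\<close>

locale symmetric_strip = strip_chart +
  fixes \<kappa> :: real
  assumes sym: "\<And>s t. s \<in> {0<..<A} \<Longrightarrow> t \<in> {0<..<B} \<Longrightarrow> \<Psi> (A - s, t) = sig (\<Psi> (s, t))"
    and fibre_const: "\<And>s t t'. s \<in> {0<..<A} \<Longrightarrow> t \<in> {0<..<B} \<Longrightarrow> t' \<in> {0<..<B} \<Longrightarrow>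
      B\<^sup>2 * J (s,t) * (norm (P2 (s,t')))\<^sup>2 \<le> \<kappa> * J (s,t')"
begin

lemma sig_D: "sig ` D = D"
proof -
  have "sig ` D \<subseteq> D"
  proof
    fix w assume "w \<in> sig ` D"
    then obtain s t where st: "s \<in> {0<..<A}" "t \<in> {0<..<B}" "w = sig (\<Psi> (s,t))" by (auto simp: D_def Q_def)
    then have "w = \<Psi> (A - s, t)" "(A - s, t) \<in> Q" using sym by (auto simp: Q_def)
    then show "w \<in> D" unfolding D_def by blast
  qed
  then show ?thesis by (auto simp: image_iff) (metis image_subset_iff sig_sig)
qed

lemma distr_sig: "distr (onm D) borel sig = onm D"
proof -
  have "distr (density (onm D) (\<lambda>z. ennreal 1)) borel sig = onm (sig ` D)"
  proof (rule plane_cov(2)[where ?P1.0="\<lambda>_. (-1,0)" and ?P2.0="\<lambda>_. (0,1)", OF D_open])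
    show "inj_on sig D" by (metis inj_onI sig_sig)
    show "bounded (sig ` D)" using D_bounded by (simp add: sig_D)
    show "(sig has_derivative (\<lambda>h. fst h *\<^sub>R (-1,0) + snd h *\<^sub>R (0,1))) (at z)" for z
      using sig_derivative[of z] by (simp add: sig_def[abs_def])
  qed auto
  then show ?thesis by (simp add: sig_D density_1)
qed

lemma integral_sig:
  fixes f :: "plane \<Rightarrow> real"
  assumes "f \<in> borel_measurable borel"
  shows "(LINT z|onm D. f (sig z)) = (LINT z|onm D. f z)" "integrable (onm D) (\<lambda>z. f (sig z)) \<longleftrightarrow> integrable (onm D) f"
  using integral_distr[of sig "onm D" borel f] integrable_distr_eq[of sig "onm D" borel f] assms by (simp_all add: distr_sig)

lemma L2fun_sig: "L2fun (onm D) f \<Longrightarrow> L2fun (onm D) (\<lambda>z. f (sig z))"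
proof -
  assume f: "L2fun (onm D) f"
  have [measurable]: "f \<in> borel_measurable borel" using f by (rule L2fun_onm_borel)
  show ?thesis using integral_sig(2)[of "\<lambda>z. (f z)\<^sup>2"] L2fun_int[OF f] by (simp add: L2fun_def)
qed

lemma sob_sig:
  assumes s: "sob u g1 g2"
  shows "sob (\<lambda>z. u (sig z)) (\<lambda>z. - g1 (sig z)) (\<lambda>z. g2 (sig z))"
  unfolding sob_def
proof (intro conjI allI impI)
  note L = sob_L2[OF s]
  show "L2fun (onm D) (\<lambda>z. u (sig z))" "L2fun (onm D) (\<lambda>z. g2 (sig z))" by (intro L2fun_sig L)+
  show "L2fun (onm D) (\<lambda>z. - g1 (sig z))" using L2fun_cmult[OF L2fun_sig[OF L(2)], of "-1"] by simp
  have [measurable]: "u \<in> borel_measurable borel" "g1 \<in> borel_measurable borel" "g2 \<in> borel_measurable borel"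
    using L by (auto intro: L2fun_onm_borel)
  fix \<phi> assume tf: "test_function D \<phi>"
  have tf': "test_function D (\<lambda>z. \<phi> (sig z))" by (rule test_function_sig[OF tf]) (simp add: sig_D)
  have [measurable]: "\<phi> \<in> borel_measurable borel" "partial_deriv (1,0) \<phi> \<in> borel_measurable borel" "partial_deriv (0,1) \<phi> \<in> borel_measurable borel"
    using test_function_C1[OF tf] borel_measurable_continuous_onI by metis+
  have "(LINT z|onm D. u (sig z) * partial_deriv (1,0) \<phi> z) = (LINT z|onm D. u z * partial_deriv (1,0) \<phi> (sig z))"
    by (subst integral_sig(1)[symmetric]) simp_all
  also have "\<dots> = (LINT z|onm D. - (u z * partial_deriv (1,0) (\<lambda>z. \<phi> (sig z)) z))" by (simp add: partial_deriv_sig[OF tf])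
  also have "\<dots> = (LINT z|onm D. g1 z * \<phi> (sig z))" using sob_weak(1)[OF s tf'] by simp
  also have "\<dots> = (LINT z|onm D. g1 (sig z) * \<phi> z)" by (subst integral_sig(1)[symmetric]) simp_all
  finally show "(LINT z|onm D. u (sig z) * partial_deriv (1,0) \<phi> z) = - (LINT z|onm D. - g1 (sig z) * \<phi> z)" by simp
  have "(LINT z|onm D. u (sig z) * partial_deriv (0,1) \<phi> z) = (LINT z|onm D. u z * partial_deriv (0,1) \<phi> (sig z))"
    by (subst integral_sig(1)[symmetric]) simp_all
  also have "\<dots> = (LINT z|onm D. u z * partial_deriv (0,1) (\<lambda>z. \<phi> (sig z)) z)" by (simp add: partial_deriv_sig[OF tf])
  also have "\<dots> = - (LINT z|onm D. g2 z * \<phi> (sig z))" by (rule sob_weak(2)[OF s tf'])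
  also have "(LINT z|onm D. g2 z * \<phi> (sig z)) = (LINT z|onm D. g2 (sig z) * \<phi> z)" by (subst integral_sig(1)[symmetric]) simp_all
  finally show "(LINT z|onm D. u (sig z) * partial_deriv (0,1) \<phi> z) = - (LINT z|onm D. g2 (sig z) * \<phi> z)" .
qed

section \<open>Truncation, cutting along a fibre, and the fibre inequality\<close>

definition below :: "real \<Rightarrow> plane set" where
  "below s2 = \<Psi> ` (Q \<inter> {z. fst z < s2})"

lemma below_sets [measurable]: "below s2 \<in> sets borel"
proof -
  have o: "open (Q \<inter> {z. fst z < s2})" by (intro open_Int Q_open open_Collect_less continuous_intros)
  have "continuous_on Q \<Psi>" unfolding Q_def using deriv by (meson continuous_at_imp_continuous_on has_derivative_continuous)
  then have "open (below s2)" unfolding below_def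
    by (intro invariance_of_domain o) (use inj in \<open>auto simp: Q_def intro: continuous_on_subset inj_on_subset\<close>)
  then show ?thesis by simp
qed

lemma below_iff: "z \<in> Q \<Longrightarrow> \<Psi> z \<in> below s2 \<longleftrightarrow> fst z < s2"
  unfolding below_def using inj[folded Q_def] by (auto dest: inj_onD)

text \<open>At \<open>s2 = A\<close> nothing is cut off on \<open>D\<close> and this is the positive
  part of \<open>u\<close> there, so one definition serves for truncation and for cutting.\<close>

definition cutpos :: "real \<Rightarrow> (plane \<Rightarrow> real) \<Rightarrow> plane \<Rightarrow> real" where
  "cutpos s2 u z = indicator (below s2) z * max 0 (u z)"

definition cutgrad :: "real \<Rightarrow> (plane \<Rightarrow> real) \<Rightarrow> (plane \<Rightarrow> real) \<Rightarrow> plane \<Rightarrow> real" where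
  "cutgrad s2 u g z = indicator (below s2) z * theta (u z) * g z"

text \<open>Along a fibre \<open>s = const\<close> the cut multiplies by 0 or 1, and the truncation
  rule suffices. Only the lines that cross \<open>s = s2\<close> could see a jump; for them absolute
  continuity is the hypothesis \<open>acs\<close>.\<close>

lemma sob_cut:
  assumes s: "sob u g1 g2"
    and acs: "AE t in onm {0<..<B}. w11 0 A (\<lambda>s. if s < s2 then max 0 (u (\<Psi> (s,t))) else 0)
       (\<lambda>s. if s < s2 then theta (u (\<Psi> (s,t))) * pull P1 g1 g2 (s,t) else 0)"
  shows "sob (cutpos s2 u) (cutgrad s2 u g1) (cutgrad s2 u g2)"
proof -
  note L = sob_L2[OF s]
  have [measurable]: "u \<in> borel_measurable borel" "g1 \<in> borel_measurable borel" "g2 \<in> borel_measurable borel"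
    using L by (auto intro: L2fun_onm_borel)
  have um: "(\<lambda>z. indicator (below s2) z * theta (u z)) \<in> borel_measurable borel" by measurable
  have ub: "\<bar>indicator (below s2) z * theta (u z)\<bar> \<le> 1" for z by (auto simp: theta_bounds split: split_indicator)
  have [measurable]: "cutpos s2 u \<in> borel_measurable borel" "cutgrad s2 u g1 \<in> borel_measurable borel" "cutgrad s2 u g2 \<in> borel_measurable borel"
    unfolding cutpos_def[abs_def] cutgrad_def[abs_def] by measurable
  have Lg: "L2fun (onm D) (cutgrad s2 u g)" if "L2fun (onm D) g" for g
    unfolding cutgrad_def[abs_def] by (rule L2fun_bounded_mult[OF that _ ub]) (use um in measurable)
  have LU: "L2fun (onm D) (cutpos s2 u)"
  proof -
    have "L2fun (onm D) (\<lambda>z. (indicator (below s2) z * (if u z > 0 then 1 else 0)) * u z)"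
      by (rule L2fun_bounded_mult[OF L(1), where K=1]) (auto split: split_indicator)
    moreover have "(\<lambda>z. (indicator (below s2) z * (if u z > 0 then 1 else 0)) * u z) = cutpos s2 u"
      by (auto simp: cutpos_def fun_eq_iff max_def)
    ultimately show ?thesis by simp
  qed
  have pq: "cutpos s2 u (\<Psi> z) = (if fst z < s2 then max 0 (u (\<Psi> z)) else 0)"
    "pull P (cutgrad s2 u g1) (cutgrad s2 u g2) z = (if fst z < s2 then theta (u (\<Psi> z)) * pull P g1 g2 z else 0)" if "z \<in> Q" for z P
    using below_iff[OF that, of s2] by (auto simp: cutpos_def cutgrad_def pull_def algebra_simps)
  show ?thesis
  proof (rule sob_from_ac[OF LU Lg[OF L(2)] Lg[OF L(3)]])
    show "AE t in onm {0<..<B}. w11 0 A (\<lambda>s. cutpos s2 u (\<Psi> (s,t))) (\<lambda>s. pull P1 (cutgrad s2 u g1) (cutgrad s2 u g2) (s,t))"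
      using acs AE_ivl[of 0 B]
    proof eventually_elim
      case (elim t)
      show ?case
      proof (rule w11_cong_AE[OF elim(1)])
        show "AE s in onm {0<..<A}. cutpos s2 u (\<Psi> (s,t)) = (if s < s2 then max 0 (u (\<Psi> (s,t))) else 0)"
          using AE_ivl[of 0 A] by eventually_elim (use elim(2) pq(1) in \<open>auto simp: Q_def\<close>)
        show "AE s in onm {0<..<A}. pull P1 (cutgrad s2 u g1) (cutgrad s2 u g2) (s,t) = (if s < s2 then theta (u (\<Psi> (s,t))) * pull P1 g1 g2 (s,t) else 0)"
          using AE_ivl[of 0 A] by eventually_elim (use elim(2) pq(2) in \<open>auto simp: Q_def\<close>)
      qed measurable
    qed
    have "AE s in onm {0<..<A}. w11 0 B (\<lambda>t. u (\<Psi> (s,t))) (\<lambda>t. pull P2 g1 g2 (s,t))"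
      using sob_ac[OF s] by (simp add: ac_rect_def)
    then show "AE s in onm {0<..<A}. w11 0 B (\<lambda>t. cutpos s2 u (\<Psi> (s,t))) (\<lambda>t. pull P2 (cutgrad s2 u g1) (cutgrad s2 u g2) (s,t))"
      using AE_ivl[of 0 A]
    proof eventually_elim
      case (elim s)
      have "w11 0 B (\<lambda>t. max 0 (u (\<Psi> (s,t)))) (\<lambda>t. theta (u (\<Psi> (s,t))) * pull P2 g1 g2 (s,t))"
        by (rule w11_pos[OF elim(1)]) measurable
      moreover have "w11 0 B (\<lambda>t. 0) (\<lambda>t. 0)" by (rule w11_I[where c=0]) (auto simp: prim_def)
      ultimately have w: "w11 0 B (\<lambda>t. if s < s2 then max 0 (u (\<Psi> (s,t))) else 0) (\<lambda>t. if s < s2 then theta (u (\<Psi> (s,t))) * pull P2 g1 g2 (s,t) else 0)"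
        by (cases "s < s2") auto
      show ?case
      proof (rule w11_cong_AE[OF w])
        show "AE t in onm {0<..<B}. cutpos s2 u (\<Psi> (s,t)) = (if s < s2 then max 0 (u (\<Psi> (s,t))) else 0)"
          using AE_ivl[of 0 B] by eventually_elim (use elim(2) pq(1) in \<open>auto simp: Q_def\<close>)
        show "AE t in onm {0<..<B}. pull P2 (cutgrad s2 u g1) (cutgrad s2 u g2) (s,t) = (if s < s2 then theta (u (\<Psi> (s,t))) * pull P2 g1 g2 (s,t) else 0)"
          using AE_ivl[of 0 B] by eventually_elim (use elim(2) pq(2) in \<open>auto simp: Q_def\<close>)
      qed measurable
    qed
  qed
qed

lemma sob_pos:
  assumes s: "sob u g1 g2"
  shows "sob (cutpos A u) (cutgrad A u g1) (cutgrad A u g2)"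
proof (rule sob_cut[OF s])
  note L = sob_L2[OF s]
  have [measurable]: "u \<in> borel_measurable borel" "g1 \<in> borel_measurable borel" "g2 \<in> borel_measurable borel"
    using L by (auto intro: L2fun_onm_borel)
  have "AE t in onm {0<..<B}. w11 0 A (\<lambda>s. u (\<Psi> (s,t))) (\<lambda>s. pull P1 g1 g2 (s,t))"
    using sob_ac[OF s] by (simp add: ac_rect_def)
  then show "AE t in onm {0<..<B}. w11 0 A (\<lambda>s. if s < A then max 0 (u (\<Psi> (s,t))) else 0)
       (\<lambda>s. if s < A then theta (u (\<Psi> (s,t))) * pull P1 g1 g2 (s,t) else 0)"
  proof eventually_elim
    case (elim t)
    have w: "w11 0 A (\<lambda>s. max 0 (u (\<Psi> (s,t)))) (\<lambda>s. theta (u (\<Psi> (s,t))) * pull P1 g1 g2 (s,t))"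
      by (rule w11_pos[OF elim]) measurable
    show ?case
    proof (rule w11_cong_AE[OF w])
      show "AE s in onm {0<..<A}. (if s < A then max 0 (u (\<Psi> (s,t))) else 0) = max 0 (u (\<Psi> (s,t)))"
        using AE_ivl[of 0 A] by eventually_elim auto
      show "AE s in onm {0<..<A}. (if s < A then theta (u (\<Psi> (s,t))) * pull P1 g1 g2 (s,t) else 0) = theta (u (\<Psi> (s,t))) * pull P1 g1 g2 (s,t)"
        using AE_ivl[of 0 A] by eventually_elim auto
    qed measurable
  qed
qed

lemma below_A: "below A = D"
  unfolding below_def D_def by (rule arg_cong[where f="(`) \<Psi>"]) (auto simp: Q_def)

text \<open>Almost every line \<open>s = s2\<close> is one on which the given representative is the trace.\<close>

lemma sob_cut_good:
  assumes s: "sob u g1 g2"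
  shows "AE s2 in onm {0<..<A}. (AE t in onm {0<..<B}. u (\<Psi> (s2,t)) < 0) \<longrightarrow>
    sob (cutpos s2 u) (cutgrad s2 u g1) (cutgrad s2 u g2)"
proof -
  note L = sob_L2[OF s]
  have [measurable]: "u \<in> borel_measurable borel" "g1 \<in> borel_measurable borel" "g2 \<in> borel_measurable borel"
    using L by (auto intro: L2fun_onm_borel)
  let ?G = "\<lambda>t s. pull P1 g1 g2 (s,t)"
  have pm [measurable]: "(\<lambda>(s,t). prim 0 (?G t) s) \<in> borel_measurable (borel \<Otimes>\<^sub>M borel)"
    by (rule prim_measurable_param) measurable
  define h where "h = (\<lambda>(s,t). u (\<Psi> (s,t)) - prim 0 (?G t) s)"
  have hm [measurable]: "h \<in> borel_measurable (borel \<Otimes>\<^sub>M borel)" unfolding h_def by measurable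
  \<comment> \<open>On almost every line \<open>h\<close> is constant in \<open>s\<close>. Writing
    the constant as a mean value makes it measurable in \<open>t\<close>.\<close>
  define k where "k t = (LINT s|onm {0<..<A}. h (s,t)) / A" for t
  have [measurable]: "k \<in> borel_measurable borel"
    unfolding k_def[abs_def] by measurable
  have acs: "AE t in onm {0<..<B}. w11 0 A (\<lambda>s. u (\<Psi> (s,t))) (?G t)"
    using sob_ac[OF s] by (simp add: ac_rect_def)
  have kt: "AE t in onm {0<..<B}. AE s in onm {0<..<A}. h (s,t) = k t"
    using acs
  proof eventually_elim
    case (elim t)
    then obtain c where c: "AE s in onm {0<..<A}. u (\<Psi> (s,t)) = c + prim 0 (?G t) s" by (auto simp: w11_def)
    then have hc: "AE s in onm {0<..<A}. h (s,t) = c" by eventually_elim (simp add: h_def)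
    have "(LINT s|onm {0<..<A}. h (s,t)) = (LINT s|onm {0<..<A}. c)"
      by (rule integral_cong_AE) (use hc in auto)
    then have "k t = c" using AB by (simp add: k_def measure_ivl)
    then show ?case using hc by simp
  qed
  \<comment> \<open>Fubini's theorem exchanges the quantifiers: for almost every \<open>s2\<close>
    the value of \<open>u\<close> at \<open>s2\<close> is that of the continuous representative, for
    almost every \<open>t\<close>.\<close>
  have "AE s2 in onm {0<..<A}. AE t in onm {0<..<B}. h (s2,t) = k t"
  proof (subst pQ.AE_commute)
    show "{x \<in> space (onm {0<..<A} \<Otimes>\<^sub>M onm {0<..<B}). h (fst x, snd x) = k (snd x)} \<in> sets (onm {0<..<A} \<Otimes>\<^sub>M onm {0<..<B})"
      by measurable
  qed (rule kt)
  then show ?thesis using AE_ivl[of 0 A]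
  proof eventually_elim
    case (elim s2)
    show ?case
    proof
      assume neg: "AE t in onm {0<..<B}. u (\<Psi> (s2,t)) < 0"
      show "sob (cutpos s2 u) (cutgrad s2 u g1) (cutgrad s2 u g2)"
      proof (rule sob_cut[OF s])
        show "AE t in onm {0<..<B}. w11 0 A (\<lambda>s. if s < s2 then max 0 (u (\<Psi> (s,t))) else 0)
           (\<lambda>s. if s < s2 then theta (u (\<Psi> (s,t))) * ?G t s else 0)"
          using acs kt elim(1) neg
        proof eventually_elim
          case (elim t)
          have c: "AE s in onm {0<..<A}. u (\<Psi> (s,t)) = k t + prim 0 (?G t) s"
            using elim(2) by eventually_elim (simp add: h_def)
          show ?case
            by (rule w11_cut_pos[OF w11_int[OF elim(1)] _ c]) (use elim(3,4) \<open>0 < s2 \<and> s2 < A\<close> in \<open>auto simp: h_def\<close>)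
        qed
      qed
    qed
  qed
qed

text \<open>On a fibre the positive part is at most \<open>X\<close>, the integral of its
  derivative, as no fibre in question is positive almost everywhere. Cauchy-Schwarz bounds
  \<open>X\<^sup>2\<close> by an integral over \<open>t'\<close>, and \<open>fibre_const\<close>
  replaces the Jacobian at \<open>t\<close> by the one at \<open>t'\<close>. The right-hand side no
  longer depends on \<open>t\<close>, so integrating over \<open>t\<close> costs a factor
  \<open>B\<close>.\<close>

lemma fibre_inequality:
  assumes s: "sob u g1 g2" and n: "AE s in onm {0<..<A}. \<not> (AE t in onm {0<..<B}. u (\<Psi> (s,t)) > 0)"
  shows "(LINT z|onm D. (cutpos A u z)\<^sup>2) \<le> \<kappa> * energy (cutgrad A u g1) (cutgrad A u g2)"
proof -
  note L = sob_L2[OF s] and sc = sob_pos[OF s]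
  note Lc = sob_L2[OF sc]
  let ?w = "cutpos A u" and ?h1 = "cutgrad A u g1" and ?h2 = "cutgrad A u g2"
  have [measurable]: "u \<in> borel_measurable borel" "g1 \<in> borel_measurable borel" "g2 \<in> borel_measurable borel"
    "?w \<in> borel_measurable borel" "?h1 \<in> borel_measurable borel" "?h2 \<in> borel_measurable borel"
    using L Lc by (auto intro: L2fun_onm_borel)
  have iw: "integrable (onm Q) (\<lambda>z. J z * (?w (\<Psi> z))\<^sup>2)"
    using integral_D(2)[of "\<lambda>z. (?w z)\<^sup>2"] L2fun_int[OF Lc(1)] by simp
  have ih: "integrable (onm Q) (\<lambda>z. J z * ((?h1 (\<Psi> z))\<^sup>2 + (?h2 (\<Psi> z))\<^sup>2))"
    using integral_D(2)[of "\<lambda>z. (?h1 z)\<^sup>2 + (?h2 z)\<^sup>2"] Lc by (simp add: L2fun_def)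
  have act: "AE s in onm {0<..<A}. w11 0 B (\<lambda>t. u (\<Psi> (s,t))) (\<lambda>t. pull P2 g1 g2 (s,t))"
    using sob_ac[OF s] by (simp add: ac_rect_def)
  have "(LINT z|onm Q. J z * (?w (\<Psi> z))\<^sup>2) \<le> \<kappa> * (LINT z|onm Q. J z * ((?h1 (\<Psi> z))\<^sup>2 + (?h2 (\<Psi> z))\<^sup>2))"
    unfolding integral_Q_iterated(2)[OF iw] integral_Q_iterated(2)[OF ih] integral_mult_right_zero[symmetric]
  proof (rule integral_mono_AE)
    show "AE s in onm {0<..<A}. (LINT t|onm {0<..<B}. J (s,t) * (?w (\<Psi> (s,t)))\<^sup>2)
        \<le> (LINT t|onm {0<..<B}. \<kappa> * (J (s,t) * ((?h1 (\<Psi> (s,t)))\<^sup>2 + (?h2 (\<Psi> (s,t)))\<^sup>2)))"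
      using act n integral_Q_iterated(6)[OF iw] integral_Q_iterated(6)[OF ih] AE_ivl[of 0 A]
    proof eventually_elim
      case (elim s)
      let ?p = "\<lambda>t. theta (u (\<Psi> (s,t))) * \<bar>pull P2 g1 g2 (s,t)\<bar>" and ?H = "\<lambda>t. (?h1 (\<Psi> (s,t)))\<^sup>2 + (?h2 (\<Psi> (s,t)))\<^sup>2"
      define X where "X = (LINT t|onm {0<..<B}. ?p t)"
      have inQ: "(s,t) \<in> Q" if "0 < t" "t < B" for t using that elim by (auto simp: Q_def)
      have ww: "AE t in onm {0<..<B}. max 0 (u (\<Psi> (s,t))) \<le> X"
        unfolding X_def by (rule w11_fibre[OF elim(1) _ elim(2)]) measurable
      have p2: "(?p t)\<^sup>2 \<le> (norm (P2 (s,t)))\<^sup>2 * ?H t" if t: "0 < t" "t < B" for t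
      proof -
        have D: "\<Psi> (s,t) \<in> below A" unfolding below_A D_def using inQ[OF t] by blast
        have "(pull P2 g1 g2 (s,t))\<^sup>2 \<le> (norm (P2 (s,t)))\<^sup>2 * ((g1 (\<Psi> (s,t)))\<^sup>2 + (g2 (\<Psi> (s,t)))\<^sup>2)"
        proof -
          have "pull P2 g1 g2 (s,t) = (g1 (\<Psi> (s,t)), g2 (\<Psi> (s,t))) \<bullet> P2 (s,t)" by (simp add: pull_def inner_prod_def)
          moreover have "(norm ((g1 (\<Psi> (s,t)), g2 (\<Psi> (s,t)))::plane))\<^sup>2 = (g1 (\<Psi> (s,t)))\<^sup>2 + (g2 (\<Psi> (s,t)))\<^sup>2" by (simp add: norm_prod_def)
          moreover have "(a \<bullet> b)\<^sup>2 \<le> (norm a)\<^sup>2 * (norm b)\<^sup>2" for a b :: plane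
            using Cauchy_Schwarz_ineq[of a b] by (simp add: power2_norm_eq_inner)
          ultimately show ?thesis by (metis mult.commute)
        qed
        then have "(theta (u (\<Psi> (s,t))))\<^sup>2 * (pull P2 g1 g2 (s,t))\<^sup>2 \<le> (theta (u (\<Psi> (s,t))))\<^sup>2 * ((norm (P2 (s,t)))\<^sup>2 * ((g1 (\<Psi> (s,t)))\<^sup>2 + (g2 (\<Psi> (s,t)))\<^sup>2))"
          by (intro mult_left_mono) auto
        then show ?thesis using D by (simp add: cutgrad_def power_mult_distrib algebra_simps)
      qed
      \<comment> \<open>The case \<open>X = 0\<close> also absorbs the default value of the integral
        of a nonintegrable function, and there \<open>ww\<close> makes the positive part vanish on
        the fibre; \<open>X \<noteq> 0\<close> in turn yields integrability.\<close>
      show ?case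
      proof (cases "X = 0")
        case True
        have "AE t in onm {0<..<B}. ?w (\<Psi> (s,t)) = 0"
          using ww by eventually_elim (auto simp: True cutpos_def)
        then have "(LINT t|onm {0<..<B}. J (s,t) * (?w (\<Psi> (s,t)))\<^sup>2) = (LINT t|onm {0<..<B}. 0)"
          by (intro integral_cong_AE) auto
        moreover have "0 \<le> (LINT t|onm {0<..<B}. \<kappa> * (J (s,t) * ?H t))"
        proof (rule integral_nonneg_AE)
          show "AE t in onm {0<..<B}. 0 \<le> \<kappa> * (J (s,t) * ?H t)" using AE_ivl[of 0 B]
          proof eventually_elim
            case (elim t)
            have J: "J (s,t) \<ge> 0" using J_low[of "(s,t)"] inQ[of t] elim c_pos by (auto simp: Q_def)
            have "0 \<le> B\<^sup>2 * J (s,t) * (norm (P2 (s,t)))\<^sup>2" using J by simp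
            also have "\<dots> \<le> \<kappa> * J (s,t)" using fibre_const[of s t t] elim \<open>0 < s \<and> s < A\<close> by auto
            finally have "0 \<le> \<kappa> * J (s,t)" .
            then have "0 \<le> (\<kappa> * J (s,t)) * ?H t" by (rule mult_nonneg_nonneg) simp
            then show ?case by (simp only: mult.assoc)
          qed
        qed
        ultimately show ?thesis by simp
      next
        case False
        then have pi: "integrable (onm {0<..<B}) ?p" unfolding X_def using not_integrable_integral_eq by blast
        have X0: "X \<ge> 0" unfolding X_def by (rule integral_nonneg_AE) (auto simp: theta_bounds)
        have J0: "J (s,t) > 0" if "0 < t" "t < B" for t using J_low[of "(s,t)"] inQ[OF that] c_pos by (auto simp: Q_def)
        have HJ: "integrable (onm {0<..<B}) (\<lambda>t. J (s,t) * ?H t)" by (rule elim(4))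
        have ip: "integrable (onm {0<..<B}) (\<lambda>t. (?p t)\<^sup>2)"
        proof (rule Bochner_Integration.integrable_bound)
          show "integrable (onm {0<..<B}) (\<lambda>t. C\<^sup>2 / c * (J (s,t) * ?H t))" using HJ by simp
          show "AE t in onm {0<..<B}. norm ((?p t)\<^sup>2) \<le> norm (C\<^sup>2 / c * (J (s,t) * ?H t))" using AE_ivl[of 0 B]
          proof eventually_elim
            case (elim t)
            have "(norm (P2 (s,t)))\<^sup>2 \<le> C\<^sup>2" using P_bound(2)[of "(s,t)"] by (intro power_mono) auto
            moreover have "1 \<le> J (s,t) / c" using J_low[of "(s,t)"] inQ[of t] elim c_pos by (auto simp: Q_def)
            ultimately have "(norm (P2 (s,t)))\<^sup>2 * 1 * ?H t \<le> C\<^sup>2 * (J (s,t) / c) * ?H t"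
              by (intro mult_right_mono mult_mono) auto
            then have le: "(?p t)\<^sup>2 \<le> C\<^sup>2 / c * (J (s,t) * ?H t)" using p2[of t] elim by (simp add: mult.assoc)
            show ?case unfolding real_norm_def abs_power2 by (rule order_trans[OF le abs_ge_self])
          qed
        qed measurable
        have "X\<^sup>2 \<le> B * (LINT t|onm {0<..<B}. (?p t)\<^sup>2)"
        proof -
          have "X\<^sup>2 \<le> (LINT t|onm {0<..<B}. \<bar>?p t\<bar>)\<^sup>2" unfolding X_def by (simp add: theta_bounds abs_mult)
          also have "\<dots> \<le> measure (onm {0<..<B}) UNIV * (LINT t|onm {0<..<B}. (?p t)\<^sup>2)"
            using fB.Cauchy_Schwarz_abs[of ?p] ip by (simp add: L2fun_def)
          finally show ?thesis using AB by (simp add: measure_ivl)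
        qed
        then have BX: "B * X\<^sup>2 \<le> B\<^sup>2 * (LINT t|onm {0<..<B}. (?p t)\<^sup>2)"
          using AB mult_left_mono[of "X\<^sup>2" "B * (LINT t|onm {0<..<B}. (?p t)\<^sup>2)" B] by (simp add: power2_eq_square mult.assoc)
        have "(LINT t|onm {0<..<B}. J (s,t) * (?w (\<Psi> (s,t)))\<^sup>2) \<le> (LINT t|onm {0<..<B}. (LINT t'|onm {0<..<B}. \<kappa> * (J (s,t') * ?H t')) / B)"
        proof (rule integral_mono_AE[OF elim(3)])
          show "AE t in onm {0<..<B}. J (s,t) * (?w (\<Psi> (s,t)))\<^sup>2 \<le> (LINT t'|onm {0<..<B}. \<kappa> * (J (s,t') * ?H t')) / B"
            using ww AE_ivl[of 0 B]
          proof eventually_elim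
            case (elim t)
            have "?w (\<Psi> (s,t)) \<le> X" "0 \<le> ?w (\<Psi> (s,t))" using elim X0 by (auto simp: cutpos_def split: split_indicator)
            then have "(?w (\<Psi> (s,t)))\<^sup>2 \<le> X\<^sup>2" by (intro power_mono) auto
            then have "B * (J (s,t) * (?w (\<Psi> (s,t)))\<^sup>2) \<le> J (s,t) * (B * X\<^sup>2)"
              using J0[of t] elim AB by (simp add: mult.left_commute)
            also have "\<dots> \<le> J (s,t) * (B\<^sup>2 * (LINT t'|onm {0<..<B}. (?p t')\<^sup>2))" using BX J0[of t] elim by (intro mult_left_mono) auto
            also have "\<dots> = (LINT t'|onm {0<..<B}. B\<^sup>2 * J (s,t) * (?p t')\<^sup>2)" by simp
            also have "\<dots> \<le> (LINT t'|onm {0<..<B}. \<kappa> * (J (s,t') * ?H t'))"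
            proof (rule integral_mono_AE)
              show "AE t' in onm {0<..<B}. B\<^sup>2 * J (s,t) * (?p t')\<^sup>2 \<le> \<kappa> * (J (s,t') * ?H t')"
                using AE_ivl[of 0 B]
              proof eventually_elim
                case (elim t')
                have "B\<^sup>2 * J (s,t) * (?p t')\<^sup>2 \<le> B\<^sup>2 * J (s,t) * ((norm (P2 (s,t')))\<^sup>2 * ?H t')"
                  using p2[of t'] elim J0[of t] \<open>0 < t \<and> t < B\<close> by (intro mult_left_mono) auto
                also have "\<dots> = (B\<^sup>2 * J (s,t) * (norm (P2 (s,t')))\<^sup>2) * ?H t'" by (simp only: mult.assoc)
                also have "\<dots> \<le> (\<kappa> * J (s,t')) * ?H t'"
                  using fibre_const[of s t t'] elim \<open>0 < s \<and> s < A\<close> \<open>0 < t \<and> t < B\<close> by (intro mult_right_mono) auto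
                finally show ?case by (simp only: mult.assoc)
              qed
            qed (use ip HJ in auto)
            finally show ?case using AB by (simp add: field_simps)
          qed
        qed simp
        also have "\<dots> = (LINT t'|onm {0<..<B}. \<kappa> * (J (s,t') * ?H t'))" using AB by (simp add: measure_ivl)
        finally show ?thesis .
      qed
    qed
  qed (use integral_Q_iterated(4)[OF iw] integral_Q_iterated(4)[OF ih] in auto)
  then show ?thesis
    using integral_D(1)[of "\<lambda>z. (?w z)\<^sup>2"] integral_D(1)[of "\<lambda>z. (?h1 z)\<^sup>2 + (?h2 z)\<^sup>2"] by (simp add: energy_def)
qed

end

section \<open>Signs on fibres and the odd minimizer\<close>

context symmetric_strip
begin

definition eigen_eq :: "real \<Rightarrow> (plane \<Rightarrow> real) \<Rightarrow> (plane \<Rightarrow> real) \<Rightarrow> (plane \<Rightarrow> real) \<Rightarrow> bool" where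
  "eigen_eq \<mu> u g1 g2 \<longleftrightarrow> (\<forall>v h1 h2. sob v h1 h2 \<longrightarrow>
     (LINT z|onm D. g1 z * h1 z + g2 z * h2 z) = \<mu> * (LINT z|onm D. u z * v z))"

lemma eigen_eq_lincomb:
  assumes e: "eigen_eq \<mu> u g1 g2" "eigen_eq \<mu> v h1 h2" and s: "sob u g1 g2" "sob v h1 h2"
  shows "eigen_eq \<mu> (\<lambda>z. p * u z + q * v z) (\<lambda>z. p * g1 z + q * h1 z) (\<lambda>z. p * g2 z + q * h2 z)"
  unfolding eigen_eq_def
proof (intro allI impI)
  fix w k1 k2 assume w: "sob w k1 k2"
  note i = L2fun_prod[OF sob_L2(1)[OF s(1)] sob_L2(1)[OF w]] L2fun_prod[OF sob_L2(1)[OF s(2)] sob_L2(1)[OF w]]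
    L2fun_prod[OF sob_L2(2)[OF s(1)] sob_L2(2)[OF w]] L2fun_prod[OF sob_L2(2)[OF s(2)] sob_L2(2)[OF w]]
    L2fun_prod[OF sob_L2(3)[OF s(1)] sob_L2(3)[OF w]] L2fun_prod[OF sob_L2(3)[OF s(2)] sob_L2(3)[OF w]]
  have "(\<lambda>z. (p * g1 z + q * h1 z) * k1 z + (p * g2 z + q * h2 z) * k2 z)
      = (\<lambda>z. p * (g1 z * k1 z + g2 z * k2 z) + q * (h1 z * k1 z + h2 z * k2 z))"
    by (simp add: fun_eq_iff algebra_simps)
  then have "(LINT z|onm D. (p * g1 z + q * h1 z) * k1 z + (p * g2 z + q * h2 z) * k2 z)
      = p * (LINT z|onm D. g1 z * k1 z + g2 z * k2 z) + q * (LINT z|onm D. h1 z * k1 z + h2 z * k2 z)"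
    using i by (simp only: Bochner_Integration.integral_add Bochner_Integration.integrable_add integrable_mult_right integral_mult_right_zero)
  also have "\<dots> = p * (\<mu> * (LINT z|onm D. u z * w z)) + q * (\<mu> * (LINT z|onm D. v z * w z))"
    unfolding e(1)[unfolded eigen_eq_def, rule_format, OF w] e(2)[unfolded eigen_eq_def, rule_format, OF w] ..
  also have "\<dots> = \<mu> * (p * (LINT z|onm D. u z * w z) + q * (LINT z|onm D. v z * w z))"
    by (simp only: distrib_left mult.left_commute)
  also have "\<dots> = \<mu> * (LINT z|onm D. (p * u z + q * v z) * w z)"
    using i by (simp only: distrib_right mult.assoc Bochner_Integration.integral_add integrable_mult_right integral_mult_right_zero)
  finally show "(LINT z|onm D. (p * g1 z + q * h1 z) * k1 z + (p * g2 z + q * h2 z) * k2 z) = \<mu> * (LINT z|onm D. (p * u z + q * v z) * w z)" .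
qed

text \<open>The cut function is a test function in the equation for \<open>u\<close>. Its product
  with \<open>u\<close> is its own square, and on the gradient side
  \<open>theta\<^sup>2 \<le> theta\<close> gives the inequality.\<close>

lemma cut_energy:
  assumes s: "sob u g1 g2" and e: "eigen_eq \<mu> u g1 g2" and sc: "sob (cutpos s2 u) (cutgrad s2 u g1) (cutgrad s2 u g2)"
  shows "energy (cutgrad s2 u g1) (cutgrad s2 u g2) \<le> \<mu> * (LINT z|onm D. (cutpos s2 u z)\<^sup>2)"
proof -
  note L = sob_L2[OF s] and Lc = sob_L2[OF sc]
  have sqw: "(cutpos s2 u z)\<^sup>2 = u z * cutpos s2 u z" for z
    by (auto simp: cutpos_def power2_eq_square max_def split: split_indicator)
  have le: "(cutgrad s2 u g z)\<^sup>2 \<le> g z * cutgrad s2 u g z" for g z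
  proof -
    have "(theta (u z))\<^sup>2 * (g z)\<^sup>2 \<le> theta (u z) * (g z)\<^sup>2" by (rule mult_right_mono) (auto simp: theta_bounds)
    then show ?thesis by (auto simp: cutgrad_def power2_eq_square algebra_simps split: split_indicator)
  qed
  have "energy (cutgrad s2 u g1) (cutgrad s2 u g2) \<le> (LINT z|onm D. g1 z * cutgrad s2 u g1 z + g2 z * cutgrad s2 u g2 z)"
    unfolding energy_def
    using L2fun_int[OF Lc(2)] L2fun_int[OF Lc(3)] L2fun_prod[OF L(2) Lc(2)] L2fun_prod[OF L(3) Lc(3)]
    by (intro integral_mono add_mono le) auto
  also have "\<dots> = \<mu> * (LINT z|onm D. u z * cutpos s2 u z)" by (rule e[unfolded eigen_eq_def, rule_format, OF sc])
  finally show ?thesis unfolding sqw .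
qed

lemma kappa_nonneg: "\<kappa> \<ge> 0"
proof -
  have st: "A/2 \<in> {0<..<A}" "B/2 \<in> {0<..<B}" using AB by auto
  then have J: "J (A/2,B/2) > 0" using J_low[of "(A/2,B/2)"] c_pos by auto
  then have "0 \<le> B\<^sup>2 * J (A/2,B/2) * (norm (P2 (A/2,B/2)))\<^sup>2" by simp
  also have "\<dots> \<le> \<kappa> * J (A/2,B/2)" by (rule fibre_const[OF st(1) st(2) st(2)])
  finally show ?thesis using J by (simp add: zero_le_mult_iff)
qed

lemma integral_square_zero_AE:
  assumes "L2fun M f" "(LINT z|M. (f z)\<^sup>2) = 0"
  shows "AE z in M. f z = 0"
proof -
  have "AE z in M. (f z)\<^sup>2 = 0" using assms L2fun_int[OF assms(1)] by (subst (asm) integral_nonneg_eq_0_iff_AE) auto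
  then show ?thesis by eventually_elim simp
qed

lemma exists_positive_fibre:
  assumes s: "sob u g1 g2" and e: "eigen_eq \<mu> u g1 g2" and \<mu>: "\<kappa> * \<mu> < 1"
    and m0: "(LINT z|onm D. u z) = 0" and n: "(LINT z|onm D. (u z)\<^sup>2) \<noteq> 0"
  shows "\<not> (AE s in onm {0<..<A}. \<not> (AE t in onm {0<..<B}. u (\<Psi> (s,t)) > 0))"
proof
  assume *: "AE s in onm {0<..<A}. \<not> (AE t in onm {0<..<B}. u (\<Psi> (s,t)) > 0)"
  define b where "b = (LINT z|onm D. (cutpos A u z)\<^sup>2)"
  have "b \<le> \<kappa> * energy (cutgrad A u g1) (cutgrad A u g2)" unfolding b_def by (rule fibre_inequality[OF s *])
  also have "\<dots> \<le> \<kappa> * (\<mu> * b)" unfolding b_def by (rule mult_left_mono[OF cut_energy[OF s e sob_pos[OF s]] kappa_nonneg])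
  finally have "(1 - \<kappa> * \<mu>) * b \<le> 0" by (simp add: algebra_simps)
  moreover have "b \<ge> 0" by (simp add: b_def)
  ultimately have "b = 0" using \<mu> by (simp add: mult_le_0_iff)
  then have "AE z in onm D. cutpos A u z = 0" unfolding b_def by (intro integral_square_zero_AE sob_L2(1)[OF sob_pos[OF s]])
  then have np: "AE z in onm D. 0 \<le> - u z"
    using AE_onm_mem[OF D_sets] by eventually_elim (auto simp: cutpos_def below_A max_def split: if_splits)
  have "(LINT z|onm D. - u z) = 0" using m0 by simp
  then have "AE z in onm D. - u z = 0" using np sob_integrable(1)[OF s] by (subst (asm) integral_nonneg_eq_0_iff_AE) auto
  then have "AE z in onm D. (u z)\<^sup>2 = 0" by eventually_elim simp
  then have "(LINT z|onm D. (u z)\<^sup>2) = 0" by (rule integral_eq_zero_AE)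
  then show False using n by simp
qed

text \<open>Oddness is required at every point. The odd functions constructed here are explicit
  differences of a function and its reflection, so no null sets have to be carried along.\<close>

definition odd_solution :: "real \<Rightarrow> bool" where
  "odd_solution \<mu> \<longleftrightarrow> (\<exists>v h1 h2. sob v h1 h2 \<and> (\<forall>z. v (sig z) = - v z) \<and> (LINT z|onm D. (v z)\<^sup>2) \<noteq> 0 \<and> eigen_eq \<mu> v h1 h2)"

text \<open>A positive part cut off at a line left of the axis and extended oddly is an odd competitor
  with Rayleigh quotient at most \<open>\<mu>\<close>, hence a minimizer.\<close>

lemma odd_solution_from_cut:
  assumes low: "\<And>v h1 h2. sob v h1 h2 \<Longrightarrow> (LINT z|onm D. v z) = 0 \<Longrightarrow> \<mu> * (LINT z|onm D. (v z)\<^sup>2) \<le> energy h1 h2"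
    and s: "sob u g1 g2" and e: "eigen_eq \<mu> u g1 g2" and sc: "sob (cutpos s2 u) (cutgrad s2 u g1) (cutgrad s2 u g2)"
    and s2: "s2 < A / 2" and nz: "(LINT z|onm D. (cutpos s2 u z)\<^sup>2) \<noteq> 0"
  shows "odd_solution \<mu>"
proof -
  let ?w = "cutpos s2 u" and ?k1 = "cutgrad s2 u g1" and ?k2 = "cutgrad s2 u g2"
  note Lc = sob_L2[OF sc]
  note Ls = L2fun_sig[OF Lc(1)] L2fun_sig[OF Lc(2)] L2fun_sig[OF Lc(3)]
  have m [measurable]: "?w \<in> borel_measurable borel" "?k1 \<in> borel_measurable borel" "?k2 \<in> borel_measurable borel"
    using Lc by (auto intro: L2fun_onm_borel)
  \<comment> \<open>This is where the cut to the left of the axis matters: the two supports are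
    disjoint, mixed products vanish, and squares and energies add up.\<close>
  have dis: "sig z \<notin> below s2" if z: "z \<in> below s2" for z
  proof -
    obtain s t where st: "z = \<Psi> (s,t)" "(s,t) \<in> Q" "s < s2" using z by (auto simp: below_def)
    then have "sig z = \<Psi> (A - s, t)" "(A - s, t) \<in> Q" using sym[of s t] by (auto simp: Q_def)
    then show ?thesis using below_iff[of "(A - s, t)" s2] st(3) s2 by simp
  qed
  have prod0: "?w z * ?w (sig z) = 0" "cutgrad s2 u g z * cutgrad s2 u g (sig z) = 0" for z g
    using dis[of z] by (auto simp: cutpos_def cutgrad_def split: split_indicator)
  define v where "v z = ?w z - ?w (sig z)" for z
  define h1 where "h1 z = ?k1 z + ?k1 (sig z)" for z
  define h2 where "h2 z = ?k2 z - ?k2 (sig z)" for z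
  have sv: "sob v h1 h2"
    using sob_lincomb[OF sc sob_sig[OF sc], of 1 "-1"] by (simp add: v_def[abs_def] h1_def[abs_def] h2_def[abs_def])
  have sq: "(v z)\<^sup>2 = (?w z)\<^sup>2 + (?w (sig z))\<^sup>2" "(h1 z)\<^sup>2 = (?k1 z)\<^sup>2 + (?k1 (sig z))\<^sup>2" "(h2 z)\<^sup>2 = (?k2 z)\<^sup>2 + (?k2 (sig z))\<^sup>2" for z
    unfolding v_def h1_def h2_def power2_sum power2_diff using prod0(1)[of z] prod0(2)[of g1 z] prod0(2)[of g2 z] by (simp_all add: mult.assoc)
  have dbl: "(LINT z|onm D. (f z)\<^sup>2 + (f (sig z))\<^sup>2) = 2 * (LINT z|onm D. (f z)\<^sup>2)" if f: "L2fun (onm D) f" for f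
  proof -
    have [measurable]: "f \<in> borel_measurable borel" using f by (rule L2fun_onm_borel)
    show ?thesis using L2fun_int[OF f] L2fun_int[OF L2fun_sig[OF f]] integral_sig(1)[of "\<lambda>z. (f z)\<^sup>2"] by simp
  qed
  have v2: "(LINT z|onm D. (v z)\<^sup>2) = 2 * (LINT z|onm D. (?w z)\<^sup>2)" unfolding sq by (rule dbl[OF Lc(1)])
  have eh: "energy h1 h2 = 2 * energy ?k1 ?k2"
    unfolding energy_split[OF sv] energy_split[OF sc] sq dbl[OF Lc(2)] dbl[OF Lc(3)] by simp
  have v0: "(LINT z|onm D. v z) = 0"
    unfolding v_def using fD.L2fun_integrable[OF Lc(1)] fD.L2fun_integrable[OF Ls(1)] integral_sig(1)[OF m(1)] by simp
  have "energy h1 h2 \<le> \<mu> * (LINT z|onm D. (v z)\<^sup>2)" unfolding eh v2 using cut_energy[OF s e sc] by simp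
  \<comment> \<open>The cut function alone need not have mean value zero; its odd extension does, so
    it competes, attains the minimum and satisfies the equation.\<close>
  then have en: "energy h1 h2 = \<mu> * (LINT z|onm D. (v z)\<^sup>2)" using low[OF sv v0] by simp
  have "eigen_eq \<mu> v h1 h2" unfolding eigen_eq_def using euler_lagrange[OF sv v0 en low] by blast
  moreover have "\<forall>z. v (sig z) = - v z" by (simp add: v_def)
  moreover have "(LINT z|onm D. (v z)\<^sup>2) \<noteq> 0" using nz v2 by simp
  ultimately show ?thesis unfolding odd_solution_def using sv by blast
qed

lemma onm_B_nonnull: "\<not> (AE t in onm {0<..<B}. False)"
proof
  assume "AE t in onm {0<..<B}. False"
  then have "emeasure (onm {0<..<B}) UNIV = 0" using AE_iff_measurable[of UNIV "onm {0<..<B}" "\<lambda>_. False"] by simp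
  then show False using AB by (simp add: emeasure_onm)
qed

text \<open>A nonzero cut at a negative fibre would yield an odd solution. In the absence of odd
  solutions almost no positive fibre lies to the left of a negative one that is itself left of the
  axis.\<close>

lemma cut_dichotomy:
  assumes low: "\<And>v h1 h2. sob v h1 h2 \<Longrightarrow> (LINT z|onm D. v z) = 0 \<Longrightarrow> \<mu> * (LINT z|onm D. (v z)\<^sup>2) \<le> energy h1 h2"
    and s: "sob u g1 g2" and e: "eigen_eq \<mu> u g1 g2" and no: "\<not> odd_solution \<mu>"
  shows "AE s2 in onm {0<..<A}. (AE t in onm {0<..<B}. u (\<Psi> (s2,t)) < 0) \<and> s2 < A / 2 \<longrightarrow>
     (AE s in onm {0<..<A}. s < s2 \<longrightarrow> \<not> (AE t in onm {0<..<B}. u (\<Psi> (s,t)) > 0))"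
  using sob_cut_good[OF s]
proof eventually_elim
  case (elim s2)
  show ?case
  proof
    assume *: "(AE t in onm {0<..<B}. u (\<Psi> (s2,t)) < 0) \<and> s2 < A / 2"
    then have sc: "sob (cutpos s2 u) (cutgrad s2 u g1) (cutgrad s2 u g2)" using elim by blast
    have [measurable]: "u \<in> borel_measurable borel" using sob_L2(1)[OF s] by (rule L2fun_onm_borel)
    have [measurable]: "cutpos s2 u \<in> borel_measurable borel" using sob_L2(1)[OF sc] by (rule L2fun_onm_borel)
    have "(LINT z|onm D. (cutpos s2 u z)\<^sup>2) = 0" using odd_solution_from_cut[OF low s e sc] * no by blast
    then have "AE z in onm D. cutpos s2 u z = 0" by (rule integral_square_zero_AE[OF sob_L2(1)[OF sc]])
    then have "AE z in onm Q. cutpos s2 u (\<Psi> z) = 0" by (subst (asm) AE_D) auto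
    then have "AE s in onm {0<..<A}. AE t in onm {0<..<B}. cutpos s2 u (\<Psi> (s,t)) = 0"
      by (rule pQ.AE_pair[unfolded onm_Q])
    then show "AE s in onm {0<..<A}. s < s2 \<longrightarrow> \<not> (AE t in onm {0<..<B}. u (\<Psi> (s,t)) > 0)"
      using AE_ivl[of 0 A]
    proof eventually_elim
      case (elim s)
      show ?case
      proof (intro impI notI)
        assume "s < s2" and pos: "AE t in onm {0<..<B}. u (\<Psi> (s,t)) > 0"
        have "AE t in onm {0<..<B}. False"
          using pos elim(1) AE_ivl[of 0 B]
        proof eventually_elim
          case (elim t)
          have "(s,t) \<in> Q" using elim \<open>0 < s \<and> s < A\<close> by (auto simp: Q_def)
          then have "\<Psi> (s,t) \<in> below s2" using below_iff[of "(s,t)" s2] \<open>s < s2\<close> by simp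
          then show ?case using elim by (simp add: cutpos_def)
        qed
        then show False using onm_B_nonnull by simp
      qed
    qed
  qed
qed

text \<open>Needed when two almost-everywhere quantifiers over pairs of fibres with prescribed signs
  are exchanged: the measure of the bad part of a fibre depends measurably on the fibre.\<close>

lemma fibre_sign_sets:
  fixes f :: "plane \<Rightarrow> real"
  assumes [measurable]: "f \<in> borel_measurable (borel :: plane measure)"
  shows "{s. AE t in onm {0<..<B}. f (s,t) > 0} \<in> sets borel"
proof -
  have S: "{z. \<not> f z > 0} \<in> sets (borel \<Otimes>\<^sub>M onm {0<..<B})"
  proof -
    have "{z. \<not> f z > 0} = f -` {..0}" by auto
    then have "{z. \<not> f z > 0} \<in> sets borel" using measurable_sets[OF assms, of "{..0}"] by simp
    moreover have "sets (borel \<Otimes>\<^sub>M onm {0<..<B}) = sets (borel :: plane measure)"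
      by (simp add: borel_prod[symmetric] cong: sets_pair_measure_cong)
    ultimately show ?thesis by simp
  qed
  have "(\<lambda>s. emeasure (onm {0<..<B}) (Pair s -` {z. \<not> f z > 0})) \<in> borel_measurable borel"
    by (rule fB.measurable_emeasure_Pair[OF S])
  then have "{s \<in> space borel. emeasure (onm {0<..<B}) (Pair s -` {z. \<not> f z > 0}) = 0} \<in> sets borel" by measurable
  also have "{s \<in> space borel. emeasure (onm {0<..<B}) (Pair s -` {z. \<not> f z > 0}) = 0} = {s. AE t in onm {0<..<B}. f (s,t) > 0}"
  proof (intro Collect_cong)
    fix s
    have "(AE t in onm {0<..<B}. f (s,t) > 0) \<longleftrightarrow> emeasure (onm {0<..<B}) (Pair s -` {z. \<not> f z > 0}) = 0"
    proof (rule AE_iff_measurable)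
      have "(\<lambda>t. f (s,t)) \<in> borel_measurable borel" by measurable
      from measurable_sets[OF this, of "{..0}"]
      have "(\<lambda>t. f (s,t)) -` {..0} \<in> sets borel" by simp
      moreover have "(\<lambda>t. f (s,t)) -` {..0} = Pair s -` {z. \<not> f z > 0}" by auto
      ultimately show "Pair s -` {z. \<not> f z > 0} \<in> sets (onm {0<..<B})" by simp
    qed auto
    then show "(s \<in> space borel \<and> emeasure (onm {0<..<B}) (Pair s -` {z. \<not> f z > 0}) = 0) = (AE t in onm {0<..<B}. f (s,t) > 0)" by simp
  qed
  finally show ?thesis .
qed

lemma AE_reflect:
  assumes "AE s in onm {0<..<A}. R s"
  shows "AE s in onm {0<..<A}. R (A - s)"
proof -
  have "AE s in lborel. s \<in> {0<..<A} \<longrightarrow> R s" using assms by (simp add: AE_onm)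
  then have "AE s in distr lborel borel (\<lambda>x. A - x). s \<in> {0<..<A} \<longrightarrow> R s" by (subst lborel_distr_reflect)
  then have "AE s in lborel. A - s \<in> {0<..<A} \<longrightarrow> R (A - s)" by (rule AE_distrD[rotated]) simp
  then show ?thesis by (subst AE_onm) (auto elim!: eventually_mono)
qed

theorem odd_minimizer:
  assumes s: "sob u g1 g2" and m0: "(LINT z|onm D. u z) = 0" and n1: "(LINT z|onm D. (u z)\<^sup>2) = 1"
    and low: "\<And>v h1 h2. sob v h1 h2 \<Longrightarrow> (LINT z|onm D. v z) = 0 \<Longrightarrow> energy g1 g2 * (LINT z|onm D. (v z)\<^sup>2) \<le> energy h1 h2"
    and \<kappa>: "\<kappa> * energy g1 g2 < 1"
  shows "odd_solution (energy g1 g2)"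
proof (rule ccontr)
  assume no: "\<not> odd_solution (energy g1 g2)"
  define \<mu> where "\<mu> = energy g1 g2"
  note low = low[folded \<mu>_def] and no = no[folded \<mu>_def] and \<kappa> = \<kappa>[folded \<mu>_def]
  note L = sob_L2[OF s]
  have [measurable]: "u \<in> borel_measurable borel" "g1 \<in> borel_measurable borel" "g2 \<in> borel_measurable borel"
    using L by (auto intro: L2fun_onm_borel)
  have e: "eigen_eq \<mu> u g1 g2"
    unfolding eigen_eq_def using euler_lagrange[OF s m0 _ low] n1 by (simp add: \<mu>_def)
  have ss: "sob (\<lambda>z. u (sig z)) (\<lambda>z. - g1 (sig z)) (\<lambda>z. g2 (sig z))" by (rule sob_sig[OF s])
  have ms: "(LINT z|onm D. u (sig z)) = 0" using m0 by (simp add: integral_sig)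
  have ns: "(LINT z|onm D. (u (sig z))\<^sup>2) = 1" using n1 integral_sig(1)[of "\<lambda>z. (u z)\<^sup>2"] by simp
  have "energy (\<lambda>z. - g1 (sig z)) (\<lambda>z. g2 (sig z)) = \<mu>"
    unfolding \<mu>_def energy_def using integral_sig(1)[of "\<lambda>z. (g1 z)\<^sup>2 + (g2 z)\<^sup>2"] by simp
  then have es: "eigen_eq \<mu> (\<lambda>z. u (sig z)) (\<lambda>z. - g1 (sig z)) (\<lambda>z. g2 (sig z))"
    unfolding eigen_eq_def using euler_lagrange[OF ss ms _ low] ns by simp
  have "(LINT z|onm D. (u z - u (sig z))\<^sup>2) = 0"
  proof (rule ccontr)
    assume "(LINT z|onm D. (u z - u (sig z))\<^sup>2) \<noteq> 0"
    then have "odd_solution \<mu>"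
      unfolding odd_solution_def
      using sob_lincomb[OF s ss, of 1 "-1"] eigen_eq_lincomb[OF e es s ss, of 1 "-1"]
      by (intro exI[of _ "\<lambda>z. u z - u (sig z)"] exI[of _ "\<lambda>z. g1 z + g1 (sig z)"] exI[of _ "\<lambda>z. g2 z - g2 (sig z)"]) simp
    then show False using no by simp
  qed
  then have "AE z in onm D. u z - u (sig z) = 0"
    by (rule integral_square_zero_AE[OF L2fun_diff[OF L(1) L2fun_sig[OF L(1)]]])
  then have "AE z in onm Q. u (\<Psi> z) - u (sig (\<Psi> z)) = 0" by (subst (asm) AE_D) auto
  then have "AE s in onm {0<..<A}. AE t in onm {0<..<B}. u (\<Psi> (s,t)) - u (sig (\<Psi> (s,t))) = 0"
    by (rule pQ.AE_pair[unfolded onm_Q])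
  then have even: "AE s in onm {0<..<A}. AE t in onm {0<..<B}. u (\<Psi> (A - s,t)) = u (\<Psi> (s,t))"
    using AE_ivl[of 0 A]
  proof eventually_elim
    case (elim s)
    show ?case using elim(1) AE_ivl[of 0 B] by eventually_elim (use elim(2) sym[of s] in auto)
  qed
  define PP where "PP = {s. AE t in onm {0<..<B}. u (\<Psi> (s,t)) > 0}"
  define NN where "NN = {s. AE t in onm {0<..<B}. - u (\<Psi> (s,t)) > 0}"
  have [measurable]: "PP \<in> sets borel" "NN \<in> sets borel"
    unfolding PP_def NN_def using fibre_sign_sets[of "\<lambda>z. u (\<Psi> z)"] fibre_sign_sets[of "\<lambda>z. - u (\<Psi> z)"] by simp_all
  \<comment> \<open>Evenness carries a set of signed fibres from the left half to the right half; if
    it is null on the left, it is null altogether.\<close>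
  have nul: "AE s in onm {0<..<A}. s \<notin> S"
    if S: "S = PP \<or> S = NN" and h: "AE s in onm {0<..<A}. s < A / 2 \<longrightarrow> s \<notin> S" for S
  proof -
    have pt: "AE s in onm {0<..<A}. s \<noteq> A / 2" using AE_lborel_singleton[of "A/2"] by (subst AE_onm) (auto elim!: eventually_mono)
    show ?thesis using h AE_reflect[OF h] even pt
    proof eventually_elim
      case (elim s)
      have iff: "A - s \<in> S \<longleftrightarrow> s \<in> S"
        using S
      proof
        assume S: "S = PP"
        show ?thesis unfolding S PP_def mem_Collect_eq
          by (rule iffI; (erule eventually_elim2[OF _ elim(3)]; simp))
      next
        assume S: "S = NN"
        show ?thesis unfolding S NN_def mem_Collect_eq
          by (rule iffI; (erule eventually_elim2[OF _ elim(3)]; simp))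
      qed
      show ?case
      proof (cases "s < A / 2")
        case False
        then have "A - s < A / 2" using elim(4) by linarith
        then show ?thesis using elim(2) iff by simp
      qed (use elim(1) in simp)
    qed
  qed
  have neg: "sob (\<lambda>z. - u z) (\<lambda>z. - g1 z) (\<lambda>z. - g2 z)" "eigen_eq \<mu> (\<lambda>z. - u z) (\<lambda>z. - g1 z) (\<lambda>z. - g2 z)"
    using sob_lincomb[OF s s, of "-1" 0] eigen_eq_lincomb[OF e e s s, of "-1" 0] by simp_all
  have nP: "\<not> (AE s in onm {0<..<A}. s \<notin> PP)"
    unfolding PP_def using exists_positive_fibre[OF s e \<kappa> m0] n1 by simp
  have nN: "\<not> (AE s in onm {0<..<A}. s \<notin> NN)"
    unfolding NN_def using exists_positive_fibre[OF neg \<kappa>] m0 n1 by simp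
  have i: "AE s2 in onm {0<..<A}. s2 \<in> NN \<and> s2 < A / 2 \<longrightarrow> (AE s in onm {0<..<A}. s < s2 \<longrightarrow> s \<notin> PP)"
    using cut_dichotomy[OF low s e no] unfolding NN_def PP_def by simp
  have ii: "AE s1 in onm {0<..<A}. s1 \<in> PP \<and> s1 < A / 2 \<longrightarrow> (AE s in onm {0<..<A}. s < s1 \<longrightarrow> s \<notin> NN)"
    using cut_dichotomy[OF low neg no] unfolding NN_def PP_def by simp
  interpret AA: pair_sigma_finite "onm {0<..<A}" "onm {0<..<A}" ..
  have "AE s1 in onm {0<..<A}. AE s in onm {0<..<A}. s1 \<in> PP \<and> s1 < A / 2 \<and> s < s1 \<longrightarrow> s \<notin> NN"
    using ii by eventually_elim auto
  then have "AE s in onm {0<..<A}. AE s1 in onm {0<..<A}. s1 \<in> PP \<and> s1 < A / 2 \<and> s < s1 \<longrightarrow> s \<notin> NN"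
  proof (subst AA.AE_commute)
    show "{x \<in> space (onm {0<..<A} \<Otimes>\<^sub>M onm {0<..<A}). snd x \<in> PP \<and> snd x < A / 2 \<and> fst x < snd x \<longrightarrow> fst x \<notin> NN} \<in> sets (onm {0<..<A} \<Otimes>\<^sub>M onm {0<..<A})"
      by measurable
  qed
  \<comment> \<open>Below a negative fibre \<open>s2\<close> almost no fibre is positive by
    \<open>i\<close>; above it, up to the axis, almost none is by \<open>ii\<close> with the
    quantifiers exchanged. One suitable negative fibre on the left would thus exclude positive
    fibres on the whole left half, against \<open>nP\<close> and evenness.\<close>
  then have iii: "AE s2 in onm {0<..<A}. s2 \<in> NN \<and> s2 < A / 2 \<longrightarrow> (AE s in onm {0<..<A}. s < A / 2 \<longrightarrow> s \<notin> PP)"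
    using i
  proof eventually_elim
    case (elim s2)
    show ?case
    proof
      assume s2: "s2 \<in> NN \<and> s2 < A / 2"
      have pt: "AE s in onm {0<..<A}. s \<noteq> s2" using AE_lborel_singleton[of s2] by (subst AE_onm) (auto elim!: eventually_mono)
      have "AE s in onm {0<..<A}. s < s2 \<longrightarrow> s \<notin> PP" using elim(2) s2 by blast
      then show "AE s in onm {0<..<A}. s < A / 2 \<longrightarrow> s \<notin> PP"
        using elim(1) pt by eventually_elim (use s2 in auto)
    qed
  qed
  have nPP: "\<not> (AE s in onm {0<..<A}. s < A / 2 \<longrightarrow> s \<notin> PP)" using nul[of PP] nP by blast
  have "AE s2 in onm {0<..<A}. s2 < A / 2 \<longrightarrow> s2 \<notin> NN"
    using iii by eventually_elim (use nPP in blast)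
  then show False using nul[of NN] nN by blast
qed

end

section \<open>Minimizers and Neumann eigenvalues\<close>

lemma lebesgue_on_borel_rep:
  fixes f :: "plane \<Rightarrow> real"
  assumes D: "D \<in> sets borel" and f: "f \<in> borel_measurable (lebesgue_on D)"
  obtains f' where "f' \<in> borel_measurable borel" "AE z in lebesgue_on D. f z = f' z"
proof -
  have "(\<lambda>z. indicator D z *\<^sub>R f z) \<in> borel_measurable lebesgue"
    using f D by (subst (asm) borel_measurable_restrict_space_iff) auto
  then obtain f' where f': "f' \<in> borel_measurable lborel" "AE z in lborel. indicator D z *\<^sub>R f z = f' z"
    using completion_ex_borel_measurable_real by blast
  from f'(2) have "AE z in lborel. z \<in> D \<longrightarrow> f z = f' z" by eventually_elim auto
  then have "AE z in lebesgue_on D. f z = f' z" using D by (simp add: AE_lebesgue_on_onm AE_onm)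
  then show thesis using f'(1) that by simp
qed

lemma borel_imp_lebesgue_on:
  "f \<in> borel_measurable borel \<Longrightarrow> f \<in> borel_measurable (lebesgue_on D)"
  by (intro measurable_restrict_space1 measurable_completion) simp

lemma lebesgue_on_onm_AE:
  fixes f f' :: "plane \<Rightarrow> real"
  assumes D: "D \<in> sets borel" and f: "f \<in> borel_measurable (lebesgue_on D)" and f': "f' \<in> borel_measurable borel"
    and ae: "AE z in lebesgue_on D. f z = f' z"
  shows "(LINT z|lebesgue_on D. f z) = (LINT z|onm D. f' z)" "integrable (lebesgue_on D) f \<longleftrightarrow> integrable (onm D) f'"
proof -
  show "(LINT z|lebesgue_on D. f z) = (LINT z|onm D. f' z)"
    unfolding lebesgue_on_onm(1)[OF D f', symmetric] by (rule integral_cong_AE[OF f borel_imp_lebesgue_on[OF f'] ae])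
  show "integrable (lebesgue_on D) f \<longleftrightarrow> integrable (onm D) f'"
    unfolding lebesgue_on_onm(2)[OF D f', symmetric] by (rule integrable_cong_AE[OF f borel_imp_lebesgue_on[OF f'] ae])
qed

lemma powr_two: "norm (v::'a::real_normed_vector) powr 2 = (norm v)\<^sup>2" "\<bar>w::real\<bar> powr 2 = w\<^sup>2"
  by (simp_all add: powr_numeral)

text \<open>At a zero the factor \<open>0 powr 0\<close> is 0 rather than 1, but there it multiplies
  0; so for the exponent 2 the definitions reduce to the Laplacian without exception.\<close>

lemma powr_zero_mult: "norm (v::plane) powr (2 - 2) * (v \<bullet> w) = v \<bullet> w" "\<bar>p::real\<bar> powr (2 - 2) * p = p"
  by (cases "v = 0"; simp) (cases "p = 0"; simp)

lemma plane_norm_sq: "(norm (v::plane))\<^sup>2 = (fst v)\<^sup>2 + (snd v)\<^sup>2"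
  by (simp add: norm_prod_def)

lemma plane_inner: "(v::plane) \<bullet> w = fst v * fst w + snd v * snd w"
  by (simp add: inner_prod_def)

section \<open>Translation between Borel representatives and Lebesgue measurable functions\<close>

context strip_chart
begin

lemma sobolev_from_sob:
  assumes s: "sob u g1 g2"
  shows "sobolev 2 D u (\<lambda>z. (g1 z, g2 z))"
proof -
  note L = sob_L2[OF s]
  have m [measurable]: "u \<in> borel_measurable borel" "g1 \<in> borel_measurable borel" "g2 \<in> borel_measurable borel"
    using L by (auto intro: L2fun_onm_borel)
  have gm: "(\<lambda>z. (g1 z, g2 z)) \<in> borel_measurable borel" by (rule borel_measurable_Pair) (rule m)+
  have "integrable (onm D) (\<lambda>z. (g1 z)\<^sup>2 + (g2 z)\<^sup>2)" "integrable (onm D) (\<lambda>z. (u z)\<^sup>2)" using L by (auto simp: L2fun_def)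
  then have "in_Lp 2 D u" "in_Lp 2 D (\<lambda>z. (g1 z, g2 z))"
    unfolding in_Lp_def powr_two plane_norm_sq real_norm_def power2_abs using borel_imp_lebesgue_on[OF m(1)] borel_imp_lebesgue_on[OF gm]
    by (auto simp: lebesgue_on_onm(2)[OF D_sets])
  moreover have "weak_gradient D u (\<lambda>z. (g1 z, g2 z))"
    unfolding weak_gradient_def
  proof (intro allI impI ballI)
    fix \<phi> and b :: plane assume tf: "test_function D \<phi>" and b: "b \<in> Basis"
    have [measurable]: "\<phi> \<in> borel_measurable borel" "partial_deriv (1,0) \<phi> \<in> borel_measurable borel" "partial_deriv (0,1) \<phi> \<in> borel_measurable borel"
      using test_function_C1[OF tf] borel_measurable_continuous_onI by metis+
    have "b = (1,0) \<or> b = (0,1)" using b by (auto simp: Basis_prod_def)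
    then show "(LINT z|lebesgue_on D. u z * partial_deriv b \<phi> z) = - (LINT z|lebesgue_on D. (g1 z, g2 z) \<bullet> b * \<phi> z)"
      using sob_weak[OF s tf] by (auto simp: lebesgue_on_onm(1)[OF D_sets] plane_inner)
  qed
  ultimately show ?thesis by (simp add: sobolev_def)
qed

text \<open>A Lebesgue measurable function agrees almost everywhere with a Borel function, and every
  condition in \<open>sobolev\<close> is an integral or measurability condition that survives this
  change.\<close>

lemma sob_from_sobolev:
  assumes s: "sobolev 2 D u g"
  obtains u' g1 g2 where "sob u' g1 g2" "AE z in lebesgue_on D. u z = u' z" "AE z in lebesgue_on D. g z = (g1 z, g2 z)"
proof -
  have um: "u \<in> borel_measurable (lebesgue_on D)" and gm: "g \<in> borel_measurable (lebesgue_on D)"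
    and ui: "integrable (lebesgue_on D) (\<lambda>z. (u z)\<^sup>2)" and gi: "integrable (lebesgue_on D) (\<lambda>z. (norm (g z))\<^sup>2)"
    using s by (auto simp: sobolev_def in_Lp_def powr_two)
  have w: "weak_gradient D u g" using s by (simp add: sobolev_def)
  note gc = plane_components_measurable[OF gm]
  obtain u' where u' [measurable]: "u' \<in> borel_measurable borel" and ua: "AE z in lebesgue_on D. u z = u' z"
    using lebesgue_on_borel_rep[OF D_sets um] by blast
  obtain g1 where g1 [measurable]: "g1 \<in> borel_measurable borel" and g1a: "AE z in lebesgue_on D. fst (g z) = g1 z"
    using lebesgue_on_borel_rep[OF D_sets gc(1)] by blast
  obtain g2 where g2 [measurable]: "g2 \<in> borel_measurable borel" and g2a: "AE z in lebesgue_on D. snd (g z) = g2 z"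
    using lebesgue_on_borel_rep[OF D_sets gc(2)] by blast
  have ga: "AE z in lebesgue_on D. g z = (g1 z, g2 z)" using g1a g2a by eventually_elim (auto simp: prod_eq_iff)
  have "integrable (onm D) (\<lambda>z. (u' z)\<^sup>2)"
    using ui by (subst (asm) lebesgue_on_onm_AE(2)[OF D_sets, of _ "\<lambda>z. (u' z)\<^sup>2"]) (use um ua in \<open>auto elim!: eventually_mono\<close>)
  then have LU: "L2fun (onm D) u'" by (simp add: L2fun_def)
  have gg: "integrable (onm D) (\<lambda>z. (g1 z)\<^sup>2 + (g2 z)\<^sup>2)"
    using gi by (subst (asm) lebesgue_on_onm_AE(2)[OF D_sets, of _ "\<lambda>z. (g1 z)\<^sup>2 + (g2 z)\<^sup>2"])
      (use gm gc ga in \<open>auto simp: plane_norm_sq elim!: eventually_mono\<close>)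
  have LG: "L2fun (onm D) g1" "L2fun (onm D) g2"
    unfolding L2fun_def by (auto intro!: Bochner_Integration.integrable_bound[OF gg])
  have "sob u' g1 g2"
    unfolding sob_def
  proof (intro conjI allI impI LU LG)
    fix \<phi> assume tf: "test_function D \<phi>"
    have [measurable]: "\<phi> \<in> borel_measurable borel" and p [measurable]: "partial_deriv (1,0) \<phi> \<in> borel_measurable borel" "partial_deriv (0,1) \<phi> \<in> borel_measurable borel"
      using test_function_C1[OF tf] borel_measurable_continuous_onI by metis+
    note lm = borel_imp_lebesgue_on[of \<phi> D] borel_imp_lebesgue_on[OF p(1), of D] borel_imp_lebesgue_on[OF p(2), of D]
    have tr: "(LINT z|lebesgue_on D. f z * h z) = (LINT z|onm D. f' z * h z)"
      if "f \<in> borel_measurable (lebesgue_on D)" "f' \<in> borel_measurable borel" "AE z in lebesgue_on D. f z = f' z" "h \<in> borel_measurable borel" for f f' h :: "plane \<Rightarrow> real"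
      by (rule lebesgue_on_onm_AE(1)[OF D_sets]) (use that borel_imp_lebesgue_on[OF that(4), of D] in \<open>auto elim!: eventually_mono\<close>)
    have B: "(1,0) \<in> (Basis :: plane set)" "(0,1) \<in> (Basis :: plane set)" by (auto simp: Basis_prod_def)
    have 1: "(LINT z|lebesgue_on D. u z * partial_deriv (1,0) \<phi> z) = - (LINT z|lebesgue_on D. fst (g z) * \<phi> z)"
      and 2: "(LINT z|lebesgue_on D. u z * partial_deriv (0,1) \<phi> z) = - (LINT z|lebesgue_on D. snd (g z) * \<phi> z)"
      using w tf B unfolding weak_gradient_def by (fastforce simp: plane_inner)+
    show "(LINT z|onm D. u' z * partial_deriv (1,0) \<phi> z) = - (LINT z|onm D. g1 z * \<phi> z)"
      using 1 tr[OF um u' ua p(1)] tr[OF gc(1) g1 g1a, of \<phi>] by simp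
    show "(LINT z|onm D. u' z * partial_deriv (0,1) \<phi> z) = - (LINT z|onm D. g2 z * \<phi> z)"
      using 2 tr[OF um u' ua p(2)] tr[OF gc(2) g2 g2a, of \<phi>] by simp
  qed
  then show thesis using that ua ga by blast
qed

lemma nonzero_on_iff:
  assumes "L2fun (onm D) u"
  shows "nonzero_on D u \<longleftrightarrow> (LINT z|onm D. (u z)\<^sup>2) \<noteq> 0"
  unfolding nonzero_on_def AE_lebesgue_on_onm[OF D_sets]
  using L2fun_int[OF assms] by (subst integral_nonneg_eq_0_iff_AE) auto

lemma rayleigh_quotients_iff:
  "q \<in> rayleigh_quotients 2 D \<longleftrightarrow> (\<exists>u g1 g2. sob u g1 g2 \<and> (LINT z|onm D. u z) = 0 \<and> (LINT z|onm D. (u z)\<^sup>2) \<noteq> 0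
     \<and> q = energy g1 g2 / (LINT z|onm D. (u z)\<^sup>2))"
proof
  assume "q \<in> rayleigh_quotients 2 D"
  then obtain v h where v: "sobolev 2 D v h" "nonzero_on D v" "(LINT z|lebesgue_on D. v z) = 0"
    "q = (LINT z|lebesgue_on D. (norm (h z))\<^sup>2) / (LINT z|lebesgue_on D. (v z)\<^sup>2)"
    unfolding rayleigh_quotients_def powr_two powr_zero_mult by blast
  obtain u g1 g2 where u: "sob u g1 g2" "AE z in lebesgue_on D. v z = u z" "AE z in lebesgue_on D. h z = (g1 z, g2 z)"
    using sob_from_sobolev[OF v(1)] by blast
  have [measurable]: "u \<in> borel_measurable borel" "g1 \<in> borel_measurable borel" "g2 \<in> borel_measurable borel"
    using sob_L2[OF u(1)] by (auto intro: L2fun_onm_borel)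
  have vm: "v \<in> borel_measurable (lebesgue_on D)" "h \<in> borel_measurable (lebesgue_on D)" using v(1) by (auto simp: sobolev_def in_Lp_def)
  have "(LINT z|onm D. u z) = 0" using v(3) lebesgue_on_onm_AE(1)[OF D_sets vm(1) _ u(2)] by simp
  moreover have "(LINT z|lebesgue_on D. (v z)\<^sup>2) = (LINT z|onm D. (u z)\<^sup>2)"
    by (rule lebesgue_on_onm_AE(1)[OF D_sets]) (use vm u(2) in \<open>auto elim!: eventually_mono\<close>)
  moreover have "(LINT z|lebesgue_on D. (norm (h z))\<^sup>2) = energy g1 g2"
    unfolding energy_def by (rule lebesgue_on_onm_AE(1)[OF D_sets]) (use vm plane_components_measurable[OF vm(2)] u(3) in \<open>auto simp: plane_norm_sq elim!: eventually_mono\<close>)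
  moreover have "nonzero_on D u" unfolding nonzero_on_def
  proof
    assume "AE z in lebesgue_on D. u z = 0"
    with u(2) have "AE z in lebesgue_on D. v z = 0" by eventually_elim simp
    then show False using v(2) by (simp add: nonzero_on_def)
  qed
  ultimately show "\<exists>u g1 g2. sob u g1 g2 \<and> (LINT z|onm D. u z) = 0 \<and> (LINT z|onm D. (u z)\<^sup>2) \<noteq> 0
     \<and> q = energy g1 g2 / (LINT z|onm D. (u z)\<^sup>2)"
    using u(1) v(4) nonzero_on_iff[OF sob_L2(1)[OF u(1)]] by metis
next
  assume "\<exists>u g1 g2. sob u g1 g2 \<and> (LINT z|onm D. u z) = 0 \<and> (LINT z|onm D. (u z)\<^sup>2) \<noteq> 0
     \<and> q = energy g1 g2 / (LINT z|onm D. (u z)\<^sup>2)"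
  then obtain u g1 g2 where u: "sob u g1 g2" "(LINT z|onm D. u z) = 0" "(LINT z|onm D. (u z)\<^sup>2) \<noteq> 0"
     "q = energy g1 g2 / (LINT z|onm D. (u z)\<^sup>2)" by blast
  have [measurable]: "u \<in> borel_measurable borel" "g1 \<in> borel_measurable borel" "g2 \<in> borel_measurable borel"
    using sob_L2[OF u(1)] by (auto intro: L2fun_onm_borel)
  show "q \<in> rayleigh_quotients 2 D"
    unfolding rayleigh_quotients_def powr_two powr_zero_mult mem_Collect_eq
    using sobolev_from_sob[OF u(1)] u nonzero_on_iff[OF sob_L2(1)[OF u(1)]]
    by (intro exI[of _ u] exI[of _ "\<lambda>z. (g1 z, g2 z)"]) (simp add: plane_norm_sq lebesgue_on_onm(1)[OF D_sets] energy_def)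
qed

text \<open>The minimization needs at least one competitor; the first Cartesian coordinate, shifted
  by its mean value and normalized, will be one. Its weak gradient comes from the fundamental
  theorem of calculus along the coordinate lines.\<close>

lemma sob_fst: "sob fst (\<lambda>_. 1) (\<lambda>_. 0)"
proof (rule sob_from_ac)
  have fm: "(fst :: plane \<Rightarrow> real) \<in> borel_measurable borel" using plane_components_measurable(1)[of "\<lambda>z. z" borel] by simp
  obtain R where R: "\<And>z. z \<in> D \<Longrightarrow> norm z \<le> R" using D_bounded by (auto simp: bounded_iff)
  show "L2fun (onm D) fst"
  proof (rule L2fun_cong_AE)
    show "L2fun (onm D) (\<lambda>z. indicator D z * fst z)"
    proof (rule fD.L2fun_bounded)
      show "\<bar>indicator D z * fst z\<bar> \<le> max 0 R" for z :: plane
        using R[of z] norm_fst_le[of "fst z" "snd z"] by (auto split: split_indicator)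
      show "(\<lambda>z. indicator D z * fst z) \<in> borel_measurable (onm D)" using fm by measurable
    qed
    show "AE z in onm D. fst z = indicator D z * fst z" using AE_onm_mem[OF D_sets] by eventually_elim simp
  qed (use fm in simp)
  show "L2fun (onm D) (\<lambda>_. 1)" "L2fun (onm D) (\<lambda>_. 0)" by (rule fD.L2fun_const)+
  have bnd: "\<bar>fst (P1 z)\<bar> \<le> C" "\<bar>fst (P2 z)\<bar> \<le> C" for z
    using P_bound[of z] norm_fst_le[of "fst (P1 z)" "snd (P1 z)"] norm_fst_le[of "fst (P2 z)" "snd (P2 z)"] by auto
  have pm [measurable]: "(\<lambda>z. fst (P1 z)) \<in> borel_measurable borel" "(\<lambda>z. fst (P2 z)) \<in> borel_measurable borel"
    by (intro plane_components_measurable P1m P2m)+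
  have fd: "((\<lambda>\<tau>. fst (f \<tau>)) has_vector_derivative fst f') (at \<tau>)" if "(f has_vector_derivative f') (at \<tau>)" for f :: "real \<Rightarrow> plane" and f' \<tau>
    using that unfolding has_vector_derivative_def by (auto intro!: derivative_eq_intros)
  have d\<Psi>: "((\<lambda>s. \<Psi> (s,t)) has_vector_derivative P1 (s,t)) (at s)" "((\<lambda>t. \<Psi> (s,t)) has_vector_derivative P2 (s,t)) (at t)"
    if "s \<in> {0<..<A}" "t \<in> {0<..<B}" for s t
  proof -
    have inQ: "(s,t) \<in> {0<..<A} \<times> {0<..<B}" using that by auto
    have "((\<lambda>s. (s,t)) has_derivative (\<lambda>h. (h,0))) (at s)" "((\<lambda>t. (s,t)) has_derivative (\<lambda>h. (0,h))) (at t)"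
      by (auto intro!: derivative_eq_intros)
    from has_derivative_compose[OF this(1) deriv[OF inQ]] has_derivative_compose[OF this(2) deriv[OF inQ]]
    show "((\<lambda>s. \<Psi> (s,t)) has_vector_derivative P1 (s,t)) (at s)" "((\<lambda>t. \<Psi> (s,t)) has_vector_derivative P2 (s,t)) (at t)"
      by (simp_all add: has_vector_derivative_def)
  qed
  have ftc: "w11 0 a f g"
    if fc: "continuous_on {0..a} f" and fg: "\<And>\<tau>. \<tau> \<in> {0<..<a} \<Longrightarrow> (f has_vector_derivative g \<tau>) (at \<tau>)"
      and gm: "g \<in> borel_measurable borel" and gb: "\<And>\<tau>. \<bar>g \<tau>\<bar> \<le> C"
    for f g :: "real \<Rightarrow> real" and a
  proof -
    have gi: "integrable (onm {0<..<b}) g" for b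
    proof -
      interpret fin: finite_measure "onm {0<..<b}" by (rule finite_measure_onm) auto
      show ?thesis by (rule fin.integrable_const_bound[where B=C]) (use gm gb in auto)
    qed
    have eq: "f s = f 0 + prim 0 g s" if s: "0 < s" "s < a" for s
    proof -
      have "(g has_integral (f s - f 0)) {0..s}"
        by (rule fundamental_theorem_of_calculus_interior)
          (use fg s in \<open>auto intro: continuous_on_subset[OF fc]\<close>)
      from has_integral_imp_onm[OF gi this] show ?thesis using s by (simp add: prim_eq_integral_onm[OF gm])
    qed
    have "AE s in onm {0<..<a}. f s = f 0 + prim 0 g s" using AE_ivl[of 0 a] by eventually_elim (rule eq, auto)
    then show ?thesis by (rule w11_I[OF gi])
  qed
  show "AE t in onm {0<..<B}. w11 0 A (\<lambda>s. fst (\<Psi> (s,t))) (\<lambda>s. pull P1 (\<lambda>_. 1) (\<lambda>_. 0) (s,t))"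
    using AE_ivl[of 0 B]
  proof eventually_elim
    case (elim t)
    show ?case unfolding pull_def
    proof (rule ftc)
      show "continuous_on {0..A} (\<lambda>s. fst (\<Psi> (s,t)))"
        by (intro continuous_on_fst continuous_on_compose2[OF cont(1)]) (use elim in \<open>auto intro!: continuous_intros\<close>)
      show "((\<lambda>s. fst (\<Psi> (s,t))) has_vector_derivative 1 * fst (P1 (\<tau>,t)) + 0 * snd (P1 (\<tau>,t))) (at \<tau>)" if "\<tau> \<in> {0<..<A}" for \<tau>
        using fd[OF d\<Psi>(1)[OF that, of t]] elim by simp
    qed (use bnd in \<open>simp_all\<close>)
  qed
  show "AE s in onm {0<..<A}. w11 0 B (\<lambda>t. fst (\<Psi> (s,t))) (\<lambda>t. pull P2 (\<lambda>_. 1) (\<lambda>_. 0) (s,t))"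
    using AE_ivl[of 0 A]
  proof eventually_elim
    case (elim s)
    show ?case unfolding pull_def
    proof (rule ftc)
      show "continuous_on {0..B} (\<lambda>t. fst (\<Psi> (s,t)))"
        by (intro continuous_on_fst continuous_on_compose2[OF cont(1)]) (use elim in \<open>auto intro!: continuous_intros\<close>)
      show "((\<lambda>t. fst (\<Psi> (s,t))) has_vector_derivative 1 * fst (P2 (s,\<tau>)) + 0 * snd (P2 (s,\<tau>))) (at \<tau>)" if "\<tau> \<in> {0<..<B}" for \<tau>
        using fd[OF d\<Psi>(2)[of s \<tau>]] that elim by simp
    qed (use bnd in \<open>simp_all\<close>)
  qed
qed

lemma D_nonnull: "\<not> (AE z in onm D. False)"
proof
  assume "AE z in onm D. False"
  then have "AE z in lborel. z \<notin> D" by (simp add: AE_onm)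
  then have "D \<in> null_sets lborel" by (intro AE_iff_null_sets[THEN iffD2]) auto
  then have "negligible D" using null_sets_completionI negligible_iff_null_sets by blast
  then have "D = {}" using D_open open_not_negligible by blast
  moreover have "\<Psi> (A/2, B/2) \<in> D" unfolding D_def Q_def using AB by auto
  ultimately show False by simp
qed

lemma admissible_exists:
  "\<exists>u g1 g2. sob u g1 g2 \<and> (LINT z|onm D. u z) = 0 \<and> (LINT z|onm D. (u z)\<^sup>2) = 1"
proof -
  define M where "M = measure (onm D) UNIV"
  have M: "M \<noteq> 0"
  proof
    assume "M = 0"
    then have "emeasure (onm D) UNIV = 0" using fD.emeasure_eq_measure[of UNIV] by (simp add: M_def)
    then have "AE z in onm D. False" by (intro AE_I[where N=UNIV]) auto
    then show False using D_nonnull by simp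
  qed
  define k where "k = (LINT z|onm D. fst z) / M"
  define u where "u z = fst z - k" for z :: plane
  have s: "sob u (\<lambda>_. 1) (\<lambda>_. 0)" using sob_lincomb[OF sob_fst sob_const, of 1 "-1" k] by (simp add: u_def[abs_def])
  have u0: "(LINT z|onm D. u z) = 0" using sob_integrable(1)[OF sob_fst] M by (simp add: u_def k_def M_def[symmetric])
  define b where "b = (LINT z|onm D. (u z)\<^sup>2)"
  have "b \<noteq> 0"
  proof
    assume "b = 0"
    then have "AE z in onm D. u z = 0" unfolding b_def
      using L2fun_int[OF sob_L2(1)[OF s]] by (subst (asm) integral_nonneg_eq_0_iff_AE) auto
    moreover have "AE z in onm D. fst z \<noteq> k" using AE_plane_line[of k 0] by (subst AE_onm) (auto elim!: eventually_mono)
    ultimately have "AE z in onm D. False" by eventually_elim (simp add: u_def)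
    then show False using D_nonnull by simp
  qed
  then have b: "b > 0" unfolding b_def by (simp add: less_le)
  define r where "r = inverse (sqrt b)"
  have r: "r\<^sup>2 * b = 1" using b by (simp add: r_def power_inverse)
  have "(LINT z|onm D. (r * u z)\<^sup>2) = 1" using r by (simp add: b_def power_mult_distrib)
  moreover have "(LINT z|onm D. r * u z) = 0" using u0 by simp
  moreover have "sob (\<lambda>z. r * u z) (\<lambda>z. r * 1) (\<lambda>z. r * 0)" using sob_lincomb[OF s s, of r 0] by simp
  ultimately show ?thesis by blast
qed

text \<open>\<open>mu1_odd\<close> speaks of nonzero eigenvalues, so the minimum must not be 0.
  Without energy, the Poincare inequality on the rectangle makes the pulled-back function constant;
  hence the mean \<open>k\<close> is taken over \<open>Q\<close> and not over
  \<open>D\<close>.\<close>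

lemma energy_zero_imp_zero:
  assumes s: "sob u g1 g2" and e: "energy g1 g2 = 0" and m: "(LINT z|onm D. u z) = 0"
  shows "(LINT z|onm D. (u z)\<^sup>2) = 0"
proof -
  define k where "k = (LINT z|onm Q. u (\<Psi> z)) / (A * B)"
  have mQ: "measure (onm Q) UNIV = A * B"
  proof -
    have "emeasure lborel Q = ennreal A * ennreal B"
      unfolding Q_def lborel_prod[symmetric] using AB by (subst lborel.emeasure_pair_measure_Times) auto
    then show ?thesis using AB by (simp add: measure_def emeasure_onm enn2real_mult)
  qed
  have sk: "sob (\<lambda>z. u z - k) g1 g2" using sob_lincomb[OF s sob_const, of 1 "-1" k] by simp
  have um [measurable]: "u \<in> borel_measurable borel" using sob_L2(1)[OF s] by (rule L2fun_onm_borel)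
  have z: "(LINT z|onm Q. u (\<Psi> z) - k) = 0"
    using integrable_chart(1)[OF sob_integrable(1)[OF s]] AB by (simp add: k_def mQ)
  have p: "(LINT z|onm Q. (pull P1 g1 g2 z)\<^sup>2) = 0" "(LINT z|onm Q. (pull P2 g1 g2 z)\<^sup>2) = 0"
    using pull_L2(2)[OF sob_L2(2,3)[OF s] P1m P_bound(1)] pull_L2(2)[OF sob_L2(2,3)[OF s] P2m P_bound(2)] e
    by (auto intro!: antisym)
  have "(LINT z|onm Q. (u (\<Psi> z) - k)\<^sup>2) \<le> 0"
    using poincare_rect[OF sob_ac[OF sk] AB] z p by (simp add: rect_Q)
  then have "(LINT z|onm Q. (u (\<Psi> z) - k)\<^sup>2) = 0" by (intro antisym) auto
  then have "AE z in onm Q. (u (\<Psi> z) - k)\<^sup>2 = 0"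
    using L2fun_int[OF L2fun_chart(1)[OF sob_L2(1)[OF sk]]] by (subst (asm) integral_nonneg_eq_0_iff_AE) auto
  then have "AE z in onm Q. u (\<Psi> z) = k" by eventually_elim simp
  then have uk: "AE z in onm D. u z = k" by (subst AE_D) auto
  have "(LINT z|onm D. u z) = (LINT z|onm D. k)" by (rule integral_cong_AE) (use uk in auto)
  moreover have "(LINT z|onm D. (u z)\<^sup>2) = (LINT z|onm D. k\<^sup>2)" by (rule integral_cong_AE) (use uk in \<open>auto elim!: eventually_mono\<close>)
  ultimately show ?thesis using m by auto
qed

end

section \<open>Odd Neumann eigenvalues and the minimum of the quotient\<close>

context symmetric_strip
begin

text \<open>Tested with itself, an eigenfunction has its eigenvalue as quotient, and oddness makes
  its mean value vanish. Hence no odd eigenvalue lies below the minimum.\<close>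

lemma odd_eigenvalue_quotient:
  assumes e: "neumann_eigenfunction 2 D \<mu> u" and o: "odd_in_x_on D u"
  shows "\<mu> \<in> rayleigh_quotients 2 D"
proof -
  obtain g where g: "sobolev 2 D u g" and nz: "nonzero_on D u"
    and eq: "\<And>v h. sobolev 2 D v h \<Longrightarrow> (LINT z|lebesgue_on D. g z \<bullet> h z) = \<mu> * (LINT z|lebesgue_on D. u z * v z)"
    using e unfolding neumann_eigenfunction_def powr_zero_mult by blast
  obtain w g1 g2 where w: "sob w g1 g2" "AE z in lebesgue_on D. u z = w z" "AE z in lebesgue_on D. g z = (g1 z, g2 z)"
    using sob_from_sobolev[OF g] by blast
  have wm [measurable]: "w \<in> borel_measurable borel" "g1 \<in> borel_measurable borel" "g2 \<in> borel_measurable borel"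
    using sob_L2[OF w(1)] by (auto intro: L2fun_onm_borel)
  have vm: "u \<in> borel_measurable (lebesgue_on D)" "g \<in> borel_measurable (lebesgue_on D)" using g by (auto simp: sobolev_def in_Lp_def)
  have "(LINT z|lebesgue_on D. g z \<bullet> g z) = energy g1 g2"
    unfolding energy_def by (rule lebesgue_on_onm_AE(1)[OF D_sets])
      (use vm plane_components_measurable[OF vm(2)] w(3) in \<open>auto simp: plane_inner power2_eq_square elim!: eventually_mono\<close>)
  moreover have "(LINT z|lebesgue_on D. u z * u z) = (LINT z|onm D. (w z)\<^sup>2)"
    by (rule lebesgue_on_onm_AE(1)[OF D_sets]) (use vm w(2) in \<open>auto simp: power2_eq_square elim!: eventually_mono\<close>)
  ultimately have en: "energy g1 g2 = \<mu> * (LINT z|onm D. (w z)\<^sup>2)" using eq[OF g] by simp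
  have uw: "AE z in onm D. u z = w z" using w(2) by (simp add: AE_lebesgue_on_onm[OF D_sets])
  then have "AE z in distr (onm D) borel sig. u z = w z" by (subst distr_sig)
  then have uw': "AE z in onm D. u (sig z) = w (sig z)" by (rule AE_distrD[rotated]) simp
  have "AE z in onm D. u (sig z) = - u z" using o unfolding odd_in_x_on_def by (simp add: AE_lebesgue_on_onm[OF D_sets] sig_def)
  then have ow: "AE z in onm D. w (sig z) = - w z" using uw uw' by eventually_elim simp
  have "(LINT z|onm D. w z) = (LINT z|onm D. w (sig z))" using integral_sig(1)[OF wm(1)] by simp
  also have "\<dots> = (LINT z|onm D. - w z)" by (rule integral_cong_AE) (use ow in auto)
  finally have m0: "(LINT z|onm D. w z) = 0" by simp
  have "nonzero_on D w" unfolding nonzero_on_def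
  proof
    assume "AE z in lebesgue_on D. w z = 0"
    with w(2) have "AE z in lebesgue_on D. u z = 0" by eventually_elim simp
    then show False using nz by (simp add: nonzero_on_def)
  qed
  then have "(LINT z|onm D. (w z)\<^sup>2) \<noteq> 0" using nonzero_on_iff[OF sob_L2(1)[OF w(1)]] by simp
  then show ?thesis unfolding rayleigh_quotients_iff using w(1) m0 en by (intro exI[of _ w] exI[of _ g1] exI[of _ g2]) simp
qed

lemma odd_solution_eigenfunction:
  assumes "odd_solution \<mu>"
  shows "\<exists>u. neumann_eigenfunction 2 D \<mu> u \<and> odd_in_x_on D u"
proof -
  obtain v h1 h2 where v: "sob v h1 h2" "\<And>z. v (sig z) = - v z" "(LINT z|onm D. (v z)\<^sup>2) \<noteq> 0" "eigen_eq \<mu> v h1 h2"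
    using assms unfolding odd_solution_def by blast
  have vm [measurable]: "v \<in> borel_measurable borel" "h1 \<in> borel_measurable borel" "h2 \<in> borel_measurable borel"
    using sob_L2[OF v(1)] by (auto intro: L2fun_onm_borel)
  have hm: "(\<lambda>z. (h1 z, h2 z)) \<in> borel_measurable borel" by (rule borel_measurable_Pair) (rule vm)+
  have "(LINT z|lebesgue_on D. (h1 z, h2 z) \<bullet> h z) = \<mu> * (LINT z|lebesgue_on D. v z * w z)" if s: "sobolev 2 D w h" for w h
  proof -
    obtain w' k1 k2 where w: "sob w' k1 k2" "AE z in lebesgue_on D. w z = w' z" "AE z in lebesgue_on D. h z = (k1 z, k2 z)"
      using sob_from_sobolev[OF s] by blast
    have [measurable]: "w' \<in> borel_measurable borel" "k1 \<in> borel_measurable borel" "k2 \<in> borel_measurable borel"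
      using sob_L2[OF w(1)] by (auto intro: L2fun_onm_borel)
    have wm: "w \<in> borel_measurable (lebesgue_on D)" "h \<in> borel_measurable (lebesgue_on D)" using s by (auto simp: sobolev_def in_Lp_def)
    have "(LINT z|lebesgue_on D. (h1 z, h2 z) \<bullet> h z) = (LINT z|onm D. h1 z * k1 z + h2 z * k2 z)"
      by (rule lebesgue_on_onm_AE(1)[OF D_sets])
        (use wm plane_components_measurable[OF wm(2)] w(3) borel_imp_lebesgue_on[OF hm, of D] borel_imp_lebesgue_on[OF vm(2), of D] borel_imp_lebesgue_on[OF vm(3), of D] in \<open>auto simp: plane_inner elim!: eventually_mono intro!: borel_measurable_inner\<close>)
    moreover have "(LINT z|lebesgue_on D. v z * w z) = (LINT z|onm D. v z * w' z)"
      by (rule lebesgue_on_onm_AE(1)[OF D_sets])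
        (use wm w(2) borel_imp_lebesgue_on[OF vm(1), of D] in \<open>auto elim!: eventually_mono\<close>)
    ultimately show ?thesis using v(4)[unfolded eigen_eq_def, rule_format, OF w(1)] by simp
  qed
  then have "neumann_eigenfunction 2 D \<mu> v"
    unfolding neumann_eigenfunction_def powr_zero_mult
    using sobolev_from_sob[OF v(1)] v(3) nonzero_on_iff[OF sob_L2(1)[OF v(1)]] by blast
  moreover have "odd_in_x_on D v" unfolding odd_in_x_on_def using v(2) by (simp add: sig_def)
  ultimately show ?thesis by blast
qed

text \<open>\<open>LEAST\<close> is informative on the reals only when the minimum is attained. The
  minimizer attains the first one and the odd solution the second, with the same value and the same
  lower bound.\<close>

theorem mu1_eq_mu1_odd:
  assumes \<kappa>: "\<kappa> * mu1 2 D < 1"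
  shows "mu1 2 D = mu1_odd 2 D"
proof -
  obtain u g1 g2 where u: "sob u g1 g2" "(LINT z|onm D. u z) = 0" "(LINT z|onm D. (u z)\<^sup>2) = 1"
    and low: "\<And>v h1 h2. sob v h1 h2 \<Longrightarrow> (LINT z|onm D. v z) = 0 \<Longrightarrow> energy g1 g2 * (LINT z|onm D. (v z)\<^sup>2) \<le> energy h1 h2"
    using minimizer_exists[OF admissible_exists] by blast
  define \<mu> where "\<mu> = energy g1 g2"
  have in_rq: "\<mu> \<in> rayleigh_quotients 2 D"
    unfolding rayleigh_quotients_iff \<mu>_def using u by (intro exI[of _ u] exI[of _ g1] exI[of _ g2]) simp
  have least: "\<mu> \<le> q" if qr: "q \<in> rayleigh_quotients 2 D" for q
  proof -
    obtain v h1 h2 where v: "sob v h1 h2" "(LINT z|onm D. v z) = 0" "(LINT z|onm D. (v z)\<^sup>2) \<noteq> 0"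
      "q = energy h1 h2 / (LINT z|onm D. (v z)\<^sup>2)" using qr unfolding rayleigh_quotients_iff by blast
    have "(LINT z|onm D. (v z)\<^sup>2) > 0" using v(3) by (simp add: less_le)
    then show ?thesis unfolding v(4) \<mu>_def using low[OF v(1,2)] by (simp add: pos_le_divide_eq)
  qed
  have mu1: "mu1 2 D = \<mu>" unfolding mu1_def by (rule Least_equality) (use in_rq least in auto)
  have "\<mu> \<noteq> 0" using energy_zero_imp_zero[OF u(1) _ u(2)] u(3) by (auto simp: \<mu>_def)
  moreover have "\<exists>u. neumann_eigenfunction 2 D \<mu> u \<and> odd_in_x_on D u"
    using odd_solution_eigenfunction[OF odd_minimizer[OF u low]] \<kappa> unfolding mu1 \<mu>_def by blast
  ultimately have "mu1_odd 2 D = \<mu>"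
    unfolding mu1_odd_def by (intro Least_equality) (use least odd_eigenvalue_quotient in blast)+
  then show ?thesis using mu1 by simp
qed

end

section \<open>Curved strips as symmetric charts\<close>

lemma smooth_Icc_deriv: "smooth_Icc L f \<Longrightarrow> smooth_Icc L (deriv_Icc L f)"
  unfolding smooth_Icc_def
proof (intro allI ballI)
  fix n s assume *: "\<forall>n. \<forall>s\<in>{0..L}. (deriv_Icc L ^^ n) f differentiable (at s within {0..L})" and s: "s \<in> {0..L}"
  have "(deriv_Icc L ^^ n) (deriv_Icc L f) = (deriv_Icc L ^^ Suc n) f" by (simp only: funpow_Suc_right comp_def)
  then show "(deriv_Icc L ^^ n) (deriv_Icc L f) differentiable (at s within {0..L})" using * s by metis
qed

lemma smooth_Icc_has_derivative:
  assumes "smooth_Icc L f" "s \<in> {0..L}"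
  shows "(f has_real_derivative deriv_Icc L f s) (at s within {0..L})"
proof -
  have "(deriv_Icc L ^^ 0) f differentiable (at s within {0..L})" using assms unfolding smooth_Icc_def by blast
  then have "f differentiable (at s within {0..L})" by simp
  then show ?thesis
    unfolding deriv_Icc_def by (simp add: vector_derivative_works has_real_derivative_iff_has_vector_derivative)
qed

lemma smooth_Icc_continuous: "smooth_Icc L f \<Longrightarrow> continuous_on {0..L} f"
  using smooth_Icc_has_derivative[of L f] by (meson DERIV_continuous continuous_on_eq_continuous_within)

lemma smooth_Icc_interior:
  assumes "smooth_Icc L f" "s \<in> {0<..<L}"
  shows "(f has_real_derivative deriv_Icc L f s) (at s)"
  using smooth_Icc_has_derivative[OF assms(1), of s] assms(2) at_within_Icc_at[of 0 s L] by simp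

text \<open>The factor \<open>p\<close> unifies the two symmetries of the curve: -1 for the odd
  \<open>x\<close>, 1 for the even \<open>y\<close>.\<close>

lemma deriv_Icc_reflect:
  assumes f: "smooth_Icc L f" and sym: "\<And>s. s \<in> {0..L} \<Longrightarrow> f (L - s) = p * f s" and s: "s \<in> {0<..<L}"
  shows "deriv_Icc L f (L - s) = - (p * deriv_Icc L f s)"
proof -
  have "((\<lambda>\<tau>. L - \<tau>) has_real_derivative - 1) (at s)" by (auto intro!: derivative_eq_intros)
  moreover have "(f has_real_derivative deriv_Icc L f (L - s)) (at (L - s))" using smooth_Icc_interior[OF f, of "L - s"] s by simp
  ultimately have "((\<lambda>\<tau>. f (L - \<tau>)) has_real_derivative deriv_Icc L f (L - s) * - 1) (at s)"
    by (rule DERIV_chain2[rotated])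
  moreover have "((\<lambda>\<tau>. f (L - \<tau>)) has_real_derivative p * deriv_Icc L f s) (at s)"
  proof (rule has_field_derivative_transform_within_open[OF _ _ s])
    show "((\<lambda>\<tau>. p * f \<tau>) has_real_derivative p * deriv_Icc L f s) (at s)" by (rule DERIV_cmult[OF smooth_Icc_interior[OF f s]])
    show "p * f \<tau> = f (L - \<tau>)" if "\<tau> \<in> {0<..<L}" for \<tau> using sym[of \<tau>] that by simp
  qed simp
  ultimately have "deriv_Icc L f (L - s) * - 1 = p * deriv_Icc L f s" by (rule DERIV_unique)
  then show ?thesis by simp
qed

lemma closed_extension_measurable:
  fixes F :: "plane \<Rightarrow> 'b::real_normed_vector"
  assumes "continuous_on S F" "closed S"
  shows "(\<lambda>z. if z \<in> S then F z else 0) \<in> borel_measurable borel"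
  using assms by (intro borel_measurable_continuous_on_if) auto

lemma compact_extension_bounded:
  fixes F :: "plane \<Rightarrow> 'b::real_normed_vector"
  assumes "continuous_on S F" "compact S"
  shows "\<exists>K. \<forall>z. norm (if z \<in> S then F z else 0) \<le> K"
proof -
  have "bounded (F ` S)" by (intro compact_imp_bounded compact_continuous_image assms)
  then obtain K where "\<forall>v\<in>F ` S. norm v \<le> K" by (auto simp: bounded_iff)
  then have "norm (if z \<in> S then F z else 0) \<le> max K 0" for z by (auto simp: le_max_iff_disj)
  then show ?thesis by blast
qed

section \<open>Geometry of the strip in normalized coordinates\<close>

locale curved_geometry =
  fixes L :: real and x y \<delta> k :: "real \<Rightarrow> real"
  assumes L: "L > 0" and smx: "smooth_Icc L x" and smy: "smooth_Icc L y" and sm\<delta>: "smooth_Icc L \<delta>"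
    and arc: "\<And>s. s \<in> {0..L} \<Longrightarrow> (deriv_Icc L x s)\<^sup>2 + (deriv_Icc L y s)\<^sup>2 = 1"
    and symx: "\<And>s. s \<in> {0..L} \<Longrightarrow> x (L - s) = - x s" and symy: "\<And>s. s \<in> {0..L} \<Longrightarrow> y (L - s) = y s"
    and k_def: "k = signed_curvature L x y"
    and \<delta>pos: "\<And>s. s \<in> {0..L} \<Longrightarrow> \<delta> s > 0" and sym\<delta>: "\<And>s. s \<in> {0..L} \<Longrightarrow> \<delta> (L - s) = \<delta> s"
    and inj_map: "inj_on (strip_map L x y) (closure (flat_strip L \<delta>))"
    and jac: "\<And>s r. (s, r) \<in> closure (flat_strip L \<delta>) \<Longrightarrow> 1 + r * k s > 0"
begin

abbreviation "x1 \<equiv> deriv_Icc L x"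
abbreviation "y1 \<equiv> deriv_Icc L y"
abbreviation "\<delta>1 \<equiv> deriv_Icc L \<delta>"
abbreviation "x2 \<equiv> deriv_Icc L x1"
abbreviation "y2 \<equiv> deriv_Icc L y1"

definition box2 :: "plane set" where "box2 = {0..L} \<times> {0..1}"

text \<open>The strip in the normalized coordinates \<open>(s, t) = (s, r / \<delta> s)\<close>.\<close>

definition \<Psi>0 :: "plane \<Rightarrow> plane" where
  "\<Psi>0 z = (x (fst z) + snd z * \<delta> (fst z) * y1 (fst z), y (fst z) - snd z * \<delta> (fst z) * x1 (fst z))"
text \<open>\<open>R1\<close> and \<open>R2\<close> are the partial derivatives of
  \<open>\<Psi>0\<close> in \<open>s\<close> and \<open>t\<close>, and \<open>R12\<close> is the
  mixed derivative. The Jacobian \<open>J0\<close> is \<open>1 + r * k s\<close> times the factor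
  \<open>\<delta> s\<close> of the substitution \<open>r = t * \<delta> s\<close>.\<close>

definition R1 :: "plane \<Rightarrow> plane" where
  "R1 z = (x1 (fst z) + snd z * (\<delta>1 (fst z) * y1 (fst z) + \<delta> (fst z) * y2 (fst z)),
           y1 (fst z) - snd z * (\<delta>1 (fst z) * x1 (fst z) + \<delta> (fst z) * x2 (fst z)))"
definition R2 :: "plane \<Rightarrow> plane" where
  "R2 z = (\<delta> (fst z) * y1 (fst z), - (\<delta> (fst z) * x1 (fst z)))"
definition R12 :: "plane \<Rightarrow> plane" where
  "R12 z = (\<delta>1 (fst z) * y1 (fst z) + \<delta> (fst z) * y2 (fst z), - (\<delta>1 (fst z) * x1 (fst z) + \<delta> (fst z) * x2 (fst z)))"
definition J0 :: "plane \<Rightarrow> real" where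
  "J0 z = \<delta> (fst z) * (1 + snd z * \<delta> (fst z) * k (fst z))"

text \<open>The data are controlled on the closed rectangle only, whereas the locale asks for
  functions that are measurable and, as to the derivatives, bounded on the whole plane.\<close>

definition ext :: "(plane \<Rightarrow> 'b::real_normed_vector) \<Rightarrow> plane \<Rightarrow> 'b" where
  "ext F z = (if z \<in> box2 then F z else 0)"

lemma ext_in: "z \<in> box2 \<Longrightarrow> ext F z = F z"
  by (simp add: ext_def)

lemma box2_props: "compact box2" "closed box2"
  unfolding box2_def by (auto intro!: compact_Times closed_Times)

lemma Q_box2: "{0<..<L} \<times> {0<..<1} \<subseteq> box2"
  by (auto simp: box2_def)

lemmas sm = smx smy sm\<delta> smooth_Icc_deriv[OF smx] smooth_Icc_deriv[OF smy] smooth_Icc_deriv[OF sm\<delta>]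
  smooth_Icc_deriv[OF smooth_Icc_deriv[OF smx]] smooth_Icc_deriv[OF smooth_Icc_deriv[OF smy]]

lemma k_eq: "k s = x1 s * y2 s - x2 s * y1 s"
  by (simp add: k_def signed_curvature_def)

lemma k_continuous: "continuous_on {0..L} k"
  unfolding k_eq[abs_def] by (intro continuous_intros smooth_Icc_continuous sm)

lemma cont_fst: "smooth_Icc L f \<Longrightarrow> continuous_on box2 (\<lambda>z. f (fst z))"
  by (rule continuous_on_compose2[OF smooth_Icc_continuous]) (auto simp: box2_def intro!: continuous_intros)

lemma k_cont_fst: "continuous_on box2 (\<lambda>z. k (fst z))"
  by (rule continuous_on_compose2[OF k_continuous]) (auto simp: box2_def intro!: continuous_intros)

lemma cont0: "continuous_on box2 \<Psi>0" "continuous_on box2 R1" "continuous_on box2 R2" "continuous_on box2 R12" "continuous_on box2 J0"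
  unfolding \<Psi>0_def[abs_def] R1_def[abs_def] R2_def[abs_def] R12_def[abs_def] J0_def[abs_def]
  by (intro continuous_on_Pair continuous_on_add continuous_on_diff continuous_on_mult continuous_on_minus
    cont_fst k_cont_fst sm continuous_on_snd continuous_on_id continuous_on_const)+

lemma cont_ext: "continuous_on box2 F \<Longrightarrow> continuous_on box2 (ext F)"
  by (rule continuous_on_eq) (simp_all add: ext_in)

lemma ext_measurable: "continuous_on box2 F \<Longrightarrow> ext F \<in> borel_measurable borel"
  unfolding ext_def[abs_def] by (rule closed_extension_measurable[OF _ box2_props(2)])

text \<open>Injectivity and positivity of the Jacobian are assumed on the closure of the flat strip.
  The map \<open>(s, t) \<mapsto> (s, t * \<delta> s)\<close> is continuous and the open rectangle
  is dense in the closed one, so the assumptions reach the closed rectangle.\<close>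

lemma in_closure:
  assumes "s \<in> {0..L}" "t \<in> {0..1}"
  shows "(s, t * \<delta> s) \<in> closure (flat_strip L \<delta>)"
proof -
  have cl: "closure ({0<..<L} \<times> {0<..<1::real}) = box2" using L by (simp add: closure_Times box2_def)
  have "(\<lambda>z. (fst z, snd z * \<delta> (fst z))) ` closure ({0<..<L} \<times> {0<..<1::real}) \<subseteq> closure (flat_strip L \<delta>)"
  proof (rule image_closure_subset)
    show "continuous_on (closure ({0<..<L} \<times> {0<..<1::real})) (\<lambda>z. (fst z, snd z * \<delta> (fst z)))"
      unfolding cl by (intro continuous_on_Pair continuous_on_mult cont_fst sm continuous_on_snd continuous_on_fst continuous_on_id)
    show "(\<lambda>z. (fst z, snd z * \<delta> (fst z))) ` ({0<..<L} \<times> {0<..<1::real}) \<subseteq> closure (flat_strip L \<delta>)"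
    proof -
      have "(\<lambda>z. (fst z, snd z * \<delta> (fst z))) ` ({0<..<L} \<times> {0<..<1::real}) \<subseteq> flat_strip L \<delta>"
        using \<delta>pos by (auto simp: flat_strip_def)
      then show ?thesis using closure_subset by (rule order_trans)
    qed
  qed simp
  moreover have "(s, t) \<in> closure ({0<..<L} \<times> {0<..<1::real})" unfolding cl using assms by (simp add: box2_def)
  ultimately show ?thesis by force
qed

lemma \<Psi>0_strip_map: "\<Psi>0 (s, t) = strip_map L x y (s, t * \<delta> s)"
  by (simp add: \<Psi>0_def strip_map_def)

lemma \<Psi>0_inj: "inj_on \<Psi>0 box2"
proof (rule inj_onI)
  fix z w assume z: "z \<in> box2" and w: "w \<in> box2" and eq: "\<Psi>0 z = \<Psi>0 w"
  obtain s t s' t' where st: "z = (s,t)" "w = (s',t')" by fastforce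
  have m: "s \<in> {0..L}" "t \<in> {0..1}" "s' \<in> {0..L}" "t' \<in> {0..1}" using z w st by (auto simp: box2_def)
  have "strip_map L x y (s, t * \<delta> s) = strip_map L x y (s', t' * \<delta> s')" using eq st by (simp add: \<Psi>0_strip_map)
  then have "(s, t * \<delta> s) = (s', t' * \<delta> s')"
    by (rule inj_onD[OF inj_map _ in_closure[OF m(1,2)] in_closure[OF m(3,4)]])
  then show "z = w" using \<delta>pos[OF m(1)] st by auto
qed

lemma one_plus_pos: "s \<in> {0..L} \<Longrightarrow> t \<in> {0..1} \<Longrightarrow> 1 + t * \<delta> s * k s > 0"
  using jac[OF in_closure] by simp

lemma J0_pos: "z \<in> box2 \<Longrightarrow> J0 z > 0"
  unfolding J0_def using \<delta>pos one_plus_pos by (auto simp: box2_def)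

text \<open>The unit speed of the curve removes everything but the curvature term. The sign is
  negative, the chart reverses orientation; hence \<open>sg = -1\<close> later on.\<close>

lemma det0: "z \<in> box2 \<Longrightarrow> fst (R1 z) * snd (R2 z) - snd (R1 z) * fst (R2 z) = - J0 z"
proof -
  assume z: "z \<in> box2"
  let ?s = "fst z" and ?t = "snd z"
  have a: "(x1 ?s)\<^sup>2 + (y1 ?s)\<^sup>2 = 1" using arc z by (auto simp: box2_def)
  have "fst (R1 z) * snd (R2 z) - snd (R1 z) * fst (R2 z)
    = - (\<delta> ?s * ((x1 ?s)\<^sup>2 + (y1 ?s)\<^sup>2)) - ?t * (\<delta> ?s)\<^sup>2 * k ?s"
    by (simp add: R1_def R2_def k_eq power2_eq_square algebra_simps)
  then show ?thesis unfolding a by (simp add: J0_def power2_eq_square algebra_simps)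
qed

lemma interior_derivative:
  assumes "smooth_Icc L f" "fst z \<in> {0<..<L}"
  shows "((\<lambda>z::plane. f (fst z)) has_derivative (\<lambda>h. deriv_Icc L f (fst z) * fst h)) (at z)"
proof -
  have "((\<lambda>z::plane. fst z) has_derivative (\<lambda>h. fst h)) (at z)" by (intro derivative_intros)
  from has_derivative_compose[OF this smooth_Icc_interior[OF assms, unfolded has_field_derivative_def]] show ?thesis .
qed

lemma \<Psi>0_derivative:
  assumes z: "z \<in> {0<..<L} \<times> {0<..<1}"
  shows "(\<Psi>0 has_derivative (\<lambda>h. fst h *\<^sub>R R1 z + snd h *\<^sub>R R2 z)) (at z)"
proof -
  have fz: "fst z \<in> {0<..<L}" using z by auto
  have sd: "((\<lambda>z::plane. snd z) has_derivative (\<lambda>h. snd h)) (at z)" by (intro derivative_intros)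
  note d = interior_derivative[OF _ fz]
  show ?thesis unfolding \<Psi>0_def[abs_def]
    by (rule has_derivative_eq_rhs[OF has_derivative_Pair[OF
        has_derivative_add[OF d[OF smx] has_derivative_mult[OF has_derivative_mult[OF sd d[OF sm\<delta>]] d[OF smooth_Icc_deriv[OF smy]]]]
        has_derivative_diff[OF d[OF smy] has_derivative_mult[OF has_derivative_mult[OF sd d[OF sm\<delta>]] d[OF smooth_Icc_deriv[OF smx]]]]]])
      (auto simp: fun_eq_iff R1_def R2_def algebra_simps)
qed

lemma R_derivatives:
  assumes s: "s \<in> {0<..<L}" and t: "t \<in> {0<..<1}"
  shows "((\<lambda>s. R2 (s,t)) has_vector_derivative R12 (s,t)) (at s)" "((\<lambda>t. R1 (s,t)) has_vector_derivative R12 (s,t)) (at t)"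
proof -
  note d = smooth_Icc_interior[OF _ s]
  have "((\<lambda>s. \<delta> s * y1 s) has_real_derivative \<delta>1 s * y1 s + y2 s * \<delta> s) (at s)"
    by (rule DERIV_mult[OF d[OF sm\<delta>] d[OF smooth_Icc_deriv[OF smy]]])
  moreover have "((\<lambda>s. - (\<delta> s * x1 s)) has_real_derivative - (\<delta>1 s * x1 s + x2 s * \<delta> s)) (at s)"
    by (rule DERIV_minus[OF DERIV_mult[OF d[OF sm\<delta>] d[OF smooth_Icc_deriv[OF smx]]]])
  ultimately show "((\<lambda>s. R2 (s,t)) has_vector_derivative R12 (s,t)) (at s)"
    unfolding R2_def R12_def has_real_derivative_iff_has_vector_derivative
    by (auto intro!: has_vector_derivative_Pair simp: mult.commute)
  have "((\<lambda>t. x1 s + t * p) has_real_derivative p) (at t)" "((\<lambda>t. y1 s - t * p) has_real_derivative - p) (at t)" for p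
    by (auto intro!: derivative_eq_intros)
  then show "((\<lambda>t. R1 (s,t)) has_vector_derivative R12 (s,t)) (at t)"
    unfolding R1_def R12_def has_real_derivative_iff_has_vector_derivative fst_conv snd_conv
    by (rule has_vector_derivative_Pair)
qed

lemma \<Psi>0_sym:
  assumes s: "s \<in> {0<..<L}"
  shows "\<Psi>0 (L - s, t) = sig (\<Psi>0 (s, t))"
proof -
  have "x1 (L - s) = x1 s" using deriv_Icc_reflect[OF smx, of "-1" s] symx s by simp
  moreover have "y1 (L - s) = - y1 s" using deriv_Icc_reflect[OF smy, of 1 s] symy s by simp
  ultimately show ?thesis using symx[of s] symy[of s] sym\<delta>[of s] s by (simp add: \<Psi>0_def sig_def)
qed

end

text \<open>The bound is selected at each \<open>s\<close> by the sign of \<open>k s\<close> there,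
  which covers curvature of one sign as well as curvature that changes sign.\<close>

locale thin_curved_strip = curved_geometry +
  fixes \<kappa> :: real
  assumes kap: "\<And>s. s \<in> {0..L} \<Longrightarrow> 0 \<le> k s \<Longrightarrow> (2 * \<delta> s + (\<delta> s)\<^sup>2 * k s)\<^sup>2 \<le> \<kappa>"
      "\<And>s. s \<in> {0..L} \<Longrightarrow> k s < 0 \<Longrightarrow> 4 * (\<delta> s)\<^sup>2 / (1 + \<delta> s * k s)\<^sup>2 \<le> \<kappa>"
begin

text \<open>After division by \<open>\<delta> s\<close> it remains to bound
  \<open>d\<^sup>2 * (1 + t * d * c)\<close> by \<open>\<kappa> * (1 + t' * d * c)\<close>. The
  extreme points are \<open>t = 1\<close>, \<open>t' = 0\<close> for \<open>c \<ge> 0\<close> and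
  \<open>t = 0\<close>, \<open>t' = 1\<close> for \<open>c < 0\<close>. The required constants
  \<open>d\<^sup>2 * (1 + d * c)\<close> and \<open>d\<^sup>2 / (1 + d * c)\<close> are dominated by
  the two expressions in \<open>kap\<close> with room to spare.\<close>

lemma fibre_bound:
  assumes s: "s \<in> {0..L}" and t: "t \<in> {0..1}" and t': "t' \<in> {0..1}"
  shows "J0 (s,t) * (norm (R2 (s,t')))\<^sup>2 \<le> \<kappa> * J0 (s,t')"
proof -
  define d where "d = \<delta> s"
  define c where "c = k s"
  have d: "d > 0" using \<delta>pos[OF s] by (simp add: d_def)
  have n: "(norm (R2 (s,t')))\<^sup>2 = d\<^sup>2"
  proof -
    have "(norm (R2 (s,t')))\<^sup>2 = d\<^sup>2 * ((x1 s)\<^sup>2 + (y1 s)\<^sup>2)"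
      by (simp add: plane_norm_sq R2_def d_def power_mult_distrib algebra_simps)
    then show ?thesis using arc[OF s] by simp
  qed
  have key: "d\<^sup>2 * (1 + t * d * c) \<le> \<kappa> * (1 + t' * d * c)"
  proof (cases "0 \<le> c")
    case True
    have dc: "0 \<le> d * c" using d True by simp
    have \<kappa>: "(d * (2 + d * c))\<^sup>2 \<le> \<kappa>" using kap(1)[OF s] True by (simp add: d_def c_def power2_eq_square algebra_simps)
    have "t * (d * c) \<le> 1 * (d * c)" using t dc by (intro mult_right_mono) auto
    then have "d\<^sup>2 * (1 + t * d * c) \<le> d\<^sup>2 * (1 + d * c)" by (intro mult_left_mono) (auto simp: mult.assoc)
    also have "\<dots> \<le> d\<^sup>2 * (2 + d * c)\<^sup>2"
    proof (rule mult_left_mono)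
      have "0 \<le> (d * c)\<^sup>2" by simp
      moreover have "(2 + d * c)\<^sup>2 = 4 + 4 * (d * c) + (d * c)\<^sup>2" by (simp add: power2_sum)
      ultimately show "1 + d * c \<le> (2 + d * c)\<^sup>2" using dc by linarith
    qed simp
    also have "\<dots> \<le> \<kappa>" using \<kappa> by (simp only: power_mult_distrib)
    also have "\<dots> \<le> \<kappa> * (1 + t' * d * c)"
    proof -
      have "0 \<le> \<kappa>" using \<kappa> by (rule order_trans[rotated]) simp
      moreover have "0 \<le> t' * d * c" using t' dc by (simp add: mult.assoc)
      ultimately show ?thesis by (simp add: distrib_left)
    qed
    finally show ?thesis .
  next
    case False
    \<comment> \<open>For negative \<open>c\<close> this is the smallest value of
      \<open>1 + t' * d * c\<close> on the fibre.\<close>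
    define w where "w = 1 + d * c"
    have w: "w > 0" "w \<le> 1" using one_plus_pos[OF s, of 1] d False by (auto simp: w_def d_def c_def mult_le_0_iff)
    have dc: "d * c \<le> 0" using d False by (simp add: mult_le_0_iff)
    have \<kappa>: "4 * d\<^sup>2 / w\<^sup>2 \<le> \<kappa>" using kap(2)[OF s] False by (simp add: d_def c_def w_def)
    have "t * (d * c) \<le> 0" using t dc by (simp add: mult_le_0_iff)
    then have "d\<^sup>2 * (1 + t * d * c) \<le> d\<^sup>2 * 1" by (intro mult_left_mono) (auto simp: mult.assoc)
    also have "\<dots> \<le> 4 * d\<^sup>2 / w\<^sup>2 * w"
    proof -
      have "d\<^sup>2 * w \<le> d\<^sup>2 * 1" using w by (intro mult_left_mono) auto
      then have "d\<^sup>2 * w \<le> 4 * d\<^sup>2" using zero_le_power2[of d] by linarith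
      then show ?thesis using w by (simp add: power2_eq_square field_simps)
    qed
    also have "\<dots> \<le> \<kappa> * w" using \<kappa> w by (intro mult_right_mono) auto
    also have "\<dots> \<le> \<kappa> * (1 + t' * d * c)"
    proof (rule mult_left_mono)
      have "1 * (d * c) \<le> t' * (d * c)" using t' dc by (intro mult_right_mono_neg) auto
      then show "w \<le> 1 + t' * d * c" by (simp add: w_def mult.assoc)
      show "0 \<le> \<kappa>" using \<kappa> by (rule order_trans[rotated]) simp
    qed
    finally show ?thesis .
  qed
  have "J0 (s,t) * (norm (R2 (s,t')))\<^sup>2 = d * (d\<^sup>2 * (1 + t * d * c))" unfolding n by (simp add: J0_def d_def c_def)
  also have "\<dots> \<le> d * (\<kappa> * (1 + t' * d * c))" using key d by (intro mult_left_mono) auto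
  also have "\<dots> = \<kappa> * J0 (s,t')" by (simp add: J0_def d_def c_def)
  finally show ?thesis .
qed

lemma image_strip: "\<Psi>0 ` ({0<..<L} \<times> {0<..<1}) = curved_strip L x y \<delta>"
proof
  show "\<Psi>0 ` ({0<..<L} \<times> {0<..<1}) \<subseteq> curved_strip L x y \<delta>"
  proof
    fix v assume "v \<in> \<Psi>0 ` ({0<..<L} \<times> {0<..<1})"
    then obtain s t where st: "s \<in> {0<..<L}" "t \<in> {0<..<1}" "v = \<Psi>0 (s,t)" by auto
    have "(s, t * \<delta> s) \<in> flat_strip L \<delta>" using st \<delta>pos[of s] by (auto simp: flat_strip_def)
    then show "v \<in> curved_strip L x y \<delta>" unfolding curved_strip_def st(3) \<Psi>0_strip_map by blast
  qed
  show "curved_strip L x y \<delta> \<subseteq> \<Psi>0 ` ({0<..<L} \<times> {0<..<1})"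
  proof
    fix v assume "v \<in> curved_strip L x y \<delta>"
    then obtain s r where sr: "0 < s" "s < L" "0 < r" "r < \<delta> s" "v = strip_map L x y (s, r)"
      by (auto simp: curved_strip_def flat_strip_def)
    then have "v = \<Psi>0 (s, r / \<delta> s)" unfolding \<Psi>0_strip_map by simp
    moreover have "(s, r / \<delta> s) \<in> {0<..<L} \<times> {0<..<1}" using sr by auto
    ultimately show "v \<in> \<Psi>0 ` ({0<..<L} \<times> {0<..<1})" by blast
  qed
qed

lemma symmetric_strip_exists:
  "\<exists>C c C'. symmetric_strip L 1 (ext \<Psi>0) (ext R1) (ext R2) (ext J0) C c C' (ext R12) (-1) \<kappa>"
proof -
  obtain K1 K2 K3 K4 where K: "\<And>z. norm (ext R1 z) \<le> K1" "\<And>z. norm (ext R2 z) \<le> K2" "\<And>z. norm (ext R12 z) \<le> K3" "\<And>z. norm (ext J0 z) \<le> K4"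
    using compact_extension_bounded[OF cont0(2) box2_props(1)] compact_extension_bounded[OF cont0(3) box2_props(1)]
      compact_extension_bounded[OF cont0(4) box2_props(1)] compact_extension_bounded[OF cont0(5) box2_props(1)]
    unfolding ext_def by metis
  have ne: "box2 \<noteq> {}" using L by (auto simp: box2_def)
  \<comment> \<open>The minimum over the compact rectangle, boundary included, provides the uniform
    positive lower bound for the Jacobian.\<close>
  obtain z0 where z0: "z0 \<in> box2" "\<And>z. z \<in> box2 \<Longrightarrow> J0 z0 \<le> J0 z"
    using continuous_attains_inf[OF box2_props(1) ne cont0(5)] by blast
  have QB: "z \<in> box2" if "z \<in> {0<..<L} \<times> {0<..<1}" for z using Q_box2 that by blast
  have oQ: "open ({0<..<L} \<times> {0<..<1::real})" by (intro open_Times) auto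
  have imQ: "ext \<Psi>0 ` ({0<..<L} \<times> {0<..<1}) = \<Psi>0 ` ({0<..<L} \<times> {0<..<1})"
    by (rule image_cong[OF refl]) (rule ext_in[OF QB])
  have "symmetric_strip L 1 (ext \<Psi>0) (ext R1) (ext R2) (ext J0) (max K1 (max K2 K3)) (J0 z0) K4 (ext R12) (-1) \<kappa>"
  proof
    show "0 < L" "0 < (1::real)" by (auto simp: L)
    show "0 < J0 z0" by (rule J0_pos[OF z0(1)])
    show "ext \<Psi>0 \<in> borel_measurable borel" "ext R1 \<in> borel_measurable borel" "ext R2 \<in> borel_measurable borel" "ext J0 \<in> borel_measurable borel" "ext R12 \<in> borel_measurable borel"
      by (intro ext_measurable cont0)+
    show "inj_on (ext \<Psi>0) ({0<..<L} \<times> {0<..<1})"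
      using inj_on_subset[OF \<Psi>0_inj Q_box2] by (rule inj_on_cong[THEN iffD1, rotated]) (simp add: ext_in[OF QB])
    show "norm (ext R1 z) \<le> max K1 (max K2 K3)" "norm (ext R2 z) \<le> max K1 (max K2 K3)" "norm (ext R12 z) \<le> max K1 (max K2 K3)" for z
      using K[of z] by (auto simp: le_max_iff_disj)
    show "bounded (ext \<Psi>0 ` ({0<..<L} \<times> {0<..<1}))"
      unfolding imQ using compact_imp_bounded[OF compact_continuous_image[OF cont0(1) box2_props(1)]]
      by (rule bounded_subset) (use Q_box2 in blast)
    show "(-1::real) * -1 = 1" by simp
    show "continuous_on ({0..L} \<times> {0..1}) (ext \<Psi>0)" "continuous_on ({0..L} \<times> {0..1}) (ext R1)" "continuous_on ({0..L} \<times> {0..1}) (ext R2)"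
      using cont_ext[OF cont0(1)] cont_ext[OF cont0(2)] cont_ext[OF cont0(3)] by (simp_all add: box2_def)
  next
    fix z :: plane assume z: "z \<in> {0<..<L} \<times> {0<..<1}"
    show "(ext \<Psi>0 has_derivative (\<lambda>h. fst h *\<^sub>R ext R1 z + snd h *\<^sub>R ext R2 z)) (at z)"
      unfolding ext_in[OF QB[OF z]]
      by (rule has_derivative_transform_within_open[OF \<Psi>0_derivative[OF z] oQ z]) (simp add: ext_in[OF QB])
    show "ext J0 z = \<bar>fst (ext R1 z) * snd (ext R2 z) - snd (ext R1 z) * fst (ext R2 z)\<bar>"
      unfolding ext_in[OF QB[OF z]] det0[OF QB[OF z]] using J0_pos[OF QB[OF z]] by simp
    show "fst (ext R1 z) * snd (ext R2 z) - snd (ext R1 z) * fst (ext R2 z) = - 1 * ext J0 z"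
      unfolding ext_in[OF QB[OF z]] det0[OF QB[OF z]] by simp
    show "J0 z0 \<le> ext J0 z" using z0(2)[OF QB[OF z]] by (simp add: ext_in[OF QB[OF z]])
    show "ext J0 z \<le> K4" using K(4)[of z] by simp
  next
    fix z :: plane assume z: "z \<in> {0..L} \<times> {0..1}" "z \<notin> {0<..<L} \<times> {0<..<1}"
    have zb: "z \<in> box2" using z by (simp add: box2_def)
    show "ext \<Psi>0 z \<notin> ext \<Psi>0 ` ({0<..<L} \<times> {0<..<1})"
    proof
      assume "ext \<Psi>0 z \<in> ext \<Psi>0 ` ({0<..<L} \<times> {0<..<1})"
      then obtain w where w: "w \<in> {0<..<L} \<times> {0<..<1}" "\<Psi>0 z = \<Psi>0 w" unfolding imQ ext_in[OF zb] by blast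
      then have "z = w" using inj_onD[OF \<Psi>0_inj _ zb QB] by blast
      then show False using w(1) z(2) by simp
    qed
  next
    fix s t :: real assume st: "s \<in> {0<..<L}" "t \<in> {0<..<1}"
    then have b: "(s,t) \<in> box2" by (auto simp: box2_def)
    show "((\<lambda>s. ext R2 (s,t)) has_vector_derivative ext R12 (s,t)) (at s)"
      unfolding ext_in[OF b]
      by (rule has_vector_derivative_transform_within_open[OF R_derivatives(1)[OF st] _ st(1)]) (use st in \<open>auto simp: ext_in box2_def\<close>)
    show "((\<lambda>t. ext R1 (s,t)) has_vector_derivative ext R12 (s,t)) (at t)"
      unfolding ext_in[OF b]
      by (rule has_vector_derivative_transform_within_open[OF R_derivatives(2)[OF st] _ st(2)]) (use st in \<open>auto simp: ext_in box2_def\<close>)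
    show "ext \<Psi>0 (L - s, t) = sig (ext \<Psi>0 (s, t))"
      using \<Psi>0_sym[OF st(1), of t] st by (simp add: ext_def box2_def)
    fix t' :: real assume t': "t' \<in> {0<..<1}"
    show "1\<^sup>2 * ext J0 (s,t) * (norm (ext R2 (s,t')))\<^sup>2 \<le> \<kappa> * ext J0 (s,t')"
      using fibre_bound[of s t t'] st t' by (simp add: ext_def box2_def)
  qed
  then show ?thesis by blast
qed

theorem curved_strip_mu1:
  assumes "\<kappa> * mu1 2 (curved_strip L x y \<delta>) < 1"
  shows "mu1 2 (curved_strip L x y \<delta>) = mu1_odd 2 (curved_strip L x y \<delta>)"
proof -
  obtain C c C' where S: "symmetric_strip L 1 (ext \<Psi>0) (ext R1) (ext R2) (ext J0) C c C' (ext R12) (-1) \<kappa>"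
    using symmetric_strip_exists by blast
  interpret S: symmetric_strip L 1 "ext \<Psi>0" "ext R1" "ext R2" "ext J0" C c C' "ext R12" "-1" \<kappa> by (rule S)
  have "S.D = \<Psi>0 ` ({0<..<L} \<times> {0<..<1})"
    unfolding S.D_def S.Q_def by (rule image_cong[OF refl]) (use Q_box2 in \<open>auto simp: ext_def\<close>)
  then have "S.D = curved_strip L x y \<delta>" by (simp only: image_strip)
  then show ?thesis using S.mu1_eq_mu1_odd assms by simp
qed

end

theorem theorem1p1:
  fixes L :: real and x y \<delta> k :: "real \<Rightarrow> real" and DF D :: "(real \<times> real) set"
  assumes "L > 0"
    and "smooth_Icc L x" and "smooth_Icc L y"
    and "\<forall>s\<in>{0..L}. (deriv_Icc L x s)\<^sup>2 + (deriv_Icc L y s)\<^sup>2 = 1"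
    and "inj_on (\<lambda>s. (x s, y s)) {0..L}"
    and "\<forall>s\<in>{0..L/2}. x (L - s) = - x s \<and> y (L - s) = y s"
    and k_def: "k = signed_curvature L x y"
    and "smooth_Icc L \<delta>" and "\<forall>s\<in>{0..L}. \<delta> s > 0"
    and "\<forall>s\<in>{0..L}. \<delta> (L - s) = \<delta> s"
    and DF_def: "DF = flat_strip L \<delta>"
    and D_def: "D = curved_strip L x y \<delta>"
    and "bij_betw (strip_map L x y) (closure DF) (closure D)"
    and "\<forall>(s, r)\<in>closure DF. 1 + r * k s > 0"
    and "((\<forall>s\<in>{0..L}. k s \<ge> 0) \<and>
            mu1 2 D < 1 / (SUP s\<in>{0..L}. (2 * \<delta> s + (\<delta> s)\<^sup>2 * k s)\<^sup>2))
       \<or> ((\<forall>s\<in>{0..L}. k s < 0) \<and>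
            mu1 2 D < 1 / (SUP s\<in>{0..L}. 4 * (\<delta> s)\<^sup>2 / (1 + \<delta> s * k s)\<^sup>2))
       \<or> ((\<exists>s\<in>{0..L}. k s < 0) \<and> (\<exists>s\<in>{0..L}. k s > 0) \<and>
            mu1 2 D < 1 / max (SUP s\<in>{0..L}. (2 * \<delta> s + (\<delta> s)\<^sup>2 * k s)\<^sup>2)
                              (SUP s\<in>{0..L}. 4 * (\<delta> s)\<^sup>2 / (1 + \<delta> s * k s)\<^sup>2))"
  shows "mu1 2 D = mu1_odd 2 D"
proof -
  \<comment> \<open>The symmetry of the curve is given on the left half only; on the right half it
    is read at \<open>L - s\<close>.\<close>
  have half: "s \<in> {0..L/2} \<or> L - s \<in> {0..L/2}" if "s \<in> {0..L}" for s using that by auto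
  have symx: "x (L - s) = - x s" and symy: "y (L - s) = y s" if s: "s \<in> {0..L}" for s
  proof -
    have *: "x (L - \<tau>) = - x \<tau>" "y (L - \<tau>) = y \<tau>" if "\<tau> \<in> {0..L/2}" for \<tau> using assms(6) that by blast+
    show "x (L - s) = - x s" "y (L - s) = y s"
      using half[OF s] *[of s] *[of "L - s"] by auto
  qed
  interpret G: curved_geometry L x y \<delta> k
  proof
    show "inj_on (strip_map L x y) (closure (flat_strip L \<delta>))"
      using assms(13) unfolding DF_def bij_betw_def by blast
    show "1 + r * k s > 0" if "(s, r) \<in> closure (flat_strip L \<delta>)" for s r
      using assms(14) that unfolding DF_def by blast
  qed (use assms symx symy in simp_all)
  let ?f = "\<lambda>s. (2 * \<delta> s + (\<delta> s)\<^sup>2 * k s)\<^sup>2" and ?g = "\<lambda>s. 4 * (\<delta> s)\<^sup>2 / (1 + \<delta> s * k s)\<^sup>2"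
  have pos: "1 + \<delta> s * k s > 0" if "s \<in> {0..L}" for s using G.one_plus_pos[OF that, of 1] by simp
  note cont = smooth_Icc_continuous[OF assms(8)] G.k_continuous
  have bdd: "bdd_above (h ` {0..L})" if "continuous_on {0..L} h" for h :: "real \<Rightarrow> real"
    by (rule bounded_imp_bdd_above[OF compact_imp_bounded[OF compact_continuous_image[OF that]]]) simp
  have "continuous_on {0..L} ?f" by (intro continuous_intros cont)
  then have f: "?f s \<le> (SUP s\<in>{0..L}. ?f s)" if "s \<in> {0..L}" for s by (rule cSUP_upper[OF that bdd])
  have "\<forall>s\<in>{0..L}. (1 + \<delta> s * k s)\<^sup>2 \<noteq> 0" using pos by force
  then have "continuous_on {0..L} ?g" by (intro continuous_intros cont) auto
  then have g: "?g s \<le> (SUP s\<in>{0..L}. ?g s)" if "s \<in> {0..L}" for s by (rule cSUP_upper[OF that bdd])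
  \<comment> \<open>A single constant \<open>\<kappa>\<close> replaces the three alternatives: each
    of them supplies one of the suprema, or their maximum, and the sign of \<open>k\<close> decides
    which bound is asked for at a point.\<close>
  have main: ?thesis
    if kap: "\<And>s. s \<in> {0..L} \<Longrightarrow> 0 \<le> k s \<Longrightarrow> ?f s \<le> \<kappa>" "\<And>s. s \<in> {0..L} \<Longrightarrow> k s < 0 \<Longrightarrow> ?g s \<le> \<kappa>"
      and \<kappa>: "mu1 2 D < 1 / \<kappa>" for \<kappa>
  proof -
    interpret T: thin_curved_strip L x y \<delta> k \<kappa> by unfold_locales (use kap in auto)
    have z: "0 \<in> {0..L}" and d0: "\<delta> 0 > 0" using assms(1,9) by auto
    \<comment> \<open>Positivity turns the bound by \<open>1 / \<kappa>\<close> into a bound for the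
      product; the single point \<open>s = 0\<close> suffices to see it.\<close>
    have "\<kappa> > 0"
    proof (cases "0 \<le> k 0")
      case True
      then have "0 < 2 * \<delta> 0 + (\<delta> 0)\<^sup>2 * k 0" using d0 by (intro add_pos_nonneg) auto
      then have "0 < ?f 0" by simp
      then show ?thesis using kap(1)[OF z True] by linarith
    next
      case False
      have "0 < ?g 0" using d0 pos[OF z] by (intro divide_pos_pos) auto
      then show ?thesis using kap(2)[OF z] False by linarith
    qed
    then have "\<kappa> * mu1 2 (curved_strip L x y \<delta>) < 1" using \<kappa> by (simp add: D_def field_simps)
    then show ?thesis unfolding D_def by (rule T.curved_strip_mu1)
  qed
  from assms(15) show ?thesis
  proof (elim disjE conjE)
    assume "\<forall>s\<in>{0..L}. k s \<ge> 0" "mu1 2 D < 1 / (SUP s\<in>{0..L}. ?f s)"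
    then show ?thesis using f by (intro main[of "SUP s\<in>{0..L}. ?f s"]) force+
  next
    assume "\<forall>s\<in>{0..L}. k s < 0" "mu1 2 D < 1 / (SUP s\<in>{0..L}. ?g s)"
    then show ?thesis using g by (intro main[of "SUP s\<in>{0..L}. ?g s"]) force+
  next
    assume "mu1 2 D < 1 / max (SUP s\<in>{0..L}. ?f s) (SUP s\<in>{0..L}. ?g s)"
    then show ?thesis using f g
      by (intro main[of "max (SUP s\<in>{0..L}. ?f s) (SUP s\<in>{0..L}. ?g s)"]) (auto simp: le_max_iff_disj)
  qed
qed

end
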